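(* Let $\Omega\subset\widehat{\mathbb{C}}$ be a hyperbolic multiply connected domain of connectivity greater than two, let $\pi\colon\mathbb{D}\to\Omega$ be a universal covering, and let $\Lambda\subset\partial\mathbb{D}$ be the limit set of its group of deck transformations. Then $\Lambda$ is a Cantor subset of $\partial\mathbb{D}$ if and only if there exists a true crosscut in $\Omega$.
   Context: $\widehat{\mathbb{C}}$ is the Riemann sphere, $\mathbb{D}$ the open unit disk. A domain $\Omega\subset\widehat{\mathbb{C}}$ is hyperbolic if it omits at least three points; its connectivity is the number (possibly infinite) of connected components of $\widehat{\mathbb{C}}\setminus\Omega$. $\pi$ is a holomorphic universal covering, with deck transformation group $\Gamma=\{\gamma\in\mathrm{Aut}(\mathbb{D}):\pi\circ\gamma=\pi\}$. $\Lambda$ is the set of $e^{i\theta}\in\partial\mathbb{D}$ such that $\gamma_n(0)\to e^{i\theta}$ for some sequence $(\gamma_n)_n\subset\Gamma$. A true crosscut in $\Omega$ is an open Jordan arc $C\subset\Omega$ such that $\overline{C}=C\cup\{a,b\}$, with $a\neq b$ both contained in the same connected component $\Sigma$ of $\partial\Omega$, and such that $\Omega\setminus C$ has exactly two connected components, one of which is simply connected. *)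

theory Defs
  imports "HOL-Complex_Analysis.Complex_Analysis" "HOL-Library.Extended_Nat"
begin

datatype riemann_sphere = Cpx complex | Infty

text \<open>
  Stereographic projection from the north pole \<open>(0, 1)\<close> onto the unit sphere of
  \<open>complex \<times> real\<close>. The metric on the Riemann sphere is the chordal metric
  pulled back along it.
\<close>

fun stereo :: "riemann_sphere \<Rightarrow> complex \<times> real" where
  "stereo (Cpx z) = (complex_of_real (2 / (1 + (cmod z)\<^sup>2)) * z,
                     ((cmod z)\<^sup>2 - 1) / ((cmod z)\<^sup>2 + 1))"
| "stereo Infty = (0, 1)"

lemma one_plus_cmod_sq_pos: "1 + (cmod z)\<^sup>2 > 0" "1 + (cmod z)\<^sup>2 \<noteq> 0"
proof -
  show "1 + (cmod z)\<^sup>2 > 0"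
    by (rule add_pos_nonneg) auto
  thus "1 + (cmod z)\<^sup>2 \<noteq> 0" by linarith
qed

lemma stereo_snd: "snd (stereo (Cpx z)) = 1 - 2 / (1 + (cmod z)\<^sup>2)"
  using one_plus_cmod_sq_pos[of z] by (simp add: field_simps)

lemma inj_stereo: "inj stereo"
proof (rule injI)
  fix p q assume eq: "stereo p = stereo q"
  have ne: "stereo (Cpx z) \<noteq> stereo Infty" for z
    using stereo_snd[of z] one_plus_cmod_sq_pos[of z]
    by (metis diff_eq_eq diff_add_cancel add_cancel_left_right divide_eq_0_iff
        snd_conv stereo.simps(2) zero_neq_numeral)
  show "p = q"
  proof (cases p)
    case p: (Cpx z)
    show ?thesis
    proof (cases q)
      case q: (Cpx w)
      have "2 / (1 + (cmod z)\<^sup>2) = 2 / (1 + (cmod w)\<^sup>2)"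
        using arg_cong[OF eq, of snd] unfolding p q stereo_snd by linarith
      moreover have "complex_of_real (2 / (1 + (cmod z)\<^sup>2)) * z
                   = complex_of_real (2 / (1 + (cmod w)\<^sup>2)) * w"
        using eq unfolding p q by simp
      moreover have "complex_of_real (2 / (1 + (cmod z)\<^sup>2)) \<noteq> 0"
        using one_plus_cmod_sq_pos[of z]
        by (metis divide_eq_0_iff of_real_eq_0_iff zero_neq_numeral)
      ultimately have "z = w"
        by (metis mult_cancel_left)
      with p q show ?thesis by simp
    next
      case Infty
      with eq p ne show ?thesis by metis
    qed
  next
    case Infty
    then show ?thesis
      using eq ne by (cases q) metis+
  qed
qed

instantiation riemann_sphere :: metric_space
begin

definition dist_riemann_sphere :: "riemann_sphere \<Rightarrow> riemann_sphere \<Rightarrow> real" where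
  "dist_riemann_sphere p q = dist (stereo p) (stereo q)"

definition uniformity_riemann_sphere :: "(riemann_sphere \<times> riemann_sphere) filter" where
  "uniformity_riemann_sphere = (INF e\<in>{0<..}. principal {(p, q). dist p q < e})"

definition open_riemann_sphere :: "riemann_sphere set \<Rightarrow> bool" where
  "open_riemann_sphere U \<longleftrightarrow> (\<forall>p\<in>U. eventually (\<lambda>(p', q). p' = p \<longrightarrow> q \<in> U) uniformity)"

instance
proof
  fix p q r :: riemann_sphere
  show "dist p q = 0 \<longleftrightarrow> p = q"
    by (simp add: dist_riemann_sphere_def inj_eq[OF inj_stereo])
  show "dist p q \<le> dist p r + dist q r"
    by (simp add: dist_riemann_sphere_def dist_triangle2)
qed (simp_all add: uniformity_riemann_sphere_def open_riemann_sphere_def)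

end

lemma range_stereo: "range stereo = sphere 0 1"
proof (intro equalityI subsetI)
  fix x assume "x \<in> range stereo"
  then obtain p where x: "x = stereo p" by auto
  show "x \<in> sphere 0 1"
  proof (cases p)
    case (Cpx z)
    define s where "s = (cmod z)\<^sup>2"
    have s: "1 + s > 0" using one_plus_cmod_sq_pos[of z] by (simp add: s_def)
    have "(cmod (fst x))\<^sup>2 = (2 / (1 + s))\<^sup>2 * s"
      unfolding x Cpx stereo.simps fst_conv norm_mult norm_of_real power_mult_distrib s_def
      by simp
    moreover have "(snd x)\<^sup>2 = ((s - 1) / (s + 1))\<^sup>2"
      unfolding x Cpx stereo.simps by (simp add: s_def)
    moreover have "(2 / (1 + s))\<^sup>2 * s + ((s - 1) / (s + 1))\<^sup>2 = 1"
      using s by (simp add: power_divide divide_simps add.commute)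
        (simp add: power2_eq_square algebra_simps)
    ultimately have "(cmod (fst x))\<^sup>2 + (snd x)\<^sup>2 = 1" by simp
    then show ?thesis by (cases x) (simp add: norm_prod_def)
  qed (simp add: x norm_prod_def)
next
  fix x :: "complex \<times> real" assume "x \<in> sphere 0 1"
  then obtain w t where x: "x = (w, t)" and n: "(cmod w)\<^sup>2 + t\<^sup>2 = 1"
    by (cases x) (simp add: norm_prod_def)
  show "x \<in> range stereo"
  proof (cases "t = 1")
    case True
    with n x have "x = stereo Infty" by simp
    then show ?thesis by blast
  next
    case False
    have "t\<^sup>2 \<le> 1" using n by (metis le_add_same_cancel2 zero_le_power2)
    hence t: "1 - t > 0" using False by (simp add: abs_square_le_1)
    define z where "z = w / complex_of_real (1 - t)"
    have "(cmod z)\<^sup>2 = (1 - t\<^sup>2) / (1 - t)\<^sup>2"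
      using n unfolding z_def norm_divide norm_of_real power_divide by simp
    also have "\<dots> = (1 + t) / (1 - t)"
      using t by (simp add: divide_simps) (simp add: power2_eq_square algebra_simps)
    finally have z: "(cmod z)\<^sup>2 = (1 + t) / (1 - t)" .
    have a: "2 / (1 + (cmod z)\<^sup>2) = 1 - t"
      using t unfolding z by (simp add: divide_simps)
    have "stereo (Cpx z) = (complex_of_real (1 - t) * z, 1 - (1 - t))"
      using stereo_snd[of z] unfolding a by (simp add: prod_eq_iff flip: a)
    also have "\<dots> = x"
      using t by (simp add: x z_def)
    finally show ?thesis by (metis rangeI)
  qed
qed

text \<open>The local inverse of the chart \<open>1 / z\<close> at infinity.\<close>

definition Cpx_recip :: "complex \<Rightarrow> riemann_sphere" where
  "Cpx_recip w = (if w = 0 then Infty else Cpx (1 / w))"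

text \<open>Holomorphy as a map of Riemann surfaces; meaningful for open \<open>S\<close>.\<close>

definition sphere_holomorphic_on :: "(complex \<Rightarrow> riemann_sphere) \<Rightarrow> complex set \<Rightarrow> bool" where
  "sphere_holomorphic_on f S \<longleftrightarrow>
     (\<forall>z\<in>S. \<exists>U g. open U \<and> z \<in> U \<and> U \<subseteq> S \<and> g holomorphic_on U \<and>
        ((\<forall>w\<in>U. f w = Cpx (g w)) \<or> (\<forall>w\<in>U. f w = Cpx_recip (g w))))"

abbreviation unit_disk :: "complex set" where
  "unit_disk \<equiv> ball 0 1"

definition sphere_domain :: "riemann_sphere set \<Rightarrow> bool" where
  "sphere_domain \<Omega> \<longleftrightarrow> open \<Omega> \<and> connected \<Omega> \<and> \<Omega> \<noteq> {}"

definition hyperbolic :: "riemann_sphere set \<Rightarrow> bool" where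
  "hyperbolic \<Omega> \<longleftrightarrow> (\<exists>a b c. distinct [a, b, c] \<and> \<Omega> \<inter> {a, b, c} = {})"

definition connectivity :: "riemann_sphere set \<Rightarrow> enat" where
  "connectivity \<Omega> =
     (if finite (components (- \<Omega>)) then enat (card (components (- \<Omega>))) else \<infinity>)"

definition multiply_connected :: "riemann_sphere set \<Rightarrow> bool" where
  "multiply_connected \<Omega> \<longleftrightarrow> connectivity \<Omega> > 1"

text \<open>A covering by the disk is universal because the disk is simply connected.\<close>

definition universal_covering :: "(complex \<Rightarrow> riemann_sphere) \<Rightarrow> riemann_sphere set \<Rightarrow> bool" where
  "universal_covering \<pi> \<Omega> \<longleftrightarrow>
     sphere_holomorphic_on \<pi> unit_disk \<and> covering_space unit_disk \<pi> \<Omega>"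

text \<open>
  The values of \<open>\<gamma>\<close> outside the disk are unconstrained, so an automorphism is represented
  by many functions; only the values on the disk are ever used.
\<close>

definition disk_automorphism :: "(complex \<Rightarrow> complex) \<Rightarrow> bool" where
  "disk_automorphism \<gamma> \<longleftrightarrow> \<gamma> holomorphic_on unit_disk \<and> bij_betw \<gamma> unit_disk unit_disk"

definition deck_group :: "(complex \<Rightarrow> riemann_sphere) \<Rightarrow> (complex \<Rightarrow> complex) set" where
  "deck_group \<pi> = {\<gamma>. disk_automorphism \<gamma> \<and> (\<forall>z\<in>unit_disk. \<pi> (\<gamma> z) = \<pi> z)}"

definition limit_set :: "(complex \<Rightarrow> complex) set \<Rightarrow> complex set" where
  "limit_set \<Gamma> = {\<xi> \<in> sphere 0 1. \<exists>\<gamma>::nat \<Rightarrow> complex \<Rightarrow> complex.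
     (\<forall>n. \<gamma> n \<in> \<Gamma>) \<and> (\<lambda>n. \<gamma> n 0) \<longlonglongrightarrow> \<xi>}"

text \<open>By Brouwer's theorem these are the metric spaces homeomorphic to the ternary Cantor set.\<close>

definition cantor_set :: "'a::metric_space set \<Rightarrow> bool" where
  "cantor_set K \<longleftrightarrow> K \<noteq> {} \<and> compact K \<and> (\<forall>x\<in>K. x islimpt K) \<and>
     (\<forall>x\<in>K. connected_component_set K x = {x})"

definition open_jordan_arc :: "'a::topological_space set \<Rightarrow> bool" where
  "open_jordan_arc C \<longleftrightarrow> C homeomorphic {0<..<1::real}"

definition true_crosscut :: "riemann_sphere set \<Rightarrow> riemann_sphere set \<Rightarrow> bool" where
  "true_crosscut \<Omega> C \<longleftrightarrow>
     open_jordan_arc C \<and> C \<subseteq> \<Omega> \<and>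
     (\<exists>a b \<Sigma>. closure C = C \<union> {a, b} \<and> a \<noteq> b \<and>
        \<Sigma> \<in> components (frontier \<Omega>) \<and> a \<in> \<Sigma> \<and> b \<in> \<Sigma>) \<and>
     card (components (\<Omega> - C)) = 2 \<and>
     (\<exists>U\<in>components (\<Omega> - C). simply_connected U)"

end

theory Submission
  imports Defs
begin

text \<open>
  Let \<open>\<Lambda>\<close> be the limit set. Both sides of the equivalence amount to the same condition: some point \<open>\<xi>\<close> of the
  unit circle is not in \<open>\<Lambda>\<close>, that is, \<open>\<pi>\<close> is injective on the part of the disk near \<open>\<xi>\<close>.

  The limit set is closed and invariant under the deck group, and deck transformations that move 0 far away contract
  all of the closed disk, up to one limit point, towards a limit point (\<open>limit_point_sequence\<close>). Hence a limit set
  with three points is perfect, and if it is not the whole circle it is totally disconnected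
  (\<open>limit_set_cantor\<close>); so it is a Cantor set if and only if it is not the circle. The same contraction property
  shows that \<open>\<xi> \<notin> \<Lambda>\<close> is equivalent to injectivity near \<open>\<xi>\<close> (\<open>injective_near_nonlimit\<close>,
  \<open>univalent_near_imp_not_limit\<close>).

  Three limit points exist because the connectivity is greater than two (\<open>three_limit_points\<close>). With at most two, the
  deck group would essentially be a discrete group of affine maps of a half-plane, hence cyclic, and the winding numbers
  of loops about two points in different compact pieces of the complement would be linearly dependent. A nontrivial product
  of integer powers of \<open>w - k1\<close> and \<open>w - k2\<close> would then have a logarithm on the domain, which is impossible.

  From \<open>\<xi> \<notin> \<Lambda>\<close> to a crosscut: near \<open>\<xi>\<close> the covering is, in suitable coordinates, a bounded univalent function on a
  rectangle standing on the real axis. Its image has finite area, so it has a limit along almost every vertical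
  line, and these limits are not all equal (\<open>distinct_vertical_limits\<close>). Two vertical segments with different limits,
  joined by a horizontal one, are mapped onto a true crosscut (\<open>crosscut_from_rectangle\<close>).

  From a crosscut to \<open>\<xi> \<notin> \<Lambda>\<close>: over the simply connected side \<open>U\<close> of the crosscut the covering has a section \<open>s\<close>. The end
  points of the crosscut lie in one boundary component, so a small circular crosscut \<open>Q\<close> of \<open>U\<close> around another
  boundary point separates the whole domain, and cuts off a part \<open>A\<close> of \<open>U\<close> whose only frontier in the domain is in
  \<open>Q\<close>. Then \<open>s ` A\<close> is bounded, inside the disk, by the curve \<open>s ` Q\<close> alone, which has two end points on the circle. A
  length--area argument shows that \<open>s ` A\<close> reaches the circle at another point \<open>\<xi>\<close>
  (\<open>boundary_not_two_points\<close>), so it contains all points of the disk near \<open>\<xi>\<close>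
  (\<open>crosscut_univalent_boundary\<close>), and on \<open>s ` A\<close> the covering is injective.
\<close>

section \<open>Boundary limits of bounded univalent functions along lines\<close>

lemma continuous_on_vector2: "continuous_on UNIV (\<lambda>(x,y). vector [x,y] :: real^2)"
proof -
  have "(\<lambda>(x,y). vector [x,y] :: real^2) = (\<lambda>p. \<chi> i. if i = 1 then fst p else snd p)"
    by (auto simp: fun_eq_iff vec_eq_iff forall_2)
  moreover have "continuous_on UNIV (\<lambda>p::real\<times>real. (\<chi> i. if i = 1 then fst p else snd p) :: real^2)"
  proof (rule continuous_on_vec_lambda)
    fix i :: 2
    show "continuous_on UNIV (\<lambda>x::real\<times>real. if i = 1 then fst x else snd x)"
      by (cases "i = 1") (auto intro!: continuous_intros)
  qed
  ultimately show ?thesis by simp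
qed

text \<open>
  The change of variables formula lives on \<open>real^2\<close>, whereas slicing needs a product measure; this
  identification of the two Lebesgue measures connects them.
\<close>

lemma lborel_eq_distr_pair:
  "(lborel :: (real^2) measure) = distr (lborel \<Otimes>\<^sub>M lborel) borel (\<lambda>(x,y). vector [x,y])"
proof (rule lborel_eqI)
  have meas: "(\<lambda>(x,y). vector [x,y] :: real^2) \<in> measurable (lborel \<Otimes>\<^sub>M lborel) borel"
    unfolding lborel_prod using borel_measurable_continuous_onI[OF continuous_on_vector2] by simp
  fix l u :: "real^2"
  assume lu: "\<And>b. b \<in> Basis \<Longrightarrow> l \<bullet> b \<le> u \<bullet> b"
  have le: "l$i \<le> u$i" for i
    using lu[of "axis i 1"] by (auto simp: cart_eq_inner_axis Basis_vec_def)
  have "prod ((\<bullet>) (u - l)) Basis = measure lborel (cbox l u)"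
    using lu by (simp add: content_cbox)
  also have "\<dots> = (u$1 - l$1) * (u$2 - l$2)"
    using content_cbox_cart[of l u] le by (simp add: interval_ne_empty_cart UNIV_2)
  finally have pr: "prod ((\<bullet>) (u - l)) Basis = (u$1 - l$1) * (u$2 - l$2)" .
  have "(\<lambda>(x,y). vector [x,y] :: real^2) -` box l u = {l$1<..<u$1} \<times> {l$2<..<u$2}"
    by (auto simp: mem_box_cart forall_2)
  then have "emeasure (distr (lborel \<Otimes>\<^sub>M lborel) borel (\<lambda>(x,y). vector [x,y])) (box l u) =
     emeasure (lborel \<Otimes>\<^sub>M lborel) ({l$1<..<u$1} \<times> {l$2<..<u$2})"
    using meas by (subst emeasure_distr) (auto simp: space_pair_measure)
  also have "\<dots> = ennreal (u$1 - l$1) * ennreal (u$2 - l$2)"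
    using le by (subst lborel.emeasure_pair_measure_Times) auto
  finally show "emeasure (distr (lborel \<Otimes>\<^sub>M lborel) borel (\<lambda>(x,y). vector [x,y])) (box l u)
     = ennreal (prod ((\<bullet>) (u - l)) Basis)"
    using le by (simp add: pr ennreal_mult)
qed simp

lemma nn_integral_cart2:
  assumes "f \<in> borel_measurable (borel :: (real^2) measure)"
  shows "(\<integral>\<^sup>+v. f v \<partial>lborel) = (\<integral>\<^sup>+x. \<integral>\<^sup>+y. f (vector [x,y]) \<partial>lborel \<partial>lborel)"
proof -
  have meas: "(\<lambda>(x,y). vector [x,y] :: real^2) \<in> measurable (lborel \<Otimes>\<^sub>M lborel) borel"
    unfolding lborel_prod using borel_measurable_continuous_onI[OF continuous_on_vector2] by simp
  have "(\<integral>\<^sup>+v. f v \<partial>lborel) = (\<integral>\<^sup>+p. f ((\<lambda>(x,y). vector [x,y]) p) \<partial>(lborel \<Otimes>\<^sub>M lborel))"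
    by (subst lborel_eq_distr_pair, subst nn_integral_distr[OF meas]) (use assms in auto)
  also have "\<dots> = (\<integral>\<^sup>+x. \<integral>\<^sup>+y. f (vector [x,y]) \<partial>lborel \<partial>lborel)"
    using measurable_compose[OF meas assms]
    by (subst lborel.nn_integral_fst[symmetric]) auto
  finally show ?thesis .
qed

lemma det_complex_mult:
  "det (matrix (\<lambda>v::real^2. vector [Re (c * Complex (v$1) (v$2)), Im (c * Complex (v$1) (v$2))] :: real^2)) = (cmod c)\<^sup>2"
  by (simp add: det_2 matrix_def axis_def cmod_power2) (simp add: power2_eq_square)

text \<open>
  By the change of variables formula, the integral of \<open>(cmod (deriv F))\<^sup>2\<close> over \<open>G\<close> is the area of the bounded
  set \<open>F ` G\<close>; Tonelli's theorem writes it as an iterated integral over vertical slices.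
\<close>

lemma univalent_area_slices:
  assumes holF: "F holomorphic_on G" and G: "open G" and inj: "inj_on F G" and bd: "bounded (F ` G)"
  shows "(\<integral>\<^sup>+x. \<integral>\<^sup>+y. ennreal (indicator G (Complex x y) * (cmod (deriv F (Complex x y)))\<^sup>2) \<partial>lborel \<partial>lborel) < \<infinity>"
    and "(\<lambda>(x,y). indicator G (Complex x y) * (cmod (deriv F (Complex x y)))\<^sup>2) \<in> borel_measurable (lborel \<Otimes>\<^sub>M lborel)"
proof -
  define C :: "real^2 \<Rightarrow> complex" where "C v = Complex (v$1) (v$2)" for v
  define V :: "complex \<Rightarrow> real^2" where "V z = vector [Re z, Im z]" for z
  have CV [simp]: "C (V z) = z" "V (C v) = v" for z v
    by (simp_all add: C_def V_def vec_eq_iff forall_2 complex_eq_iff)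
  have linC: "bounded_linear C"
    unfolding C_def by (rule linear_conv_bounded_linear[THEN iffD1]) (auto intro!: linearI simp: complex_eq_iff)
  have linV: "bounded_linear V"
    unfolding V_def by (rule linear_conv_bounded_linear[THEN iffD1]) (auto intro!: linearI simp: vec_eq_iff forall_2)
  define S where "S = C -` G"
  have contC: "continuous_on UNIV C" using linC by (simp add: linear_continuous_on)
  have oS: "open S" unfolding S_def by (rule open_vimage[OF G contC])
  define g where "g = V \<circ> F \<circ> C"
  define g' where "g' v = (\<lambda>h. V (deriv F (C v) * C h))" for v
  have der: "(g has_derivative g' v) (at v within S)" if "v \<in> S" for v
  proof -
    have "(F has_field_derivative deriv F (C v)) (at (C v))"
      using that holF G by (simp add: S_def holomorphic_derivI)
    then have "(F has_derivative (*) (deriv F (C v))) (at (C v))"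
      by (simp add: has_field_derivative_def)
    then have "((\<lambda>x. V (F (C x))) has_derivative g' v) (at v)"
      unfolding g'_def
      by (intro bounded_linear.has_derivative[OF linV] 
          has_derivative_compose[of C C, where g=F])
         (auto simp: linC bounded_linear_imp_has_derivative)
    then show ?thesis by (simp add: g_def o_def has_derivative_at_withinI)
  qed
  have injg: "inj_on g S"
    unfolding inj_on_def g_def o_def S_def using inj CV
    by (metis inj_onD vimageE)
  have img: "g ` S = C -` (F ` G)"
  proof (intro set_eqI iffI)
    fix v assume "v \<in> C -` (F ` G)"
    then obtain z where z: "z \<in> G" "C v = F z" by auto
    then have "v = g (V z)" by (simp add: g_def flip: z(2))
    moreover have "V z \<in> S" using z by (simp add: S_def)
    ultimately show "v \<in> g ` S" by blast
  qed (auto simp: g_def S_def)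
  have oF: "open (F ` G)"
    by (rule invariance_of_domain[OF holomorphic_on_imp_continuous_on[OF holF] G inj])
  have "open (g ` S)" unfolding img by (rule open_vimage[OF oF contC])
  moreover have "bounded (g ` S)"
  proof -
    have "g ` S \<subseteq> V ` (F ` G)" by (auto simp: g_def S_def)
    then show ?thesis using bounded_linear_image[OF bd linV] bounded_subset by blast
  qed
  ultimately have "g ` S \<in> lmeasurable"
    by (simp add: bounded_set_imp_lmeasurable)
  then have "(\<lambda>v. \<bar>det (matrix (g' v))\<bar>) absolutely_integrable_on S"
    using measurable_differentiable_image_alt[OF _ der injg] oS by (simp add: lborelD)
  moreover have "\<bar>det (matrix (g' v))\<bar> = (cmod (deriv F (C v)))\<^sup>2" for v
    unfolding g'_def V_def C_def det_complex_mult by simp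
  ultimately have ai: "(\<lambda>v. (cmod (deriv F (C v)))\<^sup>2) absolutely_integrable_on S" by simp
  define J where "J z = indicator G z * (cmod (deriv F z))\<^sup>2" for z
  have contD: "continuous_on G (deriv F)"
    using holF G holomorphic_deriv holomorphic_on_imp_continuous_on by blast
  have measJ: "J \<in> borel_measurable borel"
    unfolding J_def
    using borel_measurable_continuous_on_indicator[of G "\<lambda>z. (cmod (deriv F z))\<^sup>2"] G
      continuous_on_power[OF continuous_on_norm[OF contD]]
    by simp
  have measJC: "(\<lambda>v. J (C v)) \<in> borel_measurable borel"
    using measurable_compose[OF borel_measurable_continuous_onI[OF contC] measJ] .
  have "integrable lebesgue (\<lambda>v. J (C v))"
    using ai unfolding set_integrable_def J_def S_def by (simp add: indicator_def of_bool_def)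
  then have "integrable lborel (\<lambda>v. J (C v))"
    using measJC by (simp add: integrable_completion)
  then have fin: "(\<integral>\<^sup>+v. ennreal (J (C v)) \<partial>lborel) < \<infinity>"
    unfolding integrable_iff_bounded by (simp add: J_def)
  have "(\<integral>\<^sup>+v. ennreal (J (C v)) \<partial>lborel) = (\<integral>\<^sup>+x. \<integral>\<^sup>+y. ennreal (J (C (vector [x,y]))) \<partial>lborel \<partial>lborel)"
    by (rule nn_integral_cart2) (use measJC in auto)
  then show "(\<integral>\<^sup>+x. \<integral>\<^sup>+y. ennreal (indicator G (Complex x y) * (cmod (deriv F (Complex x y)))\<^sup>2) \<partial>lborel \<partial>lborel) < \<infinity>"
    using fin by (simp add: C_def J_def)
  have "(\<lambda>(x,y). vector [x,y] :: real^2) \<in> measurable (lborel \<Otimes>\<^sub>M lborel) borel"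
    unfolding lborel_prod using borel_measurable_continuous_onI[OF continuous_on_vector2] by simp
  from measurable_compose[OF this measJC]
  show "(\<lambda>(x,y). indicator G (Complex x y) * (cmod (deriv F (Complex x y)))\<^sup>2) \<in> borel_measurable (lborel \<Otimes>\<^sub>M lborel)"
    by (simp add: C_def J_def case_prod_unfold)
qed

lemma limits_of_integrable_derivative:
  fixes f h :: "real \<Rightarrow> complex"
  assumes "a < b" and der: "\<And>t. t \<in> {a<..<b} \<Longrightarrow> (f has_vector_derivative h t) (at t)"
    and int: "h integrable_on {a..b}"
  shows "\<exists>l. (f \<longlongrightarrow> l) (at_right a)" and "\<exists>l. (f \<longlongrightarrow> l) (at_left b)"
proof -
  define I where "I t = integral {a..t} h" for t
  have contI: "continuous_on {a..b} I"
    unfolding I_def by (rule indefinite_integral_continuous_1[OF int])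
  have diff: "f t - f s = I t - I s" if "s \<le> t" "a < s" "t < b" for s t
  proof -
    have "(h has_integral f t - f s) {s..t}"
      by (rule fundamental_theorem_of_calculus)
         (use that in \<open>auto intro!: has_vector_derivative_at_within der\<close>)
    moreover have "I s + integral {s..t} h = I t"
      unfolding I_def
      by (rule Henstock_Kurzweil_Integration.integral_combine)
        (use that int integrable_on_subinterval in \<open>auto intro: integrable_on_subinterval[OF int]\<close>)
    ultimately show ?thesis by (metis add_diff_cancel_left' integral_unique)
  qed
  define c where "c = (a + b) / 2"
  have c: "a < c" "c < b" using \<open>a < b\<close> by (auto simp: c_def)
  have eq: "f t = f c - I c + I t" if "a < t" "t < b" for t
    using diff[of t c] diff[of c t] that c by (cases "t \<le> c") (auto simp: algebra_simps)
  have "(I \<longlongrightarrow> I a) (at_right a)" "(I \<longlongrightarrow> I b) (at_left b)"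
    using contI \<open>a < b\<close> by (auto simp: continuous_on_Icc_at_rightD continuous_on_Icc_at_leftD)
  then have "((\<lambda>t. f c - I c + I t) \<longlongrightarrow> f c - I c + I a) (at_right a)"
    "((\<lambda>t. f c - I c + I t) \<longlongrightarrow> f c - I c + I b) (at_left b)"
    by (auto intro!: tendsto_intros)
  moreover have "eventually (\<lambda>t. f c - I c + I t = f t) (at_right a)"
    using eventually_at_right_less[of a] eventually_at_right_field[of _ a] \<open>a < b\<close> eq
    by (metis (mono_tags, lifting))
  moreover have "eventually (\<lambda>t. f c - I c + I t = f t) (at_left b)"
    using eventually_at_left_field[of _ b] \<open>a < b\<close> eq
    by (metis (mono_tags, lifting))
  ultimately show "\<exists>l. (f \<longlongrightarrow> l) (at_right a)" "\<exists>l. (f \<longlongrightarrow> l) (at_left b)"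
    using Lim_transform_eventually by blast+
qed

lemma vertical_derivative:
  assumes "F holomorphic_on G" "open G" "Complex x t \<in> G"
  shows "((\<lambda>t. F (Complex x t)) has_vector_derivative \<i> * deriv F (Complex x t)) (at t within S)"
proof -
  have "(F has_field_derivative deriv F (Complex x t)) (at (Complex x t))"
    using assms holomorphic_derivI by blast
  moreover have "((\<lambda>t. Complex x t) has_vector_derivative \<i>) (at t within S)"
    unfolding Complex_eq by (auto intro!: derivative_eq_intros simp: has_vector_derivative_def scaleR_conv_of_real)
  ultimately show ?thesis
    using field_vector_diff_chain_within[of "Complex x" \<i> t S F "deriv F (Complex x t)"]
    by (auto simp: o_def intro: has_field_derivative_at_within)
qed

lemma continuous_on_Complex_vertical: "continuous_on S (Complex x)"
  unfolding Complex_eq[abs_def] by (intro continuous_intros)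

text \<open>
  Almost every slice carries a finite integral of \<open>(cmod (deriv F))\<^sup>2\<close>. On a bounded interval this makes
  \<open>deriv F\<close> itself integrable, as \<open>c \<le> 1 + c\<^sup>2\<close>, so that \<open>F\<close> has limits at both ends.
\<close>

lemma univalent_slice_limits:
  assumes holF: "F holomorphic_on G" and G: "open G" and inj: "inj_on F G" and bd: "bounded (F ` G)"
  shows "AE x in lborel. \<forall>a b. a < b \<longrightarrow> (\<forall>t\<in>{a<..<b}. Complex x t \<in> G) \<longrightarrow>
    (\<exists>l. ((\<lambda>t. F (Complex x t)) \<longlongrightarrow> l) (at_right a)) \<and> (\<exists>l. ((\<lambda>t. F (Complex x t)) \<longlongrightarrow> l) (at_left b))"
proof -
  define J where "J x y = indicator G (Complex x y) * (cmod (deriv F (Complex x y)))\<^sup>2" for x y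
  note area = univalent_area_slices[OF holF G inj bd, folded J_def]
  have contD: "continuous_on G (deriv F)"
    using holF G holomorphic_deriv holomorphic_on_imp_continuous_on by blast
  have mJ: "(\<lambda>x. \<integral>\<^sup>+y. ennreal (J x y) \<partial>lborel) \<in> borel_measurable lborel"
    using area(2) by (intro lborel.borel_measurable_nn_integral) (auto simp: case_prod_unfold)
  have "AE x in lborel. (\<integral>\<^sup>+y. ennreal (J x y) \<partial>lborel) \<noteq> \<infinity>"
    using area(1) by (intro nn_integral_noteq_infinite[OF mJ]) auto
  then show ?thesis
  proof (rule AE_mp, intro AE_I2 impI allI)
    fix x a b :: real
    assume fin: "(\<integral>\<^sup>+y. ennreal (J x y) \<partial>lborel) \<noteq> \<infinity>" and "a < b" and G': "\<forall>t\<in>{a<..<b}. Complex x t \<in> G"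
    define h where "h t = \<i> * deriv F (Complex x t)" for t
    have conth: "continuous_on {a<..<b} h"
      unfolding h_def using G'
      by (intro continuous_intros continuous_on_compose2[OF contD] continuous_on_Complex_vertical) auto
    have mh: "(\<lambda>t. indicator {a<..<b} t *\<^sub>R h t) \<in> borel_measurable lborel"
      using borel_measurable_continuous_on_indicator[OF _ conth] by simp
    have "integrable lborel (\<lambda>t. indicator {a<..<b} t *\<^sub>R h t)"
      unfolding integrable_iff_bounded
    proof (intro conjI mh)
      have "(\<integral>\<^sup>+t. ennreal (norm (indicator {a<..<b} t *\<^sub>R h t)) \<partial>lborel)
        \<le> (\<integral>\<^sup>+t. indicator {a<..<b} t + ennreal (J x t) \<partial>lborel)"
      proof (rule nn_integral_mono)
        fix t
        show "ennreal (norm (indicator {a<..<b} t *\<^sub>R h t)) \<le> indicator {a<..<b} t + ennreal (J x t)"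
        proof (cases "t \<in> {a<..<b}")
          case True
          have "c \<le> 1 + c\<^sup>2" for c :: real
            using zero_le_power2[of "c - 1/2"] by (simp add: power2_eq_square algebra_simps)
          from this[of "norm (h t)"] True G' show ?thesis
            by (simp add: J_def h_def norm_mult flip: ennreal_plus ennreal_1)
        qed auto
      qed
      also have "\<dots> = (\<integral>\<^sup>+t. indicator {a<..<b} t \<partial>lborel) + (\<integral>\<^sup>+t. ennreal (J x t) \<partial>lborel)"
        using measurable_compose[OF measurable_Pair1' area(2)] 
        by (intro nn_integral_add) auto
      also have "\<dots> < \<infinity>" using fin \<open>a < b\<close> by (simp add: less_top)
      finally show "(\<integral>\<^sup>+t. ennreal (norm (indicator {a<..<b} t *\<^sub>R h t)) \<partial>lborel) < \<infinity>" .
    qed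
    then have "h integrable_on {a<..<b}"
      using set_borel_integral_eq_integral(1)[of "{a<..<b}" h] by (simp add: set_integrable_def)
    then have "h integrable_on {a..b}"
      by (simp add: integrable_on_open_interval_real)
    then show "(\<exists>l. ((\<lambda>t. F (Complex x t)) \<longlongrightarrow> l) (at_right a)) \<and> (\<exists>l. ((\<lambda>t. F (Complex x t)) \<longlongrightarrow> l) (at_left b))"
      using limits_of_integrable_derivative[OF \<open>a < b\<close>, of "\<lambda>t. F (Complex x t)" h]
        vertical_derivative[OF holF G] G' unfolding h_def by auto
  qed
qed

text \<open>
  The length--area principle: infinitely much width at the left of \<open>X\<close> shares a finite area, so some slice has
  an arbitrarily small integral of \<open>(cmod (deriv F))\<^sup>2\<close>; since slices have bounded height, its image is short.
  The finite set \<open>N\<close> leaves room to avoid exceptional slices.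
\<close>

lemma univalent_short_slices:
  assumes holF: "F holomorphic_on G" and G: "open G" and inj: "inj_on F G" and bd: "bounded (F ` G)"
    and M: "\<And>z. z \<in> G \<Longrightarrow> \<bar>Im z\<bar> \<le> M" and "\<epsilon> > 0" and N: "finite N"
  shows "\<exists>x<X. x \<notin> N \<and> (\<forall>a b. a \<le> b \<longrightarrow> (\<forall>t\<in>{a..b}. Complex x t \<in> G) \<longrightarrow>
    dist (F (Complex x a)) (F (Complex x b)) \<le> \<epsilon>)"
proof -
  define J where "J x y = indicator G (Complex x y) * (cmod (deriv F (Complex x y)))\<^sup>2" for x y
  note area = univalent_area_slices[OF holF G inj bd, folded J_def]
  define M' where "M' = max M 1"
  have M': "M' > 0" "\<And>z. z \<in> G \<Longrightarrow> \<bar>Im z\<bar> \<le> M'" using M by (auto simp: M'_def max_def intro: order_trans)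
  \<comment> \<open>From \<open>c \<le> m/2 + c\<^sup>2/(2*m)\<close> the image has length at most \<open>m * M' + \<delta>/(2*m)\<close>; with these values of \<open>m\<close> and
    \<open>\<delta>\<close> both summands equal \<open>\<epsilon>/2\<close>.\<close>
  define m where "m = \<epsilon> / (2 * M')"
  define \<delta> where "\<delta> = \<epsilon> * m"
  have m: "m > 0" "\<delta> > 0" using \<open>\<epsilon> > 0\<close> M' by (auto simp: m_def \<delta>_def)
  have contD: "continuous_on G (deriv F)"
    using holF G holomorphic_deriv holomorphic_on_imp_continuous_on by blast
  have "\<exists>x<X. x \<notin> N \<and> (\<integral>\<^sup>+y. ennreal (J x y) \<partial>lborel) < ennreal \<delta>"
  proof (rule ccontr)
    assume "\<not> ?thesis"
    then have ge: "ennreal \<delta> \<le> (\<integral>\<^sup>+y. ennreal (J x y) \<partial>lborel)" if "x < X" "x \<notin> N" for x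
      using that by (meson not_le)
    have "(\<integral>\<^sup>+x. ennreal \<delta> * indicator ({..<X} - N) x \<partial>lborel) \<le> (\<integral>\<^sup>+x. \<integral>\<^sup>+y. ennreal (J x y) \<partial>lborel \<partial>lborel)"
      by (rule nn_integral_mono) (use ge in \<open>auto simp: indicator_def\<close>)
    moreover have "(\<integral>\<^sup>+x. ennreal \<delta> * indicator ({..<X} - N) x \<partial>lborel) = ennreal \<delta> * emeasure lborel ({..<X} - N)"
      by (rule nn_integral_cmult_indicator) (use N in \<open>auto simp: borel_closed finite_imp_closed\<close>)
    moreover have "emeasure lborel ({..<X} - N) = \<infinity>"
    proof -
      have "emeasure lborel ({..<X} - N) = emeasure lborel {..<X}"
        by (rule emeasure_Diff_null_set) (use N in \<open>auto intro: finite_imp_null_set_lborel\<close>)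
      also have "\<dots> = \<infinity>"
      proof (rule ccontr)
        assume "emeasure lborel {..<X} \<noteq> \<infinity>"
        then obtain r where r: "emeasure lborel {..<X} = ennreal r" "r \<ge> 0"
          by (metis ennreal_cases infinity_ennreal_def)
        have "emeasure lborel {X - (r+1)..<X} \<le> emeasure lborel {..<X}"
          by (rule emeasure_mono) auto
        then show False using r by simp
      qed
      finally show ?thesis .
    qed
    ultimately show False using area(1) m by (simp add: ennreal_mult_top top_unique)
  qed
  then obtain x where x: "x < X" "x \<notin> N" "(\<integral>\<^sup>+y. ennreal (J x y) \<partial>lborel) < ennreal \<delta>" by blast
  moreover have "dist (F (Complex x a)) (F (Complex x b)) \<le> \<epsilon>"
    if "a \<le> b" and G': "\<forall>t\<in>{a..b}. Complex x t \<in> G" for a b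
  proof -
    define h where "h t = \<i> * deriv F (Complex x t)" for t
    have conth: "continuous_on {a..b} h"
      unfolding h_def using G'
      by (intro continuous_intros continuous_on_compose2[OF contD] continuous_on_Complex_vertical) auto
    have hb: "has_bochner_integral lborel (\<lambda>t. indicator {a..b} t *\<^sub>R h t) (F (Complex x b) - F (Complex x a))"
      using has_bochner_integral_FTC_Icc[OF \<open>a \<le> b\<close> _ conth, of "\<lambda>t. F (Complex x t)"]
        vertical_derivative[OF holF G] G' unfolding h_def by auto
    have ba: "b - a \<le> 2 * M'" using M'(2)[of "Complex x a"] M'(2)[of "Complex x b"] G' \<open>a \<le> b\<close> by auto
    have "ennreal (norm (F (Complex x b) - F (Complex x a))) \<le> (\<integral>\<^sup>+t. ennreal (norm (indicator {a..b} t *\<^sub>R h t)) \<partial>lborel)"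
      using integral_norm_bound_ennreal[of lborel "\<lambda>t. indicator {a..b} t *\<^sub>R h t"] hb
      by (simp add: has_bochner_integral_iff)
    also have "\<dots> \<le> (\<integral>\<^sup>+t. ennreal (m/2) * indicator {a..b} t + ennreal (1 / (2*m)) * ennreal (J x t) \<partial>lborel)"
    proof (rule nn_integral_mono)
      fix t
      show "ennreal (norm (indicator {a..b} t *\<^sub>R h t)) \<le> ennreal (m/2) * indicator {a..b} t + ennreal (1 / (2*m)) * ennreal (J x t)"
      proof (cases "t \<in> {a..b}")
        case True
        have "c \<le> m/2 + 1/(2*m) * c\<^sup>2" for c :: real
        proof -
          have "0 \<le> (c - m)\<^sup>2 / (2*m)" using m by simp
          also have "\<dots> = m/2 + 1/(2*m) * c\<^sup>2 - c" using m by (simp add: power2_eq_square field_simps)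
          finally show ?thesis by simp
        qed
        from this[of "norm (h t)"] True G' m show ?thesis
          by (simp add: J_def h_def norm_mult flip: ennreal_plus ennreal_mult)
      qed auto
    qed
    also have "\<dots> = ennreal (m/2) * emeasure lborel {a..b} + ennreal (1 / (2*m)) * (\<integral>\<^sup>+t. ennreal (J x t) \<partial>lborel)"
      using measurable_compose[OF measurable_Pair1' area(2)] 
      by (subst nn_integral_add) (auto simp: nn_integral_cmult nn_integral_cmult_indicator)
    also have "\<dots> \<le> ennreal (m/2) * ennreal (2*M') + ennreal (1/(2*m)) * ennreal \<delta>"
      using x(3) ba \<open>a \<le> b\<close> by (intro add_mono mult_left_mono) (auto intro: ennreal_leI)
    also have "\<dots> = ennreal (m/2 * (2*M') + 1/(2*m)*\<delta>)"
      using m M' by (simp only: ennreal_mult[symmetric] ennreal_plus[symmetric] divide_nonneg_nonneg mult_nonneg_nonneg less_imp_le zero_le_numeral zero_le_one)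
    also have "m/2 * (2*M') + 1/(2*m)*\<delta> = \<epsilon>"
      using m(1) M' by (simp add: \<delta>_def) (simp add: m_def field_simps)
    finally show ?thesis using \<open>\<epsilon> > 0\<close> by (simp add: dist_norm norm_minus_commute)
  qed
  ultimately show ?thesis by blast
qed

section \<open>Affine charts of the Riemann sphere\<close>

text \<open>
  Identifies the sphere without \<open>p\<close> with the plane. The value 0 at \<open>p\<close> itself is a default.
\<close>

definition chart :: "riemann_sphere \<Rightarrow> riemann_sphere \<Rightarrow> complex" where
  "chart p q = (case q of Infty \<Rightarrow> 0 | Cpx z \<Rightarrow> (case p of Infty \<Rightarrow> z | Cpx c \<Rightarrow> 1 / (z - c)))"

definition unchart :: "riemann_sphere \<Rightarrow> complex \<Rightarrow> riemann_sphere" where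
  "unchart p w = (case p of Infty \<Rightarrow> Cpx w | Cpx c \<Rightarrow> if w = 0 then Infty else Cpx (c + 1 / w))"

text \<open>
  In stereographic coordinates the map \<open>1/z\<close> is a rotation of the sphere, which makes its continuity evident
  and reduces charts near infinity to charts near 0.
\<close>

definition sphere_inv :: "riemann_sphere \<Rightarrow> riemann_sphere" where
  "sphere_inv q = (case q of Infty \<Rightarrow> Cpx 0 | Cpx z \<Rightarrow> Cpx_recip z)"

lemma continuous_on_stereo: "continuous_on A stereo"
  unfolding continuous_on_iff dist_riemann_sphere_def by blast

lemma continuous_on_into_sphere:
  fixes f :: "'a::metric_space \<Rightarrow> riemann_sphere"
  assumes "continuous_on A (\<lambda>x. stereo (f x))" shows "continuous_on A f"
  using assms unfolding continuous_on_iff dist_riemann_sphere_def by simp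

lemma compact_riemann_sphere: "compact (UNIV :: riemann_sphere set)"
proof -
  define g where "g = inv_into UNIV stereo"
  have s: "stereo (g x) = x" if "x \<in> sphere 0 1" for x
    using that range_stereo by (simp add: g_def f_inv_into_f)
  have "continuous_on (sphere 0 1) (\<lambda>x. stereo (g x))"
    using s continuous_on_cong[OF refl, of "sphere 0 1" "\<lambda>x. stereo (g x)" "\<lambda>x. x"] by simp
  then have "compact (g ` sphere 0 1)"
    by (intro compact_continuous_image continuous_on_into_sphere) auto
  moreover have "q \<in> g ` sphere 0 1" for q
    by (metis g_def imageI inj_stereo inv_into_f_f range_stereo rangeI UNIV_I)
  ultimately show ?thesis by (metis UNIV_eq_I)
qed

lemma closed_riemann_sphere_imp_compact: "closed K \<Longrightarrow> compact (K :: riemann_sphere set)"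
  using compact_riemann_sphere compact_Int_closed by (metis inf_top_left)

lemma continuous_on_Cpx: "continuous_on A Cpx"
proof (rule continuous_on_into_sphere)
  have "(cmod z)\<^sup>2 + 1 \<noteq> 0" for z using one_plus_cmod_sq_pos(2)[of z] by (simp add: add.commute)
  have *: "of_real (1 + (cmod z)\<^sup>2) \<noteq> (0::complex)" for z
    using one_plus_cmod_sq_pos(2)[of z] by (metis of_real_eq_0_iff)
  have "continuous_on A (\<lambda>z. 2 / of_real (1 + (cmod z)\<^sup>2) * z :: complex)"
    by (intro continuous_intros) (use * in auto)
  moreover have "continuous_on A (\<lambda>z. ((cmod z)\<^sup>2 - 1) / ((cmod z)\<^sup>2 + 1))"
    by (intro continuous_intros) (use \<open>\<And>z. (cmod z)\<^sup>2 + 1 \<noteq> 0\<close> in auto)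
  ultimately show "continuous_on A (\<lambda>x. stereo (Cpx x))"
    by (simp add: continuous_on_Pair)
qed

lemma chart_Infty_stereo: "chart Infty q = fst (stereo q) / of_real (1 - snd (stereo q))"
proof (cases q)
  case (Cpx z)
  have *: "1 - snd (stereo (Cpx z)) = 2 / (1 + (cmod z)\<^sup>2)" and f: "fst (stereo (Cpx z)) = of_real (2 / (1 + (cmod z)\<^sup>2)) * z" using stereo_snd[of z] by (linarith, simp)
  have "(of_real (2 / (1 + (cmod z)\<^sup>2)) :: complex) \<noteq> 0"
    using one_plus_cmod_sq_pos(2)[of z] by (metis divide_eq_0_iff of_real_eq_0_iff zero_neq_numeral)
  then have "of_real (2 / (1 + (cmod z)\<^sup>2)) * z / of_real (2 / (1 + (cmod z)\<^sup>2)) = z"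
    by (rule nonzero_mult_div_cancel_left)
  then show ?thesis unfolding Cpx * f by (simp only: chart_def riemann_sphere.case)
qed (simp add: chart_def)

lemma snd_stereo_eq_1: "snd (stereo q) = 1 \<longleftrightarrow> q = Infty"
proof (cases q)
  case (Cpx z)
  then show ?thesis using one_plus_cmod_sq_pos[of z] stereo_snd[of z] by simp
qed simp

lemma continuous_on_chart_Infty: "continuous_on (- {Infty}) (chart Infty)"
  unfolding chart_Infty_stereo[abs_def]
  by (intro continuous_intros continuous_on_stereo) (use snd_stereo_eq_1 in auto)

lemma stereo_inv: "stereo (sphere_inv q) = (cnj (fst (stereo q)), - snd (stereo q))"
proof (cases q)
  case (Cpx z)
  show ?thesis
  proof (cases "z = 0")
    case False
    define s where "s = (cmod z)\<^sup>2"
    have s: "s > 0" using False by (simp add: s_def)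
    have 1: "(cmod (1/z))\<^sup>2 = 1 / s" by (simp add: s_def norm_divide power_divide)
    have 2: "1 / z = cnj z / of_real s" using False
      by (simp add: s_def complex_div_cnj[of 1 z] flip: complex_norm_square)
    have 3: "2 / (1 + 1/s) = 2 * s / (1 + s)" using s by (simp add: field_simps)
    have "fst (stereo (Cpx (1/z))) = of_real (2 * s / (1 + s)) * (cnj z / of_real s)"
      unfolding stereo.simps fst_conv 1 3 by (simp only: 2)
    also have "\<dots> = cnj (of_real (2 / (1 + s)) * z)" using s by simp
    finally have f: "fst (stereo (Cpx (1/z))) = cnj (fst (stereo (Cpx z)))" by (simp add: s_def)
    have "snd (stereo (Cpx (1/z))) = (1/s - 1) / (1/s + 1)" by (simp only: stereo.simps snd_conv 1)
    also have "1/s - 1 = (1 - s) / s" using s by (simp add: field_simps)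
    also have "1/s + 1 = (1 + s) / s" using s by (simp add: field_simps)
    also have "(1 - s) / s / ((1 + s) / s) = (1 - s) / (1 + s)" using s by simp
    also have "\<dots> = - ((s - 1) / (s + 1))"
      by (metis add.commute minus_diff_eq minus_divide_left)
    finally have "snd (stereo (Cpx (1/z))) = - snd (stereo (Cpx z))" by (simp add: s_def)
    with f False Cpx show ?thesis by (simp add: sphere_inv_def Cpx_recip_def prod_eq_iff del: stereo.simps)
  qed (simp add: Cpx sphere_inv_def Cpx_recip_def)
qed (simp add: sphere_inv_def)

lemma continuous_on_sphere_inv: "continuous_on A sphere_inv"
  by (rule continuous_on_into_sphere) (auto simp: stereo_inv intro!: continuous_intros continuous_on_stereo)

lemma open_Compl_pair: "open (- {a, b :: riemann_sphere})"
  by (simp add: open_Compl finite_imp_closed)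

lemma continuous_on_chart: "continuous_on (- {p}) (chart p)"
proof (cases p)
  case (Cpx c)
  define A where "A = - {Infty, Cpx c}"
  define B where "B = - {Cpx 0, Cpx c}"
  have "continuous_on A (\<lambda>q. 1 / (chart Infty q - c))"
    by (intro continuous_intros continuous_on_subset[OF continuous_on_chart_Infty])
       (auto simp: A_def chart_def split: riemann_sphere.splits)
  moreover have "chart p q = 1 / (chart Infty q - c)" if "q \<in> A" for q
    using that by (cases q) (auto simp: A_def Cpx chart_def)
  ultimately have A: "continuous_on A (chart p)" by (simp cong: continuous_on_cong)
  have "continuous_on B (\<lambda>q. chart Infty (sphere_inv q))"
    by (intro continuous_on_compose2[OF continuous_on_chart_Infty] continuous_on_sphere_inv)
       (auto simp: B_def sphere_inv_def Cpx_recip_def split: riemann_sphere.splits if_splits)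
  moreover have "1 - c * chart Infty (sphere_inv q) \<noteq> 0" if "q \<in> B" for q
    using that by (cases q) (auto simp: B_def chart_def sphere_inv_def Cpx_recip_def field_simps split: if_splits)
  ultimately have "continuous_on B (\<lambda>q. chart Infty (sphere_inv q) / (1 - c * chart Infty (sphere_inv q)))"
    by (intro continuous_intros) auto
  moreover have "chart p q = chart Infty (sphere_inv q) / (1 - c * chart Infty (sphere_inv q))" if "q \<in> B" for q
    using that by (cases q) (auto simp: B_def Cpx chart_def sphere_inv_def Cpx_recip_def divide_simps split: if_splits)
  ultimately have B: "continuous_on B (chart p)" by (simp cong: continuous_on_cong)
  have "continuous_on (A \<union> B) (chart p)"
    by (rule continuous_on_open_Un[OF _ _ A B]) (auto simp: A_def B_def open_Compl_pair)
  then show ?thesis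
    by (rule continuous_on_subset) (auto simp: A_def B_def Cpx)
qed (simp add: continuous_on_chart_Infty)

lemma continuous_on_unchart: "continuous_on A (unchart p)"
proof (cases p)
  case (Cpx c)
  define B where "B = {w. 1 + c * w \<noteq> 0}"
  have "continuous_on (- {0}) (\<lambda>w. Cpx (c + 1 / w))"
    by (intro continuous_on_compose2[OF continuous_on_Cpx] continuous_intros) auto
  then have 1: "continuous_on (- {0}) (unchart p)"
    by (rule continuous_on_eq) (simp add: unchart_def Cpx)
  have "continuous_on B (\<lambda>w. sphere_inv (Cpx (w / (1 + c * w))))"
    by (intro continuous_on_compose2[OF continuous_on_sphere_inv] continuous_on_compose2[OF continuous_on_Cpx] continuous_intros)
      (auto simp: B_def)
  then have 2: "continuous_on B (unchart p)"
    by (rule continuous_on_eq) (auto simp: unchart_def Cpx sphere_inv_def Cpx_recip_def B_def field_simps)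
  have "open B" unfolding B_def
    by (intro open_Collect_neq continuous_intros)
  then have "continuous_on (- {0} \<union> B) (unchart p)"
    by (intro continuous_on_open_Un 1 2) auto
  then show ?thesis
    by (rule continuous_on_subset) (auto simp: B_def)
qed (simp add: unchart_def continuous_on_Cpx)

lemma chart_unchart [simp]: "chart p (unchart p w) = w"
  by (cases p) (auto simp: chart_def unchart_def)

lemma unchart_neq [simp]: "unchart p w \<noteq> p" "p \<noteq> unchart p w"
  by (cases p; auto simp: unchart_def)+

lemma unchart_chart: "q \<noteq> p \<Longrightarrow> unchart p (chart p q) = q"
  by (cases p; cases q) (auto simp: chart_def unchart_def)

lemma homeomorphism_chart: "homeomorphism (- {p}) UNIV (chart p) (unchart p)"
  by (rule homeomorphismI)
    (auto simp: continuous_on_chart continuous_on_unchart unchart_chart)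

lemma inj_on_chart: "inj_on (chart p) (- {p})"
  by (metis ComplD inj_onI insertI1 unchart_chart)

lemma chart_image_eq_vimage: "p \<notin> A \<Longrightarrow> chart p ` A = unchart p -` A"
proof (intro set_eqI iffI)
  fix w assume "w \<in> unchart p -` A"
  then show "w \<in> chart p ` A" using image_eqI[of w "chart p" "unchart p w" A] by simp
next
  fix w assume "p \<notin> A" "w \<in> chart p ` A"
  then obtain q where "q \<in> A" "w = chart p q" by blast
  moreover have "q \<noteq> p" using \<open>q \<in> A\<close> \<open>p \<notin> A\<close> by blast
  ultimately show "w \<in> unchart p -` A" by (simp add: unchart_chart)
qed

lemma open_chart_image: "open A \<Longrightarrow> p \<notin> A \<Longrightarrow> open (chart p ` A)"
  by (simp add: chart_image_eq_vimage open_vimage continuous_on_unchart)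

lemma open_unchart_image: "open A \<Longrightarrow> open (unchart p ` A)"
  using homeomorphism_imp_open_map[OF homeomorphism_symD[OF homeomorphism_chart[of p]], of A]
  by (simp add: openin_open_eq open_Compl)

lemma homeomorphism_chart_sub: "p \<notin> A \<Longrightarrow> homeomorphism A (chart p ` A) (chart p) (unchart p)"
  using homeomorphism_chart[of p] by (rule homeomorphism_of_subsets) auto

lemma compact_chart_image: "closed K \<Longrightarrow> p \<notin> K \<Longrightarrow> compact (chart p ` K)"
  by (intro compact_continuous_image continuous_on_subset[OF continuous_on_chart] closed_riemann_sphere_imp_compact) auto

lemma connected_chart_image: "connected K \<Longrightarrow> p \<notin> K \<Longrightarrow> connected (chart p ` K)"
  by (intro connected_continuous_image continuous_on_subset[OF continuous_on_chart]) auto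

lemma bounded_chart_image:
  assumes "open V" "p \<in> V" "U \<inter> V = {}" shows "bounded (chart p ` U)"
proof -
  have "compact (chart p ` (- V))" using assms by (intro compact_chart_image) auto
  then show ?thesis
    by (rule bounded_subset[OF compact_imp_bounded]) (use assms in auto)
qed

text \<open>
  In a chart centred at a point outside \<open>\<Omega>\<close> this is the corresponding fact for open subsets of the plane.
\<close>

lemma connected_remove_point:
  assumes "open \<Omega>" "connected \<Omega>" "q \<notin> \<Omega>" shows "connected (\<Omega> - {p :: riemann_sphere})"
proof -
  have "connected (chart q ` \<Omega> - {chart q p})"
    using assms by (intro connected_open_delete open_chart_image connected_chart_image) auto
  then have "connected (unchart q ` (chart q ` \<Omega> - {chart q p}))"
    by (intro connected_continuous_image continuous_on_unchart)
  moreover have "unchart q ` (chart q ` \<Omega> - {chart q p}) = \<Omega> - {p}" if "p \<in> \<Omega>"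
  proof -
    have "inj_on (chart q) \<Omega>"
      by (rule inj_on_subset[OF inj_on_chart[of q]]) (use assms(3) in blast)
    then have "chart q ` \<Omega> - {chart q p} = chart q ` (\<Omega> - {p})"
      using that by (simp add: inj_on_image_set_diff)
    moreover have "(\<lambda>x. unchart q (chart q x)) ` (\<Omega> - {p}) = (\<lambda>x. x) ` (\<Omega> - {p})"
      by (rule image_cong) (use assms(3) in \<open>auto intro!: unchart_chart\<close>)
    ultimately show ?thesis by (simp add: image_image)
  qed
  ultimately show ?thesis using assms(2) by (cases "p \<in> \<Omega>") auto
qed

lemma sphere_holomorphic_on_continuous:
  assumes "sphere_holomorphic_on f S" shows "continuous_on S f"
proof (rule continuous_at_imp_continuous_on, rule ballI)
  fix z assume "z \<in> S"
  then obtain U g where U: "open U" "z \<in> U" "g holomorphic_on U"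
    and g: "(\<forall>w\<in>U. f w = Cpx (g w)) \<or> (\<forall>w\<in>U. f w = Cpx_recip (g w))"
    using assms[unfolded sphere_holomorphic_on_def, rule_format, OF \<open>z \<in> S\<close>] by auto
  have r: "Cpx_recip w = unchart (Cpx 0) w" for w by (simp add: Cpx_recip_def unchart_def)
  have "continuous_on U (\<lambda>w. Cpx (g w))" "continuous_on U (\<lambda>w. Cpx_recip (g w))"
    unfolding r using U(3)
    by (intro continuous_on_compose2[OF continuous_on_Cpx[of UNIV]] continuous_on_compose2[OF continuous_on_unchart[of UNIV]] holomorphic_on_imp_continuous_on; simp)+
  with g have "continuous_on U f" by (metis (no_types, lifting) continuous_on_eq)
  then show "isCont f z" using U continuous_on_eq_continuous_at by blast
qed

lemma sphere_holomorphic_on_chart: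
  assumes hol: "sphere_holomorphic_on f S" and ne: "\<And>z. z \<in> S \<Longrightarrow> f z \<noteq> p"
  shows "(\<lambda>z. chart p (f z)) holomorphic_on S"
proof -
  have "(\<lambda>z. chart p (f z)) field_differentiable at z" if zS: "z \<in> S" for z
  proof -
    obtain U g where U: "open U" "z \<in> U" "U \<subseteq> S" "g holomorphic_on U"
      and g: "(\<forall>w\<in>U. f w = Cpx (g w)) \<or> (\<forall>w\<in>U. f w = Cpx_recip (g w))"
      using hol[unfolded sphere_holomorphic_on_def, rule_format, OF zS] by auto
    have "(\<lambda>z. chart p (f z)) holomorphic_on U"
    proof (cases p)
      case Infty
      from g show ?thesis
      proof
        assume g: "\<forall>w\<in>U. f w = Cpx (g w)"
        then show ?thesis using U(4) by (auto intro: holomorphic_transform simp: chart_def Infty)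
      next
        assume g: "\<forall>w\<in>U. f w = Cpx_recip (g w)"
        then have nz: "g w \<noteq> 0" if "w \<in> U" for w
          using that ne U(3) by (metis Cpx_recip_def Infty subsetD)
        have "(\<lambda>w. 1 / g w) holomorphic_on U" using nz U(4) by (intro holomorphic_intros)
        then show ?thesis by (rule holomorphic_transform) (use nz g in \<open>auto simp: chart_def Infty Cpx_recip_def\<close>)
      qed
    next
      case (Cpx c)
      from g show ?thesis
      proof
        assume g: "\<forall>w\<in>U. f w = Cpx (g w)"
        then have nz: "g w - c \<noteq> 0" if "w \<in> U" for w
          using that ne[of w] U(3) by (auto simp: Cpx)
        have "(\<lambda>w. 1 / (g w - c)) holomorphic_on U" using nz U(4) by (intro holomorphic_intros)
        then show ?thesis by (rule holomorphic_transform) (use nz g in \<open>auto simp: chart_def Cpx\<close>)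
      next
        assume g: "\<forall>w\<in>U. f w = Cpx_recip (g w)"
        then have nz: "1 - c * g w \<noteq> 0" if "w \<in> U" for w
        proof (cases "g w = 0")
          case False
          have "Cpx (1 / g w) \<noteq> Cpx c" using ne[of w] g that U(3) False by (auto simp: Cpx Cpx_recip_def)
          then show ?thesis using False by (auto simp: field_simps)
        qed simp
        have "(\<lambda>w. g w / (1 - c * g w)) holomorphic_on U" using nz U(4) by (intro holomorphic_intros)
        then show ?thesis
          by (rule holomorphic_transform) (use nz g in \<open>auto simp: chart_def Cpx Cpx_recip_def divide_simps\<close>)
      qed
    qed
    then show ?thesis using U holomorphic_on_imp_differentiable_at by blast
  qed
  then show ?thesis using field_differentiable_at_within holomorphic_on_def by blast
qed

section \<open>Automorphisms of the disk on the closed disk\<close>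

definition mob :: "complex \<Rightarrow> complex \<Rightarrow> complex \<Rightarrow> complex" where
  "mob u a z = u * (z - a) / (1 - cnj a * z)"

lemma mob_denom: "norm a < 1 \<Longrightarrow> norm z \<le> 1 \<Longrightarrow> 1 - cnj a * z \<noteq> 0"
proof
  assume a: "norm a < 1" "norm z \<le> 1" "1 - cnj a * z = 0"
  then have "norm (cnj a * z) = 1" by (metis eq_iff_diff_eq_0 norm_one)
  moreover have "norm (cnj a * z) \<le> norm a * 1" using a(2) by (simp add: norm_mult mult_left_le)
  ultimately show False using a(1) by simp
qed

lemma mob_norm_identity:
  assumes "norm u = 1" "norm a < 1" "norm z \<le> 1"
  shows "1 - (norm (mob u a z))\<^sup>2 = (1 - (norm a)\<^sup>2) * (1 - (norm z)\<^sup>2) / (norm (1 - cnj a * z))\<^sup>2"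
proof -
  have nz: "(norm (1 - cnj a * z))\<^sup>2 \<noteq> 0" using mob_denom[OF assms(2,3)] by simp
  have "(norm (1 - cnj a * z))\<^sup>2 - (norm (z - a))\<^sup>2 = (1 - (norm a)\<^sup>2) * (1 - (norm z)\<^sup>2)"
    by (simp add: cmod_power2) (simp add: power2_eq_square algebra_simps)
  moreover have "(norm (mob u a z))\<^sup>2 = (norm (z - a))\<^sup>2 / (norm (1 - cnj a * z))\<^sup>2"
    using assms by (simp add: mob_def norm_mult norm_divide power_divide)
  ultimately show ?thesis using nz
    by (metis (no_types, lifting) diff_divide_distrib divide_self)
qed

lemma mob_norm_eq_1: "norm u = 1 \<Longrightarrow> norm a < 1 \<Longrightarrow> norm z = 1 \<Longrightarrow> norm (mob u a z) = 1"
  using mob_norm_identity[of u a z] by (simp add: power2_eq_1_iff) (smt (verit) norm_ge_zero)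

lemma mob_norm_le_1:
  assumes "norm u = 1" "norm a < 1" "norm z \<le> 1" shows "norm (mob u a z) \<le> 1"
proof -
  have "0 \<le> (1 - (norm a)\<^sup>2) * (1 - (norm z)\<^sup>2) / (norm (1 - cnj a * z))\<^sup>2"
    using assms by (intro divide_nonneg_nonneg mult_nonneg_nonneg) (auto simp: abs_square_le_1)
  then show ?thesis
    using mob_norm_identity[OF assms] abs_square_le_1[of "norm (mob u a z)"] by simp
qed

lemma mob_diff:
  assumes "norm a < 1" "norm z \<le> 1" "norm w \<le> 1"
  shows "mob u a z - mob u a w = u * (1 - (norm a)\<^sup>2) * (z - w) / ((1 - cnj a * z) * (1 - cnj a * w))"
proof -
  have nz: "1 - cnj a * z \<noteq> 0" "1 - cnj a * w \<noteq> 0" using mob_denom assms by blast+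
  have aa: "(of_real (norm a))\<^sup>2 = a * cnj a" using complex_norm_square[of a] by simp
  have "mob u a z - mob u a w = (u * (z - a) * (1 - cnj a * w) - u * (w - a) * (1 - cnj a * z)) / ((1 - cnj a * z) * (1 - cnj a * w))"
    unfolding mob_def using nz by (simp add: diff_frac_eq)
  also have "u * (z - a) * (1 - cnj a * w) - u * (w - a) * (1 - cnj a * z) = u * (1 - a * cnj a) * (z - w)"
    by (simp add: algebra_simps)
  finally show ?thesis by (simp add: aa)
qed

lemma continuous_on_mob: "norm a < 1 \<Longrightarrow> continuous_on (cball 0 1) (mob u a)"
  unfolding mob_def[abs_def] by (intro continuous_intros) (use mob_denom in auto)

lemma inj_on_mob: "norm u = 1 \<Longrightarrow> norm a < 1 \<Longrightarrow> inj_on (mob u a) (cball 0 1)"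
proof (rule inj_onI)
  fix z w assume *: "norm u = 1" "norm a < 1" "z \<in> cball 0 1" "w \<in> cball 0 1" "mob u a z = mob u a w"
  then have "u * (1 - (norm a)\<^sup>2) * (z - w) / ((1 - cnj a * z) * (1 - cnj a * w)) = 0"
    using mob_diff[of a z w u] by simp
  moreover have "u \<noteq> 0" using * by auto
  moreover have "(1 - of_real ((norm a)\<^sup>2)) \<noteq> (0::complex)"
  proof
    assume "1 - of_real ((norm a)\<^sup>2) = (0::complex)"
    then have "(norm a)\<^sup>2 = 1" by (metis eq_iff_diff_eq_0 of_real_eq_1_iff)
    then show False using *(2) abs_square_less_1[of "norm a"] by simp
  qed
  ultimately show "z = w" using mob_denom[of a z] mob_denom[of a w] * by simp
qed

text \<open>
  By \<open>mob_diff\<close>, the difference to the value at 0 carries the factor \<open>1 - (norm (a n))\<^sup>2\<close>, which tends to 0, while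
  the denominators stay away from 0 as long as the points stay away from \<open>\<eta>\<close>. This contraction is what makes the
  dynamics of deck transformations near the circle simple.
\<close>

lemma mob_convergence:
  assumes a: "\<And>n. norm (a n) < 1" "\<And>n. norm (u n) = 1" "a \<longlonglongrightarrow> \<eta>" "norm \<eta> = 1"
    and \<xi>: "(\<lambda>n. mob (u n) (a n) 0) \<longlonglongrightarrow> \<xi>"
    and z: "\<And>n. norm (z n) \<le> 1" "z \<longlonglongrightarrow> z0" "z0 \<noteq> \<eta>"
  shows "(\<lambda>n. mob (u n) (a n) (z n)) \<longlonglongrightarrow> \<xi>"
proof -
  have "cnj \<eta> * \<eta> = 1" using \<open>norm \<eta> = 1\<close> complex_norm_square[of \<eta>] by (simp add: mult.commute)
  then have nz: "1 - cnj \<eta> * z0 \<noteq> 0" using \<open>z0 \<noteq> \<eta>\<close>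
    by (metis eq_iff_diff_eq_0 mult_cancel_left mult_zero_left zero_neq_one)
  have "(\<lambda>n. (1 - (norm (a n))\<^sup>2) * norm (z n) / norm (1 - cnj (a n) * z n)) \<longlonglongrightarrow> (1 - (norm \<eta>)\<^sup>2) * norm z0 / norm (1 - cnj \<eta> * z0)"
    by (intro tendsto_intros a z) (use nz in auto)
  then have "(\<lambda>n. (1 - (norm (a n))\<^sup>2) * norm (z n) / norm (1 - cnj (a n) * z n)) \<longlonglongrightarrow> 0"
    using \<open>norm \<eta> = 1\<close> by simp
  moreover have "norm (mob (u n) (a n) (z n) - mob (u n) (a n) 0) = (1 - (norm (a n))\<^sup>2) * norm (z n) / norm (1 - cnj (a n) * z n)" for n
  proof -
    have "(0::real) \<le> 1 - (norm (a n))\<^sup>2" using a(1)[of n] by (simp add: abs_square_le_1)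
    then have "norm (1 - (of_real (norm (a n)))\<^sup>2 :: complex) = 1 - (norm (a n))\<^sup>2"
      using norm_of_real[of "1 - (norm (a n))\<^sup>2", where 'a=complex] by simp
    then show ?thesis
      using mob_diff[OF a(1) z(1), where w=0] a(2) by (simp add: norm_mult norm_divide)
  qed
  ultimately have "(\<lambda>n. norm (mob (u n) (a n) (z n) - mob (u n) (a n) 0)) \<longlonglongrightarrow> 0"
    by (simp only:)
  then have "(\<lambda>n. mob (u n) (a n) (z n) - mob (u n) (a n) 0) \<longlonglongrightarrow> 0"
    by (rule tendsto_norm_zero_cancel)
  from tendsto_add[OF this \<xi>] show ?thesis by simp
qed

text \<open>
  After moving the preimage of 0 to 0, the Schwarz lemma applied to the map and its inverse shows that it is
  a rotation.
\<close>

lemma disk_automorphism_mob: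
  assumes "disk_automorphism \<gamma>"
  shows "\<exists>u a. norm u = 1 \<and> norm a < 1 \<and> (\<forall>z\<in>unit_disk. \<gamma> z = mob u a z)"
proof -
  have hol: "\<gamma> holomorphic_on unit_disk" and bij: "bij_betw \<gamma> unit_disk unit_disk"
    using assms by (auto simp: disk_automorphism_def)
  obtain \<delta> where hold: "\<delta> holomorphic_on (\<gamma> ` unit_disk)" and \<delta>: "\<And>z. z \<in> unit_disk \<Longrightarrow> \<delta> (\<gamma> z) = z"
    using holomorphic_has_inverse[OF hol open_ball bij_betw_imp_inj_on[OF bij]] by metis
  have im: "\<gamma> ` unit_disk = unit_disk" using bij by (simp add: bij_betw_def)
  have \<gamma>\<delta>: "\<gamma> (\<delta> z) = z" "\<delta> z \<in> unit_disk" if "z \<in> unit_disk" for z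
    using that \<delta> im by (metis imageE)+
  define a where "a = \<delta> 0"
  have a: "norm a < 1" "\<gamma> a = 0" using \<gamma>\<delta>[of 0] by (auto simp: a_def)
  have a': "norm (-a) < 1" using a by simp
  have Mhol: "mob 1 b holomorphic_on unit_disk" and Mim: "z \<in> unit_disk \<Longrightarrow> mob 1 b z \<in> unit_disk" if "norm b < 1" for b z
    using Moebius_function_holomorphic[OF that, of 0] Moebius_function_norm_lt_1[OF that, of z 0]
    by (auto simp: mob_def[abs_def] Moebius_function_def[abs_def])
  have MM: "mob 1 b (mob 1 (-b) z) = z" if "norm b < 1" "norm z < 1" for b z
    using Moebius_function_compose[of b "-b" z] that by (simp add: mob_def Moebius_function_def)
  define \<phi> where "\<phi> = \<gamma> \<circ> mob 1 (-a)"
  define \<psi> where "\<psi> = mob 1 a \<circ> \<delta>"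
  have h1: "\<phi> holomorphic_on unit_disk"
    unfolding \<phi>_def by (rule holomorphic_on_compose_gen[OF Mhol[OF a'] hol]) (use Mim[OF a'] in auto)
  have h2: "\<psi> holomorphic_on unit_disk"
    unfolding \<psi>_def by (rule holomorphic_on_compose_gen[OF _ Mhol[OF a(1)]]) (use hold im \<gamma>\<delta> in auto)
  have z1: "\<phi> 0 = 0" "\<psi> 0 = 0" using a by (auto simp: \<phi>_def \<psi>_def mob_def a_def)
  have b1: "norm (\<phi> z) < 1" "norm (\<psi> z) < 1" if "norm z < 1" for z
    using that Mim[OF a', of z] Mim[OF a(1), of "\<delta> z"] im \<gamma>\<delta>[of z] by (auto simp: \<phi>_def \<psi>_def)
  have inv: "\<psi> (\<phi> z) = z" if "norm z < 1" for z
    using that Mim[OF a', of z] \<delta> MM[OF a(1)] by (auto simp: \<phi>_def \<psi>_def)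
  have eqn: "norm (\<phi> z) = norm z" if "norm z < 1" for z
    using Schwarz_Lemma(1)[OF h1 z1(1) b1(1) that] Schwarz_Lemma(1)[OF h2 z1(2) b1(2) b1(1)[OF that]] inv[OF that]
    by simp
  have "\<exists>z. norm z < 1 \<and> z \<noteq> 0 \<and> norm (\<phi> z) = norm z"
    by (rule exI[of _ "1/2"], use eqn[of "1/2"] in simp)
  then obtain u where u: "\<And>z. norm z < 1 \<Longrightarrow> \<phi> z = u * z" "norm u = 1"
    using Schwarz_Lemma(3)[OF h1 z1(1) b1(1), of 0] by fastforce
  have "\<gamma> z = mob u a z" if "z \<in> unit_disk" for z
  proof -
    have "\<gamma> z = \<phi> (mob 1 a z)" using MM[of "-a" z] a' that by (simp add: \<phi>_def)
    also have "\<dots> = u * mob 1 a z" using u(1) Mim[OF a(1) that] by simp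
    finally show ?thesis by (simp add: mob_def)
  qed
  then show ?thesis using u(2) a(1) by blast
qed

text \<open>
  An automorphism is only determined on the open disk. The Moebius transformation that it agrees with there
  supplies its boundary values.
\<close>

definition circle_extension :: "(complex \<Rightarrow> complex) \<Rightarrow> complex \<Rightarrow> complex" where
  "circle_extension \<gamma> = (SOME g. \<exists>u a. norm u = 1 \<and> norm a < 1 \<and> g = mob u a \<and> (\<forall>z\<in>unit_disk. \<gamma> z = g z))"

abbreviation "ext \<equiv> circle_extension"

lemma ext_mob:
  assumes "disk_automorphism \<gamma>"
  obtains u a where "norm u = 1" "norm a < 1" "ext \<gamma> = mob u a" "\<And>z. z \<in> unit_disk \<Longrightarrow> \<gamma> z = ext \<gamma> z"
proof -
  have "\<exists>g u a. norm u = 1 \<and> norm a < 1 \<and> g = mob u a \<and> (\<forall>z\<in>unit_disk. \<gamma> z = g z)"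
    using disk_automorphism_mob[OF assms] by blast
  then have "\<exists>u a. norm u = 1 \<and> norm a < 1 \<and> ext \<gamma> = mob u a \<and> (\<forall>z\<in>unit_disk. \<gamma> z = ext \<gamma> z)"
    unfolding circle_extension_def by (rule someI_ex)
  then show thesis using that by blast
qed

text \<open>
  Maps the disk onto the right half-plane, \<open>x\<close> to infinity and 0 to 1.
\<close>

definition cayley :: "complex \<Rightarrow> complex \<Rightarrow> complex" where
  "cayley x z = (x + z) / (x - z)"

lemma cayley_inj: "x \<noteq> 0 \<Longrightarrow> z \<noteq> x \<Longrightarrow> w \<noteq> x \<Longrightarrow> cayley x z = cayley x w \<Longrightarrow> z = w"
  by (simp add: cayley_def frac_eq_eq algebra_simps)

lemma Re_cayley: "norm x = 1 \<Longrightarrow> z \<noteq> x \<Longrightarrow> Re (cayley x z) = (1 - (norm z)\<^sup>2) / (norm (x - z))\<^sup>2"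
  by (simp add: cayley_def Re_divide cmod_power2) (simp add: power2_eq_square algebra_simps cmod_def)

text \<open>
  A Moebius transformation that fixes \<open>x\<close> fixes infinity in the half-plane coordinate, hence is affine there. Its
  two real coefficients can be read off from the image of 0, where the coordinate is 1.
\<close>

lemma mob_affine:
  assumes u: "norm u = 1" "norm a < 1" "norm x = 1" "mob u a x = x" "norm z \<le> 1" "z \<noteq> x"
  shows "cayley x (mob u a z) = of_real (Re (cayley x (mob u a 0))) * cayley x z + \<i> * of_real (Im (cayley x (mob u a 0)))"
    and "Re (cayley x (mob u a 0)) > 0"
proof -
  define A where "A = (norm (x - a))\<^sup>2 / (1 - (norm a)\<^sup>2)"
  define N where "N = 1 - (norm a)\<^sup>2"
  define K where "K = of_real A + 2 * (x - a) * cnj a / of_real N - 1"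
  have N: "N > 0" using u(2) by (simp add: N_def abs_square_less_1)
  have x0: "x \<noteq> 0" using u(3) by auto
  have xx: "x * cnj x = 1" using u(3) complex_norm_square[of x] by simp
  have xa: "x \<noteq> a" using u by auto
  have key: "cayley x (mob u a w) = of_real A * cayley x w + K" if w: "norm w \<le> 1" "w \<noteq> x" for w
  proof -
    have dx: "1 - cnj a * x \<noteq> 0" and dw: "1 - cnj a * w \<noteq> 0" using mob_denom u w by auto
    have ueq: "u * (x - a) = x * (1 - cnj a * x)" using u(4) dx by (simp add: mob_def field_simps)
    have N0: "complex_of_real N \<noteq> 0" using N by simp
    have "x - mob u a w = u * of_real N * (x - w) / ((1 - cnj a * x) * (1 - cnj a * w))"
      using mob_diff[of a x w u] u w by (simp add: N_def)
    also have "\<dots> = u * (x - a) * of_real N * (x - w) / ((x - a) * (1 - cnj a * x) * (1 - cnj a * w))"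
    proof -
      have "p * r / (q * s) = p * t * r / (t * q * s)" if "t \<noteq> 0" for p q r s t :: complex
        using that nonzero_mult_divide_mult_cancel_left[of t "p * r" "q * s"] by (simp add: mult_ac)
      from this[of "x - a" u "of_real N * (x - w)" "1 - cnj a * x" "1 - cnj a * w"] show ?thesis
        using xa by (simp add: mult.assoc)
    qed
    also have "\<dots> = x * of_real N * (x - w) / ((x - a) * (1 - cnj a * w))"
      unfolding ueq
    proof -
      have "p * t * r * s / (q * t * v) = p * r * s / (q * v)" if "t \<noteq> 0" for p q r s t v :: complex
        using that nonzero_mult_divide_mult_cancel_left[of t "p * r * s" "q * v"] by (simp add: mult_ac)
      then show "x * (1 - cnj a * x) * of_real N * (x - w) / ((x - a) * (1 - cnj a * x) * (1 - cnj a * w))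
        = x * of_real N * (x - w) / ((x - a) * (1 - cnj a * w))" using dx by blast
    qed
    finally have d: "x - mob u a w = x * of_real N * (x - w) / ((x - a) * (1 - cnj a * w))" .
    have d0: "x - mob u a w \<noteq> 0" unfolding d using x0 N0 w xa dw by simp
    have "cayley x (mob u a w) = 2 * x / (x - mob u a w) - 1"
      using d0 by (simp add: cayley_def field_simps)
    also have "2 * x / (x - mob u a w) = 2 * (x - a) * (1 - cnj a * w) / (of_real N * (x - w))"
      unfolding d using x0 N0 w xa dw by (simp add: field_simps)
    also have "(1 - cnj a * w) = x * cnj (x - a) + cnj a * (x - w)"
      using xx by (simp add: algebra_simps)
    also have "2 * (x - a) * (x * cnj (x - a) + cnj a * (x - w)) / (of_real N * (x - w))
       = ((x - a) * cnj (x - a)) / of_real N * (2 * x / (x - w)) + 2 * (x - a) * cnj a / of_real N"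
    proof -
      have "2 * p * (x * q + c * d) / (n * d) = (p * q) / n * (2 * x / d) + 2 * p * c / n"
        if "d \<noteq> 0" "n \<noteq> 0" for p q c d n :: complex
        using that by (simp add: field_simps)
      moreover have "x - w \<noteq> 0" using w by simp
      ultimately show "2 * (x - a) * (x * cnj (x - a) + cnj a * (x - w)) / (of_real N * (x - w))
       = ((x - a) * cnj (x - a)) / of_real N * (2 * x / (x - w)) + 2 * (x - a) * cnj a / of_real N" using N0 by blast
    qed
    also have "((x - a) * cnj (x - a)) / of_real N = of_real A"
      by (simp only: complex_norm_square[symmetric] A_def N_def of_real_divide)
    also have "2 * x / (x - w) = cayley x w + 1" using w by (simp add: cayley_def field_simps)
    finally show ?thesis by (simp add: K_def algebra_simps)
  qed
  have "Re K = 0"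
  proof -
    have "Re K * N = A * N + Re (2 * (x - a) * cnj a) - N"
      using N by (simp add: K_def field_simps)
    also have "A * N = (norm (x - a))\<^sup>2" using N by (simp add: A_def N_def)
    also have "(norm (x - a))\<^sup>2 + Re (2 * (x - a) * cnj a) - N = (norm x)\<^sup>2 - 1"
      by (simp add: N_def cmod_power2) (simp add: power2_eq_square algebra_simps)
    finally show ?thesis using u(3) N by simp
  qed
  have c0: "cayley x 0 = 1" using x0 by (simp add: cayley_def)
  have k0: "cayley x (mob u a 0) = of_real A + K" using key[of 0] x0 c0 by simp
  then have "Re (cayley x (mob u a 0)) = A" "Im (cayley x (mob u a 0)) = Im K" using \<open>Re K = 0\<close> by auto
  moreover have "K = \<i> * of_real (Im K)" using \<open>Re K = 0\<close> by (simp add: complex_eq_iff)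
  ultimately show "cayley x (mob u a z) = of_real (Re (cayley x (mob u a 0))) * cayley x z + \<i> * of_real (Im (cayley x (mob u a 0)))"
    using key[OF u(5,6)] by simp
  show "Re (cayley x (mob u a 0)) > 0" using \<open>Re (cayley x (mob u a 0)) = A\<close> xa N by (simp add: A_def N_def)
qed

section \<open>Deck transformations and their limit set\<close>

text \<open>
  The covering is studied in a plane chart: \<open>\<Omega>\<close> is here the image of the given domain under a chart centred at a
  point of its complement.
\<close>

locale planar_cover =
  fixes f :: "complex \<Rightarrow> complex" and \<Omega> :: "complex set"
  assumes holf: "f holomorphic_on unit_disk" and cov: "covering_space unit_disk f \<Omega>"
begin

definition deck where "deck = {\<gamma>. disk_automorphism \<gamma> \<and> (\<forall>z\<in>unit_disk. f (\<gamma> z) = f z)}"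

abbreviation "\<Lambda> \<equiv> limit_set deck"

lemma deckD:
  assumes "\<gamma> \<in> deck"
  shows "disk_automorphism \<gamma>" "z \<in> unit_disk \<Longrightarrow> f (\<gamma> z) = f z" "z \<in> unit_disk \<Longrightarrow> \<gamma> z \<in> unit_disk"
    "\<gamma> holomorphic_on unit_disk" "continuous_on unit_disk \<gamma>"
  using assms by (auto simp: deck_def disk_automorphism_def bij_betw_def holomorphic_on_imp_continuous_on)

lemma ext_deck:
  assumes "\<gamma> \<in> deck"
  obtains u a where "norm u = 1" "norm a < 1" "ext \<gamma> = mob u a"
  by (rule ext_mob[OF deckD(1)[OF assms]]) (rule that)

lemma ext_eq: "\<gamma> \<in> deck \<Longrightarrow> z \<in> unit_disk \<Longrightarrow> ext \<gamma> z = \<gamma> z"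
  using ext_mob[OF deckD(1)] by metis

lemma ext_props:
  assumes "\<gamma> \<in> deck"
  shows "continuous_on (cball 0 1) (ext \<gamma>)" "inj_on (ext \<gamma>) (cball 0 1)"
    "norm z = 1 \<Longrightarrow> norm (ext \<gamma> z) = 1" "norm z \<le> 1 \<Longrightarrow> norm (ext \<gamma> z) \<le> 1"
proof -
  obtain u a where *: "norm u = 1" "norm a < 1" "ext \<gamma> = mob u a" by (rule ext_deck[OF assms])
  show "continuous_on (cball 0 1) (ext \<gamma>)" "inj_on (ext \<gamma>) (cball 0 1)"
    "norm z = 1 \<Longrightarrow> norm (ext \<gamma> z) = 1" "norm z \<le> 1 \<Longrightarrow> norm (ext \<gamma> z) \<le> 1"
    unfolding *(3) using *(1,2) continuous_on_mob inj_on_mob mob_norm_eq_1 mob_norm_le_1 by blast+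
qed

lemma local_injective:
  assumes "w \<in> unit_disk"
  obtains e where "e > 0" "ball w e \<subseteq> unit_disk" "inj_on f (ball w e)"
proof -
  obtain T u q where T: "w \<in> T" "openin (top_of_set unit_disk) T" "homeomorphism T u f q"
    using covering_space_local_homeomorphism[OF cov assms] by metis
  then have "open T" using openin_open_trans by blast
  then obtain e where "e > 0" "ball w e \<subseteq> T" using T(1) openE by blast
  moreover have "inj_on f T" using T(3) by (metis homeomorphism_def inj_on_inverseI)
  moreover have "T \<subseteq> unit_disk" using T(2) openin_imp_subset by blast
  ultimately show thesis using that inj_on_subset by (metis subset_trans)
qed

lemma deck_id: "id \<in> deck"
  by (auto simp: deck_def disk_automorphism_def bij_betw_def)

lemma deck_comp: "\<gamma> \<in> deck \<Longrightarrow> \<delta> \<in> deck \<Longrightarrow> \<gamma> \<circ> \<delta> \<in> deck"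
proof -
  assume g: "\<gamma> \<in> deck" and d: "\<delta> \<in> deck"
  have "(\<gamma> \<circ> \<delta>) holomorphic_on unit_disk"
    by (rule holomorphic_on_compose_gen[OF deckD(4)[OF d] deckD(4)[OF g]]) (use deckD(3)[OF d] in auto)
  moreover have "bij_betw (\<gamma> \<circ> \<delta>) unit_disk unit_disk"
    using g d bij_betw_trans unfolding deck_def disk_automorphism_def by blast
  ultimately show ?thesis
    using deckD(2)[OF g] deckD(2,3)[OF d] by (simp add: deck_def disk_automorphism_def)
qed

text \<open>
  Locally \<open>g\<close> is a branch of the inverse of \<open>f\<close> composed with \<open>f\<close>.
\<close>

lemma lift_holomorphic:
  assumes g: "continuous_on unit_disk g" "g ` unit_disk \<subseteq> unit_disk" "\<And>z. z \<in> unit_disk \<Longrightarrow> f (g z) = f z"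
  shows "g holomorphic_on unit_disk"
proof -
  have "g field_differentiable at z" if z: "z \<in> unit_disk" for z
  proof -
    obtain e where e: "e > 0" "ball (g z) e \<subseteq> unit_disk" "inj_on f (ball (g z) e)"
      using local_injective[of "g z"] g(2) z by blast
    obtain h where h: "h holomorphic_on (f ` ball (g z) e)" "\<And>w. w \<in> ball (g z) e \<Longrightarrow> h (f w) = w"
      using holomorphic_has_inverse[OF holomorphic_on_subset[OF holf e(2)] open_ball e(3)] by metis
    define S where "S = unit_disk \<inter> g -` ball (g z) e"
    have S: "open S" "z \<in> S"
      using continuous_open_preimage[OF g(1)] e(1) z by (auto simp: S_def)
    have im: "f w \<in> f ` ball (g z) e" if "w \<in> S" for w
      by (rule image_eqI[of _ _ "g w"]) (use that g(3)[of w] in \<open>auto simp: S_def\<close>)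
    have "(h \<circ> f) holomorphic_on S"
      by (rule holomorphic_on_compose_gen[OF holomorphic_on_subset[OF holf] h(1)])
        (use im in \<open>auto simp: S_def\<close>)
    moreover have "(h \<circ> f) w = g w" if "w \<in> S" for w
      using that h(2)[of "g w"] g(3)[of w] by (auto simp: S_def)
    ultimately have "g holomorphic_on S" by (rule holomorphic_transform)
    then show ?thesis using S holomorphic_on_imp_differentiable_at by blast
  qed
  then show ?thesis by (simp add: holomorphic_on_def field_differentiable_at_within)
qed

lemma lift_unique:
  assumes "continuous_on unit_disk g" "g ` unit_disk \<subseteq> unit_disk" "\<And>z. z \<in> unit_disk \<Longrightarrow> f (g z) = f z"
    and "continuous_on unit_disk h" "h ` unit_disk \<subseteq> unit_disk" "\<And>z. z \<in> unit_disk \<Longrightarrow> f (h z) = f z"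
    and "a \<in> unit_disk" "g a = h a" "z \<in> unit_disk"
  shows "g z = h z"
proof (rule covering_space_lift_unique[OF cov, of g a h unit_disk f z])
  show "f \<in> unit_disk \<rightarrow> \<Omega>" using covering_space_imp_surjective[OF cov] by blast
qed (use assms holf in \<open>auto intro: holomorphic_on_imp_continuous_on\<close>)

lemma deck_unique:
  assumes "\<gamma> \<in> deck" "\<delta> \<in> deck" "a \<in> unit_disk" "\<gamma> a = \<delta> a" "z \<in> unit_disk"
  shows "\<gamma> z = \<delta> z"
  by (rule lift_unique[of \<gamma> \<delta> a]) (use assms deckD in auto)

lemma lift_exists:
  assumes "z \<in> unit_disk" "w \<in> unit_disk" "f z = f w"
  obtains g where "continuous_on unit_disk g" "g ` unit_disk \<subseteq> unit_disk" "g z = w" "\<And>y. y \<in> unit_disk \<Longrightarrow> f (g y) = f y"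
proof -
  have "f \<in> unit_disk \<rightarrow> \<Omega>" using covering_space_imp_surjective[OF cov] by blast
  moreover have "simply_connected unit_disk" by (simp add: convex_imp_simply_connected)
  moreover have "locally path_connected unit_disk" by (simp add: convex_imp_locally_path_connected)
  ultimately obtain g where "continuous_on unit_disk g" "g \<in> unit_disk \<rightarrow> unit_disk" "g z = w" "\<And>y. y \<in> unit_disk \<Longrightarrow> f (g y) = f y"
    using covering_space_lift_strong[OF cov assms(2,1) _ _ holomorphic_on_imp_continuous_on[OF holf] _ assms(3)] by blast
  then show thesis by (intro that[of g]) auto
qed

lemma deck_inverse_pair:
  assumes g: "continuous_on unit_disk g" "g ` unit_disk \<subseteq> unit_disk" "\<And>z. z \<in> unit_disk \<Longrightarrow> f (g z) = f z"
    and h: "continuous_on unit_disk h" "h ` unit_disk \<subseteq> unit_disk" "\<And>z. z \<in> unit_disk \<Longrightarrow> f (h z) = f z"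
    and a: "a \<in> unit_disk" "h (g a) = a"
  shows "g \<in> deck" "h \<in> deck" "\<And>z. z \<in> unit_disk \<Longrightarrow> h (g z) = z" "\<And>z. z \<in> unit_disk \<Longrightarrow> g (h z) = z"
proof -
  have gi: "\<And>z. z \<in> unit_disk \<Longrightarrow> g z \<in> unit_disk" and hi: "\<And>z. z \<in> unit_disk \<Longrightarrow> h z \<in> unit_disk"
    using g(2) h(2) by blast+
  show hg: "h (g z) = z" if "z \<in> unit_disk" for z
  proof (rule lift_unique[of "\<lambda>z. h (g z)" "\<lambda>z. z" a])
    show "continuous_on unit_disk (\<lambda>z. h (g z))"
      by (rule continuous_on_compose2[OF h(1) g(1)]) (use g(2) in auto)
    show "f (h (g z)) = f z" if "z \<in> unit_disk" for z using that gi[OF that] g(3) h(3) by simp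
  qed (use g h a gi hi that in auto)
  show gh: "g (h z) = z" if "z \<in> unit_disk" for z
  proof (rule lift_unique[of "\<lambda>z. g (h z)" "\<lambda>z. z" "g a"])
    show "continuous_on unit_disk (\<lambda>z. g (h z))"
      by (rule continuous_on_compose2[OF g(1) h(1)]) (use h(2) in auto)
    show "f (g (h z)) = f z" if "z \<in> unit_disk" for z using that hi[OF that] g(3) h(3) by simp
  qed (use g h a gi hi that in auto)
  have "bij_betw g unit_disk unit_disk"
    by (rule bij_betw_byWitness[where f'=h]) (use g h hg gh in auto)
  then show "g \<in> deck" using lift_holomorphic[OF g] g(3) by (auto simp: deck_def disk_automorphism_def)
  have "bij_betw h unit_disk unit_disk"
    by (rule bij_betw_byWitness[where f'=g]) (use g h hg gh in auto)
  then show "h \<in> deck" using lift_holomorphic[OF h] h(3) by (auto simp: deck_def disk_automorphism_def)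
qed

text \<open>
  The disk is simply connected, so \<open>f\<close> lifts through itself; the lifts that carry \<open>z\<close> to \<open>w\<close> and \<open>w\<close> to \<open>z\<close> are inverse
  to each other by uniqueness of lifts.
\<close>

lemma deck_transitive:
  assumes "z \<in> unit_disk" "w \<in> unit_disk" "f z = f w"
  obtains \<gamma> where "\<gamma> \<in> deck" "\<gamma> z = w"
proof -
  obtain g where g: "continuous_on unit_disk g" "g ` unit_disk \<subseteq> unit_disk" "g z = w" "\<And>y. y \<in> unit_disk \<Longrightarrow> f (g y) = f y"
    using lift_exists[OF assms] by blast
  obtain h where h: "continuous_on unit_disk h" "h ` unit_disk \<subseteq> unit_disk" "h w = z" "\<And>y. y \<in> unit_disk \<Longrightarrow> f (h y) = f y"
    using lift_exists[OF assms(2,1)] assms(3) by metis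
  have "g \<in> deck" by (rule deck_inverse_pair(1)[OF g(1,2,4) h(1,2,4) assms(1)]) (use g h in auto)
  then show thesis using that g(3) by blast
qed

lemma deck_inverse:
  assumes "\<gamma> \<in> deck"
  obtains \<delta> where "\<delta> \<in> deck" "\<And>z. z \<in> unit_disk \<Longrightarrow> \<gamma> (\<delta> z) = z" "\<And>z. z \<in> unit_disk \<Longrightarrow> \<delta> (\<gamma> z) = z"
proof -
  have 0: "\<gamma> 0 \<in> unit_disk" "f (\<gamma> 0) = f 0" using deckD(2,3)[OF assms, of 0] by auto
  obtain h where h: "continuous_on unit_disk h" "h ` unit_disk \<subseteq> unit_disk" "h (\<gamma> 0) = 0" "\<And>y. y \<in> unit_disk \<Longrightarrow> f (h y) = f y"
    using lift_exists[OF 0(1) _ 0(2)] by (metis centre_in_ball zero_less_one)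
  have g: "continuous_on unit_disk \<gamma>" "\<gamma> ` unit_disk \<subseteq> unit_disk" "\<And>z. z \<in> unit_disk \<Longrightarrow> f (\<gamma> z) = f z"
    using deckD[OF assms] by auto
  show thesis
    using deck_inverse_pair[OF g h(1,2,4) _ h(3)] that by simp
qed

lemma continuous_eq_on_cball:
  assumes "continuous_on (cball 0 1) g" "continuous_on (cball 0 1) h" "\<And>z. z \<in> unit_disk \<Longrightarrow> g z = h z"
    and "norm z \<le> 1"
  shows "g z = (h z :: complex)"
proof -
  have cl: "closure unit_disk = (cball 0 1 :: complex set)" by simp
  have "continuous_on (closure unit_disk) (\<lambda>z. g z - h z)" unfolding cl using assms(1,2) by (intro continuous_intros)
  then have "g z - h z = 0"
    by (rule continuous_constant_on_closure) (use assms in auto)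
  then show ?thesis by simp
qed

lemma ext_id:
  assumes "norm z \<le> 1" shows "ext id z = z"
proof (rule continuous_eq_on_cball[OF _ _ _ assms])
  show "continuous_on (cball 0 1) (ext id)" by (rule ext_props(1)[OF deck_id])
  show "continuous_on (cball 0 1) (\<lambda>z::complex. z)" by (intro continuous_intros)
  show "ext id z = z" if "z \<in> unit_disk" for z using ext_eq[OF deck_id that] by (simp only: id_apply)
qed

lemma ext_comp:
  assumes "\<gamma> \<in> deck" "\<delta> \<in> deck" "norm z \<le> 1" shows "ext (\<gamma> \<circ> \<delta>) z = ext \<gamma> (ext \<delta> z)"
proof (rule continuous_eq_on_cball[OF _ _ _ assms(3)])
  show "continuous_on (cball 0 1) (ext (\<gamma> \<circ> \<delta>))" using ext_props(1) deck_comp assms by blast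
  show "continuous_on (cball 0 1) (\<lambda>z. ext \<gamma> (ext \<delta> z))"
    by (rule continuous_on_compose2[OF ext_props(1)[OF assms(1)] ext_props(1)[OF assms(2)]])
      (use ext_props(4)[OF assms(2)] in auto)
  show "ext (\<gamma> \<circ> \<delta>) z = ext \<gamma> (ext \<delta> z)" if "z \<in> unit_disk" for z
    using that ext_eq[OF deck_comp[OF assms(1,2)] that] ext_eq[OF assms(2) that] ext_eq[OF assms(1)] deckD(3)[OF assms(2) that]
    by simp
qed

lemma ext_inverse:
  assumes "\<gamma> \<in> deck" "\<delta> \<in> deck" "\<And>z. z \<in> unit_disk \<Longrightarrow> \<gamma> (\<delta> z) = z" "norm z \<le> 1"
  shows "ext \<gamma> (ext \<delta> z) = z"
proof (rule continuous_eq_on_cball[OF _ _ _ assms(4)])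
  show "continuous_on (cball 0 1) (\<lambda>z. ext \<gamma> (ext \<delta> z))"
    by (rule continuous_on_compose2[OF ext_props(1)[OF assms(1)] ext_props(1)[OF assms(2)]])
      (use ext_props(4)[OF assms(2)] in auto)
  show "ext \<gamma> (ext \<delta> z) = z" if "z \<in> unit_disk" for z
    using that ext_eq[OF assms(2) that] ext_eq[OF assms(1)] deckD(3)[OF assms(2) that] assms(3)
    by simp
qed (auto intro: continuous_intros)

text \<open>
  An accumulation point of the orbit inside the disk would contradict local injectivity of \<open>f\<close>.
\<close>

lemma finite_orbit:
  assumes "r < 1" shows "finite ((\<lambda>\<gamma>. \<gamma> 0) ` deck \<inter> cball 0 r)"
proof (rule ccontr)
  assume inf: "infinite ((\<lambda>\<gamma>. \<gamma> 0) ` deck \<inter> cball 0 r)" (is "infinite ?X")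
  then obtain z where z: "z \<in> cball 0 r" "z islimpt ?X"
    using compact_cball[of "0::complex" r] unfolding compact_eq_Bolzano_Weierstrass by blast
  then have "z \<in> unit_disk" using assms by auto
  then obtain e where e: "e > 0" "ball z e \<subseteq> unit_disk" "inj_on f (ball z e)" using local_injective by blast
  have "infinite (?X \<inter> ball z e)"
    using z(2) e(1) by (meson centre_in_ball islimpt_eq_infinite_ball)
  then obtain x y where xy: "x \<in> ?X \<inter> ball z e" "y \<in> ?X \<inter> ball z e" "x \<noteq> y"
  proof -
    obtain x where x: "x \<in> ?X \<inter> ball z e" using \<open>infinite (?X \<inter> ball z e)\<close> by (metis ex_in_conv finite.emptyI)
    have "infinite (?X \<inter> ball z e - {x})" using \<open>infinite (?X \<inter> ball z e)\<close> by simp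
    then obtain y where "y \<in> ?X \<inter> ball z e - {x}" by (metis ex_in_conv finite.emptyI)
    then show thesis using that x by blast
  qed
  then have "f x = f 0" "f y = f 0" using deckD(2)[of _ 0] by auto
  then show False using inj_onD[OF e(3), of x y] xy by simp
qed

text \<open>
  The convergence property of deck transformations: if they carry 0 towards the circle, then on a subsequence they
  contract everything away from one limit point \<open>\<eta>\<close>, the limit of the preimages of 0, to one limit point \<open>\<xi>\<close>.
\<close>

lemma limit_point_sequence:
  assumes \<gamma>: "\<And>n. \<gamma> n \<in> deck" and lim: "(\<lambda>n. norm (\<gamma> n 0)) \<longlonglongrightarrow> 1"
  obtains r \<xi> \<eta> where "strict_mono r" "\<xi> \<in> \<Lambda>" "\<eta> \<in> \<Lambda>" "(\<lambda>n. \<gamma> (r n) 0) \<longlonglongrightarrow> \<xi>"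
    "\<And>z z0. (\<And>n. norm (z n) \<le> 1) \<Longrightarrow> z \<longlonglongrightarrow> z0 \<Longrightarrow> z0 \<noteq> \<eta> \<Longrightarrow> (\<lambda>n. ext (\<gamma> (r n)) (z n)) \<longlonglongrightarrow> \<xi>"
proof -
  have "\<exists>u a. norm u = 1 \<and> norm a < 1 \<and> ext (\<gamma> n) = mob u a" for n
    using ext_deck[OF \<gamma>[of n]] by metis
  then obtain u a where ua: "\<And>n. norm (u n) = 1" "\<And>n. norm (a n) < 1" "\<And>n. ext (\<gamma> n) = mob (u n) (a n)" by metis
  have \<gamma>0: "\<gamma> n 0 = - (u n * a n)" for n
    using ext_eq[OF \<gamma>[of n], of 0] ua(3)[of n] by (simp add: mob_def)
  have na: "norm (a n) = norm (\<gamma> n 0)" for n using ua(1)[of n] by (simp add: \<gamma>0 norm_mult)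
  have \<gamma>a: "\<gamma> n (a n) = 0" for n
    using ext_eq[OF \<gamma>[of n], of "a n"] ua(2)[of n] ua(3)[of n] by (simp add: mob_def)
  have "\<exists>\<delta>\<in>deck. \<delta> 0 = a n" for n
  proof -
    obtain \<delta> where \<delta>: "\<delta> \<in> deck" "\<And>z. z \<in> unit_disk \<Longrightarrow> \<delta> (\<gamma> n z) = z" using deck_inverse[OF \<gamma>[of n]] by metis
    then have "\<delta> 0 = a n" using \<delta>(2)[of "a n"] \<gamma>a ua(2)[of n] by simp
    then show ?thesis using \<delta>(1) by blast
  qed
  then obtain \<delta> where \<delta>: "\<And>n. \<delta> n \<in> deck" "\<And>n. \<delta> n 0 = a n" by metis
  have "compact (cball 0 1 \<times> cball 0 1 :: (complex \<times> complex) set)" by (simp add: compact_Times)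
  moreover have "(\<gamma> n 0, a n) \<in> cball 0 1 \<times> cball 0 1" for n
    using ua(2)[of n] na[of n] by (auto simp: less_imp_le)
  ultimately obtain p r where r: "strict_mono (r::nat\<Rightarrow>nat)" "((\<lambda>n. (\<gamma> n 0, a n)) \<circ> r) \<longlonglongrightarrow> p"
    using that unfolding compact_def
    by (elim allE[of _ "\<lambda>n. (\<gamma> n 0, a n)"]) blast
  define \<xi> \<eta> where "\<xi> = fst p" and "\<eta> = snd p"
  have l\<xi>: "(\<lambda>n. \<gamma> (r n) 0) \<longlonglongrightarrow> \<xi>" and l\<eta>: "(\<lambda>n. a (r n)) \<longlonglongrightarrow> \<eta>"
    using tendsto_fst[OF r(2)] tendsto_snd[OF r(2)] by (auto simp: \<xi>_def \<eta>_def o_def)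
  have lr: "(\<lambda>n. norm (\<gamma> (r n) 0)) \<longlonglongrightarrow> 1" using LIMSEQ_subseq_LIMSEQ[OF lim r(1)] by (simp add: o_def)
  have n\<xi>: "norm \<xi> = 1" using tendsto_norm[OF l\<xi>] lr LIMSEQ_unique by blast
  have n\<eta>: "norm \<eta> = 1" using tendsto_norm[OF l\<eta>] lr LIMSEQ_unique unfolding na by blast
  have "\<xi> \<in> \<Lambda>" using n\<xi> l\<xi> \<gamma> by (auto simp: limit_set_def intro!: exI[of _ "\<lambda>n. \<gamma> (r n)"])
  moreover have "\<eta> \<in> \<Lambda>" using n\<eta> l\<eta> \<delta> by (auto simp: limit_set_def intro!: exI[of _ "\<lambda>n. \<delta> (r n)"])
  moreover have "(\<lambda>n. ext (\<gamma> (r n)) (z n)) \<longlonglongrightarrow> \<xi>" if "\<And>n. norm (z n) \<le> 1" "z \<longlonglongrightarrow> z0" "z0 \<noteq> \<eta>" for z z0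
    unfolding ua(3)
  proof (rule mob_convergence[OF _ _ l\<eta> n\<eta> _ that])
    show "(\<lambda>n. mob (u (r n)) (a (r n)) 0) \<longlonglongrightarrow> \<xi>" using l\<xi> by (simp add: \<gamma>0 mob_def)
  qed (use ua in auto)
  ultimately show thesis by (rule that[OF r(1) _ _ l\<xi>])
qed

lemma infinite_orbit_norm:
  assumes \<gamma>: "\<And>n. \<gamma> n \<in> deck" and inj: "inj (\<lambda>n. \<gamma> n 0)"
  shows "(\<lambda>n. norm (\<gamma> n 0)) \<longlonglongrightarrow> 1"
proof (rule LIMSEQ_I)
  fix e :: real assume "e > 0"
  define X where "X = (\<lambda>\<gamma>. \<gamma> 0) ` deck \<inter> cball 0 (1 - e)"
  have "finite X" unfolding X_def by (rule finite_orbit) (use \<open>e > 0\<close> in auto)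
  then have "finite ((\<lambda>n. \<gamma> n 0) -` X)" using inj by (rule finite_vimageI)
  then obtain N where N: "\<And>n. n \<in> (\<lambda>n. \<gamma> n 0) -` X \<Longrightarrow> n < N" by (meson finite_nat_iff_bounded lessThan_iff subsetD)
  have "norm (norm (\<gamma> n 0) - 1) < e" if "n \<ge> N" for n
  proof -
    have "\<gamma> n 0 \<notin> X" using N[of n] that by auto
    then have "norm (\<gamma> n 0) > 1 - e" using \<gamma>[of n] by (auto simp: X_def)
    moreover have "norm (\<gamma> n 0) < 1" using deckD(3)[OF \<gamma>, of 0] by simp
    ultimately show ?thesis by (simp add: abs_if)
  qed
  then show "\<exists>N. \<forall>n\<ge>N. norm (norm (\<gamma> n 0) - 1) < e" by blast
qed

lemma limit_set_subset: "\<Lambda> \<subseteq> sphere 0 1" by (auto simp: limit_set_def)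

lemma limit_setE:
  assumes "\<xi> \<in> \<Lambda>"
  obtains \<gamma> where "\<And>n. \<gamma> n \<in> deck" "(\<lambda>n. \<gamma> n 0) \<longlonglongrightarrow> \<xi>" "(\<lambda>n. norm (\<gamma> n 0)) \<longlonglongrightarrow> 1"
proof -
  obtain \<gamma> where \<gamma>: "\<And>n. \<gamma> n \<in> deck" "(\<lambda>n. \<gamma> n (0::complex)) \<longlonglongrightarrow> \<xi>" "norm \<xi> = 1"
    using assms by (auto simp: limit_set_def)
  then show thesis using that[OF \<gamma>(1,2)] tendsto_norm[OF \<gamma>(2)] by simp
qed

lemma closed_limit_set: "closed \<Lambda>"
proof (unfold closed_sequential_limits, intro allI impI, elim conjE)
  fix x l assume x: "\<forall>n. x n \<in> \<Lambda>" "x \<longlonglongrightarrow> l"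
  have "\<exists>\<gamma>\<in>deck. dist (\<gamma> 0) (x n) < 1 / Suc n" for n
  proof -
    obtain \<gamma> where \<gamma>: "\<And>k. \<gamma> k \<in> deck" "(\<lambda>k. \<gamma> k 0) \<longlonglongrightarrow> x n" using limit_setE x(1) by metis
    then have "eventually (\<lambda>k. dist (\<gamma> k 0) (x n) < 1 / Suc n) sequentially" by (intro tendstoD) auto
    then obtain k where "dist (\<gamma> k 0) (x n) < 1 / Suc n" by (auto simp: eventually_sequentially)
    then show ?thesis using \<gamma>(1)[of k] by blast
  qed
  then obtain \<gamma> where \<gamma>: "\<And>n. \<gamma> n \<in> deck" "\<And>n. dist (\<gamma> n 0) (x n) < 1 / Suc n" by metis
  have "(\<lambda>n. dist (\<gamma> n 0) (x n)) \<longlonglongrightarrow> 0"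
    by (rule tendsto_sandwich[OF _ _ tendsto_const LIMSEQ_Suc[OF lim_1_over_n]])
       (use \<gamma>(2) in \<open>auto intro!: always_eventually less_imp_le\<close>)
  then have "(\<lambda>n. \<gamma> n 0 - x n) \<longlonglongrightarrow> 0" unfolding dist_norm by (rule tendsto_norm_zero_cancel)
  then have "(\<lambda>n. \<gamma> n 0) \<longlonglongrightarrow> l" by (rule Lim_transform[OF x(2)])
  moreover have "l \<in> sphere 0 1"
    using closed_sphere x limit_set_subset unfolding closed_sequential_limits by blast
  ultimately show "l \<in> \<Lambda>" using \<gamma>(1) by (auto simp: limit_set_def)
qed

lemma compact_limit_set: "compact \<Lambda>"
  using closed_limit_set bounded_subset[OF bounded_sphere limit_set_subset] compact_eq_bounded_closed by blast

lemma limit_set_invariant: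
  assumes "\<gamma> \<in> deck" "\<xi> \<in> \<Lambda>" shows "ext \<gamma> \<xi> \<in> \<Lambda>"
proof -
  obtain \<delta> where \<delta>: "\<And>n. \<delta> n \<in> deck" "(\<lambda>n. \<delta> n 0) \<longlonglongrightarrow> \<xi>" using limit_setE[OF assms(2)] by metis
  have n\<xi>: "norm \<xi> = 1" using assms(2) limit_set_subset by auto
  have d: "\<delta> n 0 \<in> unit_disk" for n using deckD(3)[OF \<delta>(1), of 0] by auto
  have "(\<lambda>n. ext \<gamma> (\<delta> n 0)) \<longlonglongrightarrow> ext \<gamma> \<xi>"
    using continuous_on_tendsto_compose[OF ext_props(1)[OF assms(1)] \<delta>(2)] n\<xi> d by (simp add: less_imp_le)
  then have "(\<lambda>n. (\<gamma> \<circ> \<delta> n) 0) \<longlonglongrightarrow> ext \<gamma> \<xi>" using ext_eq[OF assms(1) d] by simp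
  then show ?thesis using deck_comp[OF assms(1) \<delta>(1)] ext_props(3)[OF assms(1) n\<xi>]
    by (auto simp: limit_set_def intro!: exI[of _ "\<lambda>n. \<gamma> \<circ> \<delta> n"])
qed

end

section \<open>Limit sets with at least three points\<close>

lemma cayley_circle: 
  assumes "norm p = 1" "norm z = 1" "z \<noteq> p" shows "cayley p z = \<i> * of_real (Im (cayley p z))"
proof -
  have "Re (cayley p z) = 0" using Re_cayley[OF assms(1,3)] assms(2) by simp
  then show ?thesis by (simp add: complex_eq_iff)
qed

text \<open>
  The half-plane coordinate belonging to the omitted point \<open>p\<close> carries the rest of the circle injectively onto a
  line, where connected sets are intervals.
\<close>

lemma connected_circle_contains_arc:
  assumes C: "connected C" "C \<subseteq> sphere 0 1" and xy: "x \<in> C" "y \<in> C" "x \<noteq> y" and p: "p \<in> sphere 0 1" "p \<notin> C"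
  obtains z e where "z \<in> C" "e > 0" "sphere 0 1 \<inter> ball z e \<subseteq> (C :: complex set)"
proof -
  define c where "c z = Im (cayley p z)" for z
  have np: "norm p = 1" "p \<noteq> 0" using p by auto
  have contc: "continuous_on (- {p}) c" unfolding c_def cayley_def[abs_def]
    by (intro continuous_intros) auto
  have inj: "z = w" if "norm z = 1" "norm w = 1" "z \<noteq> p" "w \<noteq> p" "c z = c w" for z w
    using cayley_circle[OF np(1) that(1,3)] cayley_circle[OF np(1) that(2,4)] that(5)
      cayley_inj[OF np(2) that(3,4)] by (simp add: c_def)
  have "connected (c ` C)"
    by (rule connected_continuous_image[OF continuous_on_subset[OF contc] C(1)]) (use p in auto)
  then have iv: "is_interval (c ` C)" by (simp add: is_interval_connected_1)
  have nx: "norm x = 1" "x \<noteq> p" "norm y = 1" "y \<noteq> p" using xy C(2) p by auto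
  have "c x \<noteq> c y" using inj nx xy(3) by metis
  define l u where "l = min (c x) (c y)" and "u = max (c x) (c y)"
  have lu: "l < u" "l \<in> c ` C" "u \<in> c ` C" using \<open>c x \<noteq> c y\<close> xy by (auto simp: l_def u_def min_def max_def)
  have sub: "t \<in> c ` C" if "l \<le> t" "t \<le> u" for t
    using mem_is_interval_1_I[OF iv lu(2,3) that] .
  have "(l + u) / 2 \<in> c ` C" using sub lu(1) by simp
  then obtain z where z: "z \<in> C" "c z = (l + u) / 2" by (metis imageE)
  define O' where "O' = - {p} \<inter> c -` {l<..<u}"
  have "open O'" unfolding O'_def by (rule continuous_open_preimage[OF contc]) auto
  moreover have "z \<in> O'" using z p lu(1) by (auto simp: O'_def)
  ultimately obtain e where e: "e > 0" "ball z e \<subseteq> O'" using openE by blast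
  have "w \<in> C" if "w \<in> sphere 0 1 \<inter> ball z e" for w
  proof -
    have w: "norm w = 1" "w \<noteq> p" "l < c w" "c w < u" using that e(2) by (auto simp: O'_def)
    then obtain w' where w': "w' \<in> C" "c w = c w'" using sub[of "c w"] by force
    moreover have "norm w' = 1" "w' \<noteq> p" using w'(1) C(2) p by auto
    ultimately have "w = w'" using inj[of w w'] w by blast
    then show ?thesis using w' by simp
  qed
  then show thesis using that[OF z(1) e(1)] by blast
qed

context planar_cover
begin

lemma inverse_limit:
  assumes "\<gamma> \<in> deck" "norm z = 1" "ext \<gamma> z \<in> \<Lambda>" shows "z \<in> \<Lambda>"
proof -
  obtain \<delta> where \<delta>: "\<delta> \<in> deck" "\<And>z. z \<in> unit_disk \<Longrightarrow> \<gamma> (\<delta> z) = z" "\<And>z. z \<in> unit_disk \<Longrightarrow> \<delta> (\<gamma> z) = z"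
    by (rule deck_inverse[OF assms(1)]) auto
  have "ext \<delta> (ext \<gamma> z) = z" using ext_inverse[OF \<delta>(1) assms(1) \<delta>(3)] assms(2) by simp
  then show ?thesis using limit_set_invariant[OF \<delta>(1) assms(3)] by simp
qed

text \<open>
  A nontrivial component contains an arc about a limit point \<open>z\<close>. Deck transformations that contract towards \<open>z\<close> move
  \<open>p\<close> into this arc, and invariance would make \<open>p\<close> a limit point. The point \<open>p\<close> itself is no exception to the
  contraction since the exceptional point is a limit point.
\<close>

lemma limit_set_totally_disconnected:
  assumes p: "p \<in> sphere 0 1" "p \<notin> \<Lambda>" and x: "x \<in> \<Lambda>"
  shows "connected_component_set \<Lambda> x = {x}"
proof (rule ccontr)
  define C where "C = connected_component_set \<Lambda> x"
  assume "connected_component_set \<Lambda> x \<noteq> {x}"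
  moreover have "x \<in> C" using x by (simp add: C_def)
  ultimately obtain y where y: "y \<in> C" "x \<noteq> y" by (auto simp: C_def)
  have C: "connected C" "C \<subseteq> \<Lambda>" by (auto simp: C_def connected_component_subset)
  obtain z e where z: "z \<in> C" "e > 0" "sphere 0 1 \<inter> ball z e \<subseteq> C"
    using connected_circle_contains_arc[OF C(1) _ \<open>x \<in> C\<close> y p(1)] C(2) p(2) limit_set_subset
    by (metis subset_iff subset_trans)
  have "z \<in> \<Lambda>" using z C by blast
  obtain \<gamma> where \<gamma>: "\<And>n. \<gamma> n \<in> deck" "(\<lambda>n. \<gamma> n 0) \<longlonglongrightarrow> z" "(\<lambda>n. norm (\<gamma> n 0)) \<longlonglongrightarrow> 1"
    by (rule limit_setE[OF \<open>z \<in> \<Lambda>\<close>]) blast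
  obtain r \<xi> \<eta> where r: "strict_mono r" "\<xi> \<in> \<Lambda>" "\<eta> \<in> \<Lambda>" "(\<lambda>n. \<gamma> (r n) 0) \<longlonglongrightarrow> \<xi>"
    and conv: "\<And>z z0. (\<And>n. norm (z n) \<le> 1) \<Longrightarrow> z \<longlonglongrightarrow> z0 \<Longrightarrow> z0 \<noteq> \<eta> \<Longrightarrow> (\<lambda>n. ext (\<gamma> (r n)) (z n)) \<longlonglongrightarrow> \<xi>"
    by (rule limit_point_sequence[OF \<gamma>(1,3)]) blast
  have "\<xi> = z" using LIMSEQ_unique[OF r(4) LIMSEQ_subseq_LIMSEQ[OF \<gamma>(2) r(1), unfolded o_def]] .
  have "(\<lambda>n. ext (\<gamma> (r n)) p) \<longlonglongrightarrow> z"
    unfolding \<open>\<xi> = z\<close>[symmetric] by (rule conv[of "\<lambda>_. p" p]) (use p r(3) in auto)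
  then have "eventually (\<lambda>n. dist (ext (\<gamma> (r n)) p) z < e) sequentially" using z(2) by (rule tendstoD)
  then obtain n where n: "dist (ext (\<gamma> (r n)) p) z < e" by (auto simp: eventually_sequentially)
  have "norm (ext (\<gamma> (r n)) p) = 1" using ext_props(3)[OF \<gamma>(1)] p by simp
  then have "ext (\<gamma> (r n)) p \<in> sphere 0 1 \<inter> ball z e" using n by (simp add: dist_commute)
  then have "ext (\<gamma> (r n)) p \<in> \<Lambda>" using z(3) C(2) by blast
  then have "p \<in> \<Lambda>" using inverse_limit[OF \<gamma>(1)] p(1) by simp
  then show False using p by blast
qed

text \<open>
  Two of the three limit points are different from the exceptional point of a sequence that contracts to \<open>x\<close>. Their
  images are two different limit points near \<open>x\<close>, and one of them is not \<open>x\<close>.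
\<close>

lemma limit_set_perfect:
  assumes abc: "a \<in> \<Lambda>" "b \<in> \<Lambda>" "c \<in> \<Lambda>" "a \<noteq> b" "b \<noteq> c" "a \<noteq> c" and x: "x \<in> \<Lambda>"
  shows "x islimpt \<Lambda>"
proof -
  obtain \<gamma> where \<gamma>: "\<And>n. \<gamma> n \<in> deck" "(\<lambda>n. \<gamma> n 0) \<longlonglongrightarrow> x" "(\<lambda>n. norm (\<gamma> n 0)) \<longlonglongrightarrow> 1"
    by (rule limit_setE[OF x]) blast
  obtain r \<xi> \<eta> where r: "strict_mono r" "\<xi> \<in> \<Lambda>" "\<eta> \<in> \<Lambda>" "(\<lambda>n. \<gamma> (r n) 0) \<longlonglongrightarrow> \<xi>"
    and conv: "\<And>z z0. (\<And>n. norm (z n) \<le> 1) \<Longrightarrow> z \<longlonglongrightarrow> z0 \<Longrightarrow> z0 \<noteq> \<eta> \<Longrightarrow> (\<lambda>n. ext (\<gamma> (r n)) (z n)) \<longlonglongrightarrow> \<xi>"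
    by (rule limit_point_sequence[OF \<gamma>(1,3)]) blast
  have "\<xi> = x" using LIMSEQ_unique[OF r(4) LIMSEQ_subseq_LIMSEQ[OF \<gamma>(2) r(1), unfolded o_def]] .
  obtain y z where yz: "y \<in> \<Lambda>" "z \<in> \<Lambda>" "y \<noteq> z" "y \<noteq> \<eta>" "z \<noteq> \<eta>"
    using abc by (cases "a = \<eta>"; cases "b = \<eta>") auto
  have n1: "norm y = 1" "norm z = 1" using yz limit_set_subset by auto
  have ly: "(\<lambda>n. ext (\<gamma> (r n)) y) \<longlonglongrightarrow> x" and lz: "(\<lambda>n. ext (\<gamma> (r n)) z) \<longlonglongrightarrow> x"
    unfolding \<open>\<xi> = x\<close>[symmetric] using conv[of "\<lambda>_. y" y] conv[of "\<lambda>_. z" z] n1 yz by auto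
  show ?thesis unfolding islimpt_approachable
  proof (intro allI impI)
    fix e :: real assume "e > 0"
    have "eventually (\<lambda>n. dist (ext (\<gamma> (r n)) y) x < e \<and> dist (ext (\<gamma> (r n)) z) x < e) sequentially"
      using tendstoD[OF ly \<open>e > 0\<close>] tendstoD[OF lz \<open>e > 0\<close>] by eventually_elim auto
    then obtain n where n: "dist (ext (\<gamma> (r n)) y) x < e" "dist (ext (\<gamma> (r n)) z) x < e"
      by (auto simp: eventually_sequentially)
    have "ext (\<gamma> (r n)) y \<noteq> ext (\<gamma> (r n)) z"
      using inj_onD[OF ext_props(2)[OF \<gamma>(1)], of "r n" y z] n1 yz(3) by auto
    moreover have "ext (\<gamma> (r n)) y \<in> \<Lambda>" "ext (\<gamma> (r n)) z \<in> \<Lambda>" using limit_set_invariant[OF \<gamma>(1)] yz by auto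
    ultimately show "\<exists>x'\<in>\<Lambda>. x' \<noteq> x \<and> dist x' x < e" using n by metis
  qed
qed

lemma limit_set_cantor:
  assumes "a \<in> \<Lambda>" "b \<in> \<Lambda>" "c \<in> \<Lambda>" "a \<noteq> b" "b \<noteq> c" "a \<noteq> c" and p: "p \<in> sphere 0 1" "p \<notin> \<Lambda>"
  shows "cantor_set \<Lambda>"
  unfolding cantor_set_def
proof (intro conjI ballI)
  show "\<Lambda> \<noteq> {}" using assms(1) by blast
qed (use limit_set_perfect[OF assms(1-6)] limit_set_totally_disconnected[OF p] compact_limit_set in auto)

section \<open>Covering maps near the unit circle\<close>

text \<open>
  An orbit that accumulates at \<open>\<xi>\<close> would stay in one fibre of \<open>f\<close> and, from some index on, in \<open>S\<close>; then it is constant.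
\<close>

lemma univalent_near_imp_not_limit:
  assumes "e > 0" "ball \<xi> e \<inter> unit_disk \<subseteq> S" "inj_on f S" "S \<subseteq> unit_disk"
  shows "\<xi> \<notin> \<Lambda>"
proof
  assume \<xi>: "\<xi> \<in> \<Lambda>"
  obtain \<gamma> where \<gamma>: "\<And>n. \<gamma> n \<in> deck" "(\<lambda>n. \<gamma> n 0) \<longlonglongrightarrow> \<xi>" "(\<lambda>n. norm (\<gamma> n 0)) \<longlonglongrightarrow> 1"
    by (rule limit_setE[OF \<xi>]) blast
  have "eventually (\<lambda>n. dist (\<gamma> n 0) \<xi> < e) sequentially" using tendstoD[OF \<gamma>(2) assms(1)] .
  then obtain N where N: "\<And>n. n \<ge> N \<Longrightarrow> dist (\<gamma> n 0) \<xi> < e" by (auto simp: eventually_sequentially)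
  have d: "\<gamma> n 0 \<in> unit_disk" for n using deckD(3)[OF \<gamma>(1), of 0] by auto
  have S: "\<gamma> n 0 \<in> S" if "n \<ge> N" for n
    using N[OF that] d[of n] assms(2) by (auto simp: dist_commute)
  have eq: "\<gamma> n 0 = \<gamma> N 0" if "n \<ge> N" for n
    using inj_onD[OF assms(3) _ S[OF that] S[of N]] deckD(2)[OF \<gamma>(1), of 0] by simp
  have "(\<lambda>n. norm (\<gamma> n 0)) \<longlonglongrightarrow> norm (\<gamma> N 0)"
  proof (rule tendsto_eventually)
    show "eventually (\<lambda>n. norm (\<gamma> n 0) = norm (\<gamma> N 0)) sequentially"
      unfolding eventually_sequentially by (intro exI[of _ N] allI impI arg_cong[of _ _ norm] eq)
  qed
  then have "norm (\<gamma> N 0) = 1" using \<gamma>(3) LIMSEQ_unique by blast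
  then show False using d[of N] by simp
qed

text \<open>
  If the limit were \<open>f w\<close>, deck transformations would move the points \<open>z n\<close> into a compact neighbourhood of \<open>w\<close>. As
  \<open>z n\<close> tends to the circle, these transformations carry 0 to the circle, so they contract a neighbourhood of
  the point \<open>\<zeta>\<close> off the limit set to a limit point, which lies on the circle and not near \<open>w\<close>.
\<close>

lemma boundary_limit_not_in_image:
  assumes \<zeta>: "norm \<zeta> = 1" "\<zeta> \<notin> \<Lambda>" and z: "\<And>n. z n \<in> unit_disk" "z \<longlonglongrightarrow> \<zeta>" and lim: "(\<lambda>n. f (z n)) \<longlonglongrightarrow> p"
  shows "p \<notin> \<Omega>"
proof
  assume "p \<in> \<Omega>"
  then obtain w where w: "w \<in> unit_disk" "f w = p" using covering_space_imp_surjective[OF cov] by (metis imageE)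
  obtain e where e: "e > 0" "ball w e \<subseteq> unit_disk" "inj_on f (ball w e)" by (rule local_injective[OF w(1)])
  define d where "d = e / 2"
  have d: "d > 0" "cball w d \<subseteq> ball w e" using e by (auto simp: d_def)
  have "open (f ` ball w d)"
  proof (rule invariance_of_domain)
    have sub: "ball w d \<subseteq> ball w e" using d by auto
    show "continuous_on (ball w d) f"
      using continuous_on_subset[OF holomorphic_on_imp_continuous_on[OF holf]] sub e(2) by blast
    show "inj_on f (ball w d)" using inj_on_subset[OF e(3) sub] .
  qed simp
  moreover have "p \<in> f ` ball w d" using w d by auto
  ultimately have "eventually (\<lambda>n. f (z n) \<in> f ` ball w d) sequentially" using lim topological_tendstoD by blast
  then obtain N where N: "\<And>n. n \<ge> N \<Longrightarrow> f (z n) \<in> f ` ball w d" by (auto simp: eventually_sequentially)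
  have "\<exists>v \<gamma>. v \<in> ball w d \<and> \<gamma> \<in> deck \<and> \<gamma> (z (n + N)) = v" for n
  proof -
    obtain v where v: "v \<in> ball w d" "f v = f (z (n + N))" using N[of "n + N"] by force
    then have "v \<in> unit_disk" using d(2) e(2) ball_subset_cball[of w d] by blast
    then obtain \<gamma> where "\<gamma> \<in> deck" "\<gamma> (z (n + N)) = v"
      using deck_transitive[OF z(1)[of "n+N"] _ v(2)[symmetric]] by blast
    then show ?thesis using v by blast
  qed
  then obtain v \<gamma> where v: "\<And>n. v n \<in> ball w d" and \<gamma>: "\<And>n. \<gamma> n \<in> deck" "\<And>n. \<gamma> n (z (n + N)) = v n" by metis
  have z': "(\<lambda>n. z (n + N)) \<longlonglongrightarrow> \<zeta>" using LIMSEQ_ignore_initial_segment[OF z(2)] .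
  have "\<exists>u a. norm u = 1 \<and> norm a < 1 \<and> ext (\<gamma> n) = mob u a" for n
    using ext_deck[OF \<gamma>(1)[of n]] by metis
  then obtain u a where ua: "\<And>n. norm (u n) = 1" "\<And>n. norm (a n) < 1" "\<And>n. ext (\<gamma> n) = mob (u n) (a n)" by metis
  have \<gamma>0: "norm (\<gamma> n 0) = norm (a n)" for n
  proof -
    have "\<gamma> n 0 = - (u n * a n)" using ext_eq[OF \<gamma>(1)[of n], of 0] ua(3)[of n] by (simp add: mob_def)
    then show ?thesis using ua(1)[of n] by (simp add: norm_mult)
  qed
  define \<rho> where "\<rho> = norm w + d"
  have \<rho>: "\<rho> < 1"
  proof -
    define t where "t = (if w = 0 then 1 else w / of_real (norm w))"
    have nt: "norm t = 1" "w = of_real (norm w) * t" by (auto simp: t_def norm_divide)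
    have "w + of_real d * t \<in> ball w e" using d nt(1) by (auto simp: d_def norm_mult dist_norm)
    then have "norm (w + of_real d * t) < 1" using e(2) by auto
    also have "w + of_real d * t = of_real (norm w + d) * t" using nt(2) by (simp add: algebra_simps)
    finally show ?thesis using nt(1) d by (simp only: norm_mult norm_of_real \<rho>_def) simp
  qed
  have nv: "norm (v n) \<le> \<rho>" for n using v[of n] norm_triangle_ineq2[of "v n" w] by (auto simp: \<rho>_def dist_norm norm_minus_commute)
  \<comment> \<open>The Moebius identity for \<open>norm (v n)\<close>, which stays below \<open>\<rho>\<close>: as \<open>norm (z n)\<close> tends to 1, so must
    \<open>norm (a n)\<close>.\<close>
  have ine: "1 - \<rho>\<^sup>2 \<le> (1 - (norm (z (n+N)))\<^sup>2) / (1 - norm (a n))\<^sup>2" for n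
  proof -
    have zn: "norm (z (n+N)) < 1" using z(1) by simp
    have "norm (v n) ^ 2 \<le> \<rho> ^ 2" using nv[of n] by (simp add: power_mono)
    moreover have "1 - (norm (v n))\<^sup>2 = (1 - (norm (a n))\<^sup>2) * (1 - (norm (z (n+N)))\<^sup>2) / (norm (1 - cnj (a n) * z (n+N)))\<^sup>2"
      using mob_norm_identity[OF ua(1)[of n] ua(2)[of n], of "z (n+N)"] zn ext_eq[OF \<gamma>(1)[of n] z(1)[of "n+N"]] \<gamma>(2)[of n] ua(3)[of n] by simp
    moreover have "\<dots> \<le> 1 * (1 - (norm (z (n+N)))\<^sup>2) / (1 - norm (a n))\<^sup>2"
    proof (intro frac_le mult_right_mono power_mono)
      have "norm (cnj (a n) * z (n+N)) \<le> norm (a n) * 1" using zn by (simp add: norm_mult mult_left_le)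
      then show "1 - norm (a n) \<le> norm (1 - cnj (a n) * z (n+N))"
        using norm_triangle_ineq2[of 1 "cnj (a n) * z (n+N)"] by simp
    qed (use ua(2)[of n] zn in \<open>auto simp: abs_square_le_1\<close>)
    ultimately show ?thesis by simp
  qed
  have "1 - \<rho>\<^sup>2 > 0" using \<rho> d by (simp add: \<rho>_def abs_square_less_1)
  have lim1: "(\<lambda>n. norm (a n)) \<longlonglongrightarrow> 1"
  proof (rule LIMSEQ_I)
    fix s :: real assume "s > 0"
    have "(\<lambda>n. 1 - (norm (z (n+N)))\<^sup>2) \<longlonglongrightarrow> 1 - (norm \<zeta>)\<^sup>2" by (intro tendsto_intros z')
    then have "(\<lambda>n. 1 - (norm (z (n+N)))\<^sup>2) \<longlonglongrightarrow> 0" using \<zeta> by simp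
    then have "eventually (\<lambda>n. 1 - (norm (z (n+N)))\<^sup>2 < (1 - \<rho>\<^sup>2) * s\<^sup>2) sequentially"
      using \<open>1 - \<rho>\<^sup>2 > 0\<close> \<open>s > 0\<close> by (intro order_tendstoD(2)) auto
    then obtain M where M: "\<And>n. n \<ge> M \<Longrightarrow> 1 - (norm (z (n+N)))\<^sup>2 < (1 - \<rho>\<^sup>2) * s\<^sup>2" by (auto simp: eventually_sequentially)
    have "norm (norm (a n) - 1) < s" if "n \<ge> M" for n
    proof -
      have p: "1 - norm (a n) > 0" using ua(2)[of n] by simp
      have "(1 - \<rho>\<^sup>2) * (1 - norm (a n))\<^sup>2 \<le> 1 - (norm (z (n+N)))\<^sup>2"
        using ine[of n] p by (simp add: field_simps)
      then have "(1 - \<rho>\<^sup>2) * (1 - norm (a n))\<^sup>2 < (1 - \<rho>\<^sup>2) * s\<^sup>2" using M[OF that] by linarith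
      then have "(1 - norm (a n))\<^sup>2 < s\<^sup>2" using \<open>1 - \<rho>\<^sup>2 > 0\<close> by simp
      then show ?thesis using p \<open>s > 0\<close> by (simp add: power_less_imp_less_base abs_if)
    qed
    then show "\<exists>M. \<forall>n\<ge>M. norm (norm (a n) - 1) < s" by blast
  qed
  obtain r \<xi> \<eta> where r: "strict_mono r" "\<xi> \<in> \<Lambda>" "\<eta> \<in> \<Lambda>" "(\<lambda>n. \<gamma> (r n) 0) \<longlonglongrightarrow> \<xi>"
    and conv: "\<And>z z0. (\<And>n. norm (z n) \<le> 1) \<Longrightarrow> z \<longlonglongrightarrow> z0 \<Longrightarrow> z0 \<noteq> \<eta> \<Longrightarrow> (\<lambda>n. ext (\<gamma> (r n)) (z n)) \<longlonglongrightarrow> \<xi>"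
    using lim1 unfolding \<gamma>0[symmetric] by (rule limit_point_sequence[OF \<gamma>(1)]) blast
  have "(\<lambda>n. ext (\<gamma> (r n)) (z (r n + N))) \<longlonglongrightarrow> \<xi>"
    by (rule conv[of _ \<zeta>])
      (use z(1) \<zeta>(2) r(3) LIMSEQ_subseq_LIMSEQ[OF z' r(1)] in \<open>auto simp: o_def less_imp_le\<close>)
  then have "(\<lambda>n. v (r n)) \<longlonglongrightarrow> \<xi>" using ext_eq[OF \<gamma>(1) z(1)] \<gamma>(2) by simp
  then have "norm \<xi> \<le> \<rho>" using nv by (intro tendsto_upperbound[OF tendsto_norm]) (auto intro: always_eventually)
  then show False using \<rho> r(2) limit_set_subset by auto
qed

lemma deck_power: "\<gamma> \<in> deck \<Longrightarrow> (\<gamma> ^^ n) \<in> deck"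
  by (induction n) (auto simp: deck_id deck_comp)

lemma deck_affine:
  assumes "\<gamma> \<in> deck" "norm x = 1" "ext \<gamma> x = x" "z \<in> unit_disk"
  shows "cayley x (\<gamma> z) = of_real (Re (cayley x (\<gamma> 0))) * cayley x z + \<i> * of_real (Im (cayley x (\<gamma> 0)))"
    and "Re (cayley x (\<gamma> 0)) > 0"
proof -
  obtain u a where ua: "norm u = 1" "norm a < 1" "ext \<gamma> = mob u a" by (rule ext_deck[OF assms(1)])
  have e: "\<gamma> z = mob u a z" "\<gamma> 0 = mob u a 0" using ext_eq[OF assms(1)] assms(4) ua(3) by simp_all
  have "z \<noteq> x" using assms(2,4) by auto
  then show "cayley x (\<gamma> z) = of_real (Re (cayley x (\<gamma> 0))) * cayley x z + \<i> * of_real (Im (cayley x (\<gamma> 0)))"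
    "Re (cayley x (\<gamma> 0)) > 0"
    unfolding e using mob_affine[OF ua(1,2) assms(2), of z] assms(3,4) ua(3) by simp_all
qed

text \<open>
  In the half-plane coordinate at \<open>x\<close> the powers of \<open>\<gamma>\<close> are affine and move 0 to pairwise different points, hence
  towards the circle. If \<open>x\<close> were off the limit set, they would contract the fixed point \<open>x\<close> to a limit point.
\<close>

lemma fixed_point_in_limit_set:
  assumes \<gamma>: "\<gamma> \<in> deck" "\<gamma> 0 \<noteq> 0" and x: "norm x = 1" "ext \<gamma> x = x"
  shows "x \<in> \<Lambda>"
proof (rule ccontr)
  assume nx: "x \<notin> \<Lambda>"
  define c A B where "c n = cayley x ((\<gamma> ^^ n) 0)" and "A = Re (cayley x (\<gamma> 0))" and "B = Im (cayley x (\<gamma> 0))" for n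
  have x0: "x \<noteq> 0" using x by auto
  have d: "(\<gamma> ^^ n) 0 \<in> unit_disk" for n using deckD(3)[OF deck_power[OF \<gamma>(1)], of 0] by simp
  have c0: "c 0 = 1" using x0 by (simp add: c_def cayley_def)
  have step: "c (Suc n) = of_real A * c n + \<i> * of_real B" for n
    using deck_affine(1)[OF \<gamma>(1) x d[of n]] by (simp add: c_def A_def B_def)
  have A: "A > 0" using deck_affine(2)[OF \<gamma>(1) x, of 0] by (simp add: A_def)
  have re: "Re (c n) = A ^ n" for n by (induction n) (auto simp: c0 step)
  have "inj c"
  proof (cases "A = 1")
    case True
    have im: "Im (c n) = of_nat n * B" for n by (induction n) (auto simp: c0 step True algebra_simps)
    have "B \<noteq> 0"
    proof
      assume "B = 0"
      then have "cayley x (\<gamma> 0) = cayley x 0" using step[of 0] c0 True by (simp add: c_def)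
      then have "\<gamma> 0 = 0" by (rule cayley_inj[OF x0, rotated 2]) (use x d[of 1] in auto)
      then show False using \<gamma>(2) by simp
    qed
    show ?thesis
    proof (rule injI)
      fix m n assume "c m = c n"
      then have "of_nat m * B = of_nat n * B" using im by metis
      then show "m = n" using \<open>B \<noteq> 0\<close> by simp
    qed
  next
    case False
    show ?thesis
    proof (rule injI)
      fix m n assume "c m = c n"
      then have "A ^ m = A ^ n" using re by metis
      then have "ln (A ^ m) = ln (A ^ n)" by simp
      then have "of_nat m * ln A = of_nat n * ln A" using A by (simp add: ln_realpow)
      moreover have "ln A \<noteq> 0" using A False by simp
      ultimately show "m = n" by simp
    qed
  qed
  then have "inj (\<lambda>n. (\<gamma> ^^ n) 0)" unfolding c_def inj_def by metis
  from infinite_orbit_norm[OF deck_power[OF \<gamma>(1)] this]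
  obtain r \<xi> \<eta> where r: "strict_mono r" "\<xi> \<in> \<Lambda>" "\<eta> \<in> \<Lambda>"
    and conv: "\<And>z z0. (\<And>n. norm (z n) \<le> 1) \<Longrightarrow> z \<longlonglongrightarrow> z0 \<Longrightarrow> z0 \<noteq> \<eta> \<Longrightarrow> (\<lambda>n. ext (\<gamma> ^^ r n) (z n)) \<longlonglongrightarrow> \<xi>"
    by (rule limit_point_sequence[OF deck_power[OF \<gamma>(1)]]) blast
  have fixd: "ext (\<gamma> ^^ n) x = x" for n
  proof (induction n)
    case 0
    show ?case using ext_id[of x] x(1) by (simp only: funpow.simps(1) order_refl)
  next
    case (Suc n)
    have "ext (\<gamma> \<circ> \<gamma> ^^ n) x = ext \<gamma> (ext (\<gamma> ^^ n) x)"
      by (rule ext_comp[OF \<gamma>(1) deck_power[OF \<gamma>(1)]]) (use x in simp)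
    then show ?case by (simp only: funpow.simps(2) Suc.IH x(2))
  qed
  have "(\<lambda>n. ext (\<gamma> ^^ r n) x) \<longlonglongrightarrow> \<xi>" by (rule conv[of "\<lambda>_. x" x]) (use x nx r(3) in auto)
  then have "x = \<xi>" unfolding fixd by (simp add: LIMSEQ_const_iff)
  then show False using nx r(2) by simp
qed

text \<open>
  Otherwise there are points \<open>z n \<noteq> w n\<close> that tend to \<open>\<xi>\<close> and deck transformations \<open>\<gamma> n\<close> with \<open>\<gamma> n (z n) = w n\<close>.
  If only finitely many transformations occur, one of them fixes \<open>\<xi>\<close>; if infinitely many, they contract the \<open>z n\<close> to a
  limit point, which must be the limit \<open>\<xi>\<close> of the \<open>w n\<close>. Either way \<open>\<xi>\<close> would be a limit point.
\<close>

lemma injective_near_nonlimit: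
  assumes \<xi>: "norm \<xi> = 1" "\<xi> \<notin> \<Lambda>"
  obtains e where "e > 0" "inj_on f (ball \<xi> e \<inter> unit_disk)"
proof (rule ccontr)
  assume contr: "\<not> thesis"
  have "\<exists>z w. z \<in> unit_disk \<and> w \<in> unit_disk \<and> dist \<xi> z < 1 / Suc n \<and> dist \<xi> w < 1 / Suc n \<and> z \<noteq> w \<and> f z = f w" for n
  proof -
    have "\<not> inj_on f (ball \<xi> (1 / Suc n) \<inter> unit_disk)" using contr that[of "1 / Suc n"] by auto
    then show ?thesis unfolding inj_on_def by force
  qed
  then obtain z w where zw: "\<And>n. z n \<in> unit_disk" "\<And>n. w n \<in> unit_disk" "\<And>n. dist \<xi> (z n) < 1 / Suc n" "\<And>n. dist \<xi> (w n) < 1 / Suc n"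
    "\<And>n. z n \<noteq> w n" "\<And>n. f (z n) = f (w n)" by metis
  have lim: "s \<longlonglongrightarrow> \<xi>" if "\<And>n. dist \<xi> (s n) < 1 / Suc n" for s
  proof -
    have "(\<lambda>n. dist (s n) \<xi>) \<longlonglongrightarrow> 0"
      by (rule tendsto_sandwich[OF _ _ tendsto_const LIMSEQ_Suc[OF lim_1_over_n]])
         (use that in \<open>auto intro!: always_eventually less_imp_le simp: dist_commute\<close>)
    then show ?thesis by (rule tendsto_dist_iff[THEN iffD2])
  qed
  have lz: "z \<longlonglongrightarrow> \<xi>" and lw: "w \<longlonglongrightarrow> \<xi>" using lim zw by auto
  have "\<exists>\<gamma>\<in>deck. \<gamma> (z n) = w n" for n
    by (rule deck_transitive[OF zw(1)[of n] zw(2)[of n] zw(6)[of n]]) blast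
  then obtain \<gamma> where \<gamma>: "\<And>n. \<gamma> n \<in> deck" "\<And>n. \<gamma> n (z n) = w n" by metis
  have ne: "\<gamma> n 0 \<noteq> 0" for n
  proof
    assume "\<gamma> n 0 = 0"
    then have "\<gamma> n (z n) = id (z n)" by (intro deck_unique[OF \<gamma>(1)[of n] deck_id _ _ zw(1)[of n], of 0]) simp_all
    then have "w n = z n" using \<gamma>(2)[of n] by (simp only: id_apply)
    then show False using zw(5)[of n] by (simp only:)
  qed
  show False
  proof (cases "finite (range (\<lambda>n. \<gamma> n 0))")
    case True
    then obtain m where m: "infinite {n. \<gamma> n 0 = \<gamma> m 0}"
      using pigeonhole_infinite[of UNIV "\<lambda>n. \<gamma> n 0"] by auto
    obtain r :: "nat \<Rightarrow> nat" where r: "strict_mono r" "\<And>n. r n \<in> {n. \<gamma> n 0 = \<gamma> m 0}"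
      using infinite_enumerate[OF m] by blast
    have eq: "\<gamma> m (z (r n)) = w (r n)" for n
      using deck_unique[OF \<gamma>(1)[of m] \<gamma>(1)[of "r n"] _ _ zw(1)[of "r n"], of 0] r(2)[of n] \<gamma>(2)[of "r n"] by (simp only: mem_Collect_eq centre_in_ball zero_less_one)
    have "(\<lambda>n. ext (\<gamma> m) (z (r n))) \<longlonglongrightarrow> ext (\<gamma> m) \<xi>"
      using continuous_on_tendsto_compose[OF ext_props(1)[OF \<gamma>(1)[of m]] LIMSEQ_subseq_LIMSEQ[OF lz r(1)]] \<xi>(1) zw(1)
      by (simp add: o_def less_imp_le)
    then have "(\<lambda>n. w (r n)) \<longlonglongrightarrow> ext (\<gamma> m) \<xi>" using ext_eq[OF \<gamma>(1) zw(1)] eq by simp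
    moreover have "(\<lambda>n. w (r n)) \<longlonglongrightarrow> \<xi>" using LIMSEQ_subseq_LIMSEQ[OF lw r(1)] by (simp add: o_def)
    ultimately have "ext (\<gamma> m) \<xi> = \<xi>" using LIMSEQ_unique by blast
    then show False using fixed_point_in_limit_set[OF \<gamma>(1) ne \<xi>(1)] \<xi>(2) by blast
  next
    case False
    then obtain s :: "nat \<Rightarrow> complex" where s: "inj s" "range s \<subseteq> range (\<lambda>n. \<gamma> n 0)"
      using infinite_countable_subset by blast
    then have "\<exists>k. \<gamma> k 0 = s n" for n by (metis UNIV_I imageE image_subset_iff)
    then obtain k where k: "\<And>n. \<gamma> (k n) 0 = s n" by metis
    have "inj k" using s(1) k by (metis injD injI)
    then have "infinite (range k)" using finite_imageD infinite_UNIV_nat by blast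
    then obtain r :: "nat \<Rightarrow> nat" where r: "strict_mono r" "\<And>n. r n \<in> range k" using infinite_enumerate by blast
    have "inj (\<lambda>n. \<gamma> (r n) 0)"
    proof (rule injI)
      fix a b assume ab: "\<gamma> (r a) 0 = \<gamma> (r b) 0"
      obtain i j where "r a = k i" "r b = k j" using r(2) by (metis imageE)
      then show "a = b" using ab k s(1) r(1) by (metis injD strict_mono_eq)
    qed
    from infinite_orbit_norm[of "\<lambda>n. \<gamma> (r n)", OF \<gamma>(1) this] have "(\<lambda>n. norm (\<gamma> (r n) 0)) \<longlonglongrightarrow> 1" .
    then obtain q \<xi>' \<eta> where q: "strict_mono q" "\<xi>' \<in> \<Lambda>" "\<eta> \<in> \<Lambda>"
      and conv: "\<And>z z0. (\<And>n. norm (z n) \<le> 1) \<Longrightarrow> z \<longlonglongrightarrow> z0 \<Longrightarrow> z0 \<noteq> \<eta> \<Longrightarrow> (\<lambda>n. ext (\<gamma> (r (q n))) (z n)) \<longlonglongrightarrow> \<xi>'"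
      by (rule limit_point_sequence[OF \<gamma>(1)]) blast
    have rq: "strict_mono (r \<circ> q)" using r(1) q(1) by (rule strict_mono_o)
    have "(\<lambda>n. ext (\<gamma> (r (q n))) (z (r (q n)))) \<longlonglongrightarrow> \<xi>'"
      by (rule conv[of _ \<xi>]) (use zw(1) \<xi>(2) q(3) LIMSEQ_subseq_LIMSEQ[OF lz rq] in \<open>auto simp: o_def intro!: less_imp_le\<close>)
    then have "(\<lambda>n. w (r (q n))) \<longlonglongrightarrow> \<xi>'" using ext_eq[OF \<gamma>(1) zw(1)] \<gamma>(2) by simp
    moreover have "(\<lambda>n. w (r (q n))) \<longlonglongrightarrow> \<xi>" using LIMSEQ_subseq_LIMSEQ[OF lw rq] by (simp add: o_def)
    ultimately have "\<xi> = \<xi>'" using LIMSEQ_unique by blast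
    then show False using \<xi>(2) q(2) by simp
  qed
qed

end

section \<open>Characters of discrete groups of affine maps of the line\<close>

lemma discrete_real_subgroup_cyclic:
  fixes T :: "real set"
  assumes T0: "0 \<in> T" and Tdiff: "\<And>s t. s \<in> T \<Longrightarrow> t \<in> T \<Longrightarrow> s - t \<in> T"
    and e: "e > 0" "\<And>t. t \<in> T \<Longrightarrow> \<bar>t\<bar> < e \<Longrightarrow> t = 0"
  obtains t0 where "t0 \<in> T" "\<And>t. t \<in> T \<Longrightarrow> \<exists>k::int. t = of_int k * t0"
proof (cases "T = {0}")
  case True
  then show thesis using that[of 0] by auto
next
  case False
  have Tneg: "- t \<in> T" if "t \<in> T" for t using Tdiff[OF T0 that] by simp
  have Tadd: "s + t \<in> T" if "s \<in> T" "t \<in> T" for s t using Tdiff[OF that(1) Tneg[OF that(2)]] by simp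
  have Tnat: "of_nat n * t \<in> T" if "t \<in> T" for n t
    by (induction n) (auto simp: T0 algebra_simps intro: Tadd that)
  have Tint: "of_int k * t \<in> T" if "t \<in> T" for k t
    by (cases k) (use Tnat[OF that] Tneg[OF Tnat[OF that]] in \<open>auto simp del: of_nat_Suc\<close>)
  define P where "P = {t \<in> T. t > 0}"
  obtain s where "s \<in> T" "s \<noteq> 0" using False T0 by auto
  then have Pne: "P \<noteq> {}" using Tneg[of s] by (cases "s > 0") (auto simp: P_def intro: exI[of _ "-s"])
  have bb: "bdd_below P" by (auto simp: P_def intro!: bdd_belowI[of _ 0])
  define m where "m = Inf P"
  have mle: "m \<le> t" if "t \<in> P" for t using bb that by (simp add: m_def cInf_lower)
  have "\<exists>t\<in>P. t < m + e / 2" using cInf_less_iff[OF Pne bb, of "m + e/2"] e(1) by (auto simp: m_def)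
  then obtain t1 where t1: "t1 \<in> P" "t1 < m + e / 2" by blast
  have t1min: "t1 \<le> t" if "t \<in> P" for t
  proof (rule ccontr)
    assume "\<not> t1 \<le> t"
    then have "t1 - t \<in> T" "\<bar>t1 - t\<bar> < e" "t1 - t \<noteq> 0"
      using mle[OF that] mle[OF t1(1)] t1 that e(1) Tdiff by (auto simp: P_def abs_if)
    then show False using e(2) by blast
  qed
  have p: "t1 > 0" "t1 \<in> T" using t1 by (auto simp: P_def)
  have "\<exists>k::int. t = of_int k * t1" if "t \<in> T" for t
  proof -
    define k where "k = \<lfloor>t / t1\<rfloor>"
    have "of_int k \<le> t / t1" "t / t1 < of_int k + 1" by (auto simp: k_def)
    then have r: "0 \<le> t - of_int k * t1" "t - of_int k * t1 < t1" using p by (auto simp: field_simps)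
    have "t - of_int k * t1 \<in> T" by (intro Tdiff Tint that p)
    then have "t - of_int k * t1 = 0" using r t1min[of "t - of_int k * t1"] by (force simp: P_def)
    then show ?thesis by auto
  qed
  then show thesis using that p by blast
qed

text \<open>
  The pair \<open>(a, b)\<close> stands for the map that takes \<open>t\<close> to \<open>a * t + b\<close>; the product is composition.
\<close>

definition aff_mult :: "real \<times> real \<Rightarrow> real \<times> real \<Rightarrow> real \<times> real" where
  "aff_mult g h = (fst g * fst h, fst g * snd h + snd g)"

text \<open>
  The character \<open>\<tau>\<close> has trivial kernel and discrete values, so \<open>H\<close> is generated by one element \<open>g0\<close>, and
  any two integer characters are proportional to each other.
\<close>

lemma cyclic_rank_le_1:
  fixes n1 n2 :: "real \<times> real \<Rightarrow> int" and \<tau> :: "real \<times> real \<Rightarrow> real"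
  assumes one: "(1,0) \<in> H" and mult: "\<And>g h. g \<in> H \<Longrightarrow> h \<in> H \<Longrightarrow> aff_mult g h \<in> H"
    and inv: "\<And>g. g \<in> H \<Longrightarrow> \<exists>h\<in>H. aff_mult g h = (1,0)"
    and n1: "\<And>g h. g \<in> H \<Longrightarrow> h \<in> H \<Longrightarrow> n1 (aff_mult g h) = n1 g + n1 h"
    and n2: "\<And>g h. g \<in> H \<Longrightarrow> h \<in> H \<Longrightarrow> n2 (aff_mult g h) = n2 g + n2 h"
    and \<tau>: "\<And>g h. g \<in> H \<Longrightarrow> h \<in> H \<Longrightarrow> \<tau> (aff_mult g h) = \<tau> g + \<tau> h"
    and e: "e > 0" "\<And>h. h \<in> H \<Longrightarrow> \<bar>\<tau> h\<bar> < e \<Longrightarrow> h = (1,0)"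
  shows "\<exists>p q. (p,q) \<noteq> (0,0) \<and> (\<forall>h\<in>H. p * n1 h + q * n2 h = 0)"
proof -
  have triv: "n1 (1,0) = 0" "n2 (1,0) = 0" "\<tau> (1,0) = 0"
    using n1[OF one one] n2[OF one one] \<tau>[OF one one] by (auto simp: aff_mult_def)
  have ratio: "\<exists>k\<in>H. \<tau> k = \<tau> g - \<tau> h \<and> n1 k = n1 g - n1 h \<and> n2 k = n2 g - n2 h" if "g \<in> H" "h \<in> H" for g h
  proof -
    obtain i where i: "i \<in> H" "aff_mult h i = (1,0)" using inv[OF \<open>h \<in> H\<close>] by blast
    then have "\<tau> h + \<tau> i = 0" "n1 h + n1 i = 0" "n2 h + n2 i = 0"
      using \<tau>[OF \<open>h \<in> H\<close> i(1)] n1[OF \<open>h \<in> H\<close> i(1)] n2[OF \<open>h \<in> H\<close> i(1)] triv by auto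
    then show ?thesis using mult[OF \<open>g \<in> H\<close> i(1)] \<tau>[OF \<open>g \<in> H\<close> i(1)] n1[OF \<open>g \<in> H\<close> i(1)] n2[OF \<open>g \<in> H\<close> i(1)]
      by (intro bexI[of _ "aff_mult g i"]) auto
  qed
  have disc: "t = 0" if "t \<in> \<tau> ` H" "\<bar>t\<bar> < e" for t using that e(2) triv by auto
  have T0: "0 \<in> \<tau> ` H" using one triv(3) by (metis imageI)
  have Td: "s - t \<in> \<tau> ` H" if st: "s \<in> \<tau> ` H" "t \<in> \<tau> ` H" for s t
  proof -
    obtain g h where "g \<in> H" "h \<in> H" "s = \<tau> g" "t = \<tau> h" using st by blast
    then show ?thesis using ratio[of g h] by (metis imageI)
  qed
  obtain t0 where t0: "t0 \<in> \<tau> ` H" "\<And>t. t \<in> \<tau> ` H \<Longrightarrow> \<exists>k::int. t = of_int k * t0"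
    by (rule discrete_real_subgroup_cyclic[OF T0 Td e(1) disc]) blast+
  obtain g0 where g0: "g0 \<in> H" "\<tau> g0 = t0" using t0 by blast
  have nat: "n1 h = int k * n1 g0 \<and> n2 h = int k * n2 g0" if "h \<in> H" "\<tau> h = of_nat k * t0" for h k
    using that
  proof (induction k arbitrary: h)
    case 0
    then have "h = (1,0)" using e by simp
    then show ?case using triv by simp
  next
    case (Suc k)
    obtain h' where h': "h' \<in> H" "\<tau> h' = \<tau> h - \<tau> g0" "n1 h' = n1 h - n1 g0" "n2 h' = n2 h - n2 g0"
      using ratio[OF \<open>h \<in> H\<close> g0(1)] by blast
    then show ?case using Suc.IH[OF h'(1)] Suc.prems g0 by (simp add: algebra_simps)
  qed
  have int: "\<exists>k. n1 h = k * n1 g0 \<and> n2 h = k * n2 g0" if "h \<in> H" for h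
  proof -
    obtain k where k: "\<tau> h = of_int k * t0" using t0(2) \<open>h \<in> H\<close> by blast
    show ?thesis
    proof (cases "k \<ge> 0")
      case True
      then show ?thesis using nat[OF \<open>h \<in> H\<close>, of "nat k"] k by auto
    next
      case False
      obtain h' where h': "h' \<in> H" "\<tau> h' = \<tau> (1,0) - \<tau> h" "n1 h' = n1 (1,0) - n1 h" "n2 h' = n2 (1,0) - n2 h"
        using ratio[OF one \<open>h \<in> H\<close>] by blast
      then have "\<tau> h' = of_nat (nat (- k)) * t0" using False k triv by simp
      from nat[OF h'(1) this] show ?thesis using h' triv False by (intro exI[of _ k]) auto
    qed
  qed
  show ?thesis
  proof (cases "n1 g0 = 0 \<and> n2 g0 = 0")
    case True
    have "1 * n1 h + 0 * n2 h = 0" if "h \<in> H" for h using int[OF that] True by auto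
    then show ?thesis by (intro exI[of _ "1::int"] exI[of _ "0::int"]) auto
  next
    case False
    have "n2 g0 * n1 h + (- n1 g0) * n2 h = 0" if "h \<in> H" for h using int[OF that] by (auto simp: algebra_simps)
    then show ?thesis using False by (intro exI[of _ "n2 g0"] exI[of _ "- n1 g0"]) auto
  qed
qed

text \<open>
  A discrete group of increasing affine maps is cyclic. If it consists of translations, use the translation length. Otherwise
  conjugation by a contraction makes translations arbitrarily short, so there are none apart from the identity;
  then all commutators are trivial, the group has a common fixed point, and the logarithm of the slope is
  a faithful discrete character.
\<close>

lemma affine_rank_le_1:
  fixes n1 n2 :: "real \<times> real \<Rightarrow> int"
  assumes one: "(1,0) \<in> H" and mult: "\<And>g h. g \<in> H \<Longrightarrow> h \<in> H \<Longrightarrow> aff_mult g h \<in> H"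
    and inv: "\<And>g. g \<in> H \<Longrightarrow> \<exists>h\<in>H. aff_mult g h = (1,0)"
    and pos: "\<And>g. g \<in> H \<Longrightarrow> fst g > 0"
    and n1: "\<And>g h. g \<in> H \<Longrightarrow> h \<in> H \<Longrightarrow> n1 (aff_mult g h) = n1 g + n1 h"
    and n2: "\<And>g h. g \<in> H \<Longrightarrow> h \<in> H \<Longrightarrow> n2 (aff_mult g h) = n2 g + n2 h"
    and e: "e > 0" "\<And>h. h \<in> H \<Longrightarrow> \<bar>fst h - 1\<bar> < e \<Longrightarrow> \<bar>snd h\<bar> < e \<Longrightarrow> h = (1,0)"
  shows "\<exists>p q. (p,q) \<noteq> (0,0) \<and> (\<forall>h\<in>H. p * n1 h + q * n2 h = 0)"
proof (cases "\<forall>g\<in>H. fst g = 1")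
  case True
  show ?thesis
  proof (rule cyclic_rank_le_1[where \<tau>=snd and e=e, OF one mult inv n1 n2])
    show "snd (aff_mult g h) = snd g + snd h" if "g \<in> H" "h \<in> H" for g h
      using that True by (auto simp: aff_mult_def)
    show "h = (1, 0)" if "h \<in> H" "\<bar>snd h\<bar> < e" for h using e(2)[OF that(1)] e(1) True that by simp
  qed (use e(1) in auto)
next
  case False
  then obtain g' where g': "g' \<in> H" "fst g' \<noteq> 1" by blast
  have invf: "\<exists>h\<in>H. fst h = 1 / fst g \<and> snd h = - snd g / fst g" if "g \<in> H" for g
  proof -
    obtain h where "h \<in> H" "aff_mult g h = (1,0)" using inv[OF \<open>g \<in> H\<close>] by blast
    then show ?thesis using pos[OF \<open>g \<in> H\<close>] by (intro bexI[of _ h]) (auto simp: aff_mult_def field_simps)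
  qed
  obtain g where g: "g \<in> H" "fst g < 1"
  proof (cases "fst g' < 1")
    case False
    then have "fst g' > 1" using g' by simp
    then show thesis using invf[OF g'(1)] that by auto
  qed (use g' that in blast)
  define A0 B0 where "A0 = fst g" and "B0 = snd g"
  have A0: "0 < A0" "A0 < 1" using g pos by (auto simp: A0_def)
  have trans: "t = 0" if t: "(1, t) \<in> H" for t
  proof -
    \<comment> \<open>Conjugating the translation by the contraction \<open>g\<close> multiplies its length by \<open>A0\<close>.\<close>
    have pw: "(1, A0 ^ m * t) \<in> H" for m
    proof (induction m)
      case (Suc m)
      obtain h where h: "h \<in> H" "fst h = 1 / A0" "snd h = - B0 / A0" using invf[OF g(1)] by (auto simp: A0_def B0_def)
      have "aff_mult (aff_mult g (1, A0 ^ m * t)) h \<in> H" using mult g(1) Suc h(1) by blast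
      moreover have "aff_mult (aff_mult g (1, A0 ^ m * t)) h = (1, A0 ^ Suc m * t)"
        using A0 h by (simp add: aff_mult_def A0_def[symmetric] B0_def[symmetric])
      ultimately show ?case by simp
    qed (use t in simp)
    have "(\<lambda>m. A0 ^ m * t) \<longlonglongrightarrow> 0 * t" by (intro tendsto_intros LIMSEQ_realpow_zero) (use A0 in auto)
    then have "(\<lambda>m. A0 ^ m * t) \<longlonglongrightarrow> 0" by simp
    from LIMSEQ_D[OF this e(1)] obtain m where "\<bar>A0 ^ m * t\<bar> < e" by auto
    then have "(1, A0 ^ m * t) = (1, 0)" using e(2)[OF pw[of m]] e(1) by simp
    then show ?thesis using A0 by simp
  qed
  define K where "K = B0 / (A0 - 1)"
  have snd: "snd h = K * (fst h - 1)" if h: "h \<in> H" for h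
  proof -
    obtain gi where gi: "gi \<in> H" "fst gi = 1 / A0" "snd gi = - B0 / A0" using invf[OF g(1)] by (auto simp: A0_def B0_def)
    obtain hi where hi: "hi \<in> H" "fst hi = 1 / fst h" "snd hi = - snd h / fst h" using invf[OF h] by blast
    \<comment> \<open>The commutator of \<open>g\<close> and \<open>h\<close> has slope 1.\<close>
    define k where "k = aff_mult (aff_mult g h) (aff_mult gi hi)"
    have "k \<in> H" unfolding k_def using mult g(1) h gi(1) hi(1) by blast
    have ph: "fst h > 0" using pos[OF h] .
    have "fst k = 1" using A0 ph gi hi by (simp add: k_def aff_mult_def A0_def[symmetric])
    moreover have "snd k = (A0 - 1) * snd h - (fst h - 1) * B0"
      unfolding k_def aff_mult_def fst_conv snd_conv gi(2,3) hi(2,3) A0_def[symmetric] B0_def[symmetric]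
      using A0 ph by (simp add: field_simps)
    ultimately have "k = (1, (A0 - 1) * snd h - (fst h - 1) * B0)" by (simp add: prod_eq_iff)
    then have "(A0 - 1) * snd h - (fst h - 1) * B0 = 0" using trans \<open>k \<in> H\<close> by metis
    then show ?thesis using A0 by (simp add: K_def field_simps)
  qed
  define d where "d = min e (e / (\<bar>K\<bar> + 1))"
  have d: "d > 0" "d \<le> e" "\<bar>K\<bar> * d < e"
  proof -
    show "d > 0" "d \<le> e" using e(1) by (auto simp: d_def)
    have "\<bar>K\<bar> * d \<le> \<bar>K\<bar> * (e / (\<bar>K\<bar> + 1))" by (intro mult_left_mono) (auto simp: d_def)
    also have "\<dots> < e" using e(1) by (simp add: field_simps)
    finally show "\<bar>K\<bar> * d < e" .
  qed
  have "isCont exp (0::real)" by simp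
  then obtain s where s: "s > 0" "\<And>x::real. \<bar>x\<bar> < s \<Longrightarrow> \<bar>exp x - 1\<bar> < d"
    using d(1) unfolding continuous_at_eps_delta by (auto simp: dist_real_def)
  show ?thesis
  proof (rule cyclic_rank_le_1[where \<tau>="\<lambda>h. ln (fst h)" and e=s, OF one mult inv n1 n2])
    show "ln (fst (aff_mult g h)) = ln (fst g) + ln (fst h)" if "g \<in> H" "h \<in> H" for g h
      using that pos by (simp add: aff_mult_def ln_mult_pos)
    show "h = (1, 0)" if "h \<in> H" "\<bar>ln (fst h)\<bar> < s" for h
    proof (rule e(2)[OF that(1)])
      have *: "\<bar>fst h - 1\<bar> < d" using s(2)[OF that(2)] pos[OF that(1)] by simp
      then show "\<bar>fst h - 1\<bar> < e" using d by simp
      have "\<bar>snd h\<bar> \<le> \<bar>K\<bar> * d" using * by (simp add: snd[OF that(1)] abs_mult mult_left_mono)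
      then show "\<bar>snd h\<bar> < e" using d by simp
    qed
  qed (use s(1) in auto)
qed

section \<open>Existence of three limit points\<close>

lemma exp_eq_1_constant:
  fixes \<phi> :: "'a::topological_space \<Rightarrow> complex"
  assumes "connected S" "continuous_on S \<phi>" "\<And>t. t \<in> S \<Longrightarrow> exp (\<phi> t) = 1" "s \<in> S" "t \<in> S"
  shows "\<phi> s = \<phi> t"
proof -
  have "\<phi> constant_on S"
  proof (rule continuous_discrete_range_constant[OF assms(1,2)])
    fix x assume "x \<in> S"
    have "1 \<le> norm (\<phi> y - \<phi> x)" if "y \<in> S" "\<phi> y \<noteq> \<phi> x" for y
    proof -
      obtain m where m: "Re (\<phi> x) = 0" "Im (\<phi> x) = of_int (2 * m) * pi" using assms(3)[OF \<open>x \<in> S\<close>] by (auto simp: exp_eq_1)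
      obtain n where n: "Re (\<phi> y) = 0" "Im (\<phi> y) = of_int (2 * n) * pi" using assms(3)[OF \<open>y \<in> S\<close>] by (auto simp: exp_eq_1)
      have "n \<noteq> m" using that(2) m n by (auto simp: complex_eq_iff)
      then have "1 \<le> \<bar>real_of_int (n - m)\<bar>" by linarith
      moreover have "1 \<le> 2 * pi" using pi_ge_two by simp
      ultimately have "1 * 1 \<le> \<bar>real_of_int (n - m)\<bar> * (2 * pi)" by (intro mult_mono) auto
      also have "\<dots> = \<bar>Im (\<phi> y - \<phi> x)\<bar>"
      proof -
        have "Im (\<phi> y - \<phi> x) = real_of_int (n - m) * (2 * pi)" using m n by (simp add: algebra_simps)
        then show ?thesis by (simp only: abs_mult) simp
      qed
      also have "\<dots> \<le> norm (\<phi> y - \<phi> x)" by (rule abs_Im_le_cmod)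
      finally show ?thesis by simp
    qed
    then show "\<exists>e>0. \<forall>y. y \<in> S \<and> \<phi> y \<noteq> \<phi> x \<longrightarrow> e \<le> norm (\<phi> y - \<phi> x)" by (intro exI[of _ 1]) auto
  qed
  then show ?thesis using assms(4,5) by (auto simp: constant_on_def)
qed

text \<open>
  The function \<open>(w - k) powi p\<close> is kept away from \<open>K\<close>; near \<open>K\<close> it is replaced by \<open>exp (h w) / g w\<close>, with \<open>h\<close> extended
  across \<open>K\<close> by Tietze's theorem. The result is a zero-free continuous function on the plane, which has a
  logarithm, although it has winding number \<open>p\<close> along a large circle.
\<close>

lemma no_logarithm_around_compact_piece:
  fixes K L :: "complex set" and p :: int
  assumes K: "compact K" "closed L" "K \<inter> L = {}" "k \<in> K" and "p \<noteq> 0"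
    and g: "continuous_on (- L) g" "\<And>w. w \<notin> L \<Longrightarrow> g w \<noteq> 0"
    and h: "continuous_on (- (K \<union> L)) h" "\<And>w. w \<notin> K \<union> L \<Longrightarrow> exp (h w) = (w - k) powi p * g w"
  shows False
proof -
  obtain d where d: "d > 0" "\<And>x y. x \<in> K \<Longrightarrow> y \<in> L \<Longrightarrow> d \<le> dist x y"
    using separate_compact_closed[OF K(1,2,3)] by blast
  have Kne: "K \<noteq> {}" "closed K" using K by (auto simp: compact_imp_closed)
  define i where "i z = infdist z K" for z
  have conti: "continuous_on A i" for A unfolding i_def by (intro continuous_intros)
  have notL: "z \<notin> L" if "i z \<le> d / 2" for z
  proof
    assume "z \<in> L"
    obtain x where "x \<in> K" "i z = dist z x" using infdist_attains_inf[OF Kne(2,1)] by (auto simp: i_def)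
    then show False using d(2)[OF \<open>x \<in> K\<close> \<open>z \<in> L\<close>] that d(1) by (simp add: dist_commute)
  qed
  have notK: "z \<notin> K" if "i z \<ge> d / 2" for z
    using that d(1) by (auto simp: i_def)
  define S where "S = i -` {d/2}"
  have clS: "closed S" unfolding S_def by (intro closed_vimage conti) auto
  have "continuous_on S h" by (rule continuous_on_subset[OF h(1)]) (use notL notK in \<open>auto simp: S_def\<close>)
  then obtain h' where h': "continuous_on UNIV h'" "\<And>x. x \<in> S \<Longrightarrow> h' x = h x"
    using Tietze_unbounded[of S h UNIV] clS by auto
  define G where "G z = (if i z \<le> d / 2 then exp (h' z) / g z else (z - k) powi p)" for z
  have "continuous_on ({z. i z \<le> d/2} \<union> {z. i z \<ge> d/2}) G"
    unfolding G_def
  proof (rule continuous_on_cases)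
    show "closed {z. i z \<le> d/2}" "closed {z. i z \<ge> d/2}"
      by (intro closed_Collect_le conti continuous_on_const)+
    show "continuous_on {z. i z \<le> d/2} (\<lambda>z. exp (h' z) / g z)"
      by (intro continuous_intros continuous_on_subset[OF h'(1)] continuous_on_subset[OF g(1)]) (use notL g(2) in auto)
    show "continuous_on {z. i z \<ge> d/2} (\<lambda>z. (z - k) powi p)"
      by (intro continuous_on_power_int continuous_intros) (use notK K(4) in auto)
    show "\<forall>z. z \<in> {z. i z \<le> d/2} \<and> \<not> i z \<le> d/2 \<or> z \<in> {z. i z \<ge> d/2} \<and> i z \<le> d/2 \<longrightarrow> exp (h' z) / g z = (z - k) powi p"
    proof (intro allI impI)
      fix z assume "z \<in> {z. i z \<le> d/2} \<and> \<not> i z \<le> d/2 \<or> z \<in> {z. i z \<ge> d/2} \<and> i z \<le> d/2"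
      then have e: "i z = d/2" by auto
      have "z \<notin> K" "z \<notin> L" using notK[of z] notL[of z] e by auto
      then have "exp (h z) = (z - k) powi p * g z" "g z \<noteq> 0" using h(2) g(2) by auto
      then show "exp (h' z) / g z = (z - k) powi p" using h'(2)[of z] e by (simp add: S_def)
    qed
  qed
  moreover have "{z. i z \<le> d/2} \<union> {z. i z \<ge> d/2} = UNIV" by auto
  ultimately have contG: "continuous_on UNIV G" by simp
  have nzG: "G z \<noteq> 0" for z
    using notL[of z] g(2)[of z] notK[of z] K(4) by (auto simp: G_def)
  obtain F where F: "continuous_on UNIV F" "\<And>z. G z = exp (F z)"
    using continuous_logarithm_on_contractible[OF contG] nzG contractible_UNIV by auto
  obtain B where B: "\<And>x. x \<in> K \<Longrightarrow> dist k x \<le> B" using compact_imp_bounded[OF K(1)] bounded_any_center[of K k] by auto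
  define R where "R = B + d"
  have R: "R > 0" using B[OF K(4)] d(1) by (simp add: R_def)
  have far: "G z = (z - k) powi p" if "norm (z - k) = R" for z
  proof -
    obtain x where x: "x \<in> K" "i z = dist z x" using infdist_attains_inf[OF Kne(2,1)] by (auto simp: i_def)
    have "R \<le> dist z x + dist k x" using dist_triangle[of z k x] that by (simp add: dist_norm norm_minus_commute)
    then have "i z > d/2" using x B[OF x(1)] d(1) by (simp add: R_def)
    then show ?thesis by (simp add: G_def)
  qed
  define c where "c t = k + of_real R * exp (\<i> * of_real t)" for t :: real
  define \<phi> where "\<phi> t = F (c t) - of_int p * (of_real (ln R) + \<i> * of_real t)" for t
  have "\<phi> 0 = \<phi> (2 * pi)"
  proof (rule exp_eq_1_constant[of UNIV \<phi>])
    show "continuous_on UNIV \<phi>" unfolding \<phi>_def c_def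
      by (intro continuous_intros continuous_on_compose2[OF F(1)]) auto
    fix t
    have "exp (F (c t)) = (of_real R * exp (\<i> * of_real t)) powi p"
      using far[of "c t"] F(2)[of "c t"] R by (simp add: c_def norm_mult)
    also have "of_real R * exp (\<i> * of_real t) = exp (of_real (ln R) + \<i> * of_real t)"
      using R by (simp add: exp_add exp_of_real)
    also have "\<dots> powi p = exp (of_int p * (of_real (ln R) + \<i> * of_real t))" by (simp add: exp_power_int)
    finally show "exp (\<phi> t) = 1" by (simp add: \<phi>_def exp_diff)
  qed auto
  moreover have "c (2 * pi) = c 0" using exp_two_pi_i by (simp add: c_def mult_ac)
  ultimately have "of_int p * (\<i> * of_real (2 * pi)) = 0" by (simp add: \<phi>_def algebra_simps)
  then show False using \<open>p \<noteq> 0\<close> by simp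
qed

context planar_cover
begin

text \<open>
  For \<open>exp \<circ> F = f - k\<close> this is the winding number about \<open>k\<close> of the loop in \<open>\<Omega>\<close> that belongs to \<open>\<gamma>\<close>. The
  quotient is already an integer; rounding only changes its type.
\<close>

definition log_period :: "(complex \<Rightarrow> complex) \<Rightarrow> (complex \<Rightarrow> complex) \<Rightarrow> int" where
  "log_period F \<gamma> = \<lfloor>Im (F (\<gamma> 0) - F 0) / (2 * pi)\<rfloor>"

lemma log_lift_deck:
  assumes F: "continuous_on unit_disk F" "\<And>z. z \<in> unit_disk \<Longrightarrow> exp (F z) = f z - k"
    and \<gamma>: "\<gamma> \<in> deck" "z \<in> unit_disk" and k: "k \<notin> \<Omega>"
  shows "F (\<gamma> z) = F z + 2 * pi * \<i> * of_int (log_period F \<gamma>)"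
proof -
  have nz: "f z - k \<noteq> 0" if "z \<in> unit_disk" for z
    using k that covering_space_imp_surjective[OF cov] by auto
  define \<phi> where "\<phi> w = F (\<gamma> w) - F w" for w
  have e: "exp (\<phi> w) = 1" if "w \<in> unit_disk" for w
    using F(2)[OF that] F(2)[OF deckD(3)[OF \<gamma>(1) that]] deckD(2)[OF \<gamma>(1) that] nz[OF that] by (simp add: \<phi>_def exp_diff)
  have "\<phi> z = \<phi> 0"
  proof (rule exp_eq_1_constant[OF _ _ e \<gamma>(2)])
    show "continuous_on unit_disk \<phi>" unfolding \<phi>_def
      by (intro continuous_intros F(1) continuous_on_compose2[OF F(1) deckD(5)[OF \<gamma>(1)]]) (use deckD(3)[OF \<gamma>(1)] in auto)
  qed auto
  moreover obtain m where m: "Re (\<phi> 0) = 0" "Im (\<phi> 0) = of_int (2 * m) * pi" using e[of 0] by (auto simp: exp_eq_1)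
  moreover have "log_period F \<gamma> = m" using m by (simp add: log_period_def \<phi>_def)
  ultimately have "\<phi> z = 2 * pi * \<i> * of_int (log_period F \<gamma>)" by (simp add: complex_eq_iff)
  then show ?thesis by (simp add: \<phi>_def algebra_simps)
qed

lemma log_period_comp:
  assumes F: "continuous_on unit_disk F" "\<And>z. z \<in> unit_disk \<Longrightarrow> exp (F z) = f z - k"
    and \<gamma>: "\<gamma> \<in> deck" "\<delta> \<in> deck" and k: "k \<notin> \<Omega>"
  shows "log_period F (\<gamma> \<circ> \<delta>) = log_period F \<gamma> + log_period F \<delta>"
proof -
  have d: "\<delta> 0 \<in> unit_disk" using deckD(3)[OF \<gamma>(2), of 0] by simp
  have "F (\<gamma> (\<delta> 0)) = F 0 + 2 * pi * \<i> * of_int (log_period F \<gamma> + log_period F \<delta>)"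
    using log_lift_deck[OF F \<gamma>(1) d k] log_lift_deck[OF F \<gamma>(2) _ k, of 0] by (simp add: algebra_simps)
  moreover have "F ((\<gamma> \<circ> \<delta>) 0) = F 0 + 2 * pi * \<i> * of_int (log_period F (\<gamma> \<circ> \<delta>))"
    using log_lift_deck[OF F deck_comp[OF \<gamma>] _ k, of 0] by simp
  ultimately have "complex_of_int (log_period F (\<gamma> \<circ> \<delta>)) = of_int (log_period F \<gamma> + log_period F \<delta>)" by simp
  then show ?thesis by (simp only: of_int_eq_iff)
qed

text \<open>
  In the half-plane coordinate at \<open>x\<close>, the deck transformations that fix \<open>x\<close> form a group of affine maps, which is discrete
  because \<open>f\<close> is injective near 0. Periods are characters of this group.
\<close>

lemma stabilizer_rank_le_1:
  assumes x: "norm x = 1"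
    and F: "continuous_on unit_disk F" "\<And>z. z \<in> unit_disk \<Longrightarrow> exp (F z) = f z - k" "k \<notin> \<Omega>"
    and G: "continuous_on unit_disk G" "\<And>z. z \<in> unit_disk \<Longrightarrow> exp (G z) = f z - l" "l \<notin> \<Omega>"
  shows "\<exists>p q. (p,q) \<noteq> (0,0) \<and> (\<forall>\<gamma>\<in>deck. ext \<gamma> x = x \<longrightarrow> p * log_period F \<gamma> + q * log_period G \<gamma> = 0)"
proof -
  define \<Gamma> where "\<Gamma> = {\<gamma> \<in> deck. ext \<gamma> x = x}"
  define P where "P \<gamma> = (Re (cayley x (\<gamma> 0)), Im (cayley x (\<gamma> 0)))" for \<gamma> :: "complex \<Rightarrow> complex"
  \<comment> \<open>Different functions may represent the same automorphism, so the group of affine maps is the primary object, and \<open>\<sigma>\<close> picks a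
    representative of each element.\<close>
  define \<sigma> where "\<sigma> h = (SOME \<gamma>. \<gamma> \<in> \<Gamma> \<and> P \<gamma> = h)" for h
  have x0: "x \<noteq> 0" using x by auto
  have \<sigma>: "\<sigma> h \<in> \<Gamma>" "P (\<sigma> h) = h" if "h \<in> P ` \<Gamma>" for h
    using someI_ex[of "\<lambda>\<gamma>. \<gamma> \<in> \<Gamma> \<and> P \<gamma> = h"] that unfolding \<sigma>_def by blast+
  have \<Gamma>D: "\<gamma> \<in> deck" "ext \<gamma> x = x" if "\<gamma> \<in> \<Gamma>" for \<gamma> using that by (auto simp: \<Gamma>_def)
  have d0: "\<gamma> 0 \<in> unit_disk" "\<gamma> 0 \<noteq> x" if "\<gamma> \<in> \<Gamma>" for \<gamma>
    using deckD(3)[OF \<Gamma>D(1)[OF that], of 0] x by auto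
  have Pinj: "\<gamma> 0 = \<delta> 0" if "\<gamma> \<in> \<Gamma>" "\<delta> \<in> \<Gamma>" "P \<gamma> = P \<delta>" for \<gamma> \<delta>
    by (rule cayley_inj[OF x0 d0(2)[OF that(1)] d0(2)[OF that(2)]]) (use that(3) in \<open>auto simp: P_def complex_eq_iff\<close>)
  have per: "log_period F (\<sigma> (P \<gamma>)) = log_period F \<gamma>" "log_period G (\<sigma> (P \<gamma>)) = log_period G \<gamma>" if "\<gamma> \<in> \<Gamma>" for \<gamma>
    using Pinj[OF \<sigma>(1) that \<sigma>(2)] that by (auto simp: log_period_def)
  have comp: "\<gamma> \<circ> \<delta> \<in> \<Gamma>" if "\<gamma> \<in> \<Gamma>" "\<delta> \<in> \<Gamma>" for \<gamma> \<delta>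
    using that ext_comp[of \<gamma> \<delta> x] deck_comp x by (auto simp: \<Gamma>_def)
  have Pcomp: "P (\<gamma> \<circ> \<delta>) = aff_mult (P \<gamma>) (P \<delta>)" if "\<gamma> \<in> \<Gamma>" "\<delta> \<in> \<Gamma>" for \<gamma> \<delta>
    using deck_affine(1)[OF \<Gamma>D(1)[OF that(1)] x \<Gamma>D(2)[OF that(1)] d0(1)[OF that(2)]]
    by (simp add: P_def aff_mult_def)
  have c0: "cayley x 0 = 1" using x0 by (simp add: cayley_def)
  have P0: "P \<gamma> = (1,0)" if "\<gamma> 0 = 0" for \<gamma> using that c0 by (simp add: P_def)
  obtain e where e: "e > 0" "inj_on f (ball 0 e)" "ball 0 e \<subseteq> unit_disk" using local_injective[of 0] by auto
  have id\<Gamma>: "id \<in> \<Gamma>"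
    using deck_id ext_id[of x] x by (simp only: \<Gamma>_def mem_Collect_eq order_refl simp_thms)
  have "\<exists>p q. (p,q) \<noteq> (0,0) \<and> (\<forall>h\<in>P ` \<Gamma>. p * log_period F (\<sigma> h) + q * log_period G (\<sigma> h) = 0)"
  proof (rule affine_rank_le_1[where e="e/2"])
    have "P id = (1,0)" by (rule P0) simp
    then show "(1,0) \<in> P ` \<Gamma>" using id\<Gamma> by (metis imageI)
    show "aff_mult g h \<in> P ` \<Gamma>" if "g \<in> P ` \<Gamma>" "h \<in> P ` \<Gamma>" for g h
      using that comp Pcomp by (metis (no_types, lifting) image_iff)
    show "\<exists>h\<in>P ` \<Gamma>. aff_mult g h = (1,0)" if "g \<in> P ` \<Gamma>" for g
    proof -
      obtain \<gamma> where \<gamma>: "\<gamma> \<in> \<Gamma>" "g = P \<gamma>" using \<open>g \<in> P ` \<Gamma>\<close> by blast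
      obtain \<delta> where \<delta>: "\<delta> \<in> deck" "\<And>z. z \<in> unit_disk \<Longrightarrow> \<gamma> (\<delta> z) = z" "\<And>z. z \<in> unit_disk \<Longrightarrow> \<delta> (\<gamma> z) = z"
        by (rule deck_inverse[OF \<Gamma>D(1)[OF \<gamma>(1)]]) blast
      have "ext \<delta> (ext \<gamma> x) = x" by (rule ext_inverse[OF \<delta>(1) \<Gamma>D(1)[OF \<gamma>(1)] \<delta>(3)]) (use x in auto)
      then have "\<delta> \<in> \<Gamma>" using \<delta>(1) \<Gamma>D(2)[OF \<gamma>(1)] by (simp add: \<Gamma>_def)
      moreover have "P (\<gamma> \<circ> \<delta>) = (1,0)" by (rule P0) (use \<delta>(2)[of 0] in simp)
      ultimately show ?thesis using Pcomp[OF \<gamma>(1)] \<gamma>(2) by (intro bexI[of _ "P \<delta>"]) auto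
    qed
    show "fst g > 0" if "g \<in> P ` \<Gamma>" for g
      using that deck_affine(2)[OF \<Gamma>D(1) x \<Gamma>D(2), of _ 0] by (auto simp: P_def)
    show "log_period F (\<sigma> (aff_mult g h)) = log_period F (\<sigma> g) + log_period F (\<sigma> h)" 
      "log_period G (\<sigma> (aff_mult g h)) = log_period G (\<sigma> g) + log_period G (\<sigma> h)" if gh: "g \<in> P ` \<Gamma>" "h \<in> P ` \<Gamma>" for g h
    proof -
      obtain \<gamma> \<delta> where "\<gamma> \<in> \<Gamma>" "g = P \<gamma>" "\<delta> \<in> \<Gamma>" "h = P \<delta>" using gh by blast
      then show "log_period F (\<sigma> (aff_mult g h)) = log_period F (\<sigma> g) + log_period F (\<sigma> h)" 
        "log_period G (\<sigma> (aff_mult g h)) = log_period G (\<sigma> g) + log_period G (\<sigma> h)"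
        using per(1)[OF comp] per(2)[OF comp] per Pcomp log_period_comp[OF F(1,2) \<Gamma>D(1) \<Gamma>D(1) F(3)] log_period_comp[OF G(1,2) \<Gamma>D(1) \<Gamma>D(1) G(3)]
        by metis+
    qed
    show "e / 2 > 0" using e by simp
    show "h = (1,0)" if h: "h \<in> P ` \<Gamma>" "\<bar>fst h - 1\<bar> < e / 2" "\<bar>snd h\<bar> < e / 2" for h
    proof -
      obtain \<gamma> where \<gamma>: "\<gamma> \<in> \<Gamma>" "h = P \<gamma>" using h(1) by blast
      define c where "c = cayley x (\<gamma> 0)"
      have "Re c > 0" using deck_affine(2)[OF \<Gamma>D(1)[OF \<gamma>(1)] x \<Gamma>D(2)[OF \<gamma>(1)], of 0] by (simp add: c_def)
      have "1 \<le> norm (c + 1)" using \<open>Re c > 0\<close> complex_Re_le_cmod[of "c + 1"] by simp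
      have "x - \<gamma> 0 \<noteq> 0" using d0(2)[OF \<gamma>(1)] by simp
      then have "\<gamma> 0 * (c + 1) = x * (c - 1)" by (simp add: c_def cayley_def field_simps)
      then have "norm (\<gamma> 0) * norm (c + 1) = norm (c - 1)" using x by (metis norm_mult mult_1)
      moreover have "norm (\<gamma> 0) * 1 \<le> norm (\<gamma> 0) * norm (c + 1)" using \<open>1 \<le> norm (c + 1)\<close> by (intro mult_left_mono) auto
      moreover have "norm (c - 1) \<le> \<bar>Re (c - 1)\<bar> + \<bar>Im (c - 1)\<bar>" by (rule cmod_le)
      ultimately have "norm (\<gamma> 0) < e" using h(2,3) \<gamma>(2) by (simp add: P_def c_def)
      then have "\<gamma> 0 = 0" using inj_onD[OF e(2), of "\<gamma> 0" 0] deckD(2)[OF \<Gamma>D(1)[OF \<gamma>(1)], of 0] e(1) by simp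
      then show ?thesis using P0 \<gamma>(2) by simp
    qed
  qed
  then obtain p q where pq: "(p,q) \<noteq> (0,0)" "\<And>h. h \<in> P ` \<Gamma> \<Longrightarrow> p * log_period F (\<sigma> h) + q * log_period G (\<sigma> h) = 0" by blast
  have "p * log_period F \<gamma> + q * log_period G \<gamma> = 0" if "\<gamma> \<in> deck" "ext \<gamma> x = x" for \<gamma>
  proof -
    have "\<gamma> \<in> \<Gamma>" using that by (simp add: \<Gamma>_def)
    then show ?thesis using pq(2)[of "P \<gamma>"] per[of \<gamma>] by simp
  qed
  then show ?thesis using pq(1) by blast
qed

text \<open>
  If there are one or two limit points, the square of every deck transformation fixes one of them, and its periods are
  twice the original ones. If there is none, every deck transformation has finite order on the orbit of 0,
  and its periods vanish.
\<close>

lemma elementary_rank_le_1: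
  assumes few: "\<And>a b c. a \<in> \<Lambda> \<Longrightarrow> b \<in> \<Lambda> \<Longrightarrow> c \<in> \<Lambda> \<Longrightarrow> a = b \<or> b = c \<or> a = c"
    and F: "continuous_on unit_disk F" "\<And>z. z \<in> unit_disk \<Longrightarrow> exp (F z) = f z - k" "k \<notin> \<Omega>"
    and G: "continuous_on unit_disk G" "\<And>z. z \<in> unit_disk \<Longrightarrow> exp (G z) = f z - l" "l \<notin> \<Omega>"
  shows "\<exists>p q. (p,q) \<noteq> (0,0) \<and> (\<forall>\<gamma>\<in>deck. p * log_period F \<gamma> + q * log_period G \<gamma> = 0)"
proof (cases "\<Lambda> = {}")
  case True
  have "log_period F \<gamma> = 0" if \<gamma>: "\<gamma> \<in> deck" for \<gamma>
  proof -
    have "\<not> inj (\<lambda>n. (\<gamma> ^^ n) 0)"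
    proof
      assume "inj (\<lambda>n. (\<gamma> ^^ n) 0)"
      from infinite_orbit_norm[OF deck_power[OF \<gamma>] this] show False
        by (rule limit_point_sequence[OF deck_power[OF \<gamma>]]) (use True in blast)
    qed
    then obtain m n where mn: "m \<noteq> n" "(\<gamma> ^^ m) 0 = (\<gamma> ^^ n) 0" by (auto simp: inj_def)
    have pw: "log_period F (\<gamma> ^^ n) = int n * log_period F \<gamma>" for n
    proof (induction n)
      case 0
      show ?case by (simp add: log_period_def)
    next
      case (Suc n)
      have "log_period F (\<gamma> \<circ> \<gamma> ^^ n) = log_period F \<gamma> + log_period F (\<gamma> ^^ n)"
        by (rule log_period_comp[OF F(1,2) \<gamma> deck_power[OF \<gamma>] F(3)])
      then show ?case using Suc by (simp only: funpow.simps) (simp add: algebra_simps)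
    qed
    have "int m * log_period F \<gamma> = int n * log_period F \<gamma>" using mn(2) unfolding pw[symmetric] by (simp add: log_period_def)
    then show ?thesis using mn(1) by simp
  qed
  then show ?thesis by (intro exI[of _ "1::int"] exI[of _ "0::int"]) auto
next
  case False
  then obtain x where x: "x \<in> \<Lambda>" by blast
  then have nx: "norm x = 1" using limit_set_subset by auto
  obtain p q where pq: "(p,q) \<noteq> (0,0)" "\<And>\<gamma>. \<gamma> \<in> deck \<Longrightarrow> ext \<gamma> x = x \<Longrightarrow> p * log_period F \<gamma> + q * log_period G \<gamma> = 0"
    using stabilizer_rank_le_1[OF nx F G] by blast
  have "p * log_period F \<gamma> + q * log_period G \<gamma> = 0" if \<gamma>: "\<gamma> \<in> deck" for \<gamma>
  proof -
    define y where "y = ext \<gamma> x"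
    have y: "y \<in> \<Lambda>" "ext \<gamma> y \<in> \<Lambda>" using limit_set_invariant[OF \<gamma>] x by (auto simp: y_def)
    have ny: "norm y = 1" using y limit_set_subset by auto
    have "ext \<gamma> y = x"
    proof (cases "y = x")
      case False
      then have "ext \<gamma> y \<noteq> ext \<gamma> x" using inj_onD[OF ext_props(2)[OF \<gamma>], of y x] nx ny by auto
      then show ?thesis using few[OF x y] False by (auto simp: y_def)
    qed (use y_def in simp)
    then have "ext (\<gamma> \<circ> \<gamma>) x = x" using ext_comp[OF \<gamma> \<gamma>, of x] nx by (simp add: y_def)
    from pq(2)[OF deck_comp[OF \<gamma> \<gamma>] this] have "2 * (p * log_period F \<gamma> + q * log_period G \<gamma>) = 0"
      using log_period_comp[OF F(1,2) \<gamma> \<gamma> F(3)] log_period_comp[OF G(1,2) \<gamma> \<gamma> G(3)] by (simp add: algebra_simps)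
    then show ?thesis by simp
  qed
  then show ?thesis using pq(1) by blast
qed

text \<open>
  Choose logarithms \<open>F\<close> and \<open>G\<close> of \<open>f - k1\<close> and \<open>f - k2\<close>. With at most two limit points some nontrivial
  combination \<open>p * F + q * G\<close> is invariant under deck transformations and therefore descends to a logarithm of
  \<open>(w - k1) powi p * (w - k2) powi q\<close> on \<open>\<Omega>\<close>. That is impossible around \<open>K1\<close> if \<open>p \<noteq> 0\<close> and around \<open>K2\<close> if
  \<open>q \<noteq> 0\<close>. The third piece \<open>K3\<close> is the one that may be unbounded.
\<close>

lemma three_limit_points:
  assumes "open \<Omega>" and cpl: "- \<Omega> = K1 \<union> K2 \<union> K3" and K: "compact K1" "compact K2" "closed K3"
    and disj: "K1 \<inter> K2 = {}" "K1 \<inter> K3 = {}" "K2 \<inter> K3 = {}" and k: "k1 \<in> K1" "k2 \<in> K2"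
  obtains a b c where "a \<in> \<Lambda>" "b \<in> \<Lambda>" "c \<in> \<Lambda>" "a \<noteq> b" "b \<noteq> c" "a \<noteq> c"
proof (rule ccontr)
  assume "\<not> thesis"
  then have few: "\<And>a b c. a \<in> \<Lambda> \<Longrightarrow> b \<in> \<Lambda> \<Longrightarrow> c \<in> \<Lambda> \<Longrightarrow> a = b \<or> b = c \<or> a = c" using that by blast
  have im: "f ` unit_disk = \<Omega>" using covering_space_imp_surjective[OF cov] .
  have contf: "continuous_on unit_disk f" using holf by (rule holomorphic_on_imp_continuous_on)
  have kk: "k1 \<notin> \<Omega>" "k2 \<notin> \<Omega>" using k cpl by auto
  have ex: "\<exists>F. continuous_on unit_disk F \<and> (\<forall>z\<in>unit_disk. exp (F z) = f z - k)" if "k \<notin> \<Omega>" for k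
  proof -
    have "continuous_on (ball 0 1) (\<lambda>z. f z - k)" "\<And>z. z \<in> ball 0 1 \<Longrightarrow> f z - k \<noteq> 0"
      using contf im that by (auto intro!: continuous_intros)
    then show ?thesis
    proof (rule continuous_logarithm_on_ball)
      fix F :: "complex \<Rightarrow> complex"
      assume F: "continuous_on (ball 0 1) F" "\<And>z. z \<in> ball 0 1 \<Longrightarrow> f z - k = exp (F z)"
      then show ?thesis by (intro exI[of _ F] conjI ballI) (simp_all only: F(1) F(2)[symmetric])
    qed
  qed
  obtain F where F: "continuous_on unit_disk F" "\<And>z. z \<in> unit_disk \<Longrightarrow> exp (F z) = f z - k1" using ex[OF kk(1)] by blast
  obtain G where G: "continuous_on unit_disk G" "\<And>z. z \<in> unit_disk \<Longrightarrow> exp (G z) = f z - k2" using ex[OF kk(2)] by blast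
  obtain p q where pq: "(p,q) \<noteq> (0,0)" "\<And>\<gamma>. \<gamma> \<in> deck \<Longrightarrow> p * log_period F \<gamma> + q * log_period G \<gamma> = 0"
    using elementary_rank_le_1[OF few F kk(1) G kk(2)] by blast
  define E where "E z = of_int p * F z + of_int q * G z" for z
  define h where "h w = E (SOME z. z \<in> unit_disk \<and> f z = w)" for w
  have hE: "h (f z) = E z" if z: "z \<in> unit_disk" for z
  proof -
    define z' where "z' = (SOME z'. z' \<in> unit_disk \<and> f z' = f z)"
    have z': "z' \<in> unit_disk" "f z' = f z" using someI_ex[of "\<lambda>z'. z' \<in> unit_disk \<and> f z' = f z"] z unfolding z'_def by blast+
    obtain \<gamma> where \<gamma>: "\<gamma> \<in> deck" "\<gamma> z = z'" by (rule deck_transitive[OF z z'(1) z'(2)[symmetric]])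
    have "E z' = E z + 2 * pi * \<i> * of_int (p * log_period F \<gamma> + q * log_period G \<gamma>)"
      using log_lift_deck[OF F \<gamma>(1) z kk(1)] log_lift_deck[OF G \<gamma>(1) z kk(2)] \<gamma>(2) by (simp add: E_def algebra_simps)
    then show ?thesis using pq(2)[OF \<gamma>(1)] by (simp add: h_def z'_def)
  qed
  have contE: "continuous_on unit_disk E" unfolding E_def by (intro continuous_intros F G)
  have conth: "continuous_on \<Omega> h"
    unfolding continuous_on_open_vimage[OF \<open>open \<Omega>\<close>]
  proof (intro allI impI)
    fix B :: "complex set" assume "open B"
    have "openin (top_of_set unit_disk) (unit_disk \<inter> E -` B)" by (rule continuous_openin_preimage_gen[OF contE \<open>open B\<close>])
    then have "openin (top_of_set \<Omega>) (f ` (unit_disk \<inter> E -` B))" by (rule covering_space_open_map[OF cov])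
    moreover have "f ` (unit_disk \<inter> E -` B) = h -` B \<inter> \<Omega>"
    proof (intro set_eqI iffI)
      fix w assume w: "w \<in> h -` B \<inter> \<Omega>"
      then obtain z where z: "z \<in> unit_disk" "w = f z" using im by (metis IntD2 imageE)
      then have "z \<in> unit_disk \<inter> E -` B" using w hE[OF z(1)] by simp
      then show "w \<in> f ` (unit_disk \<inter> E -` B)" using z(2) by blast
    qed (use hE im in auto)
    ultimately show "open (h -` B \<inter> \<Omega>)" using \<open>open \<Omega>\<close> by (metis openin_open_trans)
  qed
  have exph: "exp (h w) = (w - k1) powi p * (w - k2) powi q" if w: "w \<in> \<Omega>" for w
  proof -
    obtain z where z: "z \<in> unit_disk" "w = f z" using im w by (metis imageE)
    have "exp (h w) = exp (F z) powi p * exp (G z) powi q"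
      unfolding z(2) hE[OF z(1)] by (simp add: E_def exp_add exp_power_int)
    then show ?thesis using F(2)[OF z(1)] G(2)[OF z(1)] z(2) by simp
  qed
  have cont: "continuous_on (- L) (\<lambda>w. (w - k) powi n)" if "k \<in> L" for k :: complex and L n
    by (intro continuous_on_power_int continuous_intros) (use that in auto)
  have O: "- (K1 \<union> (K2 \<union> K3)) = \<Omega>" "- (K2 \<union> (K1 \<union> K3)) = \<Omega>" using cpl by blast+
  show False
  proof (cases "p = 0")
    case False
    show False
    proof (rule no_logarithm_around_compact_piece[of K1 "K2 \<union> K3" k1 p "\<lambda>w. (w - k2) powi q" h])
      show "continuous_on (- (K1 \<union> (K2 \<union> K3))) h" unfolding O by (rule conth)
      show "exp (h w) = (w - k1) powi p * (w - k2) powi q" if "w \<notin> K1 \<union> (K2 \<union> K3)" for w using that exph O by blast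
      show "continuous_on (- (K2 \<union> K3)) (\<lambda>w. (w - k2) powi q)" using cont k by blast
      show "closed (K2 \<union> K3)" using K by (simp add: compact_imp_closed closed_Un)
    qed (use K disj k False in auto)
  next
    case True
    then have "q \<noteq> 0" using pq(1) by simp
    show False
    proof (rule no_logarithm_around_compact_piece[of K2 "K1 \<union> K3" k2 q "\<lambda>w. (w - k1) powi p" h])
      show "continuous_on (- (K2 \<union> (K1 \<union> K3))) h" unfolding O by (rule conth)
      show "exp (h w) = (w - k2) powi q * (w - k1) powi p" if "w \<notin> K2 \<union> (K1 \<union> K3)" for w
        using that exph[of w] O by (auto simp: mult.commute)
      show "continuous_on (- (K1 \<union> K3)) (\<lambda>w. (w - k1) powi p)" using cont k by blast
      show "closed (K1 \<union> K3)" using K by (simp add: compact_imp_closed closed_Un)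
    qed (use K disj k \<open>q \<noteq> 0\<close> in auto)
  qed
qed

end

section \<open>Length and area near the unit circle\<close>

lemma next_outside_right:
  fixes T :: "real set"
  assumes "open T" "a \<in> T" "b \<notin> T" "a < b"
  obtains c where "a < c" "c \<le> b" "c \<notin> T" "{a..<c} \<subseteq> T"
proof -
  define X where "X = {a..b} - T"
  have X: "closed X" "X \<noteq> {}" "bdd_below X"
  proof -
    show "closed X" using assms(1) by (auto simp: X_def intro!: closed_Diff)
    have "b \<in> X" using assms by (simp add: X_def)
    then show "X \<noteq> {}" by blast
    show "bdd_below X" by (auto simp: X_def intro!: bdd_belowI[of _ a])
  qed
  define c where "c = Inf X"
  have c: "c \<in> X" unfolding c_def by (rule closed_contains_Inf[OF X(2,3,1)])
  have "t \<in> T" if "a \<le> t" "t < c" for t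
  proof (rule ccontr)
    assume "t \<notin> T"
    then have "t \<in> X" using that c by (auto simp: X_def)
    then have "c \<le> t" unfolding c_def using X(3) by (rule cInf_lower)
    then show False using that by simp
  qed
  then have "{a..<c} \<subseteq> T" by auto
  moreover have "a \<noteq> c" using c assms(2) by (auto simp: X_def)
  ultimately show thesis using that[of c] c by (auto simp: X_def)
qed

lemma next_outside_left:
  fixes T :: "real set"
  assumes "open T" "a \<in> T" "b \<notin> T" "b < a"
  obtains c where "c < a" "b \<le> c" "c \<notin> T" "{c<..a} \<subseteq> T"
proof -
  have "open (uminus ` T)" using assms(1) by (simp add: open_negations)
  moreover have "- a \<in> uminus ` T" "- b \<notin> uminus ` T" "- a < - b" using assms by auto
  ultimately obtain c where c: "- a < c" "c \<le> - b" "c \<notin> uminus ` T" "{-a..<c} \<subseteq> uminus ` T"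
    by (rule next_outside_right)
  show thesis
  proof (rule that[of "- c"])
    show "- c \<notin> T" using c(3) by (metis add.inverse_inverse imageI)
    show "{- c<..a} \<subseteq> T"
    proof
      fix t assume "t \<in> {- c<..a}"
      then have "- t \<in> uminus ` T" using c(4) by auto
      then show "t \<in> T" by auto
    qed
  qed (use c in auto)
qed

lemma frontier_component_disjoint:
  fixes S :: "'a::real_normed_vector set"
  assumes "open S" "U \<in> components S" shows "frontier U \<inter> S = {}"
proof -
  have "x \<in> U" if "x \<in> closure U" "x \<in> S" for x
  proof -
    have "closedin (top_of_set S) U" using assms(2) closedin_component by blast
    then show ?thesis using that by (metis Int_iff closedin_closed closure_minimal closure_closed closed_closure inf.cobounded2 subsetD)
  qed
  moreover have "open U" using assms open_components by blast
  ultimately show ?thesis by (auto simp: frontier_def interior_open)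
qed

text \<open>
  The substitution \<open>\<alpha> * (1 - exp \<zeta>)\<close> turns circles about \<open>\<alpha>\<close> into vertical lines. Inside the disk only
  arguments between \<open>- pi/2\<close> and \<open>pi/2\<close> occur, so these lines have bounded length.
\<close>

lemma short_arcs:
  fixes f :: "complex \<Rightarrow> complex"
  assumes holf: "f holomorphic_on S" and S: "open S" "S \<subseteq> ball 0 1" and inj: "inj_on f S" and bd: "bounded (f ` S)"
    and \<alpha>: "norm \<alpha> = 1" and "\<epsilon> > 0" "r0 > 0" "finite N"
  obtains r where "0 < r" "r < r0" "r \<notin> N"
    "\<And>a b. a \<le> b \<Longrightarrow> (\<And>t. t \<in> {a..b} \<Longrightarrow> \<bar>t\<bar> < pi/2 \<and> \<alpha> * (1 - of_real r * cis t) \<in> S) \<Longrightarrow>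
      dist (f (\<alpha> * (1 - of_real r * cis a))) (f (\<alpha> * (1 - of_real r * cis b))) \<le> \<epsilon>"
proof -
  define g where "g \<zeta> = \<alpha> * (1 - exp \<zeta>)" for \<zeta>
  define G where "G = {\<zeta>. - pi/2 < Im \<zeta>} \<inter> {\<zeta>. Im \<zeta> < pi/2} \<inter> g -` S"
  have contg: "continuous_on UNIV g" unfolding g_def by (intro continuous_intros)
  have oG: "open G" unfolding G_def
    by (intro open_Int open_halfspace_Im_gt open_halfspace_Im_lt open_vimage S contg)
  have "\<alpha> \<noteq> 0" using \<alpha> by auto
  have injg: "inj_on g G"
  proof (rule inj_onI)
    fix x y assume xy: "x \<in> G" "y \<in> G" "g x = g y"
    then have "exp x = exp y" using \<open>\<alpha> \<noteq> 0\<close> by (simp add: g_def)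
    moreover have "\<bar>Im x - Im y\<bar> < 2 * pi" using xy by (auto simp: G_def abs_if)
    ultimately show "x = y" by (metis complex_eq_iff exp_complex_eqI)
  qed
  have holfg: "(f \<circ> g) holomorphic_on G"
  proof (rule holomorphic_on_compose_gen[OF _ holf])
    show "g holomorphic_on G" unfolding g_def by (intro holomorphic_intros)
  qed (auto simp: G_def)
  have injfg: "inj_on (f \<circ> g) G"
    by (rule comp_inj_on[OF injg inj_on_subset[OF inj]]) (auto simp: G_def)
  have bdfg: "bounded ((f \<circ> g) ` G)"
    by (rule bounded_subset[OF bd]) (auto simp: G_def)
  have "finite (ln ` N)" using \<open>finite N\<close> by simp
  from univalent_short_slices[OF holfg oG injfg bdfg _ \<open>\<epsilon> > 0\<close> this, of "pi/2" "ln r0"]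
  obtain x where x: "x < ln r0" "x \<notin> ln ` N"
    "\<And>a b. a \<le> b \<Longrightarrow> (\<forall>t\<in>{a..b}. Complex x t \<in> G) \<Longrightarrow> dist ((f \<circ> g) (Complex x a)) ((f \<circ> g) (Complex x b)) \<le> \<epsilon>"
    by (force simp: G_def abs_if)
  define r where "r = exp x"
  have gC: "g (Complex x t) = \<alpha> * (1 - of_real r * cis t)" for t
    by (simp add: g_def r_def exp_eq_polar)
  show thesis
  proof (rule that[of r])
    show "0 < r" by (simp add: r_def)
    show "r < r0" using x(1) \<open>r0 > 0\<close> by (metis exp_ln exp_less_mono r_def)
    show "r \<notin> N" using x(2) by (metis imageI ln_exp r_def)
    fix a b :: real assume ab: "a \<le> b" "\<And>t. t \<in> {a..b} \<Longrightarrow> \<bar>t\<bar> < pi/2 \<and> \<alpha> * (1 - of_real r * cis t) \<in> S"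
    have "Complex x t \<in> G" if "t \<in> {a..b}" for t
      using ab(2)[OF that] gC[of t] by (auto simp: G_def abs_less_iff)
    then show "dist (f (\<alpha> * (1 - of_real r * cis a))) (f (\<alpha> * (1 - of_real r * cis b))) \<le> \<epsilon>"
      using x(3)[OF ab(1)] by (simp add: gC)
  qed
qed

lemma disk_polar_at_boundary:
  assumes \<alpha>: "norm \<alpha> = 1" and p: "norm p < 1" "norm (p - \<alpha>) = r"
  obtains \<theta> where "\<bar>\<theta>\<bar> < pi/2" "p = \<alpha> * (1 - of_real r * cis \<theta>)"
proof -
  define u where "u = 1 - cnj \<alpha> * p"
  have aa: "\<alpha> * cnj \<alpha> = 1" using \<alpha> complex_norm_square[of \<alpha>] by simp
  have "Re (cnj \<alpha> * p) \<le> norm (cnj \<alpha> * p)" by (rule complex_Re_le_cmod)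
  also have "\<dots> < 1" using p \<alpha> by (simp add: norm_mult)
  finally have Re: "Re u > 0" by (simp add: u_def)
  then have u0: "u \<noteq> 0" by auto
  have "\<alpha> * (1 - u) = (\<alpha> * cnj \<alpha>) * p" by (simp add: u_def)
  then have pu: "p = \<alpha> * (1 - u)" by (simp only: aa mult_1)
  have "p - \<alpha> = - (\<alpha> * u)" using pu by (simp add: algebra_simps)
  then have "norm u = r" using p(2) \<alpha> by (simp add: norm_mult)
  moreover have "u = of_real (norm u) * cis (Im (Ln u))"
    using exp_Ln[OF u0] by (metis exp_eq_polar Re_Ln exp_ln zero_less_norm_iff u0 of_real_exp)
  moreover have "\<bar>Im (Ln u)\<bar> < pi/2" using Re u0 Re_Ln_pos_lt by blast
  ultimately show thesis using that pu by metis
qed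

text \<open>
  Suppose the closure of \<open>D = s ` A\<close> meets the unit circle at most in \<open>\<alpha>\<close> and \<open>\<beta>\<close>. Cut off small disks about
  these two points along arcs whose images under the inverse \<open>f\<close> of \<open>s\<close> are short. Such arcs end on \<open>s ` Q\<close>, so
  the image \<open>f ` P\<close> of the remaining part \<open>P\<close> of \<open>D\<close> has its whole frontier in a thin strip around \<open>sphere d \<rho>\<close>.
  A subset of \<open>A\<close> with such a frontier contains all of a disk about \<open>d\<close>, although \<open>d \<notin> A\<close>, or a whole
  neighbourhood of infinity, although \<open>A\<close> is bounded. The hypothesis \<open>H\<close> says that inside the disk the frontier of
  \<open>s ` A\<close> comes from \<open>Q\<close> only.
\<close>

lemma boundary_not_two_points:
  fixes s :: "complex \<Rightarrow> complex"
  assumes A: "open A" "A \<noteq> {}" "bounded A" and d: "d \<notin> A"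
    and Q: "Q \<subseteq> sphere d \<rho>" and \<rho>: "\<rho> > 0"
    and hols: "s holomorphic_on A" and conts: "continuous_on (A \<union> Q) s" and injs: "inj_on s (A \<union> Q)"
    and ims: "s ` (A \<union> Q) \<subseteq> ball 0 1"
    and H: "\<And>w z. (\<And>n. w n \<in> A) \<Longrightarrow> (\<lambda>n. s (w n)) \<longlonglongrightarrow> z \<Longrightarrow> norm z < 1 \<Longrightarrow> \<exists>w0\<in>A \<union> Q. w \<longlonglongrightarrow> w0"
    and \<alpha>: "norm \<alpha> = 1" and \<beta>: "norm \<beta> = 1"
  shows "\<exists>\<xi>\<in>closure (s ` A). norm \<xi> = 1 \<and> \<xi> \<noteq> \<alpha> \<and> \<xi> \<noteq> \<beta>"
proof (rule ccontr)
  assume contr: "\<not> ?thesis"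
  define D where "D = s ` A"
  have injA: "inj_on s A" using injs by (rule inj_on_subset) auto
  have oD: "open D" unfolding D_def
    by (rule invariance_of_domain[OF holomorphic_on_imp_continuous_on[OF hols] A(1) injA])
  have DB: "D \<subseteq> ball 0 1" using ims by (auto simp: D_def)
  have clB: "closure D \<subseteq> cball 0 1" using closure_mono[OF DB] by simp
  obtain f where holf: "f holomorphic_on D" and fs: "\<And>w. w \<in> A \<Longrightarrow> f (s w) = w"
    using holomorphic_has_inverse[OF hols A(1) injA] unfolding D_def by metis
  have sf: "s (f z) = z" "f z \<in> A" if "z \<in> D" for z using that fs by (auto simp: D_def)
  have injf: "inj_on f D" using sf by (metis inj_onI)
  have fD: "f ` D = A" using sf fs by (force simp: D_def)
  have bdf: "bounded (f ` D)" using A(3) fD by simp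
  have contf: "continuous_on D f" using holf by (rule holomorphic_on_imp_continuous_on)
  \<comment> \<open>The inverse \<open>f\<close> of \<open>s\<close> extends continuously to the part of the closure of \<open>D\<close> inside the disk,
    with values in \<open>A \<union> Q\<close>.\<close>
  have lim: "\<exists>w0\<in>A \<union> Q. (\<lambda>n. f (z n)) \<longlonglongrightarrow> w0 \<and> s w0 = z0" if zD: "\<And>n. z n \<in> D" and zl: "z \<longlonglongrightarrow> z0" "norm z0 < 1" for z z0
  proof -
    have "(\<lambda>n. s (f (z n))) \<longlonglongrightarrow> z0" using zl(1) sf(1)[OF zD] by simp
    then obtain w0 where w0: "w0 \<in> A \<union> Q" "(\<lambda>n. f (z n)) \<longlonglongrightarrow> w0" using H[of "\<lambda>n. f (z n)" z0, OF sf(2)[OF zD] _ zl(2)] by blast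
    have "(\<lambda>n. s (f (z n))) \<longlonglongrightarrow> s w0"
      by (rule continuous_on_tendsto_compose[OF conts w0(2,1)]) (use sf(2)[OF zD] in auto)
    then have "s w0 = z0" using \<open>(\<lambda>n. s (f (z n))) \<longlonglongrightarrow> z0\<close> LIMSEQ_unique by blast
    then show ?thesis using w0 by blast
  qed
  have circ: "norm \<xi> < 1 \<or> \<xi> = \<alpha> \<or> \<xi> = \<beta>" if "\<xi> \<in> closure D" for \<xi>
    using that contr clB by (force simp: D_def)
  \<comment> \<open>Follow the arc through \<open>p\<close> about \<open>\<gamma>\<close> until it leaves \<open>D\<close>. The exit point is not on the unit circle,
    because it is neither \<open>\<alpha>\<close> nor \<open>\<beta>\<close>; so it corresponds to a point of \<open>Q\<close>, at distance \<open>\<rho>\<close> from \<open>d\<close>.\<close>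
  have arc: "\<bar>norm (f p - d) - \<rho>\<bar> \<le> \<epsilon>"
    if p: "p \<in> D" "norm (p - \<gamma>) = r" and \<gamma>: "norm \<gamma> = 1" "r \<noteq> norm (\<alpha> - \<beta>)" "r > 0" "\<gamma> = \<alpha> \<or> \<gamma> = \<beta>"
    and short: "\<And>a b. a \<le> b \<Longrightarrow> (\<And>t. t \<in> {a..b} \<Longrightarrow> \<bar>t\<bar> < pi/2 \<and> \<gamma> * (1 - of_real r * cis t) \<in> D) \<Longrightarrow>
      dist (f (\<gamma> * (1 - of_real r * cis a))) (f (\<gamma> * (1 - of_real r * cis b))) \<le> \<epsilon>" for p \<gamma> r \<epsilon>
  proof -
    have "norm p < 1" using p(1) DB by auto
    then obtain \<theta> where \<theta>: "\<bar>\<theta>\<bar> < pi/2" "p = \<gamma> * (1 - of_real r * cis \<theta>)"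
      using disk_polar_at_boundary[OF \<gamma>(1) _ p(2)] by blast
    define k where "k t = \<gamma> * (1 - of_real r * cis t)" for t
    have contk: "continuous_on UNIV k" unfolding k_def by (intro continuous_intros)
    define T where "T = {-pi/2<..<pi/2} \<inter> k -` D"
    have oT: "open T" unfolding T_def by (intro open_Int open_vimage oD contk) auto
    have "\<theta> \<in> T" using \<theta> p(1) by (auto simp: T_def k_def abs_less_iff)
    moreover have "pi/2 \<notin> T" by (auto simp: T_def)
    ultimately obtain c where c: "\<theta> < c" "c \<le> pi/2" "c \<notin> T" "{\<theta>..<c} \<subseteq> T"
      using next_outside_right[OF oT] \<theta>(1) by (metis abs_less_iff)
    define t where "t n = c - (c - \<theta>) / real (Suc n)" for n
    have tT: "t n \<in> {\<theta>..<c}" for n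
    proof -
      have "(c - \<theta>) / real (Suc n) \<le> (c - \<theta>) / 1" using c by (intro divide_left_mono) auto
      then show ?thesis using c by (simp add: t_def)
    qed
    have tlim: "t \<longlonglongrightarrow> c"
    proof -
      have "(\<lambda>n. c - (c - \<theta>) * (1 / real (Suc n))) \<longlonglongrightarrow> c - (c - \<theta>) * 0"
        by (intro tendsto_intros LIMSEQ_Suc[OF lim_1_over_n])
      then show ?thesis by (simp add: t_def[abs_def])
    qed
    have kt: "k (t n) \<in> D" for n using tT[of n] c(4) by (auto simp: T_def)
    have klim: "(\<lambda>n. k (t n)) \<longlonglongrightarrow> k c"
      by (rule continuous_on_tendsto_compose[OF contk tlim]) auto
    have kcl: "k c \<in> closure D" unfolding closure_sequential
      by (rule exI[of _ "\<lambda>n. k (t n)"]) (intro conjI allI kt klim)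
    have "k c - \<gamma> = - (\<gamma> * (of_real r * cis c))" by (simp add: k_def algebra_simps)
    then have nk: "norm (k c - \<gamma>) = r" using \<gamma>(1,3) by (simp only: norm_minus_cancel norm_mult norm_of_real norm_cis)
    have "k c \<noteq> \<alpha>" "k c \<noteq> \<beta>" using nk \<gamma> by (auto simp: norm_minus_commute)
    then have kc1: "norm (k c) < 1" using circ[OF kcl] by blast
    have "c \<noteq> pi/2"
    proof
      assume "c = pi/2"
      then have "norm (k c) = norm (1 - of_real r * \<i>)" using \<gamma>(1) by (simp only: k_def norm_mult cis_pi_half mult_1)
      also have "\<dots> \<ge> 1" using complex_Re_le_cmod[of "1 - of_real r * \<i>"] by simp
      finally show False using kc1 by simp
    qed
    then have kcD: "k c \<notin> D" using c \<theta>(1) by (auto simp: T_def abs_less_iff)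
    obtain w0 where w0: "w0 \<in> A \<union> Q" "(\<lambda>n. f (k (t n))) \<longlonglongrightarrow> w0" "s w0 = k c"
      using lim[OF kt klim kc1] by blast
    have "w0 \<in> Q" using w0(1,3) kcD by (metis D_def UnE imageI)
    have "dist (f p) (f (k (t n))) \<le> \<epsilon>" for n
    proof -
      have "dist (f (k \<theta>)) (f (k (t n))) \<le> \<epsilon>"
        unfolding k_def by (rule short) (use tT[of n] c(4) in \<open>force simp: T_def k_def abs_less_iff\<close>)+
      then show ?thesis using \<theta>(2) by (simp add: k_def)
    qed
    moreover have "(\<lambda>n. dist (f p) (f (k (t n)))) \<longlonglongrightarrow> dist (f p) w0" by (intro tendsto_intros w0(2))
    ultimately have "dist (f p) w0 \<le> \<epsilon>" by (intro tendsto_upperbound) (auto intro: always_eventually)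
    moreover have "dist d w0 = \<rho>" using \<open>w0 \<in> Q\<close> Q by auto
    ultimately show ?thesis
      using dist_triangle[of "f p" d w0] dist_triangle[of d w0 "f p"] by (simp add: dist_norm norm_minus_commute abs_le_iff)
  qed
  \<comment> \<open>The bound \<open>\<epsilon>\<close> is chosen for a point \<open>w1\<close> off the circle, such that \<open>w1\<close> and \<open>d\<close> stay outside the \<open>\<epsilon>\<close>-strip
    around the circle.\<close>
  have "\<exists>w\<in>A. norm (w - d) \<noteq> \<rho>"
  proof (rule ccontr)
    assume "\<not> ?thesis"
    then have "A \<subseteq> sphere d \<rho>" by (auto simp: dist_norm norm_minus_commute)
    then have "negligible A" using negligible_sphere negligible_subset by blast
    then show False using open_not_negligible[OF A(1,2)] by blast
  qed
  then obtain w1 where w1: "w1 \<in> A" "norm (w1 - d) \<noteq> \<rho>" by blast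
  define z1 where "z1 = s w1"
  have z1: "z1 \<in> D" "f z1 = w1" using w1 fs by (auto simp: z1_def D_def)
  have nz1: "norm z1 < 1" using z1 DB by auto
  define \<epsilon> where "\<epsilon> = min (\<rho>/2) (\<bar>norm (w1 - d) - \<rho>\<bar> / 2)"
  have \<epsilon>: "\<epsilon> > 0" "\<epsilon> < \<bar>norm (w1 - d) - \<rho>\<bar>" "\<epsilon> < \<rho>" using w1(2) \<rho> by (auto simp: \<epsilon>_def min_def)
  have "norm (z1 - \<alpha>) > 0" "norm (z1 - \<beta>) > 0" using nz1 \<alpha> \<beta> by auto
  obtain r where r: "0 < r" "r < norm (z1 - \<alpha>)" "r \<notin> {norm (\<alpha> - \<beta>)}"
    "\<And>a b. a \<le> b \<Longrightarrow> (\<And>t. t \<in> {a..b} \<Longrightarrow> \<bar>t\<bar> < pi/2 \<and> \<alpha> * (1 - of_real r * cis t) \<in> D) \<Longrightarrow>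
      dist (f (\<alpha> * (1 - of_real r * cis a))) (f (\<alpha> * (1 - of_real r * cis b))) \<le> \<epsilon>"
    using short_arcs[OF holf oD DB injf bdf \<alpha> \<epsilon>(1) \<open>norm (z1 - \<alpha>) > 0\<close>, of "{norm (\<alpha> - \<beta>)}"] by auto
  obtain r' where r': "0 < r'" "r' < norm (z1 - \<beta>)" "r' \<notin> {norm (\<alpha> - \<beta>)}"
    "\<And>a b. a \<le> b \<Longrightarrow> (\<And>t. t \<in> {a..b} \<Longrightarrow> \<bar>t\<bar> < pi/2 \<and> \<beta> * (1 - of_real r' * cis t) \<in> D) \<Longrightarrow>
      dist (f (\<beta> * (1 - of_real r' * cis a))) (f (\<beta> * (1 - of_real r' * cis b))) \<le> \<epsilon>"
    using short_arcs[OF holf oD DB injf bdf \<beta> \<epsilon>(1) \<open>norm (z1 - \<beta>) > 0\<close>, of "{norm (\<alpha> - \<beta>)}"] by auto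
  define P where "P = D - cball \<alpha> r - cball \<beta> r'"
  have oP: "open P" unfolding P_def by (intro open_Diff oD) auto
  have PD: "P \<subseteq> D" by (auto simp: P_def)
  have ofP: "open (f ` P)"
    by (rule invariance_of_domain[OF continuous_on_subset[OF contf PD] oP inj_on_subset[OF injf PD]])
  have z1P: "z1 \<in> P" using z1 r r' by (auto simp: P_def dist_norm norm_minus_commute)
  have fr: "\<bar>norm (y - d) - \<rho>\<bar> \<le> \<epsilon>" if "y \<in> frontier (f ` P)" for y
  proof -
    have y: "y \<in> closure (f ` P)" "y \<notin> f ` P" using that ofP by (auto simp: frontier_def interior_open)
    then obtain v where v: "\<And>n. v n \<in> f ` P" "v \<longlonglongrightarrow> y" unfolding closure_sequential by blast
    define p where "p n = s (v n)" for n
    have pP: "p n \<in> P" and fp: "f (p n) = v n" for n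
    proof -
      obtain z where "z \<in> P" "v n = f z" using v(1) by blast
      then show "p n \<in> P" "f (p n) = v n" using sf PD by (auto simp: p_def)
    qed
    have "p n \<in> cball 0 1" for n using pP[of n] PD DB by (force intro: less_imp_le)
    then obtain p0 q where q: "strict_mono (q :: nat \<Rightarrow> nat)" "(p \<circ> q) \<longlonglongrightarrow> p0"
      using compact_cball[of "0::complex" 1] unfolding compact_def by (elim allE[of _ p]) blast
    have pq: "(\<lambda>n. p (q n)) \<longlonglongrightarrow> p0" using q(2) by (simp add: o_def)
    have vq: "(\<lambda>n. f (p (q n))) \<longlonglongrightarrow> y" unfolding fp using LIMSEQ_subseq_LIMSEQ[OF v(2) q(1)] by (simp add: o_def)
    have p0cl: "p0 \<in> closure D" unfolding closure_sequential
      by (rule exI[of _ "\<lambda>n. p (q n)"]) (intro conjI allI subsetD[OF PD pP] pq)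
    have far: "r \<le> norm (p0 - \<alpha>)" "r' \<le> norm (p0 - \<beta>)"
    proof -
      have l: "(\<lambda>n. norm (p (q n) - \<alpha>)) \<longlonglongrightarrow> norm (p0 - \<alpha>)" "(\<lambda>n. norm (p (q n) - \<beta>)) \<longlonglongrightarrow> norm (p0 - \<beta>)"
        by (intro tendsto_intros pq)+
      have b: "r \<le> norm (p (q n) - \<alpha>)" "r' \<le> norm (p (q n) - \<beta>)" for n
        using pP[of "q n"] by (simp_all add: P_def dist_norm norm_minus_commute)
      show "r \<le> norm (p0 - \<alpha>)" by (rule LIMSEQ_le_const[OF l(1)]) (intro exI[of _ 0] allI impI b(1))
      show "r' \<le> norm (p0 - \<beta>)" by (rule LIMSEQ_le_const[OF l(2)]) (intro exI[of _ 0] allI impI b(2))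
    qed
    have np0: "norm p0 < 1" using circ[OF p0cl] far r(1) r'(1) by auto
    obtain w0 where w0: "w0 \<in> A \<union> Q" "(\<lambda>n. f (p (q n))) \<longlonglongrightarrow> w0" "s w0 = p0"
      using lim[OF _ pq np0] pP PD by blast
    have "w0 = y" using LIMSEQ_unique[OF w0(2) vq] .
    show ?thesis
    proof (cases "w0 \<in> Q")
      case True
      then show ?thesis using Q \<epsilon>(1) \<open>w0 = y\<close> by (auto simp: dist_norm norm_minus_commute)
    next
      case False
      then have yA: "y \<in> A" using w0(1) \<open>w0 = y\<close> by simp
      then have p0D: "p0 \<in> D" "f p0 = y" using w0(3) \<open>w0 = y\<close> fs by (auto simp: D_def)
      then have "p0 \<notin> P" using y(2) by blast
      then have "norm (p0 - \<alpha>) = r \<or> norm (p0 - \<beta>) = r'"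
        using far p0D(1) by (auto simp: P_def dist_norm norm_minus_commute)
      then show ?thesis
      proof
        assume "norm (p0 - \<alpha>) = r"
        from arc[OF p0D(1) this \<alpha> _ r(1) _ r(4)] r(3) show ?thesis using p0D(2) by simp
      next
        assume "norm (p0 - \<beta>) = r'"
        from arc[OF p0D(1) this \<beta> _ r'(1) _ r'(4)] r'(3) show ?thesis using p0D(2) by simp
      qed
    qed
  qed
  have sub: "X \<subseteq> f ` P" if X: "connected X" "w1 \<in> X" "\<And>y. y \<in> X \<Longrightarrow> \<epsilon> < \<bar>norm (y - d) - \<rho>\<bar>" for X
  proof (rule ccontr)
    assume "\<not> X \<subseteq> f ` P"
    then have "X - f ` P \<noteq> {}" by blast
    moreover have "X \<inter> f ` P \<noteq> {}" using X(2) z1P z1(2) by blast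
    ultimately have "X \<inter> frontier (f ` P) \<noteq> {}" by (intro connected_Int_frontier[OF X(1)])
    then obtain y where y: "y \<in> X" "y \<in> frontier (f ` P)" by (auto simp del: frontier_def)
    show False using fr[OF y(2)] X(3)[OF y(1)] by simp
  qed
  show False
  proof (cases "norm (w1 - d) < \<rho>")
    case True
    have "ball d (\<rho> - \<epsilon>) \<subseteq> f ` P"
      by (rule sub) (use True \<epsilon> in \<open>auto simp: dist_norm norm_minus_commute\<close>)
    then have "d \<in> f ` P" using \<epsilon>(3) by auto
    then show False using d PD fD by blast
  next
    case False
    have "- cball d (\<rho> + \<epsilon>) \<subseteq> f ` P"
    proof (rule sub)
      show "connected (- cball d (\<rho> + \<epsilon>))"
        by (rule connected_complement_bounded_convex) auto
    qed (use False \<epsilon> in \<open>auto simp: dist_norm norm_minus_commute\<close>)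
    then have "bounded (- cball d (\<rho> + \<epsilon>))" using bdf PD bounded_subset by (meson image_mono subset_trans)
    then have "bounded (- cball d (\<rho> + \<epsilon>) \<union> cball d (\<rho> + \<epsilon>))" unfolding bounded_Un by simp
    then have "bounded (UNIV :: complex set)" by (simp only: Compl_partition2)
    then show False using not_bounded_UNIV by blast
  qed
qed

section \<open>Circular crosscuts of simply connected domains\<close>

text \<open>
  The quotient \<open>(z - p1) / (z - p2)\<close> for the two end points has a logarithm on the simply connected set \<open>G\<close>. It takes
  nonpositive real values in \<open>G\<close> only on the segment, so \<open>Ln\<close> provides a second logarithm off the segment. On a connected
  set the two would differ by a constant, but \<open>Ln\<close> jumps across the segment and the first one does not.
\<close>

lemma segment_separates:
  fixes G :: "complex set"
  assumes G: "open G" "simply_connected G" and t: "t1 < t2"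
    and Q: "Q = Complex x ` {t1<..<t2}" "Q \<subseteq> G" and ends: "Complex x t1 \<notin> G" "Complex x t2 \<notin> G"
  shows "\<not> connected (G - Q)"
proof
  assume conn: "connected (G - Q)"
  define p1 p2 where "p1 = Complex x t1" and "p2 = Complex x t2"
  define v where "v z = (z - p1) / (z - p2)" for z
  have nz: "z - p1 \<noteq> 0" "z - p2 \<noteq> 0" if "z \<in> G" for z using that ends by (auto simp: p1_def p2_def)
  have contv: "continuous_on G v" unfolding v_def by (intro continuous_intros) (use nz in auto)
  obtain \<phi> where \<phi>: "continuous_on G \<phi>" "\<And>z. z \<in> G \<Longrightarrow> v z = exp (\<phi> z)"
  proof (rule continuous_logarithm_on_simply_connected[OF contv G(2)])
    show "locally path_connected G" using G(1) by (rule open_imp_locally_path_connected)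
    show "v z \<noteq> 0" if "z \<in> G" for z using nz[OF that] by (simp add: v_def)
  qed blast
  have vreal: "z \<in> Q" if z: "z \<in> G" "v z \<in> \<real>\<^sub>\<le>\<^sub>0" for z
  proof -
    obtain r where r: "v z = of_real r" "r \<le> 0" using z(2) by (auto elim: nonpos_Reals_cases)
    have "z - p1 = of_real r * (z - p2)" using r(1) nz[OF z(1)] by (simp add: v_def field_simps)
    then have e: "Re z - x = r * (Re z - x)" "Im z - t1 = r * (Im z - t2)"
      by (simp_all add: p1_def p2_def complex_eq_iff)
    have "(1 - r) * (Re z - x) = 0" using e(1) by (simp add: algebra_simps)
    then have rez: "Re z = x" using r(2) by simp
    have "r \<noteq> 0" using \<open>z - p1 = of_real r * (z - p2)\<close> nz[OF z(1)] by auto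
    then have r': "r < 0" using r(2) by simp
    have "Im z * (1 - r) = t1 - r * t2" using e(2) by (simp add: algebra_simps)
    then have imz: "Im z = (t1 - r * t2) / (1 - r)" using r' by (simp add: field_simps)
    have "r * t2 < r * t1" using r' t by simp
    then have "t1 < Im z" unfolding imz using r' by (simp add: field_simps)
    moreover have "Im z < t2" unfolding imz using r' t by (simp add: field_simps)
    ultimately have "Complex x (Im z) \<in> Q" using Q(1) by auto
    then show ?thesis using rez by (metis complex_surj)
  qed
  have contP: "continuous_on (G - Q) (\<lambda>z. Ln (v z))"
    by (intro continuous_on_Ln' continuous_on_subset[OF contv]) (use vreal in auto)
  define m where "m = Complex x ((t1 + t2) / 2)"
  define s where "s = (t2 - t1) / 2"
  have s: "s > 0" using t by (simp add: s_def)
  have mQ: "m \<in> Q" using t by (auto simp: m_def Q(1))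
  have mG: "m \<in> G" using mQ Q(2) by blast
  have const: "\<phi> z - Ln (v z) = \<phi> w - Ln (v w)" if "z \<in> G - Q" "w \<in> G - Q" for z w
  proof (rule exp_eq_1_constant[OF conn _ _ that])
    show "continuous_on (G - Q) (\<lambda>z. \<phi> z - Ln (v z))"
      by (intro continuous_intros contP continuous_on_subset[OF \<phi>(1)]) auto
    show "exp (\<phi> z - Ln (v z)) = 1" if "z \<in> G - Q" for z
      using \<phi>(2)[of z] that nz[of z] by (simp add: exp_diff v_def)
  qed
  have "isCont \<phi> m" using \<phi>(1) G(1) mG continuous_on_eq_continuous_at by blast
  then obtain e1 where e1: "e1 > 0" "\<And>z. dist z m < e1 \<Longrightarrow> dist (\<phi> z) (\<phi> m) < 1"
    unfolding continuous_at_eps_delta by (metis zero_less_one)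
  obtain e2 where e2: "e2 > 0" "ball m e2 \<subseteq> G" using G(1) mG openE by blast
  define \<delta> where "\<delta> = min (min e1 e2) s / 2"
  have \<delta>: "\<delta> > 0" "\<delta> < e1" "\<delta> < e2" "\<delta> < s" using e1(1) e2(1) s by (auto simp: \<delta>_def)
  \<comment> \<open>Two points close to the midpoint \<open>m\<close> on either side of the segment, at which the quotient takes
    conjugate values with negative real part.\<close>
  define z w where "z = m + of_real \<delta>" and "w = m - of_real \<delta>"
  have dist: "dist z m = \<delta>" "dist w m = \<delta>" using \<delta>(1) by (auto simp: z_def w_def dist_norm)
  have zw: "z \<in> G - Q" "w \<in> G - Q"
  proof -
    have "Re z \<noteq> x" "Re w \<noteq> x" using \<delta>(1) by (auto simp: z_def w_def m_def)
    then show "z \<in> G - Q" "w \<in> G - Q" using dist \<delta> e2(2) Q(1) by (auto simp: dist_commute)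
  qed
  have "dist (\<phi> z) (\<phi> m) < 1" "dist (\<phi> w) (\<phi> m) < 1" using e1(2) dist \<delta> by auto
  then have "norm (\<phi> z - \<phi> w) < 2" using dist_triangle2[of "\<phi> z" "\<phi> w" "\<phi> m"] by (simp add: dist_norm)
  moreover have "\<phi> z - \<phi> w = Ln (v z) - Ln (v w)" using const[OF zw] by (simp add: algebra_simps)
  ultimately have small: "norm (Ln (v z) - Ln (v w)) < 2" by simp
  have mp: "m - p1 = \<i> * of_real s" "m - p2 = - \<i> * of_real s"
    by (simp_all add: m_def p1_def p2_def s_def complex_eq_iff field_simps)
  have vz: "v z = (of_real \<delta> + \<i> * of_real s) / (of_real \<delta> - \<i> * of_real s)"
    using mp by (simp add: v_def z_def algebra_simps)
  have vw: "v w = cnj (v z)"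
  proof -
    have "v w = (- of_real \<delta> + \<i> * of_real s) / (- of_real \<delta> - \<i> * of_real s)"
      using mp by (simp add: v_def w_def algebra_simps)
    also have "\<dots> = (of_real \<delta> - \<i> * of_real s) / (of_real \<delta> + \<i> * of_real s)"
      by (metis (no_types, opaque_lifting) minus_add_distrib minus_diff_eq minus_divide_divide uminus_add_conv_diff diff_minus_eq_add add.commute)
    also have "\<dots> = cnj (v z)" by (simp add: vz)
    finally show ?thesis .
  qed
  define q where "q = \<delta>\<^sup>2 + s\<^sup>2"
  have q: "q > 0" using s by (simp add: q_def add_nonneg_pos)
  have "v z = (of_real \<delta> + \<i> * of_real s)\<^sup>2 / of_real q"
  proof -
    have "of_real q = (of_real \<delta> + \<i> * of_real s) * (of_real \<delta> - \<i> * of_real s)"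
      by (simp add: q_def complex_eq_iff power2_eq_square)
    moreover have "of_real \<delta> + \<i> * of_real s \<noteq> 0" using s by (simp add: complex_eq_iff)
    ultimately show ?thesis by (simp add: vz power2_eq_square)
  qed
  then have "Re (v z) = (\<delta>\<^sup>2 - s\<^sup>2) / q" "Im (v z) = 2 * \<delta> * s / q"
    using q by (simp_all add: power2_eq_square Re_divide_of_real Im_divide_of_real)
  moreover have "\<delta>\<^sup>2 < s\<^sup>2" using \<delta> by (simp add: power_strict_mono)
  ultimately have neg: "Re (v z) < 0" "Im (v z) > 0" using q \<delta>(1) s by (auto simp: divide_neg_pos)
  then have nr: "v z \<noteq> 0" "v z \<notin> \<real>\<^sub>\<le>\<^sub>0" by (auto simp: complex_nonpos_Reals_iff)
  have "\<not> \<bar>Im (Ln (v z))\<bar> < pi / 2" using Re_Ln_pos_lt[OF nr(1)] neg(1) by simp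
  then have "pi / 2 \<le> \<bar>Im (Ln (v z))\<bar>" by simp
  moreover have "Ln (v w) = cnj (Ln (v z))" unfolding vw using cnj_Ln[OF nr(2)] by simp
  then have "\<bar>Im (Ln (v z) - Ln (v w))\<bar> = 2 * \<bar>Im (Ln (v z))\<bar>" by simp
  moreover have "\<bar>Im (Ln (v z) - Ln (v w))\<bar> \<le> norm (Ln (v z) - Ln (v w))" by (rule abs_Im_le_cmod)
  ultimately have "pi \<le> norm (Ln (v z) - Ln (v w))" by simp
  then show False using small pi_gt3 by simp
qed

lemma AE_lborel_interval_exists:
  assumes "AE x in lborel. P x" "a < (b::real)"
  obtains x where "a < x" "x < b" "P x"
proof -
  have "\<exists>x\<in>{a<..<b}. P x"
  proof (rule ccontr)
    assume "\<not> ?thesis"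
    then have "AE x in lborel. x \<notin> {a<..<b}" using assms(1) by (auto elim!: eventually_mono)
    then have "{a<..<b} \<in> null_sets lborel" by (subst AE_iff_null_sets) auto
    then show False using assms(2) by (simp add: null_sets_def)
  qed
  then show thesis using that by auto
qed

text \<open>
  A logarithm of \<open>z - d\<close> on \<open>U\<close> turns circles about \<open>d\<close> into vertical lines and \<open>s\<close> into a bounded univalent function,
  which has limits at both ends along almost every line. The crosscut is a maximal segment of such a line; it has
  length at most \<open>2 * pi\<close> because \<open>exp\<close> is injective on the image of the logarithm. The curve \<open>\<sigma>\<close> is \<open>s\<close> along the
  crosscut, extended to its ends.
\<close>

lemma circular_crosscut:
  fixes U :: "complex set" and s :: "complex \<Rightarrow> complex"
  assumes U: "open U" "simply_connected U" and d: "d \<notin> U" "d \<in> closure U" and big: "\<not> U \<subseteq> cball d \<delta>" and "\<delta> > 0"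
    and hols: "s holomorphic_on U" and injs: "inj_on s U" and bds: "bounded (s ` U)"
  obtains \<rho> \<sigma> k q1 q2 where "0 < \<rho>" "\<rho> < \<delta>" "q1 \<in> closure U - U" "q2 \<in> closure U - U" "dist d q1 = \<rho>" "dist d q2 = \<rho>"
    "(k::real \<Rightarrow> complex) ` {0<..<1} \<subseteq> U" "k ` {0<..<1} \<subseteq> sphere d \<rho>" "continuous_on {0..1} k" "k 0 = q1" "k 1 = q2"
    "continuous_on {0..1} \<sigma>" "\<And>t. t \<in> {0<..<1} \<Longrightarrow> \<sigma> t = s (k t)" 
    "\<not> connected (U - k ` {0<..<1})"
proof -
  have lpc: "locally path_connected U" using U(1) by (rule open_imp_locally_path_connected)
  have "(\<lambda>z. z - d) holomorphic_on U" by (intro holomorphic_intros)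
  then obtain L where L: "L holomorphic_on U" "\<And>z. z \<in> U \<Longrightarrow> z - d = exp (L z)"
    by (rule simply_connected_imp_holomorphic_log[OF _ U(2) lpc]) (use d in auto)
  define E where "E \<zeta> = d + exp \<zeta>" for \<zeta>
  define G where "G = L ` U"
  have EL: "E (L z) = z" if "z \<in> U" for z using L(2)[OF that] by (simp add: E_def algebra_simps)
  have injL: "inj_on L U" using EL by (metis inj_onI)
  have contL: "continuous_on U L" using L(1) by (rule holomorphic_on_imp_continuous_on)
  have oG: "open G" unfolding G_def by (rule invariance_of_domain[OF contL U(1) injL])
  have contE: "continuous_on A E" for A unfolding E_def by (intro continuous_intros)
  have holE: "E holomorphic_on A" for A unfolding E_def by (intro holomorphic_intros)
  have hom: "homeomorphism U G L E"
    unfolding G_def by (rule homeomorphismI) (use contL contE EL in auto)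
  have scG: "simply_connected G"
    using homeomorphic_simply_connected_eq[of U G] U(2) hom homeomorphic_def by blast
  have EG: "E \<zeta> \<in> U" "L (E \<zeta>) = \<zeta>" if "\<zeta> \<in> G" for \<zeta> using that EL by (auto simp: G_def)
  have injE: "inj_on E G" using EG by (metis inj_onI)
  define S where "S = s \<circ> E"
  have holS: "S holomorphic_on G" unfolding S_def
    by (rule holomorphic_on_compose_gen[OF holE hols]) (use EG in auto)
  have injS: "inj_on S G" unfolding S_def by (rule comp_inj_on[OF injE inj_on_subset[OF injs]]) (use EG in auto)
  have bdS: "bounded (S ` G)" by (rule bounded_subset[OF bds]) (use EG in \<open>auto simp: S_def\<close>)
  have "ln \<delta> - 1 < ln \<delta>" by simp
  then obtain x where x: "ln \<delta> - 1 < x" "x < ln \<delta>" and ae: "\<And>a b. a < b \<Longrightarrow> (\<forall>t\<in>{a<..<b}. Complex x t \<in> G) \<Longrightarrow>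
    (\<exists>l. ((\<lambda>t. S (Complex x t)) \<longlongrightarrow> l) (at_right a)) \<and> (\<exists>l. ((\<lambda>t. S (Complex x t)) \<longlongrightarrow> l) (at_left b))"
    by (rule AE_lborel_interval_exists[OF univalent_slice_limits[OF holS oG injS bdS]]) blast
  define \<rho> where "\<rho> = exp x"
  have \<rho>: "0 < \<rho>" "\<rho> < \<delta>" using x(2) \<open>\<delta> > 0\<close> by (auto simp: \<rho>_def) (metis exp_less_mono exp_ln)
  have "connected U" using U(2) by (rule simply_connected_imp_connected)
  obtain u where u: "u \<in> U" "dist d u = \<rho>"
  proof -
    have "U \<inter> ball d \<rho> \<noteq> {}" using d(2) \<rho>(1) by (metis centre_in_ball open_Int_closure_eq_empty open_ball disjoint_iff inf_commute)
    moreover have "U - ball d \<rho> \<noteq> {}" using big \<rho>(2) by auto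
    ultimately have "U \<inter> frontier (ball d \<rho>) \<noteq> {}" using connected_Int_frontier[OF \<open>connected U\<close>] by blast
    then obtain u where "u \<in> U" "u \<in> frontier (ball d \<rho>)" by blast
    then show thesis using that[of u] \<rho>(1) by simp
  qed
  define t0 where "t0 = Im (L u)"
  have ReL: "Re (L u) = x"
  proof -
    have "norm (u - d) = \<rho>" using u(2) by (simp add: dist_norm norm_minus_commute)
    then have "exp (Re (L u)) = exp x" unfolding L(2)[OF u(1)] norm_exp_eq_Re \<rho>_def .
    then show ?thesis by simp
  qed
  define T where "T = Complex x -` G"
  have oT: "open T" unfolding T_def by (intro open_vimage oG continuous_on_Complex_vertical)
  have t0T: "t0 \<in> T" using ReL u(1) by (simp add: T_def t0_def G_def) (metis complex_surj imageI)
  have shift: "E (Complex x (t + 2 * pi)) = E (Complex x t)" for t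
    by (simp add: E_def exp_eq_polar cis.code flip: cis_mult)
  have notboth: "t + 2 * pi \<notin> T" if "t \<in> T" for t
  proof
    assume "t + 2 * pi \<in> T"
    then have "Complex x (t + 2 * pi) = Complex x t" using inj_onD[OF injE shift] that by (simp add: T_def)
    then show False by simp
  qed
  have "t0 + 2 * pi \<notin> T" using notboth t0T by blast
  moreover have "t0 - 2 * pi \<notin> T" using notboth[of "t0 - 2 * pi"] t0T by auto
  ultimately obtain t1 t2 where t2: "t0 < t2" "t2 \<notin> T" "{t0..<t2} \<subseteq> T" and t1: "t1 < t0" "t1 \<notin> T" "{t1<..t0} \<subseteq> T"
    using next_outside_right[OF oT t0T, of "t0 + 2*pi"] next_outside_left[OF oT t0T, of "t0 - 2*pi"]
    by (metis add_strict_increasing2 diff_less_eq less_add_same_cancel1 mult_pos_pos order_refl pi_gt_zero zero_less_numeral)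
  have seg: "Complex x t \<in> G" if "t1 < t" "t < t2" for t
    using that t1(3) t2(3) by (cases "t \<le> t0") (auto simp: T_def subset_iff)
  have t12: "t1 < t2" using t1 t2 by simp
  define K where "K = Complex x ` {t1<..<t2}"
  have KG: "K \<subseteq> G" using seg by (auto simp: K_def)
  have sep: "\<not> connected (G - K)"
    by (rule segment_separates[OF oG scG t12 K_def KG]) (use t1 t2 in \<open>auto simp: T_def\<close>)
  \<comment> \<open>An end of the segment is outside the image \<open>G\<close> of the logarithm, but \<open>E\<close> might take it into \<open>U\<close> at a point with a
    different logarithm; injectivity of \<open>E\<close> near that logarithm excludes this.\<close>
  have endU: "E (Complex x a) \<notin> U" if a: "a \<notin> T" and near: "\<And>e. e > 0 \<Longrightarrow> \<exists>t\<in>T. \<bar>t - a\<bar> < e" for a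
  proof
    assume EU: "E (Complex x a) \<in> U"
    define g where "g = L (E (Complex x a))"
    have g: "g \<in> G" "E g = E (Complex x a)" using EU EL by (auto simp: g_def G_def)
    obtain e where e: "e > 0" "ball g e \<subseteq> G" using oG g(1) openE by blast
    obtain t where t: "t \<in> T" "\<bar>t - a\<bar> < e" using near[OF e(1)] by blast
    have "E (g + \<i> * of_real (t - a)) = E (Complex x a + \<i> * of_real (t - a))"
      using g(2) by (simp add: E_def exp_add)
    moreover have "Complex x a + \<i> * of_real (t - a) = Complex x t" by (simp add: complex_eq_iff)
    moreover have "g + \<i> * of_real (t - a) \<in> G"
    proof (rule subsetD[OF e(2)])
      have "dist g (g + \<i> * of_real (t - a)) = \<bar>t - a\<bar>"
        by (simp only: dist_norm norm_minus_commute[of g] add_diff_cancel_left' norm_mult norm_of_real norm_ii mult_1)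
      then show "g + \<i> * of_real (t - a) \<in> ball g e" using t(2) by simp
    qed
    ultimately have "g + \<i> * of_real (t - a) = Complex x t"
      using inj_onD[OF injE, of "g + \<i> * of_real (t - a)" "Complex x t"] t(1) by (simp add: T_def)
    then have "g = Complex x a" by (simp add: complex_eq_iff)
    then show False using g(1) a by (simp add: T_def)
  qed
  have end1: "E (Complex x t1) \<notin> U"
  proof (rule endU[OF t1(2)])
    fix e :: real assume "e > 0"
    then show "\<exists>t\<in>T. \<bar>t - t1\<bar> < e" using t1 by (intro bexI[of _ "min t0 (t1 + e/2)"]) (auto simp: min_def subset_iff)
  qed
  have end2: "E (Complex x t2) \<notin> U"
  proof (rule endU[OF t2(2)])
    fix e :: real assume "e > 0"
    then show "\<exists>t\<in>T. \<bar>t - t2\<bar> < e" using t2 by (intro bexI[of _ "max t0 (t2 - e/2)"]) (auto simp: max_def subset_iff)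
  qed
  obtain \<alpha> \<beta> where lim: "((\<lambda>t. S (Complex x t)) \<longlongrightarrow> \<alpha>) (at_right t1)" "((\<lambda>t. S (Complex x t)) \<longlongrightarrow> \<beta>) (at_left t2)"
    using ae[OF t12] seg by auto
  define \<theta> where "\<theta> u = t1 + u * (t2 - t1)" for u :: real
  define k where "k u = E (Complex x (\<theta> u))" for u
  define \<sigma>0 where "\<sigma>0 t = (if t = t1 then \<alpha> else if t = t2 then \<beta> else S (Complex x t))" for t
  have \<theta>01: "\<theta> u \<in> {t1<..<t2}" if "u \<in> {0<..<1}" for u
  proof -
    have "u * (t2 - t1) < 1 * (t2 - t1)" using that t12 by (intro mult_strict_right_mono) auto
    moreover have "0 < u * (t2 - t1)" using that t12 by simp
    ultimately show ?thesis unfolding \<theta>_def greaterThanLessThan_iff mult_1 right_diff_distrib by (intro conjI) linarith+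
  qed
  have contk: "continuous_on UNIV k" unfolding k_def
    by (intro continuous_on_compose2[OF contE[of UNIV]] continuous_on_compose2[OF continuous_on_Complex_vertical[of UNIV x]]) (auto simp: \<theta>_def intro!: continuous_intros)
  have cont0: "continuous_on {t1..t2} \<sigma>0"
  proof (rule continuous_on_IccI[OF _ _ _ t12])
    have "continuous_on {t1<..<t2} (\<lambda>t. S (Complex x t))"
      by (rule continuous_on_compose2[OF holomorphic_on_imp_continuous_on[OF holS] continuous_on_Complex_vertical]) (use seg in auto)
    then have S_at: "((\<lambda>t. S (Complex x t)) \<longlongrightarrow> S (Complex x t)) (at t)" if "t1 < t" "t < t2" for t
      using that by (simp add: continuous_on_eq_continuous_at isCont_def)
    show "(\<sigma>0 \<longlongrightarrow> \<sigma>0 t1) (at_right t1)"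
    proof (rule Lim_transform_eventually)
      show "((\<lambda>t. S (Complex x t)) \<longlongrightarrow> \<sigma>0 t1) (at_right t1)" using lim(1) by (simp add: \<sigma>0_def)
      show "\<forall>\<^sub>F t in at_right t1. S (Complex x t) = \<sigma>0 t"
        unfolding eventually_at_right_field by (rule exI[of _ t2]) (use t12 in \<open>auto simp: \<sigma>0_def\<close>)
    qed
    show "(\<sigma>0 \<longlongrightarrow> \<sigma>0 t2) (at_left t2)"
    proof (rule Lim_transform_eventually)
      show "((\<lambda>t. S (Complex x t)) \<longlongrightarrow> \<sigma>0 t2) (at_left t2)" using lim(2) t12 by (simp add: \<sigma>0_def)
      show "\<forall>\<^sub>F t in at_left t2. S (Complex x t) = \<sigma>0 t"
        unfolding eventually_at_left_field by (rule exI[of _ t1]) (use t12 in \<open>auto simp: \<sigma>0_def\<close>)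
    qed
    show "(\<sigma>0 \<longlongrightarrow> \<sigma>0 t) (at t)" if "t1 < t" "t < t2" for t
    proof (rule Lim_transform_within_open[OF _ open_greaterThanLessThan[of t1 t2]])
      show "((\<lambda>t. S (Complex x t)) \<longlongrightarrow> \<sigma>0 t) (at t)" using S_at[OF that] that by (simp add: \<sigma>0_def)
    qed (use that in \<open>auto simp: \<sigma>0_def\<close>)
  qed
  have dk: "dist d (k u) = \<rho>" for u by (simp add: k_def E_def dist_norm \<rho>_def)
  have kU: "k u \<in> U" if "u \<in> {0<..<1}" for u using EG(1) seg \<theta>01[OF that] by (simp add: k_def)
  have Kk: "E ` K = k ` {0<..<1}"
  proof (intro set_eqI iffI)
    fix w assume "w \<in> E ` K"
    then obtain t where t: "t1 < t" "t < t2" "w = E (Complex x t)" by (auto simp: K_def)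
    have "\<theta> ((t - t1) / (t2 - t1)) = t" using t12 by (simp add: \<theta>_def)
    moreover have "(t - t1) / (t2 - t1) \<in> {0<..<1}" using t t12 by simp
    ultimately show "w \<in> k ` {0<..<1}" using t(3) unfolding k_def by force
  next
    fix w assume "w \<in> k ` {0<..<1}"
    then show "w \<in> E ` K" using \<theta>01 by (auto simp: k_def K_def)
  qed
  have nconn: "\<not> connected (U - k ` {0<..<1})"
  proof
    assume "connected (U - k ` {0<..<1})"
    then have "connected (L ` (U - k ` {0<..<1}))"
      by (intro connected_continuous_image continuous_on_subset[OF contL]) auto
    moreover have "L ` (U - E ` K) = L ` U - L ` (E ` K)"
      by (rule inj_on_image_set_diff[OF injL]) (use EG(1) KG in auto)
    moreover have "L ` (E ` K) = K" using EG(2) KG by (force simp: image_image)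
    ultimately show False using sep by (simp add: Kk G_def)
  qed
  have clo: "k 0 \<in> closure U" "k 1 \<in> closure U"
  proof -
    have "k ` closure {0<..<1} \<subseteq> closure (k ` {0<..<1})"
    proof (rule image_closure_subset)
      show "k ` {0<..<1} \<subseteq> closure (k ` {0<..<1})" by (rule closure_subset)
    qed (use continuous_on_subset[OF contk] in auto)
    moreover have "closure (k ` {0<..<1}) \<subseteq> closure U" using kU by (intro closure_mono) auto
    moreover have "closure {0<..<1::real} = {0..1}" by simp
    ultimately have "k ` {0..1} \<subseteq> closure U" by (metis subset_trans)
    moreover have "k 0 \<in> k ` {0..1}" "k 1 \<in> k ` {0..1}" by (intro imageI; simp)+
    ultimately show "k 0 \<in> closure U" "k 1 \<in> closure U" by blast+
  qed
  show thesis
  proof (rule that[of \<rho> "k 0" "k 1" k "\<lambda>u. \<sigma>0 (\<theta> u)"])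
    show "k 0 \<in> closure U - U" "k 1 \<in> closure U - U" using clo end1 end2 by (auto simp: k_def \<theta>_def)
    show "continuous_on {0..1} (\<lambda>u. \<sigma>0 (\<theta> u))"
    proof (rule continuous_on_compose2[OF cont0])
      show "continuous_on {0..1} \<theta>" unfolding \<theta>_def by (intro continuous_intros)
      show "\<theta> ` {0..1} \<subseteq> {t1..t2}"
      proof (clarsimp)
        fix u :: real assume u: "0 \<le> u" "u \<le> 1"
        have "u * (t2 - t1) \<le> 1 * (t2 - t1)" using u t12 by (intro mult_right_mono) auto
        moreover have "0 \<le> u * (t2 - t1)" using u t12 by simp
        ultimately show "t1 \<le> \<theta> u \<and> \<theta> u \<le> t2" unfolding \<theta>_def mult_1 right_diff_distrib by (intro conjI) linarith+
      qed
    qed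
    show "\<sigma>0 (\<theta> t) = s (k t)" if "t \<in> {0<..<1}" for t using \<theta>01[OF that] by (simp add: \<sigma>0_def S_def k_def)
    show "continuous_on {0..1} k" using contk continuous_on_subset by blast
  qed (use \<rho> dk kU nconn in auto)
qed

section \<open>From a crosscut to a univalent half-neighbourhood\<close>

text \<open>
  Choose a frontier point \<open>d\<close> of \<open>U\<close> off the closure of \<open>C\<close> and a small circular crosscut \<open>Q\<close> of \<open>U\<close> about \<open>d\<close>. As
  \<open>a\<close> and \<open>b\<close> are joined by \<open>\<Sigma>\<close> outside \<open>\<Omega>\<close>, the crosscut \<open>Q\<close> separates not only \<open>U\<close> but all of \<open>\<Omega>\<close>; one of the pieces,
  \<open>A\<close>, avoids \<open>C\<close> and therefore lies in \<open>U\<close>. Inside the disk \<open>s ` A\<close> is bounded only by \<open>s ` Q\<close>, whose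
  closure has two points on the circle. At any other point of the circle in the closure of \<open>s ` A\<close>, and there is
  one by \<open>boundary_not_two_points\<close>, the set \<open>s ` A\<close> fills a half-neighbourhood.
\<close>

lemma crosscut_univalent_boundary:
  fixes \<Omega> U C \<Sigma> :: "complex set" and s :: "complex \<Rightarrow> complex"
  assumes \<Omega>: "open \<Omega>" "connected \<Omega>"
    and C: "C \<subseteq> \<Omega>" "connected C" "compact (closure C)" "closure C = C \<union> {a, b}" "C \<noteq> {}"
    and \<Sigma>: "compact \<Sigma>" "connected \<Sigma>" "a \<in> \<Sigma>" "b \<in> \<Sigma>" "\<Sigma> \<inter> \<Omega> = {}"
    and U: "U \<in> components (\<Omega> - C)" "simply_connected U" "bounded U"
    and far: "\<not> frontier U \<subseteq> closure C"
    and s: "s holomorphic_on U" "inj_on s U" "s ` U \<subseteq> ball 0 1"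
    and H: "\<And>w z. (\<And>n. w n \<in> U) \<Longrightarrow> (\<lambda>n. s (w n)) \<longlonglongrightarrow> z \<Longrightarrow> norm z < 1 \<Longrightarrow> \<exists>w0\<in>\<Omega>. w \<longlonglongrightarrow> w0"
  shows "\<exists>\<xi> e. norm \<xi> = 1 \<and> e > 0 \<and> ball \<xi> e \<inter> ball 0 1 \<subseteq> s ` U"
proof -
  have aC: "a \<notin> \<Omega>" "b \<notin> \<Omega>" using \<Sigma> by auto
  have clC: "closure C \<inter> \<Omega> = C" using C(1,4) aC by blast
  have "\<Omega> - C = \<Omega> - closure C" using clC by blast
  then have oOC: "open (\<Omega> - C)" using \<Omega>(1) by (metis closed_closure open_Diff)
  have oU: "open U" using open_components[OF oOC U(1)] .
  have Usub: "U \<subseteq> \<Omega> - C" "connected U" "U \<noteq> {}"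
    using U(1) in_components_subset in_components_connected in_components_nonempty by blast+
  have frU: "frontier U \<inter> (\<Omega> - C) = {}" by (rule frontier_component_disjoint[OF oOC U(1)])
  obtain d where d: "d \<in> frontier U" "d \<notin> closure C" using far by blast
  have dU: "d \<notin> U" "d \<in> closure U" using d(1) oU by (auto simp: frontier_def interior_open)
  obtain \<delta>0 where \<delta>0: "\<delta>0 > 0" "ball d \<delta>0 \<subseteq> - closure C"
    using d(2) by (metis ComplI closed_closure open_Compl openE)
  have "\<not> U \<subseteq> {d}" using oU Usub(3) dU(1) by blast
  then obtain u0 where u0: "u0 \<in> U" "u0 \<noteq> d" by blast
  define \<delta> where "\<delta> = min \<delta>0 (dist d u0) / 2"
  have \<delta>: "\<delta> > 0" "\<delta> < \<delta>0" "\<not> U \<subseteq> cball d \<delta>"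
    using \<delta>0(1) u0 by (auto simp: \<delta>_def min_def subset_iff dist_pos_lt intro!: bexI[of _ u0])
  have bds: "bounded (s ` U)" using s(3) bounded_ball bounded_subset by blast
  obtain \<rho> \<sigma> k q1 q2 where k: "0 < \<rho>" "\<rho> < \<delta>" "q1 \<in> closure U - U" "q2 \<in> closure U - U" "dist d q1 = \<rho>" "dist d q2 = \<rho>"
    "(k::real \<Rightarrow> complex) ` {0<..<1} \<subseteq> U" "k ` {0<..<1} \<subseteq> sphere d \<rho>" "continuous_on {0..1} k" "k 0 = q1" "k 1 = q2"
    "continuous_on {0..1} \<sigma>" "\<And>t. t \<in> {0<..<1} \<Longrightarrow> \<sigma> t = s (k t)" 
    "\<not> connected (U - k ` {0<..<1})"
    by (rule circular_crosscut[OF oU U(2) dU \<delta>(3,1) s(1,2) bds]) blast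
  define Q where "Q = k ` {0<..<1}"
  have QU: "Q \<subseteq> U" and Qs: "Q \<subseteq> sphere d \<rho>" using k(7,8) by (auto simp: Q_def)
  have q\<Omega>: "q \<notin> \<Omega>" "q \<notin> closure C" if "q \<in> closure U - U" "dist d q = \<rho>" for q
  proof -
    have "q \<in> ball d \<delta>0" using that(2) k(2) \<delta>(2) by simp
    then show "q \<notin> closure C" using \<delta>0(2) by blast
    moreover have "q \<in> frontier U" using that(1) oU by (auto simp: frontier_def interior_open)
    ultimately show "q \<notin> \<Omega>" using frU closure_subset by blast
  qed
  have q: "q1 \<notin> \<Omega>" "q2 \<notin> \<Omega>" "q1 \<notin> closure C" "q2 \<notin> closure C" using q\<Omega> k(3-6) by auto
  have I01: "{0..1} = {0<..<1} \<union> {0,1::real}" by auto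
  have Qbar: "k ` {0..1} = Q \<union> {q1, q2}" unfolding I01 image_Un Q_def using k(10,11) by simp
  have compQ: "compact (Q \<union> {q1, q2})" unfolding Qbar[symmetric] by (intro compact_continuous_image k(9)) simp
  have clQ: "closed (Q \<union> {q1, q2})" using compQ compact_imp_closed by blast
  have oOQ: "open (\<Omega> - Q)"
  proof -
    have "\<Omega> - Q = \<Omega> - (Q \<union> {q1, q2})" using q by blast
    then show ?thesis using \<Omega>(1) clQ by (metis open_Diff)
  qed
  \<comment> \<open>A connection of two points of \<open>U\<close> off \<open>Q\<close> within \<open>\<Omega> - Q\<close> could, by the theorem of Janiszewski, be replaced
    by one that also avoids \<open>closure C\<close>, since \<open>closure C \<union> \<Sigma>\<close> meets the complement of \<open>\<Omega> - Q\<close> exactly in the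
    connected set \<open>\<Sigma>\<close>. It would then stay in \<open>U - Q\<close>.\<close>
  have nconn: "\<not> connected (\<Omega> - Q)"
  proof
    assume conn: "connected (\<Omega> - Q)"
    have "\<not> (\<forall>x\<in>U - Q. \<forall>y\<in>U - Q. connected_component (U - Q) x y)"
      using k(14) unfolding Q_def[symmetric] connected_iff_connected_component by blast
    then obtain x y where xy: "x \<in> U - Q" "y \<in> U - Q" "\<not> connected_component (U - Q) x y" by blast
    define S where "S = closure C \<union> \<Sigma>"
    define T where "T = (Q \<union> {q1, q2}) \<union> - \<Omega>"
    have T: "- T = \<Omega> - Q" using q by (auto simp: T_def)
    have "S \<inter> T = \<Sigma>"
      using C(4) \<Sigma>(3-5) q QU Usub(1) C(1) by (auto simp: S_def T_def)
    have "connected_component (- (S \<union> T)) x y"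
    proof (rule Janiszewski)
      show "compact S" using C(3) \<Sigma>(1) by (simp add: S_def compact_Un)
      show "closed T" unfolding T_def by (rule closed_Un[OF clQ]) (use \<Omega>(1) in auto)
      show "connected (S \<inter> T)" using \<open>S \<inter> T = \<Sigma>\<close> \<Sigma>(2) by simp
      have "U \<subseteq> - S" using Usub(1) clC \<Sigma>(5) by (auto simp: S_def)
      then show "connected_component (- S) x y"
        using Usub(2) xy(1,2) unfolding connected_component_def by blast
      show "connected_component (- T) x y" unfolding T
        using conn xy(1,2) Usub(1) by (auto simp: connected_component_def intro!: exI[of _ "\<Omega> - Q"])
    qed
    then obtain X where X: "connected X" "X \<subseteq> - (S \<union> T)" "x \<in> X" "y \<in> X" unfolding connected_component_def by blast
    have "X \<subseteq> \<Omega> - C" using X(2) T clC by (auto simp: S_def)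
    then have "X \<subseteq> U" using components_maximal[OF U(1) X(1)] X(3) xy(1) by blast
    then have "X \<subseteq> U - Q" using X(2) by (auto simp: T_def)
    then show False using xy(3) X unfolding connected_component_def by blast
  qed
  have CQ: "C \<subseteq> \<Omega> - Q" using C(1) QU Usub(1) by blast
  obtain c0 where c0: "c0 \<in> C" using C(5) by blast
  define O1 where "O1 = connected_component_set (\<Omega> - Q) c0"
  have "C \<subseteq> O1" unfolding O1_def by (rule connected_component_maximal[OF c0 C(2) CQ])
  have "O1 \<noteq> \<Omega> - Q" using nconn by (metis O1_def connected_connected_component)
  moreover have "O1 \<subseteq> \<Omega> - Q" by (simp add: O1_def connected_component_subset)
  ultimately obtain v where v: "v \<in> \<Omega> - Q" "v \<notin> O1" by blast
  define A where "A = connected_component_set (\<Omega> - Q) v"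
  have Acomp: "A \<in> components (\<Omega> - Q)" using v(1) by (simp add: A_def componentsI)
  have A: "v \<in> A" "connected A" "A \<subseteq> \<Omega> - Q" using v(1) by (auto simp: A_def connected_component_subset)
  have oA: "open A" using open_components[OF oOQ Acomp] .
  have "A \<inter> O1 = {}"
    using v(2) connected_component_eq unfolding A_def O1_def by (metis (no_types, lifting) connected_component_disjoint connected_component_sym mem_Collect_eq)
  then have AC: "A \<inter> C = {}" using \<open>C \<subseteq> O1\<close> by blast
  have frA: "frontier A \<inter> (\<Omega> - Q) = {}" by (rule frontier_component_disjoint[OF oOQ Acomp])
  have "\<Omega> \<inter> A \<noteq> {}" "\<Omega> - A \<noteq> {}" using A(1,3) c0 AC C(1) by blast+
  then have "\<Omega> \<inter> frontier A \<noteq> {}" by (rule connected_Int_frontier[OF \<Omega>(2)])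
  then obtain y where y: "y \<in> Q" "y \<in> frontier A" using frA by blast
  then have "y \<in> closure A" "y \<in> U" using QU by (auto simp: frontier_def)
  then have "A \<inter> U \<noteq> {}" using oU by (metis Int_commute disjoint_iff open_Int_closure_eq_empty)
  then have AU: "A \<subseteq> U" using components_maximal[OF U(1) A(2)] A(3) AC by blast
  have clA: "z \<in> A \<union> Q" if "z \<in> closure A" "z \<in> \<Omega>" for z
    using that frA oA by (auto simp: frontier_def interior_open)
  have contU: "continuous_on U s" using s(1) by (rule holomorphic_on_imp_continuous_on)
  have lim: "\<exists>w0\<in>A \<union> Q. w \<longlonglongrightarrow> w0" if w: "\<And>n. w n \<in> A" "(\<lambda>n. s (w n)) \<longlonglongrightarrow> z" "norm z < 1" for w z
  proof -
    obtain w0 where w0: "w0 \<in> \<Omega>" "w \<longlonglongrightarrow> w0" using H[of w z] w AU by blast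
    moreover have "w0 \<in> closure A" unfolding closure_sequential using w(1) w0(2) by blast
    ultimately show ?thesis using clA by blast
  qed
  \<comment> \<open>The ends of \<open>Q\<close> lie outside \<open>\<Omega>\<close>, so by \<open>H\<close> the values of \<open>s\<close> cannot converge inside the disk there.\<close>
  have n\<sigma>: "norm (\<sigma> c) = 1" if c: "c \<in> {0,1}" for c
  proof -
    define t where "t n = (if c = 0 then 1 / real (n + 2) else 1 - 1 / real (n + 2))" for n
    have t01: "t n \<in> {0<..<1}" for n by (auto simp: t_def)
    have l: "(\<lambda>n. 1 / real (n + 2)) \<longlonglongrightarrow> 0"
      using LIMSEQ_ignore_initial_segment[OF lim_1_over_n, of 2] by simp
    have tl: "t \<longlonglongrightarrow> c"
      using c l tendsto_diff[OF tendsto_const l, of 1] by (auto simp: t_def[abs_def])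
    have c01: "c \<in> {0..1}" using c by auto
    have l\<sigma>: "(\<lambda>n. \<sigma> (t n)) \<longlonglongrightarrow> \<sigma> c"
      by (rule continuous_on_tendsto_compose[OF k(12) tl c01]) (use t01 in \<open>auto simp: less_imp_le\<close>)
    have lk: "(\<lambda>n. k (t n)) \<longlonglongrightarrow> k c"
      by (rule continuous_on_tendsto_compose[OF k(9) tl c01]) (use t01 in \<open>auto simp: less_imp_le\<close>)
    have kU: "k (t n) \<in> U" for n using k(7) t01 by blast
    have ls: "(\<lambda>n. s (k (t n))) \<longlonglongrightarrow> \<sigma> c" using l\<sigma> k(13)[OF t01] by simp
    have "norm (\<sigma> c) \<le> 1"
    proof (rule tendsto_upperbound[OF tendsto_norm[OF ls]])
      show "\<forall>\<^sub>F n in sequentially. norm (s (k (t n))) \<le> 1"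
        using s(3) kU by (intro always_eventually allI) (force intro: less_imp_le)
    qed simp
    moreover have "\<not> norm (\<sigma> c) < 1"
    proof
      assume "norm (\<sigma> c) < 1"
      then obtain w0 where "w0 \<in> \<Omega>" "(\<lambda>n. k (t n)) \<longlonglongrightarrow> w0" using H[OF kU ls] by blast
      then have "k c \<in> \<Omega>" using LIMSEQ_unique[OF lk] by blast
      then show False using c k(10,11) q by auto
    qed
    ultimately show ?thesis by simp
  qed
  define \<alpha> \<beta> where "\<alpha> = \<sigma> 0" and "\<beta> = \<sigma> 1"
  have n\<alpha>\<beta>: "norm \<alpha> = 1" "norm \<beta> = 1" using n\<sigma> by (auto simp: \<alpha>_def \<beta>_def)
  have "\<sigma> ` {0<..<1} = s ` Q" unfolding Q_def image_image using k(13) by (intro image_cong) auto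
  then have s\<sigma>: "\<sigma> ` {0..1} = s ` Q \<union> {\<alpha>, \<beta>}" unfolding I01 image_Un by (simp add: \<alpha>_def \<beta>_def)
  have clsQ: "closed (s ` Q \<union> {\<alpha>, \<beta>})"
    unfolding s\<sigma>[symmetric] by (intro compact_imp_closed compact_continuous_image k(12)) simp
  have AQU: "A \<union> Q \<subseteq> U" using AU QU by blast
  obtain \<xi> where \<xi>: "\<xi> \<in> closure (s ` A)" "norm \<xi> = 1" "\<xi> \<noteq> \<alpha>" "\<xi> \<noteq> \<beta>"
  proof -
    have "A \<noteq> {}" "d \<notin> A" "s ` (A \<union> Q) \<subseteq> ball 0 1" using A(1) AU dU(1) s(3) AQU by blast+
    have "\<exists>\<xi>\<in>closure (s ` A). norm \<xi> = 1 \<and> \<xi> \<noteq> \<alpha> \<and> \<xi> \<noteq> \<beta>"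
      by (rule boundary_not_two_points[OF oA \<open>A \<noteq> {}\<close> bounded_subset[OF U(3) AU] \<open>d \<notin> A\<close> Qs k(1)
        holomorphic_on_subset[OF s(1) AU] continuous_on_subset[OF contU AQU] inj_on_subset[OF s(2) AQU]
        \<open>s ` (A \<union> Q) \<subseteq> ball 0 1\<close> _ n\<alpha>\<beta>]) (rule lim)
    then show thesis using that by blast
  qed
  have "\<xi> \<notin> s ` Q" using s(3) QU \<xi>(2) by (force simp: subset_iff)
  then have "\<xi> \<notin> s ` Q \<union> {\<alpha>, \<beta>}" using \<xi> by simp
  then obtain e where e: "e > 0" "ball \<xi> e \<subseteq> - (s ` Q \<union> {\<alpha>, \<beta>})" using clsQ by (metis ComplI open_Compl openE)
  have osA: "open (s ` A)"
    by (rule invariance_of_domain[OF continuous_on_subset[OF contU AU] oA inj_on_subset[OF s(2) AU]])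
  define B where "B = ball \<xi> e \<inter> ball 0 1"
  have frB: "B \<inter> frontier (s ` A) = {}"
  proof (rule ccontr)
    assume "B \<inter> frontier (s ` A) \<noteq> {}"
    then obtain z where z: "z \<in> B" "z \<in> closure (s ` A)" "z \<notin> s ` A" using osA by (auto simp: frontier_def interior_open)
    obtain x where x: "\<And>n. x n \<in> s ` A" "x \<longlonglongrightarrow> z" using z(2) unfolding closure_sequential by blast
    have "\<exists>w. w \<in> A \<and> s w = x n" for n
    proof -
      from x(1)[of n] obtain w where "x n = s w" "w \<in> A" by (rule imageE)
      then show ?thesis by (intro exI[of _ w]) simp
    qed
    then obtain w where w: "\<And>n. w n \<in> A" "\<And>n. s (w n) = x n" by metis
    have nz: "norm z < 1" using z(1) by (simp add: B_def)
    have l: "(\<lambda>n. s (w n)) \<longlonglongrightarrow> z" using w(2) x(2) by simp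
    obtain w0 where w0: "w0 \<in> A \<union> Q" "w \<longlonglongrightarrow> w0" using lim[OF w(1) l nz] by blast
    have "(\<lambda>n. s (w n)) \<longlonglongrightarrow> s w0"
      by (rule continuous_on_tendsto_compose[OF contU w0(2)]) (use w0(1) AQU w(1) AU in \<open>auto intro!: always_eventually\<close>)
    then have "z = s w0" using l LIMSEQ_unique by blast
    then have "z \<in> s ` Q" using w0(1) z(3) by blast
    then show False using z(1) e(2) by (auto simp: B_def)
  qed
  have "connected B" unfolding B_def by (intro convex_connected convex_Int) auto
  moreover have "B \<inter> s ` A \<noteq> {}"
  proof -
    have "\<xi> \<in> ball \<xi> e \<inter> closure (s ` A)" using \<xi>(1) e(1) by simp
    then have "ball \<xi> e \<inter> s ` A \<noteq> {}" using open_Int_closure_eq_empty[OF open_ball, of \<xi> e "s ` A"] by blast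
    moreover have "s ` A \<subseteq> ball 0 1" using image_mono[OF AU, of s] s(3) by (rule subset_trans)
    ultimately show ?thesis unfolding B_def by blast
  qed
  ultimately have "B \<subseteq> s ` A" using frB connected_Int_frontier[of B "s ` A"] by blast
  then have "ball \<xi> e \<inter> ball 0 1 \<subseteq> s ` U" using image_mono[OF AU, of s] unfolding B_def by (rule subset_trans)
  then show ?thesis using \<xi>(2) e(1) by (intro exI[of _ \<xi>] exI[of _ e]) simp
qed

section \<open>Distinct limits along vertical lines\<close>

lemma convex_rectangle: "convex {z. a < Re z \<and> Re z < b \<and> c < Im z \<and> Im z < d}"
proof -
  have "{z. a < Re z \<and> Re z < b \<and> c < Im z \<and> Im z < d} =
    {z. a < Re z} \<inter> {z. Re z < b} \<inter> ({z. c < Im z} \<inter> {z. Im z < d})" by auto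
  then show ?thesis
    by (simp add: convex_Int convex_halfspace_Re_gt convex_halfspace_Re_lt convex_halfspace_Im_gt convex_halfspace_Im_lt)
qed

lemma open_rectangle: "open {z. a < Re z \<and> Re z < b \<and> c < Im z \<and> Im z < d}"
proof -
  have "{z. a < Re z \<and> Re z < b \<and> c < Im z \<and> Im z < d} =
    {z. a < Re z} \<inter> {z. Re z < b} \<inter> ({z. c < Im z} \<inter> {z. Im z < d})" by auto
  then show ?thesis
    by (simp add: open_Int open_halfspace_Re_gt open_halfspace_Re_lt open_halfspace_Im_gt open_halfspace_Im_lt)
qed

text \<open>
  If all vertical limits agreed, with common value \<open>a\<close>, then the horizontal averages \<open>K z\<close>, the integrals of \<open>F\<close> from \<open>z\<close>
  to \<open>z + h\<close>, would tend to the constant \<open>h * a\<close> at the bottom side, by dominated convergence and a Lipschitz bound.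
  Continued by this constant below the real axis, \<open>K\<close> is holomorphic, hence constant; then its derivative
  \<open>F (z + h) - F z\<close> vanishes, against injectivity. Averaging replaces a uniqueness theorem for boundary values of
  \<open>F\<close> itself, which are only known almost everywhere.
\<close>

lemma distinct_vertical_limits:
  fixes F :: "complex \<Rightarrow> complex" and h :: real
  defines "R \<equiv> {z. - h < Re z \<and> Re z < h \<and> 0 < Im z \<and> Im z < h}"
  assumes h: "h > 0" and hol: "F holomorphic_on R" and inj: "inj_on F R" and bd: "bounded (F ` R)"
  obtains x1 x2 l1 l2 where "- h < x1" "x1 < x2" "x2 < h" "l1 \<noteq> l2"
    "((\<lambda>y. F (Complex x1 y)) \<longlongrightarrow> l1) (at_right 0)" "((\<lambda>y. F (Complex x2 y)) \<longlongrightarrow> l2) (at_right 0)"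
proof (rule ccontr)
  define good where "good x l \<longleftrightarrow> ((\<lambda>y. F (Complex x y)) \<longlongrightarrow> l) (at_right 0)" for x l
  assume "\<not> thesis"
  then have contr: "l1 = l2" if "- h < x1" "x1 < x2" "x2 < h" "good x1 l1" "good x2 l2" for x1 x2 l1 l2
    using \<open>\<And>x1 x2 l1 l2. - h < x1 \<Longrightarrow> x1 < x2 \<Longrightarrow> x2 < h \<Longrightarrow> l1 \<noteq> l2 \<Longrightarrow>
      ((\<lambda>y. F (Complex x1 y)) \<longlongrightarrow> l1) (at_right 0) \<Longrightarrow> ((\<lambda>y. F (Complex x2 y)) \<longlongrightarrow> l2) (at_right 0) \<Longrightarrow> thesis\<close> that
    unfolding good_def by blast
  have oR: "open R" and cR: "convex R" unfolding R_def by (rule open_rectangle, rule convex_rectangle)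
  have ae: "AE x in lborel. x \<in> {-h<..<h} \<longrightarrow> (\<exists>l. good x l)"
    using univalent_slice_limits[OF hol oR inj bd]
  proof (rule AE_mp, intro AE_I2 impI)
    fix x assume *: "\<forall>a b. a < b \<longrightarrow> (\<forall>t\<in>{a<..<b}. Complex x t \<in> R) \<longrightarrow>
      (\<exists>l. ((\<lambda>t. F (Complex x t)) \<longlongrightarrow> l) (at_right a)) \<and> (\<exists>l. ((\<lambda>t. F (Complex x t)) \<longlongrightarrow> l) (at_left b))" and x: "x \<in> {-h<..<h}"
    have "\<forall>t\<in>{0<..<h}. Complex x t \<in> R" using x by (auto simp: R_def)
    then show "\<exists>l. good x l" unfolding good_def using *[rule_format, of 0 h] h by auto
  qed
  have eq: "l1 = l2" if "good x1 l1" "good x2 l2" "x1 \<in> {-h<..<h}" "x2 \<in> {-h<..<h}" for x1 x2 l1 l2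
  proof (cases x1 x2 rule: linorder_cases)
    case less
    then show ?thesis using contr[of x1 x2 l1 l2] that by auto
  next
    case equal
    then show ?thesis using that tendsto_unique[of "at_right (0::real)"] unfolding good_def by auto
  next
    case greater
    then show ?thesis using contr[of x2 x1 l2 l1] that by auto
  qed
  obtain x0 where x0: "-h < x0" "x0 < h" "x0 \<in> {-h<..<h} \<longrightarrow> (\<exists>l. good x0 l)"
    by (rule AE_lborel_interval_exists[OF ae, of "-h" h]) (use h in auto)
  then obtain a where a: "good x0 a" by auto
  have aea: "AE x in lborel. x \<in> {-h<..<h} \<longrightarrow> good x a"
    using ae
  proof (rule AE_mp, intro AE_I2 impI)
    fix x assume "x \<in> {-h<..<h} \<longrightarrow> (\<exists>l. good x l)" "x \<in> {-h<..<h}"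
    then show "good x a" using eq[OF _ a, of x] x0 by auto
  qed
  obtain M where M: "\<And>z. z \<in> R \<Longrightarrow> norm (F z) \<le> M" using bd by (auto simp: bounded_iff)
  obtain P where P: "\<And>x. x \<in> R \<Longrightarrow> (P has_field_derivative F x) (at x within R)"
    by (rule holomorphic_convex_primitive'[OF cR oR hol]) blast
  have Pat: "(P has_field_derivative F x) (at x)" if "x \<in> R" for x
    using P[OF that] at_within_open[OF that oR] by simp
  \<comment> \<open>The translation that carries the left half \<open>R1\<close> of the rectangle to the right half.\<close>
  define \<delta> where "\<delta> = h"
  define R1 where "R1 = {z. - h < Re z \<and> Re z < 0 \<and> 0 < Im z \<and> Im z < h}"
  have R1R: "z \<in> R" "z + of_real \<delta> \<in> R" if "z \<in> R1" for z using that h by (auto simp: R1_def R_def \<delta>_def)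
  define K where "K z = P (z + of_real \<delta>) - P z" for z
  have derK: "(K has_field_derivative (F (z + of_real \<delta>) - F z)) (at z)" if "z \<in> R1" for z
    unfolding K_def using Pat[OF R1R(1)[OF that]] DERIV_shift[THEN iffD1, OF Pat[OF R1R(2)[OF that]]]
    by (intro derivative_intros) auto
  have lip: "norm (K z - K w) \<le> (2 * M) * norm (z - w)" if "z \<in> R1" "w \<in> R1" for z w
  proof (rule field_differentiable_bound[of R1])
    show "convex R1" unfolding R1_def by (rule convex_rectangle)
    show "(K has_field_derivative (F (z + of_real \<delta>) - F z)) (at z within R1)" if "z \<in> R1" for z
      using derK[OF that] has_field_derivative_at_within by blast
    show "norm (F (z + of_real \<delta>) - F z) \<le> 2 * M" if "z \<in> R1" for z
      using norm_triangle_ineq4[of "F (z + of_real \<delta>)" "F z"] M[OF R1R(1)[OF that]] M[OF R1R(2)[OF that]] by simp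
  qed (use that in auto)
  define e where "e n = h / real (n + 2)" for n
  have e: "e n > 0" "e n < h" for n
  proof -
    show "e n > 0" using h by (simp add: e_def)
    have "e n \<le> h / 2" unfolding e_def using h by (intro divide_left_mono) auto
    then show "e n < h" using h by simp
  qed
  have elim: "e \<longlonglongrightarrow> 0"
    using tendsto_mult[OF tendsto_const LIMSEQ_ignore_initial_segment[OF lim_1_over_n, of 2], of h] by (simp add: e_def[abs_def])
  have Klim: "(\<lambda>n. K (Complex x (e n))) \<longlonglongrightarrow> of_real \<delta> * a" if x: "-h < x" "x < 0" for x
  proof -
    define g where "g n t = F (Complex t (e n))" for n t
    have inR: "Complex t (e n) \<in> R" if "t \<in> {x..x+\<delta>}" for t n using that x e[of n] by (auto simp: R_def \<delta>_def)
    have FTC: "has_bochner_integral lborel (\<lambda>t. indicator {x..x+\<delta>} t *\<^sub>R g n t) (P (Complex (x+\<delta>) (e n)) - P (Complex x (e n)))" for n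
    proof (rule has_bochner_integral_FTC_Icc[where F="\<lambda>t. P (Complex t (e n))"])
      show "x \<le> x + \<delta>" using h by (simp add: \<delta>_def)
      have c: "continuous_on {x..x+\<delta>} (\<lambda>t. Complex t (e n))" unfolding Complex_eq by (intro continuous_intros)
      show "continuous_on {x..x+\<delta>} (g n)" unfolding g_def
        by (rule continuous_on_compose2[OF holomorphic_on_imp_continuous_on[OF hol] c]) (use inR in auto)
      fix t assume "x \<le> t" "t \<le> x + \<delta>"
      then have "(P has_field_derivative g n t) (at (Complex t (e n)))" unfolding g_def by (intro Pat inR) auto
      moreover have "((\<lambda>t. Complex t (e n)) has_vector_derivative 1) (at t within {x..x+\<delta>})"
        unfolding Complex_eq by (auto intro!: derivative_eq_intros simp: has_vector_derivative_def scaleR_conv_of_real)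
      ultimately show "((\<lambda>t. P (Complex t (e n))) has_vector_derivative g n t) (at t within {x..x+\<delta>})"
        using field_vector_diff_chain_within[of "\<lambda>t. Complex t (e n)" 1 t "{x..x+\<delta>}" P "g n t"]
        by (auto simp: o_def intro: has_field_derivative_at_within)
    qed
    have "(\<lambda>n. integral\<^sup>L lborel (\<lambda>t. indicator {x..x+\<delta>} t *\<^sub>R g n t)) \<longlonglongrightarrow> integral\<^sup>L lborel (\<lambda>t. indicator {x..x+\<delta>} t *\<^sub>R a)"
    proof (rule integral_dominated_convergence[where w="\<lambda>t. indicator {x..x+\<delta>} t * M"])
      show "(\<lambda>t. indicator {x..x+\<delta>} t *\<^sub>R g n t) \<in> borel_measurable lborel" for n
        using FTC[of n] by (auto simp: has_bochner_integral_iff)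
      show "AE t in lborel. (\<lambda>n. indicator {x..x+\<delta>} t *\<^sub>R g n t) \<longlonglongrightarrow> indicator {x..x+\<delta>} t *\<^sub>R a"
        using aea
      proof (rule AE_mp, intro AE_I2 impI)
        fix t assume t: "t \<in> {-h<..<h} \<longrightarrow> good t a"
        show "(\<lambda>n. indicator {x..x+\<delta>} t *\<^sub>R g n t) \<longlonglongrightarrow> indicator {x..x+\<delta>} t *\<^sub>R a"
        proof (cases "t \<in> {x..x+\<delta>}")
          case True
          then have "t \<in> {-h<..<h}" using x by (auto simp: \<delta>_def)
          then have "good t a" using t by blast
          moreover have "filterlim e (at_right 0) sequentially"
            using elim e(1) less_imp_neq[OF e(1)] by (auto simp: filterlim_at intro!: always_eventually)
          ultimately have "(\<lambda>n. F (Complex t (e n))) \<longlonglongrightarrow> a" unfolding good_def by (rule filterlim_compose)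
          then show ?thesis using True by (simp add: g_def)
        qed simp
      qed
      show "AE t in lborel. norm (indicator {x..x+\<delta>} t *\<^sub>R g n t) \<le> indicator {x..x+\<delta>} t * M" for n
        using M[OF inR] by (intro AE_I2) (auto simp: g_def indicator_def)
      show "integrable lborel (\<lambda>t. indicator {x..x+\<delta>} t * M)"
        by (rule integrable_mult_left) (use h in \<open>auto simp: integrable_indicator_iff \<delta>_def\<close>)
    qed auto
    moreover have "integral\<^sup>L lborel (\<lambda>t. indicator {x..x+\<delta>} t *\<^sub>R g n t) = K (Complex x (e n))" for n
      using FTC[of n] by (simp add: has_bochner_integral_iff K_def Complex_eq algebra_simps)
    moreover have "integral\<^sup>L lborel (\<lambda>t. indicator {x..x+\<delta>} t *\<^sub>R a) = of_real \<delta> * a"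
      using h by (simp add: \<delta>_def scaleR_conv_of_real)
    ultimately show ?thesis by simp
  qed
  have Kbound: "norm (K z - of_real \<delta> * a) \<le> 2 * M * Im z" if z: "z \<in> R1" for z
  proof -
    have l1: "(\<lambda>n. norm (K z - K (Complex (Re z) (e n)))) \<longlonglongrightarrow> norm (K z - of_real \<delta> * a)"
      using z by (intro tendsto_intros Klim) (auto simp: R1_def)
    have l2: "(\<lambda>n. 2 * M * \<bar>Im z - e n\<bar>) \<longlonglongrightarrow> 2 * M * \<bar>Im z - 0\<bar>" by (intro tendsto_intros elim)
    have l3: "norm (K z - K (Complex (Re z) (e n))) \<le> 2 * M * \<bar>Im z - e n\<bar>" for n
    proof -
      have "Complex (Re z) (e n) \<in> R1" using z e[of n] by (auto simp: R1_def)
      from lip[OF z this] show ?thesis by (simp add: cmod_def)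
    qed
    have "norm (K z - of_real \<delta> * a) \<le> 2 * M * \<bar>Im z - 0\<bar>"
      by (rule LIMSEQ_le[OF l1 l2]) (intro exI[of _ 0] allI impI l3)
    then show ?thesis using z by (simp add: R1_def)
  qed
  define S where "S = {z. - h < Re z \<and> Re z < 0 \<and> - h < Im z \<and> Im z < h}"
  define K' where "K' z = (if Im z > 0 then K z else of_real \<delta> * a)" for z
  have oS: "open S" and cS: "convex S" unfolding S_def by (rule open_rectangle, rule convex_rectangle)
  have holK: "K' holomorphic_on R1"
  proof (rule holomorphic_transform[of K])
    show "K holomorphic_on R1" using derK unfolding holomorphic_on_def
      by (meson field_differentiable_at_within field_differentiable_def)
  qed (auto simp: K'_def R1_def)
  have holS: "K' holomorphic_on S"
  proof (rule holomorphic_on_paste_across_line[OF oS, where d=\<i> and k=0])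
    have i: "\<i> \<bullet> z = Im z" for z by (simp add: inner_complex_def)
    show "K' holomorphic_on S \<inter> {z. \<i> \<bullet> z < 0}"
    proof (rule holomorphic_transform)
      show "(\<lambda>_. of_real \<delta> * a) holomorphic_on S \<inter> {z. \<i> \<bullet> z < 0}" by (rule holomorphic_on_const)
      show "of_real \<delta> * a = K' z" if "z \<in> S \<inter> {z. \<i> \<bullet> z < 0}" for z using that by (simp add: K'_def i)
    qed
    have "S \<inter> {z. 0 < \<i> \<bullet> z} = R1" unfolding i using h by (auto simp: S_def R1_def)
    then show "K' holomorphic_on S \<inter> {z. 0 < \<i> \<bullet> z}" using holK by simp
    have "isCont K' z" if z: "z \<in> S" for z
    proof (cases "Im z" "0::real" rule: linorder_cases)
      case greater
      then have "z \<in> R1" using z by (auto simp: S_def R1_def)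
      moreover have "open R1" unfolding R1_def by (rule open_rectangle)
      ultimately show ?thesis using holK holomorphic_on_imp_continuous_on continuous_on_eq_continuous_at by blast
    next
      case less
      have "open {z. Im z < 0}" by (rule open_halfspace_Im_lt)
      moreover have "continuous_on {z. Im z < 0} K'"
        by (rule continuous_on_eq[of _ "\<lambda>_. of_real \<delta> * a"]) (auto simp: K'_def)
      ultimately show ?thesis using less continuous_on_eq_continuous_at by blast
    next
      case equal
      have "(K' \<longlongrightarrow> of_real \<delta> * a) (at z)"
      proof (rule Lim_transform_within_open[OF _ oS z, of "\<lambda>w. K' w"])
        show "(K' \<longlongrightarrow> of_real \<delta> * a) (at z)"
        proof (rule metric_LIM_I)
          fix r :: real assume "r > 0"
          define s where "s = r / (2 * \<bar>M\<bar> + 1)"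
          have s: "s > 0" using \<open>r > 0\<close> by (simp add: s_def)
          obtain d where d: "d > 0" "ball z d \<subseteq> S" using oS z openE by blast
          have "dist (K' w) (of_real \<delta> * a) < r" if w: "dist w z < min d s" for w
          proof (cases "Im w > 0")
            case True
            have "w \<in> S" using w d(2) by (auto simp: dist_commute)
            then have "w \<in> R1" using True by (auto simp: S_def R1_def)
            have "Im w \<le> norm (w - z)" using abs_Im_le_cmod[of "w - z"] equal by simp
            then have iw: "Im w < s" using w by (simp add: dist_norm)
            have "norm (K w - of_real \<delta> * a) \<le> 2 * M * Im w" by (rule Kbound[OF \<open>w \<in> R1\<close>])
            also have "\<dots> \<le> (2 * \<bar>M\<bar> + 1) * Im w" using True by (intro mult_right_mono) auto
            also have "\<dots> < (2 * \<bar>M\<bar> + 1) * s" using iw by (intro mult_strict_left_mono) auto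
            also have "\<dots> = r" by (simp add: s_def)
            finally show ?thesis using True by (simp add: K'_def dist_norm)
          next
            case False
            then show ?thesis using \<open>r > 0\<close> by (simp add: K'_def)
          qed
          then show "\<exists>s>0. \<forall>w. w \<noteq> z \<and> dist w z < s \<longrightarrow> dist (K' w) (of_real \<delta> * a) < r"
            using d s by (intro exI[of _ "min d s"]) auto
        qed
      qed auto
      then show ?thesis using equal by (simp add: isCont_def K'_def)
    qed
    then show "continuous_on S K'" by (simp add: continuous_at_imp_continuous_on)
  qed auto
  have const: "K' z = of_real \<delta> * a" if "z \<in> S" for z
  proof (rule analytic_continuation_open[of "S \<inter> {z. Im z < 0}" S K' "\<lambda>_. of_real \<delta> * a"])
    show "open S" by (rule oS)
    show "K' holomorphic_on S" by (rule holS)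
    show "z \<in> S" by (rule that)
    show "open (S \<inter> {z. Im z < 0})" by (intro open_Int oS open_halfspace_Im_lt)
    have "Complex (-h/2) (-h/2) \<in> S \<inter> {z. Im z < 0}" using h by (auto simp: S_def)
    then show "S \<inter> {z. Im z < 0} \<noteq> {}" by blast
    show "connected S" using cS by (rule convex_connected)
  qed (auto simp: K'_def)
  define z where "z = Complex (-h/2) (h/2)"
  have z: "z \<in> R1" using h by (auto simp: z_def R1_def)
  have oR1: "open R1" unfolding R1_def by (rule open_rectangle)
  have "((\<lambda>_. of_real \<delta> * a) has_field_derivative (F (z + of_real \<delta>) - F z)) (at z)"
  proof (rule has_field_derivative_transform_within_open[OF derK[OF z] oR1 z])
    show "K w = of_real \<delta> * a" if "w \<in> R1" for w using const[of w] that h by (auto simp: K'_def R1_def S_def)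
  qed
  then have "F (z + of_real \<delta>) - F z = 0" using DERIV_const DERIV_unique by blast
  then have "z + of_real \<delta> = z" using inj_onD[OF inj _ R1R(2)[OF z] R1R(1)[OF z]] by simp
  then show False using h by (simp add: \<delta>_def)
qed

section \<open>Crosscuts from univalent rectangles\<close>

lemma components_of_two_open_pieces:
  fixes U V :: "'a::topological_space set"
  assumes U: "open U" "connected U" "U \<noteq> {}" and V: "open V" "connected V" "V \<noteq> {}" and "U \<inter> V = {}"
  shows "components (U \<union> V) = {U, V}"
proof -
  have max: "X \<in> components (X \<union> Y)" if X: "open X" "connected X" "X \<noteq> {}" and Y: "open Y" "X \<inter> Y = {}" for X Y :: "'a set"
    unfolding in_components_maximal
  proof (intro conjI allI impI; (elim conjE)?)
    fix D assume D: "D \<noteq> {}" "X \<subseteq> D" "D \<subseteq> X \<union> Y" "connected D"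
    have "D \<inter> Y = {}"
    proof (rule ccontr)
      assume "D \<inter> Y \<noteq> {}"
      moreover have "D \<inter> X \<noteq> {}" using D X by blast
      moreover have "X \<inter> Y \<inter> D = {}" using Y by blast
      ultimately show False using connectedD[OF D(4) X(1) Y(1)] D(3) by blast
    qed
    then show "D = X" using D by blast
  qed (use X in auto)
  have UV: "U \<in> components (U \<union> V)" "V \<in> components (U \<union> V)"
    using max[OF U V(1)] max[OF V U(1)] assms(7) by (auto simp: Un_commute Int_commute)
  have "W \<in> {U, V}" if W: "W \<in> components (U \<union> V)" for W
  proof -
    obtain w where "w \<in> W" using in_components_nonempty[OF W] by blast
    then have "w \<in> U \<or> w \<in> V" using in_components_subset[OF W] by blast
    then show ?thesis using components_eq[OF W UV(1)] components_eq[OF W UV(2)] \<open>w \<in> W\<close> by blast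
  qed
  then show ?thesis using UV by blast
qed

text \<open>
  Through the stereographic embedding this is the statement for compact sets in Euclidean space.
\<close>

lemma connected_riemann_sphere_nest:
  fixes K :: "nat \<Rightarrow> riemann_sphere set"
  assumes K: "\<And>n. closed (K n)" "\<And>n. connected (K n)" "\<And>m n. m \<le> n \<Longrightarrow> K n \<subseteq> K m"
  shows "connected (\<Inter>n. K n)"
proof -
  have "connected (\<Inter> (range (\<lambda>n. stereo ` K n)))"
  proof (rule connected_nest)
    show "compact (stereo ` K n)" "connected (stereo ` K n)" for n
      using K by (auto intro!: compact_continuous_image connected_continuous_image continuous_on_stereo closed_riemann_sphere_imp_compact)
    show "stereo ` K n \<subseteq> stereo ` K m" if "m \<le> n" for m n using K(3)[OF that] by blast
  qed
  moreover have "\<Inter> (range (\<lambda>n. stereo ` K n)) = stereo ` (\<Inter>n. K n)"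
    using image_INT[OF inj_stereo, of UNIV K] by simp
  ultimately have c: "connected (stereo ` (\<Inter>n. K n))" by simp
  have inv: "inv stereo (stereo p) = p" for p by (rule inv_f_f[OF inj_stereo])
  have "continuous_on (range stereo) (inv stereo)"
  proof (rule continuous_on_into_sphere)
    show "continuous_on (range stereo) (\<lambda>x. stereo (inv stereo x))"
    proof (rule continuous_on_eq[of _ "\<lambda>x. x"])
      show "continuous_on (range stereo) (\<lambda>x. x)" by (intro continuous_intros)
      show "x = stereo (inv stereo x)" if "x \<in> range stereo" for x
        using f_inv_into_f[OF that] by (rule sym)
    qed
  qed
  then have "connected (inv stereo ` stereo ` (\<Inter>n. K n))"
    by (intro connected_continuous_image[OF _ c]) (rule continuous_on_subset, assumption, blast)
  then show ?thesis by (simp add: image_image inv)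
qed

lemma filterlim_scale_right: "k > 0 \<Longrightarrow> filterlim (\<lambda>t. k * t) (at_right 0) (at_right (0::real))"
proof -
  assume k: "k > 0"
  have "((\<lambda>t. k * t) \<longlongrightarrow> k * 0) (at_right 0)" by (intro tendsto_intros)
  moreover have "\<forall>\<^sub>F t in at_right 0. k * t \<in> {0<..} \<and> k * t \<noteq> 0"
    using eventually_at_right_less[of "0::real"] by eventually_elim (use k in auto)
  ultimately show ?thesis by (simp add: filterlim_at)
qed

lemma filterlim_reflect_left: "k > 0 \<Longrightarrow> filterlim (\<lambda>t. k * (b - t)) (at_right 0) (at_left (b::real))"
proof -
  assume k: "k > 0"
  have "((\<lambda>t. k * (b - t)) \<longlongrightarrow> k * (b - b)) (at_left b)" by (intro tendsto_intros)
  moreover have "\<forall>\<^sub>F t in at_left b. k * (b - t) \<in> {0<..} \<and> k * (b - t) \<noteq> 0"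
    unfolding eventually_at_left_field by (rule exI[of _ "b - 1"]) (use k in auto)
  ultimately show ?thesis by (simp add: filterlim_at)
qed

text \<open>
  Runs through the left, the top and the right side of the rectangle of height \<open>k\<close> over the interval from \<open>x1\<close> to \<open>x2\<close> while
  \<open>t\<close> runs from 0 to 3.
\<close>

definition tent :: "real \<Rightarrow> real \<Rightarrow> real \<Rightarrow> real \<Rightarrow> complex" where
  "tent x1 x2 k t = Complex (x1 + (x2 - x1) * max 0 (min 1 (t - 1))) (k * min 1 (min t (3 - t)))"

lemma tent_cases:
  "t \<le> 1 \<Longrightarrow> tent x1 x2 k t = Complex x1 (k * t)"
  "1 \<le> t \<Longrightarrow> t \<le> 2 \<Longrightarrow> tent x1 x2 k t = Complex (x1 + (x2 - x1) * (t - 1)) k"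
  "2 \<le> t \<Longrightarrow> tent x1 x2 k t = Complex x2 (k * (3 - t))"
  by (auto simp: tent_def min_def max_def)

lemma continuous_on_tent: "continuous_on A (tent x1 x2 k)"
  unfolding tent_def[abs_def] Complex_eq by (intro continuous_intros)

lemma inj_on_tent:
  assumes "x1 < x2" "k > 0" shows "inj_on (tent x1 x2 k) {0..3}"
proof (rule inj_onI)
  have lr: "s = t" if st: "s \<le> t" "0 \<le> s" "t \<le> 3" "tent x1 x2 k s = tent x1 x2 k t" for s t
  proof -
    note e = st(4)
    have k0: "k \<noteq> 0" and x0: "x2 - x1 \<noteq> 0" using assms by auto
    consider "t \<le> 1" | "s \<le> 1" "1 < t" "t \<le> 2" | "s \<le> 1" "2 < t" | "1 < s" "t \<le> 2" | "1 < s" "s \<le> 2" "2 < t" | "2 < s" using st by linarith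
    then show ?thesis
    proof cases
      case 1
      then have "s \<le> 1" using st by simp
      from e[unfolded tent_cases(1)[OF 1] tent_cases(1)[OF this]] show ?thesis using k0 by simp
    next
      case 2
      then have "1 \<le> t" by simp
      from e[unfolded tent_cases(1)[OF 2(1)] tent_cases(2)[OF this 2(3)]] show ?thesis using x0 2 by simp
    next
      case 3
      then have "2 \<le> t" by simp
      from e[unfolded tent_cases(1)[OF 3(1)] tent_cases(3)[OF this]] show ?thesis using x0 by simp
    next
      case 4
      then have "1 \<le> s" "s \<le> 2" "1 \<le> t" using st by auto
      from e[unfolded tent_cases(2)[OF this(1,2)] tent_cases(2)[OF this(3) 4(2)]] show ?thesis using x0 by simp
    next
      case 5
      then have "1 \<le> s" "2 \<le> t" by auto
      from e[unfolded tent_cases(2)[OF this(1) 5(2)] tent_cases(3)[OF this(2)]] have "k * 1 = k * (3 - t)" by simp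
      then have "1 = 3 - t" using k0 by (simp only: mult_cancel_left) simp
      then show ?thesis using 5 by simp
    next
      case 6
      then have "2 \<le> s" "2 \<le> t" using st by auto
      from e[unfolded tent_cases(3)[OF this(1)] tent_cases(3)[OF this(2)]] show ?thesis using k0 by simp
    qed
  qed
  fix s t assume "s \<in> {0..3}" "t \<in> {0..3}" "tent x1 x2 k s = tent x1 x2 k t"
  then show "s = t" using lr[of s t] lr[of t s] by (cases "s \<le> t") auto
qed

lemma tent_image:
  assumes "x1 < x2" "k > 0"
  shows "tent x1 x2 k ` {0<..<3} = {z. x1 \<le> Re z \<and> Re z \<le> x2 \<and> 0 < Im z \<and> Im z \<le> k \<and> (Re z = x1 \<or> Re z = x2 \<or> Im z = k)}" (is "_ = ?T")
proof (intro set_eqI iffI)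
  fix z assume "z \<in> tent x1 x2 k ` {0<..<3}"
  then obtain t where t: "0 < t" "t < 3" "z = tent x1 x2 k t" by auto
  consider "t \<le> 1" | "1 \<le> t" "t \<le> 2" | "2 \<le> t" by linarith
  then show "z \<in> ?T"
  proof cases
    case 1
    then show ?thesis using t tent_cases(1)[OF 1, of x1 x2 k] assms by (auto simp: mult_left_le)
  next
    case 2
    have "(x2 - x1) * (t - 1) \<le> (x2 - x1) * 1" using 2 assms by (intro mult_left_mono) auto
    then have "x1 + (x2 - x1) * (t - 1) \<le> x2" unfolding mult_1_right by linarith
    moreover have "0 \<le> (x2 - x1) * (t - 1)" using 2 assms by simp
    ultimately show ?thesis unfolding t(3) tent_cases(2)[OF 2, of x1 x2 k] using assms(2) by simp
  next
    case 3
    have "k * (3 - t) \<le> k * 1" using 3 assms by (intro mult_left_mono) auto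
    then show ?thesis using t tent_cases(3)[OF 3, of x1 x2 k] assms by auto
  qed
next
  fix z assume z: "z \<in> ?T"
  then consider "Re z = x1" | "Im z = k" | "Re z = x2" by auto
  then show "z \<in> tent x1 x2 k ` {0<..<3}"
  proof cases
    case 1
    have "z = tent x1 x2 k (Im z / k)" using tent_cases(1)[of "Im z / k" x1 x2 k] 1 z assms by (simp add: complex_eq_iff)
    then show ?thesis using z assms by (intro image_eqI[of _ _ "Im z / k"]) (auto simp: field_simps)
  next
    case 2
    define t where "t = 1 + (Re z - x1) / (x2 - x1)"
    have t: "1 \<le> t" "t \<le> 2" using z assms by (auto simp: t_def)
    have "z = tent x1 x2 k t" using tent_cases(2)[OF t, of x1 x2 k] 2 assms by (simp add: complex_eq_iff t_def)
    then show ?thesis using t by (intro image_eqI[of _ _ t]) auto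
  next
    case 3
    define t where "t = 3 - Im z / k"
    have t: "2 \<le> t" "t < 3" using z assms by (auto simp: t_def field_simps)
    have "z = tent x1 x2 k t" using tent_cases(3)[OF t(1), of x1 x2 k] 3 assms by (simp add: complex_eq_iff t_def)
    then show ?thesis using t by (intro image_eqI[of _ _ t]) auto
  qed
qed

text \<open>
  The crosscut is the image of three sides of a smaller rectangle that stands on the real axis. The image \<open>U\<close> of its
  interior is one component of the complement, simply connected because \<open>\<phi>\<close> is a homeomorphism there; the other one
  contains the image of the outer collar \<open>Y\<close>. The hypothesis \<open>bdry\<close> keeps the boundary values on the real axis out of
  \<open>\<Omega>\<close>, so that the end points are boundary points, and the cluster set along the bottom side connects them within the
  frontier.
\<close>

lemma crosscut_from_rectangle:
  fixes \<phi> :: "complex \<Rightarrow> riemann_sphere" and h x1 x2 :: real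
  defines "R \<equiv> {z. - h < Re z \<and> Re z < h \<and> 0 < Im z \<and> Im z < h}"
  assumes \<Omega>: "open \<Omega>" "connected \<Omega>" and \<phi>: "continuous_on R \<phi>" "inj_on \<phi> R" "\<phi> ` R \<subseteq> \<Omega>"
    and op: "\<And>W. open W \<Longrightarrow> W \<subseteq> R \<Longrightarrow> open (\<phi> ` W)"
    and bdry: "\<And>z x p. (\<And>n. z n \<in> R) \<Longrightarrow> z \<longlonglongrightarrow> of_real x \<Longrightarrow> - h < x \<Longrightarrow> x < h \<Longrightarrow> (\<lambda>n. \<phi> (z n)) \<longlonglongrightarrow> p \<Longrightarrow> p \<notin> \<Omega>"
    and x: "- h < x1" "x1 < x2" "x2 < h" and a: "a1 \<noteq> a2"
    and lim: "((\<lambda>y. \<phi> (Complex x1 y)) \<longlongrightarrow> a1) (at_right 0)" "((\<lambda>y. \<phi> (Complex x2 y)) \<longlongrightarrow> a2) (at_right 0)"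
  shows "\<exists>C. true_crosscut \<Omega> C"
proof -
  define k where "k = h / 2"
  have h: "h > 0" using x by simp
  have k: "k > 0" "k < h" using h by (auto simp: k_def)
  have oR: "open R" unfolding R_def by (rule open_rectangle)
  define T where "T = tent x1 x2 k ` {0<..<3}"
  have Teq: "T = {z. x1 \<le> Re z \<and> Re z \<le> x2 \<and> 0 < Im z \<and> Im z \<le> k \<and> (Re z = x1 \<or> Re z = x2 \<or> Im z = k)}"
    unfolding T_def by (rule tent_image[OF x(2) k(1)])
  define R' where "R' = {z. x1 < Re z \<and> Re z < x2 \<and> 0 < Im z \<and> Im z < k}"
  define Y where "Y = {z. - h < Re z \<and> Re z < x1 \<and> 0 < Im z \<and> Im z < h} \<union> {z. - h < Re z \<and> Re z < h \<and> k < Im z \<and> Im z < h}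
    \<union> {z. x2 < Re z \<and> Re z < h \<and> 0 < Im z \<and> Im z < h}"
  have TR: "T \<subseteq> R" using x k by (auto simp: Teq R_def)
  have R'R: "R' \<subseteq> R" using x k by (auto simp: R'_def R_def)
  have YR: "Y \<subseteq> R" using x k by (auto simp: Y_def R_def)
  have R_dec: "R = R' \<union> T \<union> Y"
  proof
    show "R \<subseteq> R' \<union> T \<union> Y"
    proof
      fix z assume z: "z \<in> R"
      show "z \<in> R' \<union> T \<union> Y"
      proof (cases "z \<in> Y")
        case False
        then have "x1 \<le> Re z" "Re z \<le> x2" "Im z \<le> k" "0 < Im z" using z by (auto simp: Y_def R_def)
        then show ?thesis by (auto simp: R'_def Teq)
      qed auto
    qed
  qed (use TR R'R YR in blast)
  have disj: "R' \<inter> T = {}" "R' \<inter> Y = {}" "T \<inter> Y = {}" using x by (auto simp: R'_def Teq Y_def)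
  have oR': "open R'" and cR': "connected R'" and vR': "convex R'"
    unfolding R'_def by (rule open_rectangle, rule convex_connected, rule convex_rectangle, rule convex_rectangle)
  have cY: "connected Y" unfolding Y_def
  proof (intro connected_Un convex_connected convex_rectangle)
    have "Complex ((x1 - h) / 2) ((k + h) / 2) \<in> {z. - h < Re z \<and> Re z < x1 \<and> 0 < Im z \<and> Im z < h} \<inter> {z. - h < Re z \<and> Re z < h \<and> k < Im z \<and> Im z < h}"
      using x k by auto
    then show "{z. - h < Re z \<and> Re z < x1 \<and> 0 < Im z \<and> Im z < h} \<inter> {z. - h < Re z \<and> Re z < h \<and> k < Im z \<and> Im z < h} \<noteq> {}" by blast
    have "Complex ((x2 + h) / 2) ((k + h) / 2) \<in> ({z. - h < Re z \<and> Re z < x1 \<and> 0 < Im z \<and> Im z < h} \<union> {z. - h < Re z \<and> Re z < h \<and> k < Im z \<and> Im z < h}) \<inter> {z. x2 < Re z \<and> Re z < h \<and> 0 < Im z \<and> Im z < h}"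
      using x k by auto
    then show "({z. - h < Re z \<and> Re z < x1 \<and> 0 < Im z \<and> Im z < h} \<union> {z. - h < Re z \<and> Re z < h \<and> k < Im z \<and> Im z < h}) \<inter> {z. x2 < Re z \<and> Re z < h \<and> 0 < Im z \<and> Im z < h} \<noteq> {}" by blast
  qed
  define C U V where "C = \<phi> ` T" and "U = \<phi> ` R'" and "V = \<Omega> - C - U"
  have imdisj: "\<phi> ` A \<inter> \<phi> ` B = {}" if "A \<subseteq> R" "B \<subseteq> R" "A \<inter> B = {}" for A B
    using inj_on_image_Int[OF \<phi>(2) that(1,2)] that(3) by simp
  have UC: "U \<inter> C = {}" unfolding U_def C_def by (rule imdisj[OF R'R TR disj(1)])
  have CO: "C \<subseteq> \<Omega>" and UO: "U \<subseteq> \<Omega>" using \<phi>(3) TR R'R by (auto simp: C_def U_def)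
  have YV: "\<phi> ` Y \<subseteq> V"
  proof -
    have "\<phi> ` Y \<inter> C = {}" unfolding C_def by (rule imdisj[OF YR TR]) (use disj(3) in blast)
    moreover have "\<phi> ` Y \<inter> U = {}" unfolding U_def by (rule imdisj[OF YR R'R]) (use disj(2) in blast)
    moreover have "\<phi> ` Y \<subseteq> \<Omega>" using image_mono[OF YR, of \<phi>] \<phi>(3) by (rule subset_trans)
    ultimately show ?thesis unfolding V_def by blast
  qed
  have contA: "continuous_on A \<phi>" if "A \<subseteq> R" for A using continuous_on_subset[OF \<phi>(1) that] .
  have oU: "open U" unfolding U_def by (rule op[OF oR' R'R])
  have cU: "connected U" unfolding U_def by (rule connected_continuous_image[OF contA[OF R'R] cR'])
  have mid: "Complex ((x1 + x2) / 2) (k / 2) \<in> R'" using x k by (auto simp: R'_def)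
  have Une: "U \<noteq> {}" using mid by (auto simp: U_def)
  \<comment> \<open>A limit point of \<open>U\<close> comes from a point of the closed inner rectangle; the bottom side contributes
    only points outside \<open>\<Omega>\<close>.\<close>
  have seqlim: "p \<notin> \<Omega> \<or> p \<in> \<phi> ` (R' \<union> T)"
    if z: "\<And>n. z n \<in> R'" and l: "(\<lambda>n. \<phi> (z n)) \<longlonglongrightarrow> p" for z p
  proof -
    have "compact (cbox (Complex x1 0) (Complex x2 k))" by (rule compact_cbox)
    moreover have "z n \<in> cbox (Complex x1 0) (Complex x2 k)" for n
      using z[of n] by (auto simp: R'_def in_cbox_complex_iff)
    ultimately obtain z0 r where r: "z0 \<in> cbox (Complex x1 0) (Complex x2 k)" "strict_mono (r::nat\<Rightarrow>nat)" "(z \<circ> r) \<longlonglongrightarrow> z0"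
      unfolding compact_def by (elim allE[of _ z]) blast
    have zr: "(\<lambda>n. z (r n)) \<longlonglongrightarrow> z0" using r(3) by (simp add: o_def)
    have lr: "(\<lambda>n. \<phi> (z (r n))) \<longlonglongrightarrow> p" using LIMSEQ_subseq_LIMSEQ[OF l r(2)] by (simp add: o_def)
    have b: "x1 \<le> Re z0" "Re z0 \<le> x2" "0 \<le> Im z0" "Im z0 \<le> k" using r(1) by (auto simp: in_cbox_complex_iff)
    show ?thesis
    proof (cases "Im z0 = 0")
      case True
      then have "z0 = of_real (Re z0)" by (simp add: complex_eq_iff)
      then have "p \<notin> \<Omega>" 
      proof (intro bdry[OF _ _ _ _ lr, of "Re z0"])
        show "z (r n) \<in> R" for n using z R'R by blast
        show "(\<lambda>n. z (r n)) \<longlonglongrightarrow> of_real (Re z0)" using zr \<open>z0 = of_real (Re z0)\<close> by (rule back_subst)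
      qed (use b x in auto)
      then show ?thesis by blast
    next
      case False
      then have z0: "z0 \<in> R' \<union> T" using b by (auto simp: R'_def Teq)
      then have z0R: "z0 \<in> R" using TR R'R by blast
      have "(\<lambda>n. \<phi> (z (r n))) \<longlonglongrightarrow> \<phi> z0"
        by (rule continuous_on_tendsto_compose[OF \<phi>(1) zr z0R]) (use z R'R in \<open>auto intro!: always_eventually\<close>)
      then have "p = \<phi> z0" using lr LIMSEQ_unique by blast
      then show ?thesis using z0 by blast
    qed
  qed
  have clU: "closure U \<inter> \<Omega> \<subseteq> U \<union> C"
  proof
    fix p assume p: "p \<in> closure U \<inter> \<Omega>"
    then have "p \<in> closure U" by blast
    then obtain u where u: "\<And>n. u n \<in> U" "u \<longlonglongrightarrow> p" unfolding closure_sequential by blast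
    have "\<exists>z. z \<in> R' \<and> u n = \<phi> z" for n using u(1)[of n] by (auto simp: U_def)
    then obtain z where z: "\<And>n. z n \<in> R'" "\<And>n. u n = \<phi> (z n)" by metis
    have "(\<lambda>n. \<phi> (z n)) \<longlonglongrightarrow> p" unfolding z(2)[symmetric] by (rule u(2))
    from seqlim[OF z(1) this] show "p \<in> U \<union> C" using p by (auto simp: U_def C_def)
  qed
  \<comment> \<open>The path \<open>\<psi>\<close> completes the arc by its two limits. It is injective on a compact interval, hence a
    homeomorphism onto its image.\<close>
  define \<psi> where "\<psi> t = (if t = 0 then a1 else if t = 3 then a2 else \<phi> (tent x1 x2 k t))" for t
  have tR: "tent x1 x2 k t \<in> R" if "0 < t" "t < 3" for t using TR that by (auto simp: T_def)
  have cont\<psi>: "continuous_on {0..3} \<psi>"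
  proof (rule continuous_on_IccI)
    have at0: "((\<lambda>t. \<phi> (Complex x1 (k * t))) \<longlongrightarrow> a1) (at_right 0)"
    proof (rule filterlim_compose[OF lim(1)])
      show "filterlim (\<lambda>t. k * t) (at_right 0) (at_right (0::real))"
        by (rule filterlim_scale_right[OF k(1)])
    qed
    have at3: "((\<lambda>t. \<phi> (Complex x2 (k * (3 - t)))) \<longlongrightarrow> a2) (at_left 3)"
    proof (rule filterlim_compose[OF lim(2)])
      show "filterlim (\<lambda>t. k * (3 - t)) (at_right 0) (at_left (3::real))"
        by (rule filterlim_reflect_left[OF k(1)])
    qed
    show "(\<psi> \<longlongrightarrow> \<psi> 0) (at_right 0)"
    proof (rule Lim_transform_eventually)
      show "((\<lambda>t. \<phi> (Complex x1 (k * t))) \<longlongrightarrow> \<psi> 0) (at_right 0)" using at0 by (simp add: \<psi>_def)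
      show "\<forall>\<^sub>F t in at_right 0. \<phi> (Complex x1 (k * t)) = \<psi> t"
        unfolding eventually_at_right_field by (rule exI[of _ 1]) (auto simp: \<psi>_def tent_cases(1))
    qed
    show "(\<psi> \<longlongrightarrow> \<psi> 3) (at_left 3)"
    proof (rule Lim_transform_eventually)
      show "((\<lambda>t. \<phi> (Complex x2 (k * (3 - t)))) \<longlongrightarrow> \<psi> 3) (at_left 3)" using at3 by (simp add: \<psi>_def)
      show "\<forall>\<^sub>F t in at_left 3. \<phi> (Complex x2 (k * (3 - t))) = \<psi> t"
        unfolding eventually_at_left_field by (rule exI[of _ 2]) (auto simp: \<psi>_def tent_cases(3))
    qed
    show "(\<psi> \<longlongrightarrow> \<psi> t) (at t)" if t: "0 < t" "t < 3" for t
    proof (rule Lim_transform_within_open[OF _ open_greaterThanLessThan[of 0 3]])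
      have "continuous_on {0<..<3} (\<lambda>t. \<phi> (tent x1 x2 k t))"
        by (rule continuous_on_compose2[OF \<phi>(1) continuous_on_tent]) (use tR in auto)
      then show "((\<lambda>t. \<phi> (tent x1 x2 k t)) \<longlongrightarrow> \<psi> t) (at t)"
        using t by (simp add: continuous_on_eq_continuous_at isCont_def \<psi>_def)
    qed (use t in \<open>auto simp: \<psi>_def\<close>)
  qed simp
  define t where "t n = 1 / real (n + 2)" for n
  have t: "0 < t n" "t n < 1" for n by (auto simp: t_def)
  have tl: "t \<longlonglongrightarrow> 0" using LIMSEQ_ignore_initial_segment[OF lim_1_over_n, of 2] by (simp add: t_def[abs_def])
  have tfl: "filterlim t (at_right 0) sequentially"
    using tl t(1) less_imp_neq[OF t(1)] by (auto simp: filterlim_at intro!: always_eventually)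
  have aO: "aj \<notin> \<Omega>" and acl: "aj \<in> closure (\<phi> ` {z. x1 < Re z \<and> Re z < x2 \<and> 0 < Im z \<and> Im z < s})"
    if aj: "(xj, aj) \<in> {(x1, a1), (x2, a2)}" and s: "0 < s" "s \<le> k" for xj aj s
  proof -
    have xj: "-h < xj" "xj < h" "x1 \<le> xj" "xj \<le> x2" using aj x by auto
    have lj: "((\<lambda>y. \<phi> (Complex xj y)) \<longlongrightarrow> aj) (at_right 0)" using aj lim by auto
    define v where "v n = Complex xj (s * t n)" for n
    have vR: "v n \<in> R" for n
    proof -
      have "s * t n < k * 1" using s t[of n] by (intro mult_le_less_imp_less) auto
      then show ?thesis using xj s t[of n] k by (auto simp: v_def R_def)
    qed
    have "filterlim (\<lambda>n. s * t n) (at_right 0) sequentially"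
    proof (rule filterlim_compose[OF _ tfl])
      show "filterlim (\<lambda>t. s * t) (at_right 0) (at_right (0::real))" by (rule filterlim_scale_right[OF s(1)])
    qed
    then have lv: "(\<lambda>n. \<phi> (v n)) \<longlonglongrightarrow> aj" unfolding v_def by (rule filterlim_compose[OF lj])
    have "(\<lambda>n. Complex xj (s * t n)) \<longlonglongrightarrow> Complex xj (s * 0)"
      by (intro tendsto_intros tl)
    then have "v \<longlonglongrightarrow> of_real xj" by (simp add: v_def[abs_def] complex_of_real_def)
    then show "aj \<notin> \<Omega>" using bdry[OF vR _ xj(1,2) lv] by blast
    define Rs where "Rs = {z. x1 < Re z \<and> Re z < x2 \<and> 0 < Im z \<and> Im z < s}"
    have "\<phi> (v n) \<in> closure (\<phi> ` Rs)" for n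
    proof -
      define w where "w m = v n + of_real (((x1 + x2) / 2 - xj) * t m)" for m
      have wRs: "w m \<in> Rs" for m
      proof -
        have "s * t n < s * 1" using s(1) t[of n] by (intro mult_strict_left_mono) auto
        moreover have "x1 < xj + ((x1 + x2) / 2 - xj) * t m \<and> xj + ((x1 + x2) / 2 - xj) * t m < x2"
        proof -
          have e: "xj + ((x1 + x2) / 2 - xj) * t m = xj * (1 - t m) + (x1 + x2) / 2 * t m" by (simp add: algebra_simps)
          have "x1 * (1 - t m) + x1 * t m < xj * (1 - t m) + (x1 + x2) / 2 * t m"
            using xj t[of m] x(2) by (intro add_le_less_mono mult_right_mono mult_strict_right_mono) auto
          moreover have "xj * (1 - t m) + (x1 + x2) / 2 * t m < x2 * (1 - t m) + x2 * t m"
            using xj t[of m] x(2) by (intro add_le_less_mono mult_right_mono mult_strict_right_mono) auto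
          ultimately show ?thesis unfolding e by (simp add: algebra_simps)
        qed
        ultimately show ?thesis using s t[of n] by (simp add: w_def v_def Rs_def)
      qed
      have "(\<lambda>m. v n + of_real (((x1 + x2) / 2 - xj) * t m)) \<longlonglongrightarrow> v n + of_real (((x1 + x2) / 2 - xj) * 0)"
        by (intro tendsto_intros tl)
      then have wl: "w \<longlonglongrightarrow> v n" by (simp add: w_def[abs_def])
      have RsR: "Rs \<subseteq> R" using x s k by (auto simp: Rs_def R_def)
      have "(\<lambda>m. \<phi> (w m)) \<longlonglongrightarrow> \<phi> (v n)"
        by (rule continuous_on_tendsto_compose[OF \<phi>(1) wl vR]) (use wRs RsR in \<open>auto intro!: always_eventually\<close>)
      then show ?thesis unfolding closure_sequential using wRs by (intro exI[of _ "\<lambda>m. \<phi> (w m)"]) auto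
    qed
    then show "aj \<in> closure (\<phi> ` {z. x1 < Re z \<and> Re z < x2 \<and> 0 < Im z \<and> Im z < s})"
      using closed_sequentially[OF closed_closure _ lv] unfolding Rs_def by blast
  qed
  have aO12: "a1 \<notin> \<Omega>" "a2 \<notin> \<Omega>" using aO[of x1 a1 k] aO[of x2 a2 k] k by auto
  have \<psi>img: "\<psi> ` {0<..<3} = C" unfolding C_def T_def image_image by (intro image_cong) (auto simp: \<psi>_def)
  have inj\<psi>: "inj_on \<psi> {0..3}"
  proof (rule inj_onI)
    have in\<Omega>: "\<psi> u \<in> \<Omega>" if "u \<in> {0<..<3}" for u using that \<psi>img CO by blast
    have e: "\<psi> 0 = a1" "\<psi> 3 = a2" by (auto simp: \<psi>_def)
    have ends: "u = 0 \<or> u = 3 \<or> u \<in> {0<..<3}" if "u \<in> {0..3}" for u :: real using that by auto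
    fix u v assume uv: "u \<in> {0..3}" "v \<in> {0..3}" "\<psi> u = \<psi> v"
    show "u = v"
    proof (cases "u \<in> {0<..<3} \<and> v \<in> {0<..<3}")
      case True
      then have "\<phi> (tent x1 x2 k u) = \<phi> (tent x1 x2 k v)" using uv(3) by (auto simp: \<psi>_def)
      then have "tent x1 x2 k u = tent x1 x2 k v" using inj_onD[OF \<phi>(2)] tR True by auto
      then show ?thesis using inj_onD[OF inj_on_tent[OF x(2) k(1)]] uv by auto
    next
      case False
      then show ?thesis using ends[OF uv(1)] ends[OF uv(2)] in\<Omega>[of u] in\<Omega>[of v] e aO12 a uv(3) by metis
    qed
  qed
  have I: "{0..3} = {0<..<3} \<union> {0, 3::real}" by auto
  have \<psi>all: "\<psi> ` {0..3} = C \<union> {a1, a2}" unfolding I image_Un \<psi>img by (simp add: \<psi>_def insert_commute)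
  have clC: "closure C = C \<union> {a1, a2}"
  proof
    have "closed (C \<union> {a1, a2})" unfolding \<psi>all[symmetric]
      by (intro compact_imp_closed compact_continuous_image cont\<psi>) simp
    then show "closure C \<subseteq> C \<union> {a1, a2}" by (intro closure_minimal) auto
    have "\<psi> ` closure {0<..<3} \<subseteq> closure (\<psi> ` {0<..<3})"
    proof (rule image_closure_subset)
      show "\<psi> ` {0<..<3} \<subseteq> closure (\<psi> ` {0<..<3})" by (rule closure_subset)
    qed (use cont\<psi> in auto)
    moreover have "closure {0<..<3::real} = {0..3}" by simp
    ultimately show "C \<union> {a1, a2} \<subseteq> closure C" unfolding \<psi>all[symmetric] \<psi>img by (simp only:)
  qed
  have arc: "open_jordan_arc C"
  proof -
    obtain g where g: "homeomorphism {0..3} (C \<union> {a1, a2}) \<psi> g"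
      using homeomorphism_compact[OF _ cont\<psi> \<psi>all inj\<psi>] by auto
    have "homeomorphism {0<..<3} C \<psi> g"
      by (rule homeomorphism_of_subsets[OF g]) (use \<psi>img in auto)
    then have "{0<..<3::real} homeomorphic C" unfolding homeomorphic_def by blast
    moreover have "{0<..<1::real} homeomorphic {0<..<3::real}"
      using homeomorphic_open_interval_UNIV[of 0 1] homeomorphic_open_interval_UNIV[of 0 3] homeomorphic_sym homeomorphic_trans by (metis zero_less_numeral zero_less_one)
    ultimately show ?thesis unfolding open_jordan_arc_def using homeomorphic_sym homeomorphic_trans by blast
  qed
  \<comment> \<open>The second component is the exterior of \<open>U\<close> in \<open>\<Omega>\<close>. A relatively clopen part of it that misses
    \<open>\<phi> ` Y\<close> would be clopen in \<open>\<Omega>\<close> as well, which makes it connected.\<close>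
  have clUO: "\<Omega> - closure U = V"
  proof -
    have "C \<subseteq> closure U"
    proof -
      have "T \<subseteq> closure R'"
      proof
        fix z assume z: "z \<in> T"
        have "z \<in> cbox (Complex x1 0) (Complex x2 k)" using z by (auto simp: Teq in_cbox_complex_iff)
        moreover have "R' = box (Complex x1 0) (Complex x2 k)" by (auto simp: R'_def in_box_complex_iff)
        moreover have "box (Complex x1 0) (Complex x2 k) \<noteq> {}" using mid \<open>R' = box (Complex x1 0) (Complex x2 k)\<close> by blast
        ultimately show "z \<in> closure R'" by (simp add: closure_box)
      qed
      have "\<phi> z \<in> closure U" if z: "z \<in> T" for z
      proof -
        have "z \<in> closure R'" using z \<open>T \<subseteq> closure R'\<close> by blast
        then obtain w where w: "\<And>n. w n \<in> R'" "w \<longlonglongrightarrow> z" unfolding closure_sequential by blast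
        have "(\<lambda>n. \<phi> (w n)) \<longlonglongrightarrow> \<phi> z"
          by (rule continuous_on_tendsto_compose[OF \<phi>(1) w(2)]) (use z TR w(1) R'R in \<open>auto intro!: always_eventually\<close>)
        then show ?thesis unfolding closure_sequential U_def using w(1) by (intro exI[of _ "\<lambda>n. \<phi> (w n)"]) auto
      qed
      then show ?thesis by (auto simp: C_def)
    qed
    then show ?thesis using clU closure_subset[of U] by (auto simp: V_def)
  qed
  have oV: "open V" unfolding clUO[symmetric] using \<Omega>(1) by (intro open_Diff) auto
  have "Complex 0 ((k + h) / 2) \<in> Y" using k h by (auto simp: Y_def)
  then have Yne: "\<phi> ` Y \<noteq> {}" by blast
  then have Vne: "V \<noteq> {}" using YV by blast
  have cpY: "connected (\<phi> ` Y)" by (rule connected_continuous_image[OF contA[OF YR] cY])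
  have cV: "connected V"
  proof (rule connectedI)
    fix A B :: "riemann_sphere set" assume AB: "open A" "open B" "A \<inter> V \<noteq> {}" "B \<inter> V \<noteq> {}" "A \<inter> B \<inter> V = {}" "V \<subseteq> A \<union> B"
    have contra: False if AB: "open A" "open B" "A \<inter> V \<noteq> {}" "B \<inter> V \<noteq> {}" "A \<inter> B \<inter> V = {}" "V \<subseteq> A \<union> B" "\<phi> ` Y \<inter> B = {}"
      for A B :: "riemann_sphere set"
    proof -
      have "open (A \<inter> V \<union> \<phi> ` R)" using AB(1) oV op[OF oR] by auto
      moreover have "open (B \<inter> V)" using AB(2) oV by blast
      moreover have "\<phi> ` R = U \<union> C \<union> \<phi> ` Y" unfolding R_dec U_def C_def by blast
      then have "\<Omega> \<subseteq> (A \<inter> V \<union> \<phi> ` R) \<union> (B \<inter> V)" "(A \<inter> V \<union> \<phi> ` R) \<inter> (B \<inter> V) \<inter> \<Omega> = {}"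
        using AB(5-7) by (auto simp: V_def)
      moreover have "(A \<inter> V \<union> \<phi> ` R) \<inter> \<Omega> \<noteq> {}" using AB(3) by (auto simp: V_def)
      moreover have "(B \<inter> V) \<inter> \<Omega> \<noteq> {}" using AB(4) by (auto simp: V_def)
      ultimately show False using connectedD[OF \<Omega>(2)] by blast
    qed
    have "\<phi> ` Y \<inter> A = {} \<or> \<phi> ` Y \<inter> B = {}"
    proof -
      have "A \<inter> B \<inter> \<phi> ` Y = {}" "\<phi> ` Y \<subseteq> A \<union> B" using AB(5,6) YV by blast+
      from connectedD[OF cpY AB(1,2) this] show ?thesis by blast
    qed
    then show False
    proof
      assume "\<phi> ` Y \<inter> B = {}" then show False using contra[OF AB] by blast
    next
      assume "\<phi> ` Y \<inter> A = {}"
      then show False using contra[OF AB(2,1,4,3)] AB(5,6) by blast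
    qed
  qed
  have OC: "\<Omega> - C = U \<union> V" using UC UO by (auto simp: V_def)
  have comps: "components (\<Omega> - C) = {U, V}" unfolding OC
    by (rule components_of_two_open_pieces[OF oU cU Une oV cV Vne]) (auto simp: V_def)
  have "U \<noteq> V" using Une by (auto simp: V_def)
  then have card: "card (components (\<Omega> - C)) = 2" unfolding comps by simp
  have scU: "simply_connected U"
  proof -
    define g where "g = inv_into R' \<phi>"
    have injR': "inj_on \<phi> R'" using \<phi>(2) R'R inj_on_subset by blast
    have "homeomorphism R' U \<phi> g"
    proof (rule homeomorphismI)
      show "continuous_on R' \<phi>" by (rule contA[OF R'R])
      show "continuous_on U g"
        unfolding continuous_on_open_vimage[OF oU]
      proof (intro allI impI)
        fix B :: "complex set" assume "open B"
        have "g -` B \<inter> U = \<phi> ` (B \<inter> R')"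
          using injR' by (auto simp: g_def U_def)
        then show "open (g -` B \<inter> U)" using op[of "B \<inter> R'"] \<open>open B\<close> oR' R'R by auto
      qed
    qed (use injR' in \<open>auto simp: g_def U_def\<close>)
    then have "R' homeomorphic U" unfolding homeomorphic_def by blast
    moreover have "simply_connected R'" using vR' by (rule convex_imp_simply_connected)
    ultimately show ?thesis by (rule homeomorphic_simply_connected)
  qed
  \<comment> \<open>The cluster set of \<open>\<phi>\<close> along the bottom side is a nested intersection of connected compact sets; it is
    disjoint from \<open>\<Omega>\<close> and contains both end points.\<close>
  define K where "K n = closure (\<phi> ` {z. x1 < Re z \<and> Re z < x2 \<and> 0 < Im z \<and> Im z < k * t n})" for n
  define \<Sigma>0 where "\<Sigma>0 = (\<Inter>n. K n)"
  have kt: "0 < k * t n" "k * t n \<le> k" for n using k(1) t[of n] by (auto simp: mult_left_le)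
  have c\<Sigma>: "connected \<Sigma>0" unfolding \<Sigma>0_def
  proof (rule connected_riemann_sphere_nest)
    show "closed (K n)" for n by (simp add: K_def)
    show "connected (K n)" for n unfolding K_def
    proof (intro connected_imp_connected_closure connected_continuous_image convex_connected convex_rectangle contA)
      show "{z. x1 < Re z \<and> Re z < x2 \<and> 0 < Im z \<and> Im z < k * t n} \<subseteq> R"
        using order.strict_trans1[OF kt(2)[of n] k(2)] x by (auto simp: R_def)
    qed
    show "K n \<subseteq> K m" if "m \<le> n" for m n
    proof -
      have "k * t n \<le> k * t m" using that k(1) by (auto simp: t_def divide_simps)
      then show ?thesis unfolding K_def by (intro closure_mono image_mono) auto
    qed
  qed
  have a\<Sigma>: "a1 \<in> \<Sigma>0" "a2 \<in> \<Sigma>0" unfolding \<Sigma>0_def K_def using acl[of x1 a1] acl[of x2 a2] kt by auto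
  have \<Sigma>fr: "\<Sigma>0 \<subseteq> frontier \<Omega>"
  proof
    fix p assume p: "p \<in> \<Sigma>0"
    have "\<exists>z. x1 < Re z \<and> Re z < x2 \<and> 0 < Im z \<and> Im z < k * t n \<and> dist (\<phi> z) p < t n" for n
    proof -
      have "p \<in> closure (\<phi> ` {z. x1 < Re z \<and> Re z < x2 \<and> 0 < Im z \<and> Im z < k * t n})" using p by (simp add: \<Sigma>0_def K_def)
      then show ?thesis unfolding closure_approachable using t(1)[of n] by force
    qed
    then obtain z where z: "\<And>n. x1 < Re (z n)" "\<And>n. Re (z n) < x2" "\<And>n. 0 < Im (z n)" "\<And>n. Im (z n) < k * t n" "\<And>n. dist (\<phi> (z n)) p < t n" by metis
    have zR: "z n \<in> R'" for n using z(1-3)[of n] order.strict_trans2[OF z(4)[of n] kt(2)[of n]] by (simp add: R'_def)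
    have l: "(\<lambda>n. \<phi> (z n)) \<longlonglongrightarrow> p"
    proof (rule tendsto_dist_iff[THEN iffD2], rule tendsto_sandwich[OF _ _ tendsto_const tl])
      show "\<forall>\<^sub>F n in sequentially. dist (\<phi> (z n)) p \<le> t n" using z(5) by (auto intro!: always_eventually less_imp_le)
    qed auto
    have Iml: "(\<lambda>n. Im (z n)) \<longlonglongrightarrow> 0"
    proof (rule tendsto_sandwich[OF _ _ tendsto_const])
      show "(\<lambda>n. k * t n) \<longlonglongrightarrow> 0" using tendsto_mult[OF tendsto_const tl, of k] by simp
    qed (use z in \<open>auto intro!: always_eventually less_imp_le\<close>)
    have "compact {x1..x2}" by simp
    moreover have "Re (z n) \<in> {x1..x2}" for n using z(1,2)[of n] by simp
    ultimately obtain x0 r where r: "x0 \<in> {x1..x2}" "strict_mono (r::nat\<Rightarrow>nat)" "((\<lambda>n. Re (z n)) \<circ> r) \<longlonglongrightarrow> x0"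
      unfolding compact_def by (elim allE[of _ "\<lambda>n. Re (z n)"]) blast
    have "(\<lambda>n. Complex (Re (z (r n))) (Im (z (r n)))) \<longlonglongrightarrow> Complex x0 0"
      using r(3) LIMSEQ_subseq_LIMSEQ[OF Iml r(2)] by (intro tendsto_Complex) (auto simp: o_def)
    then have "(\<lambda>n. z (r n)) \<longlonglongrightarrow> of_real x0" by (simp add: complex_of_real_def)
    then have "p \<notin> \<Omega>"
      using bdry[of "\<lambda>n. z (r n)" x0 p] zR R'R r(1) x LIMSEQ_subseq_LIMSEQ[OF l r(2)] by (auto simp: o_def subset_iff)
    moreover have "p \<in> closure \<Omega>"
      unfolding closure_sequential using l zR R'R \<phi>(3) by (intro exI[of _ "\<lambda>n. \<phi> (z n)"]) auto
    ultimately show "p \<in> frontier \<Omega>" using \<Omega>(1) by (simp add: frontier_def interior_open)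
  qed
  define \<Sigma> where "\<Sigma> = connected_component_set (frontier \<Omega>) a1"
  have "\<Sigma>0 \<subseteq> \<Sigma>" unfolding \<Sigma>_def by (rule connected_component_maximal[OF a\<Sigma>(1) c\<Sigma> \<Sigma>fr])
  moreover have "\<Sigma> \<in> components (frontier \<Omega>)" unfolding \<Sigma>_def using a\<Sigma>(1) \<Sigma>fr by (auto intro: componentsI)
  ultimately have "\<exists>a b \<Sigma>. closure C = C \<union> {a, b} \<and> a \<noteq> b \<and> \<Sigma> \<in> components (frontier \<Omega>) \<and> a \<in> \<Sigma> \<and> b \<in> \<Sigma>"
    using clC a a\<Sigma> by blast
  then have "true_crosscut \<Omega> C"
    unfolding true_crosscut_def using arc CO card scU comps by blast
  then show ?thesis by blast
qed

section \<open>From the sphere to the plane\<close>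

lemma section_holomorphic:
  assumes "open T" "continuous_on T s" "s ` T \<subseteq> S" "F holomorphic_on S" "\<And>w. w \<in> T \<Longrightarrow> F (s w) = w"
  shows "s holomorphic_on (T :: complex set)"
proof -
  have inj: "inj_on s T" using assms(5) by (metis inj_onI)
  have op: "open (s ` T)" by (rule invariance_of_domain[OF assms(2,1) inj])
  have injF: "inj_on F (s ` T)" using assms(5) by (auto simp: inj_on_def)
  obtain G where G: "G holomorphic_on (F ` s ` T)" "\<And>z. z \<in> s ` T \<Longrightarrow> G (F z) = z"
    using holomorphic_has_inverse[OF holomorphic_on_subset[OF assms(4,3)] op injF] by metis
  have "F ` s ` T = T" using assms(5) by (force simp: image_image)
  then have "G holomorphic_on T" using G(1) by simp
  then show ?thesis by (rule holomorphic_transform) (use G(2) assms(5) in force)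
qed

lemma sphere_holomorphic_on_subset:
  assumes hol: "sphere_holomorphic_on f S" and T: "open T" "T \<subseteq> S" shows "sphere_holomorphic_on f T"
  unfolding sphere_holomorphic_on_def
proof
  fix z assume z: "z \<in> T"
  have zS: "z \<in> S" using z T by blast
  obtain U g where U: "open U" "z \<in> U" "U \<subseteq> S" "g holomorphic_on U"
      and g: "(\<forall>w\<in>U. f w = Cpx (g w)) \<or> (\<forall>w\<in>U. f w = Cpx_recip (g w))"
    using hol[unfolded sphere_holomorphic_on_def, rule_format, OF zS] by auto
  show "\<exists>U g. open U \<and> z \<in> U \<and> U \<subseteq> T \<and> g holomorphic_on U \<and>
        ((\<forall>w\<in>U. f w = Cpx (g w)) \<or> (\<forall>w\<in>U. f w = Cpx_recip (g w)))"
    using U g z T holomorphic_on_subset[OF U(4), of "U \<inter> T"] by (intro exI[of _ "U \<inter> T"] exI[of _ g]) auto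
qed

lemma covering_space_chart:
  assumes cov: "covering_space c \<pi> \<Omega>" and q: "q \<notin> \<Omega>"
  shows "covering_space c (\<lambda>z. chart q (\<pi> z)) (chart q ` \<Omega>)"
proof -
  have hom: "homeomorphism \<Omega> (chart q ` \<Omega>) (chart q) (unchart q)" by (rule homeomorphism_chart_sub[OF q])
  have inj: "x = y" if "x \<in> \<Omega>" "y \<in> \<Omega>" "chart q x = chart q y" for x y
    using that q inj_onD[OF inj_on_chart[of q]] by auto
  have cont: "continuous_on c \<pi>" and im: "\<pi> ` c = \<Omega>" using cov by (auto simp: covering_space_def)
  show ?thesis
  proof
    show "continuous_on c (\<lambda>z. chart q (\<pi> z))"
      by (rule continuous_on_compose2[OF continuous_on_chart cont]) (use im q in auto)
    show "(\<lambda>z. chart q (\<pi> z)) ` c = chart q ` \<Omega>" using im by (simp add: image_image[symmetric])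
    fix y assume "y \<in> chart q ` \<Omega>"
    then obtain x where x: "x \<in> \<Omega>" "y = chart q x" by blast
    then obtain T v where T: "x \<in> T" "openin (top_of_set \<Omega>) T" "\<Union>v = c \<inter> \<pi> -` T"
      "\<forall>u\<in>v. openin (top_of_set c) u" "pairwise disjnt v" "\<forall>u\<in>v. \<exists>r. homeomorphism u T \<pi> r"
      using cov unfolding covering_space_def by metis
    have TO: "T \<subseteq> \<Omega>" using T(2) openin_imp_subset by blast
    show "\<exists>T'. y \<in> T' \<and> openin (top_of_set (chart q ` \<Omega>)) T' \<and>
      (\<exists>v. \<Union>v = c \<inter> (\<lambda>z. chart q (\<pi> z)) -` T' \<and> (\<forall>u\<in>v. openin (top_of_set c) u) \<and> pairwise disjnt v \<and>
        (\<forall>u\<in>v. \<exists>r. homeomorphism u T' (\<lambda>z. chart q (\<pi> z)) r))"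
    proof (rule exI[of _ "chart q ` T"], intro conjI exI[of _ v])
      show "y \<in> chart q ` T" using x T(1) by blast
      show "openin (top_of_set (chart q ` \<Omega>)) (chart q ` T)" by (rule homeomorphism_imp_open_map[OF hom T(2)])
      have "\<pi> z \<in> T" if z: "z \<in> c" "chart q (\<pi> z) \<in> chart q ` T" for z
      proof -
        from z(2) obtain t where t: "chart q (\<pi> z) = chart q t" "t \<in> T" by (rule imageE)
        have "\<pi> z \<in> \<Omega>" "t \<in> \<Omega>" using im z(1) t(2) TO by blast+
        from inj[OF this t(1)] show ?thesis using t(2) by simp
      qed
      then show "\<Union>v = c \<inter> (\<lambda>z. chart q (\<pi> z)) -` chart q ` T" unfolding T(3) by auto
      show "\<forall>u\<in>v. \<exists>r. homeomorphism u (chart q ` T) (\<lambda>z. chart q (\<pi> z)) r"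
      proof
        fix u assume "u \<in> v"
        then obtain r where r: "homeomorphism u T \<pi> r" using T(6) by blast
        have "homeomorphism T (chart q ` T) (chart q) (unchart q)" by (rule homeomorphism_chart_sub) (use TO q in blast)
        from homeomorphism_compose[OF r this] show "\<exists>r. homeomorphism u (chart q ` T) (\<lambda>z. chart q (\<pi> z)) r"
          unfolding o_def by (rule exI[of _ "\<lambda>x. r (unchart q x)"])
      qed
      show "\<forall>u\<in>v. openin (top_of_set c) u" by (rule T(4))
      show "pairwise disjnt v" by (rule T(5))
    qed
  qed
qed

lemma split_disconnected_closed:
  fixes S :: "'a::topological_space set"
  assumes "closed S" "\<not> connected S"
  obtains X Y where "closed X" "closed Y" "X \<noteq> {}" "Y \<noteq> {}" "X \<inter> Y = {}" "X \<union> Y = S"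
proof -
  obtain A B where "closed A" "closed B" "S \<subseteq> A \<union> B" "A \<inter> B \<inter> S = {}" "A \<inter> S \<noteq> {}" "B \<inter> S \<noteq> {}"
    using assms(2) unfolding connected_closed by blast
  then show thesis using assms(1) by (intro that[of "A \<inter> S" "B \<inter> S"]) (auto intro: closed_Int)
qed

text \<open>
  Being disconnected, \<open>S\<close> splits into two closed pieces. They cannot both be connected, since then they would be the
  only components; so one of them splits again.
\<close>

lemma three_closed_pieces:
  fixes S :: "'a::topological_space set"
  assumes "closed S" and more: "finite (components S) \<Longrightarrow> card (components S) > 2"
  obtains X Y Z where "closed X" "closed Y" "closed Z" "X \<noteq> {}" "Y \<noteq> {}" "Z \<noteq> {}"
    "X \<inter> Y = {}" "X \<inter> Z = {}" "Y \<inter> Z = {}" "X \<union> Y \<union> Z = S"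
proof -
  have "\<not> connected S"
  proof
    assume "connected S"
    then have "components S \<subseteq> {S}" using in_components_maximal[of _ S] components_maximal in_components_nonempty
      by (metis (no_types, lifting) inf.orderE in_components_subset insertI1 order_refl subsetI subset_antisym Int_absorb1)
    then show False using more card_mono[of "{S}" "components S"] finite_subset by fastforce
  qed
  then obtain X Y where XY: "closed X" "closed Y" "X \<noteq> {}" "Y \<noteq> {}" "X \<inter> Y = {}" "X \<union> Y = S"
    by (rule split_disconnected_closed[OF assms(1)])
  have "\<not> (connected X \<and> connected Y)"
  proof
    assume c: "connected X \<and> connected Y"
    have "W \<in> {X, Y}" if W: "W \<in> components S" for W
    proof -
      have Wc: "connected W" "W \<subseteq> S" "W \<noteq> {}" using W in_components_connected in_components_subset in_components_nonempty by blast+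
      have "X \<inter> W = {} \<or> Y \<inter> W = {}"
        using Wc(1) XY(1,2,5,6) Wc(2) unfolding connected_closed by blast
      then show ?thesis
      proof
        assume "X \<inter> W = {}"
        then have "W \<subseteq> Y" using Wc(2) XY(6) by blast
        moreover have "Y \<subseteq> W" by (rule components_maximal[OF W]) (use c XY Wc \<open>W \<subseteq> Y\<close> in auto)
        ultimately show ?thesis by blast
      next
        assume "Y \<inter> W = {}"
        then have "W \<subseteq> X" using Wc(2) XY(6) by blast
        moreover have "X \<subseteq> W" by (rule components_maximal[OF W]) (use c XY Wc \<open>W \<subseteq> X\<close> in auto)
        ultimately show ?thesis by blast
      qed
    qed
    then have sub: "components S \<subseteq> {X, Y}" by blast
    then have fin: "finite (components S)" using finite_subset by blast
    have "card (components S) \<le> card {X, Y}" by (rule card_mono[OF _ sub]) simp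
    also have "\<dots> \<le> 2" by (simp add: card_insert_if)
    finally show False using more[OF fin] by simp
  qed
  then consider "\<not> connected X" | "\<not> connected Y" by blast
  then show thesis
  proof cases
    case 1
    then obtain A B where "closed A" "closed B" "A \<noteq> {}" "B \<noteq> {}" "A \<inter> B = {}" "A \<union> B = X"
      by (rule split_disconnected_closed[OF XY(1)])
    then show thesis using XY by (intro that[of A B Y]) auto
  next
    case 2
    then obtain A B where "closed A" "closed B" "A \<noteq> {}" "B \<noteq> {}" "A \<inter> B = {}" "A \<union> B = Y"
      by (rule split_disconnected_closed[OF XY(2)])
    then show thesis using XY by (intro that[of A B X]) auto
  qed
qed

text \<open>
  A homeomorphism of the open interval onto \<open>C\<close> need not extend to the closed interval for an arbitrary arc. It does here
  because the closure adds two points only, and each end can accumulate at just one of them.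
\<close>

lemma open_jordan_arc_closure_arc:
  fixes C :: "'a::euclidean_space set"
  assumes arc: "C homeomorphic {0<..<1::real}" and cl: "closure C = C \<union> {a, b}" "a \<noteq> b" "a \<notin> C" "b \<notin> C"
    and bd: "bounded C"
  obtains g where "arc g" "path_image g = closure C"
proof -
  obtain c d where cd: "homeomorphism {0<..<1::real} C c d"
    using homeomorphic_sym[THEN iffD1, OF arc] unfolding homeomorphic_def by blast
  have contc: "continuous_on {0<..<1} c" and contd: "continuous_on C d" and imc: "c ` {0<..<1} = C" and imd: "d ` C = {0<..<1}"
    and dc: "\<And>t. t \<in> {0<..<1} \<Longrightarrow> d (c t) = t" using cd unfolding homeomorphism_def by auto
  have cC: "c t \<in> C" if "t \<in> {0<..<1}" for t using that imc by blast
  have compC: "compact (closure C)" using bd by (simp add: compact_closure)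
  \<comment> \<open>At an end of the parameter interval \<open>c\<close> cannot accumulate in \<open>C\<close>, where \<open>d\<close> is continuous.\<close>
  have ends: "\<exists>r. strict_mono (r::nat\<Rightarrow>nat) \<and> ((\<lambda>n. c (t (r n))) \<longlonglongrightarrow> a \<or> (\<lambda>n. c (t (r n))) \<longlonglongrightarrow> b)"
    if t: "\<And>n. t n \<in> {0<..<1}" and tl: "t \<longlonglongrightarrow> l" "l \<notin> {0<..<1}" for t and l :: real
  proof -
    have "c (t n) \<in> closure C" for n using cC[OF t] closure_subset by blast
    then obtain p r where r: "p \<in> closure C" "strict_mono (r::nat\<Rightarrow>nat)" "((\<lambda>n. c (t n)) \<circ> r) \<longlonglongrightarrow> p"
      using compC unfolding compact_def by (elim allE[of _ "\<lambda>n. c (t n)"]) blast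
    have rl: "(\<lambda>n. c (t (r n))) \<longlonglongrightarrow> p" using r(3) by (simp add: o_def)
    have "p \<notin> C"
    proof
      assume p: "p \<in> C"
      have "(\<lambda>n. d (c (t (r n)))) \<longlonglongrightarrow> d p"
        by (rule continuous_on_tendsto_compose[OF contd rl p]) (use cC t in \<open>auto intro!: always_eventually\<close>)
      then have "(\<lambda>n. t (r n)) \<longlonglongrightarrow> d p" using dc t by simp
      moreover have "(\<lambda>n. t (r n)) \<longlonglongrightarrow> l" using LIMSEQ_subseq_LIMSEQ[OF tl(1) r(2)] by (simp add: o_def)
      ultimately have "l = d p" using LIMSEQ_unique by blast
      then show False using p imd tl(2) by blast
    qed
    then have "p = a \<or> p = b" using r(1) cl(1) by blast
    then show ?thesis using rl r(2) by blast
  qed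
  define \<rho> where "\<rho> = dist a b / 2"
  have \<rho>: "\<rho> > 0" using cl(2) by (simp add: \<rho>_def)
  have disjAB: "ball a \<rho> \<inter> ball b \<rho> = {}"
    by (rule disjoint_ballI) (simp add: \<rho>_def)
  \<comment> \<open>Near an end the arc lies in two disjoint balls about \<open>a\<close> and \<open>b\<close>, so by connectedness in one of them.\<close>
  have lim: "\<exists>p\<in>{a,b}. (c \<longlongrightarrow> p) (at l within {0<..<1})" if l: "l \<in> {0, 1::real}" for l
  proof -
    have lN: "l \<notin> {0<..<1}" using l by auto
    have near: "\<exists>\<eta>>0. \<forall>t\<in>{0<..<1}. \<bar>t - l\<bar> < \<eta> \<longrightarrow> c t \<in> ball a \<epsilon> \<union> ball b \<epsilon>" if "\<epsilon> > 0" for \<epsilon>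
    proof (rule ccontr)
      assume "\<not> ?thesis"
      then have "\<exists>t\<in>{0<..<1}. \<bar>t - l\<bar> < 1 / Suc n \<and> c t \<notin> ball a \<epsilon> \<union> ball b \<epsilon>" for n
        by (metis of_nat_0_less_iff zero_less_Suc zero_less_divide_1_iff)
      then obtain t where t: "\<And>n. t n \<in> {0<..<1}" "\<And>n. \<bar>t n - l\<bar> < 1 / Suc n" "\<And>n. c (t n) \<notin> ball a \<epsilon> \<union> ball b \<epsilon>" by metis
      have "t \<longlonglongrightarrow> l"
      proof (rule tendsto_dist_iff[THEN iffD2], rule tendsto_sandwich[OF _ _ tendsto_const LIMSEQ_Suc[OF lim_1_over_n]])
        show "\<forall>\<^sub>F n in sequentially. dist (t n) l \<le> 1 / real (Suc n)"
          using t(2) by (auto intro!: always_eventually less_imp_le simp: dist_real_def)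
      qed auto
      then obtain r where "(\<lambda>n. c (t (r n))) \<longlonglongrightarrow> a \<or> (\<lambda>n. c (t (r n))) \<longlonglongrightarrow> b" using ends[of t l, OF t(1) _ lN] by blast
      then have "\<exists>n. c (t (r n)) \<in> ball a \<epsilon> \<union> ball b \<epsilon>"
      proof
        assume "(\<lambda>n. c (t (r n))) \<longlonglongrightarrow> a"
        from tendstoD[OF this \<open>\<epsilon> > 0\<close>] show ?thesis by (auto simp: eventually_sequentially dist_commute)
      next
        assume "(\<lambda>n. c (t (r n))) \<longlonglongrightarrow> b"
        from tendstoD[OF this \<open>\<epsilon> > 0\<close>] show ?thesis by (auto simp: eventually_sequentially dist_commute)
      qed
      then show False using t(3) by blast
    qed
    obtain \<eta> where \<eta>: "\<eta> > 0" "\<And>t. t \<in> {0<..<1} \<Longrightarrow> \<bar>t - l\<bar> < \<eta> \<Longrightarrow> c t \<in> ball a \<rho> \<union> ball b \<rho>" using near[OF \<rho>] by blast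
    define J where "J = {0<..<1} \<inter> ball l \<eta>"
    have "connected J" unfolding J_def by (intro convex_connected convex_Int) auto
    then have cJ: "connected (c ` J)" by (intro connected_continuous_image continuous_on_subset[OF contc]) (auto simp: J_def)
    have Jsub: "c ` J \<subseteq> ball a \<rho> \<union> ball b \<rho>"
    proof (rule image_subsetI)
      fix t assume "t \<in> J"
      then show "c t \<in> ball a \<rho> \<union> ball b \<rho>" by (intro \<eta>(2)) (auto simp: J_def dist_real_def)
    qed
    have "ball a \<rho> \<inter> c ` J = {} \<or> ball b \<rho> \<inter> c ` J = {}"
      using connectedD[OF cJ open_ball open_ball _ Jsub] disjAB by blast
    then have "\<exists>p o'. {p, o'} = {a, b} \<and> ball o' \<rho> \<inter> c ` J = {}" by blast
    then obtain p o' where p: "{p, o'} = {a, b}" "ball o' \<rho> \<inter> c ` J = {}" by blast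
    have "(c \<longlongrightarrow> p) (at l within {0<..<1})"
    proof (rule tendstoI)
      fix \<epsilon> :: real assume "\<epsilon> > 0"
      define \<epsilon>' where "\<epsilon>' = min \<epsilon> \<rho>"
      have \<epsilon>': "\<epsilon>' > 0" "\<epsilon>' \<le> \<epsilon>" "\<epsilon>' \<le> \<rho>" using \<open>\<epsilon> > 0\<close> \<rho> by (auto simp: \<epsilon>'_def)
      obtain \<eta>' where \<eta>': "\<eta>' > 0" "\<And>t. t \<in> {0<..<1} \<Longrightarrow> \<bar>t - l\<bar> < \<eta>' \<Longrightarrow> c t \<in> ball a \<epsilon>' \<union> ball b \<epsilon>'" using near[OF \<epsilon>'(1)] by blast
      have "dist (c t) p < \<epsilon>" if "t \<in> {0<..<1}" "dist t l < min \<eta> \<eta>'" for t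
      proof -
        have "t \<in> J" using that by (auto simp: J_def dist_commute)
        then have "c t \<notin> ball o' \<rho>" using p(2) by blast
        then have "c t \<notin> ball o' \<epsilon>'" using \<epsilon>'(3) by auto
        moreover have "c t \<in> ball a \<epsilon>' \<union> ball b \<epsilon>'" using \<eta>'(2)[OF that(1)] that(2) by (simp add: dist_real_def)
        then have "c t \<in> ball p \<epsilon>' \<union> ball o' \<epsilon>'" using p(1) by (auto simp: doubleton_eq_iff)
        ultimately show ?thesis using \<epsilon>'(2) by (auto simp: dist_commute)
      qed
      then show "\<forall>\<^sub>F t in at l within {0<..<1}. dist (c t) p < \<epsilon>"
        unfolding eventually_at using \<eta>(1) \<eta>'(1) by (intro exI[of _ "min \<eta> \<eta>'"]) auto
    qed
    then show ?thesis using p(1) by blast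
  qed
  obtain p0 where p0: "p0 \<in> {a,b}" "(c \<longlongrightarrow> p0) (at 0 within {0<..<1})" using lim[of 0] by blast
  obtain p1 where p1: "p1 \<in> {a,b}" "(c \<longlongrightarrow> p1) (at 1 within {0<..<1})" using lim[of 1] by blast
  define g where "g t = (if t = 0 then p0 else if t = 1 then p1 else c t)" for t
  have "at 0 within {0<..<1} = at_right (0::real)"
    by (rule at_within_nhd[of _ "{..<1}"]) auto
  then have r0: "(c \<longlongrightarrow> p0) (at_right 0)" using p0(2) by simp
  have "at 1 within {0<..<1} = at_left (1::real)"
    by (rule at_within_nhd[of _ "{0<..}"]) auto
  then have l1: "(c \<longlongrightarrow> p1) (at_left 1)" using p1(2) by simp
  have contg: "continuous_on {0..1} g"
  proof (rule continuous_on_IccI)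
    show "(g \<longlongrightarrow> g 0) (at_right 0)"
    proof (rule Lim_transform_eventually)
      show "(c \<longlongrightarrow> g 0) (at_right 0)" using r0 by (simp add: g_def)
      show "\<forall>\<^sub>F t in at_right 0. c t = g t" unfolding eventually_at_right_field by (rule exI[of _ 1]) (auto simp: g_def)
    qed
    show "(g \<longlongrightarrow> g 1) (at_left 1)"
    proof (rule Lim_transform_eventually)
      show "(c \<longlongrightarrow> g 1) (at_left 1)" using l1 by (simp add: g_def)
      show "\<forall>\<^sub>F t in at_left 1. c t = g t" unfolding eventually_at_left_field by (rule exI[of _ 0]) (auto simp: g_def)
    qed
    show "(g \<longlongrightarrow> g t) (at t)" if t: "0 < t" "t < 1" for t
    proof (rule Lim_transform_within_open[OF _ open_greaterThanLessThan[of 0 1]])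
      show "(c \<longlongrightarrow> g t) (at t)" using contc t by (simp add: continuous_on_eq_continuous_at isCont_def g_def)
    qed (use t in \<open>auto simp: g_def\<close>)
  qed simp
  have I: "{0..1} = {0<..<1} \<union> {0, 1::real}" by auto
  have "g ` {0<..<1} = C" using imc by (auto simp: g_def image_iff)
  then have img: "g ` {0..1} = C \<union> {p0, p1}" unfolding I image_Un by (simp add: g_def insert_commute)
  have "closed (g ` {0..1})" by (intro compact_imp_closed compact_continuous_image contg) simp
  then have "closure C \<subseteq> C \<union> {p0, p1}" unfolding img by (intro closure_minimal) auto
  then have ab: "{a, b} = {p0, p1}" using cl p0(1) p1(1) by blast
  then have "p0 \<noteq> p1" using cl(2) by (auto simp: doubleton_eq_iff)
  have pi: "path_image g = closure C" unfolding path_image_def img cl(1) ab ..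
  have pC: "p0 \<notin> C" "p1 \<notin> C" using p0(1) p1(1) cl by auto
  have "inj_on g {0..1}"
  proof (rule inj_onI)
    fix s t assume st: "s \<in> {0..1}" "t \<in> {0..1}" "g s = g t"
    have gi: "g u \<in> C" "g u = c u" if "u \<in> {0<..<1}" for u using that cC[OF that] by (auto simp: g_def)
    have e: "g 0 = p0" "g 1 = p1" by (auto simp: g_def)
    have ss: "u = 0 \<or> u = 1 \<or> u \<in> {0<..<1}" if "u \<in> {0..1}" for u :: real using that by auto
    show "s = t"
    proof (cases "s \<in> {0<..<1} \<and> t \<in> {0<..<1}")
      case True
      then show ?thesis using gi st(3) dc by metis
    next
      case False
      then show ?thesis using ss[OF st(1)] ss[OF st(2)] gi(1)[of s] gi(1)[of t] e st(3) pC \<open>p0 \<noteq> p1\<close> by metis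
    qed
  qed
  then have "arc g" unfolding arc_def path_def using contg by simp
  then show thesis using that pi by blast
qed

section \<open>True crosscuts and limit sets\<close>

lemma components_chart_image:
  assumes U: "U \<in> components S" and p: "p \<notin> S"
  shows "chart p ` U \<in> components (chart p ` S)"
proof -
  have U': "U \<noteq> {}" "U \<subseteq> S" "connected U"
    using in_components_nonempty[OF U] in_components_subset[OF U] in_components_connected[OF U] by auto
  have max: "D = U" if "U \<subseteq> D" "D \<subseteq> S" "connected D" for D
    using components_maximal[OF U that(3)] that(1,2) U'(1) by blast
  have un: "unchart p ` chart p ` X = X" if "X \<subseteq> S" for X
  proof -
    have "unchart p (chart p x) = x" if "x \<in> X" for x
      by (rule unchart_chart) (use that \<open>X \<subseteq> S\<close> p in blast)
    then show ?thesis by (simp add: image_image)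
  qed
  show ?thesis unfolding in_components_maximal
  proof (intro conjI allI impI; (elim conjE)?)
    show "chart p ` U \<noteq> {}" using U'(1) by blast
    show "chart p ` U \<subseteq> chart p ` S" using U'(2) by blast
    show "connected (chart p ` U)" by (rule connected_chart_image[OF U'(3)]) (use U'(2) p in blast)
    fix D assume D: "D \<noteq> {}" "chart p ` U \<subseteq> D" "D \<subseteq> chart p ` S" "connected D"
    have "unchart p ` D = U"
    proof (rule max)
      show "U \<subseteq> unchart p ` D" using image_mono[OF D(2), of "unchart p"] un[OF U'(2)] by simp
      show "unchart p ` D \<subseteq> S" using image_mono[OF D(3), of "unchart p"] un[of S] by simp
      show "connected (unchart p ` D)" by (rule connected_continuous_image[OF continuous_on_unchart D(4)])
    qed
    moreover have "chart p ` unchart p ` D = D" by (simp add: image_image)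
    ultimately show "D = chart p ` U" by metis
  qed
qed

text \<open>
  The map \<open>\<xi> * exp (\<i> * \<zeta>)\<close> takes a small rectangle standing on the real axis into the given half-neighbourhood of
  \<open>\<xi>\<close>. There \<open>\<pi>\<close> is univalent, and in a chart centred at a value \<open>p\<close> taken by \<open>\<pi>\<close> elsewhere it is also bounded, so
  it has two different boundary values along vertical lines.
\<close>

lemma univalent_near_imp_true_crosscut:
  assumes \<Omega>: "open \<Omega>" "connected \<Omega>" and hol: "sphere_holomorphic_on \<pi> unit_disk"
    and cov: "covering_space unit_disk \<pi> \<Omega>"
    and \<xi>: "norm \<xi> = 1" and e: "e > 0" "inj_on \<pi> (ball \<xi> e \<inter> unit_disk)"
    and bdry: "\<And>z \<zeta> p. (\<And>n. z n \<in> unit_disk) \<Longrightarrow> z \<longlonglongrightarrow> \<zeta> \<Longrightarrow> norm \<zeta> = 1 \<Longrightarrow> dist \<xi> \<zeta> < e \<Longrightarrow> (\<lambda>n. \<pi> (z n)) \<longlonglongrightarrow> p \<Longrightarrow> p \<notin> \<Omega>"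
  shows "\<exists>C. true_crosscut \<Omega> C"
proof -
  have im: "\<pi> ` unit_disk = \<Omega>" using cov by (simp add: covering_space_imp_surjective)
  have op: "open (\<pi> ` W)" if W: "open W" "W \<subseteq> unit_disk" for W
  proof -
    have "openin (top_of_set unit_disk) W" using W by (simp add: openin_open_eq)
    then have "openin (top_of_set \<Omega>) (\<pi> ` W)" by (rule covering_space_open_map[OF cov])
    then show ?thesis using \<Omega>(1) openin_open_trans by blast
  qed
  define e' where "e' = min e 1"
  have e': "e' > 0" "e' \<le> e" "e' \<le> 1" using e(1) by (auto simp: e'_def)
  define s where "s = e' / 4"
  define z0 where "z0 = of_real (1 - e' / 2) * \<xi>"
  have "\<xi> - z0 = of_real (e' / 2) * \<xi>" by (simp add: z0_def algebra_simps)
  then have "dist \<xi> z0 = norm (of_real (e' / 2) * \<xi>)" by (simp only: dist_norm)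
  then have dz: "dist \<xi> z0 = e' / 2" using \<xi> e'(1) by (simp add: norm_mult)
  have nz: "norm z0 < 1" using \<xi> e' unfolding z0_def norm_mult norm_of_real by simp
  define W where "W = (ball \<xi> e \<inter> unit_disk) - cball \<xi> s"
  have W: "open W" "z0 \<in> W" "W \<subseteq> unit_disk" using dz nz e' by (auto simp: W_def s_def)
  define p where "p = \<pi> z0"
  have Ws: "\<pi> ` (ball \<xi> s \<inter> unit_disk) \<inter> \<pi> ` W = {}"
  proof -
    have "\<pi> ` (ball \<xi> s \<inter> unit_disk) \<inter> \<pi> ` W = \<pi> ` ((ball \<xi> s \<inter> unit_disk) \<inter> W)"
      by (rule inj_on_image_Int[OF e(2), symmetric]) (use e' in \<open>auto simp: W_def s_def\<close>)
    also have "(ball \<xi> s \<inter> unit_disk) \<inter> W = {}" by (auto simp: W_def)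
    finally show ?thesis by simp
  qed
  have bdd: "bounded (chart p ` \<pi> ` (ball \<xi> s \<inter> unit_disk))"
    by (rule bounded_chart_image[OF op[OF W(1,3)]]) (use W(2) Ws in \<open>auto simp: p_def\<close>)
  have np: "\<pi> z \<noteq> p" if "z \<in> ball \<xi> s \<inter> unit_disk" for z
    using that Ws W(2) unfolding p_def by blast
  define g where "g \<zeta> = \<xi> * exp (\<i> * \<zeta>)" for \<zeta>
  have contg: "continuous_on UNIV g" unfolding g_def by (intro continuous_intros)
  have "s > 0" using e' by (simp add: s_def)
  have "isCont g 0" using contg continuous_on_eq_continuous_at open_UNIV by blast
  then obtain \<eta> where \<eta>: "\<eta> > 0" "\<And>\<zeta>. dist \<zeta> 0 < \<eta> \<Longrightarrow> dist (g \<zeta>) (g 0) < s"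
    unfolding continuous_at_eps_delta using \<open>s > 0\<close> by blast
  have g0: "g 0 = \<xi>" by (simp add: g_def)
  define h where "h = min (\<eta> / 3) 1"
  have h: "h > 0" "2 * h < \<eta>" "h \<le> 1" using \<eta>(1) by (auto simp: h_def min_def)
  define R where "R = {z. - h < Re z \<and> Re z < h \<and> 0 < Im z \<and> Im z < h}"
  have ng: "norm (g \<zeta>) = exp (- Im \<zeta>)" for \<zeta> using \<xi> by (simp add: g_def norm_mult)
  have gs: "dist \<xi> (g \<zeta>) < s" if "\<bar>Re \<zeta>\<bar> < h" "\<bar>Im \<zeta>\<bar> < h" for \<zeta>
  proof -
    have "norm \<zeta> \<le> \<bar>Re \<zeta>\<bar> + \<bar>Im \<zeta>\<bar>" by (rule cmod_le)
    then have "dist \<zeta> 0 < \<eta>" using that h by simp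
    then show ?thesis using \<eta>(2) g0 by (simp add: dist_commute)
  qed
  have gR: "g \<zeta> \<in> ball \<xi> s \<inter> unit_disk" if "\<zeta> \<in> R" for \<zeta>
    using gs[of \<zeta>] ng[of \<zeta>] that by (auto simp: R_def abs_less_iff)
  have injg: "inj_on g R"
  proof (rule inj_onI)
    fix x y assume xy: "x \<in> R" "y \<in> R" "g x = g y"
    have "\<xi> \<noteq> 0" using \<xi> by auto
    then have "exp (\<i> * x) = exp (\<i> * y)" using xy(3) by (simp add: g_def)
    moreover have "\<bar>Im (\<i> * x) - Im (\<i> * y)\<bar> < 2 * pi" using xy h pi_gt3 by (auto simp: R_def abs_if)
    ultimately have "\<i> * x = \<i> * y" by (rule exp_complex_eqI[rotated])
    then show "x = y" by simp
  qed
  have sub: "ball \<xi> s \<inter> unit_disk \<subseteq> ball \<xi> e \<inter> unit_disk" using e' by (auto simp: s_def)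
  define \<phi> where "\<phi> = \<pi> \<circ> g"
  have cont\<pi>: "continuous_on unit_disk \<pi>" by (rule sphere_holomorphic_on_continuous[OF hol])
  have cont\<phi>: "continuous_on R \<phi>" unfolding \<phi>_def o_def
    by (rule continuous_on_compose2[OF cont\<pi> continuous_on_subset[OF contg]]) (use gR in auto)
  have inj\<phi>: "inj_on \<phi> R" unfolding \<phi>_def
    by (rule comp_inj_on[OF injg inj_on_subset[OF e(2)]]) (use gR sub in blast)
  have im\<phi>: "\<phi> ` R \<subseteq> \<Omega>" using gR im by (auto simp: \<phi>_def)
  have op\<phi>: "open (\<phi> ` X)" if X: "open X" "X \<subseteq> R" for X
  proof -
    have "open (g ` X)"
      by (rule invariance_of_domain[OF continuous_on_subset[OF contg] X(1) inj_on_subset[OF injg X(2)]]) simp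
    moreover have "g ` X \<subseteq> unit_disk" using gR X(2) by blast
    ultimately show ?thesis unfolding \<phi>_def image_comp[symmetric] by (rule op)
  qed
  have bdry\<phi>: "p' \<notin> \<Omega>" if z: "\<And>n. z n \<in> R" "z \<longlonglongrightarrow> of_real x" "- h < x" "x < h" "(\<lambda>n. \<phi> (z n)) \<longlonglongrightarrow> p'" for z x p'
  proof (rule bdry)
    show "g (z n) \<in> unit_disk" for n using gR[OF z(1)] by blast
    show "(\<lambda>n. g (z n)) \<longlonglongrightarrow> g (of_real x)" by (rule continuous_on_tendsto_compose[OF contg z(2)]) auto
    show "norm (g (of_real x)) = 1" using ng by simp
    have "dist \<xi> (g (of_real x)) < s" using gs[of "of_real x"] z(3,4) h by (simp add: abs_less_iff)
    then show "dist \<xi> (g (of_real x)) < e" using e' by (simp add: s_def)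
    show "(\<lambda>n. \<pi> (g (z n))) \<longlonglongrightarrow> p'" using z(5) by (simp add: \<phi>_def)
  qed
  define F where "F = (\<lambda>z. chart p (\<pi> z)) \<circ> g"
  have "sphere_holomorphic_on \<pi> (ball \<xi> s \<inter> unit_disk)" by (rule sphere_holomorphic_on_subset[OF hol]) auto
  then have holc: "(\<lambda>z. chart p (\<pi> z)) holomorphic_on (ball \<xi> s \<inter> unit_disk)"
    by (rule sphere_holomorphic_on_chart) (rule np)
  have holg: "g holomorphic_on R" unfolding g_def by (intro holomorphic_intros)
  have holF: "F holomorphic_on R" unfolding F_def
    by (rule holomorphic_on_compose_gen[OF holg holc]) (use gR in blast)
  have F\<phi>: "\<phi> \<zeta> = unchart p (F \<zeta>)" if "\<zeta> \<in> R" for \<zeta>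
    using unchart_chart[OF np[OF gR[OF that]]] by (simp add: F_def \<phi>_def)
  have injF: "inj_on F R"
  proof (rule inj_onI)
    fix x y assume "x \<in> R" "y \<in> R" "F x = F y"
    then have "\<phi> x = \<phi> y" using F\<phi> by simp
    then show "x = y" using inj_onD[OF inj\<phi>] \<open>x \<in> R\<close> \<open>y \<in> R\<close> by blast
  qed
  have bdF: "bounded (F ` R)" by (rule bounded_subset[OF bdd]) (use gR in \<open>auto simp: F_def\<close>)
  obtain x1 x2 l1 l2 where x: "- h < x1" "x1 < x2" "x2 < h" "l1 \<noteq> l2"
    and l: "((\<lambda>y. F (Complex x1 y)) \<longlongrightarrow> l1) (at_right 0)" "((\<lambda>y. F (Complex x2 y)) \<longlongrightarrow> l2) (at_right 0)"
    by (rule distinct_vertical_limits[OF h(1) holF[unfolded R_def] injF[unfolded R_def] bdF[unfolded R_def]]) blast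
  have lim: "((\<lambda>y. \<phi> (Complex xj y)) \<longlongrightarrow> unchart p lj) (at_right 0)"
    if xj: "- h < xj" "xj < h" and lj: "((\<lambda>y. F (Complex xj y)) \<longlongrightarrow> lj) (at_right 0)" for xj lj
  proof (rule Lim_transform_eventually)
    show "((\<lambda>y. unchart p (F (Complex xj y))) \<longlongrightarrow> unchart p lj) (at_right 0)"
      by (rule continuous_on_tendsto_compose[OF continuous_on_unchart[of UNIV] lj]) auto
    show "\<forall>\<^sub>F y in at_right 0. unchart p (F (Complex xj y)) = \<phi> (Complex xj y)"
      unfolding eventually_at_right_field
    proof (rule exI[of _ h], intro conjI allI impI)
      fix y assume "0 < y" "y < h"
      then have "Complex xj y \<in> R" using xj by (simp add: R_def)
      then show "unchart p (F (Complex xj y)) = \<phi> (Complex xj y)" by (rule F\<phi>[symmetric])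
    qed (rule h(1))
  qed
  have ne: "unchart p l1 \<noteq> unchart p l2" using x(4) by (metis chart_unchart)
  have xs: "x1 < h" "- h < x2" using x by simp_all
  show ?thesis
  proof (rule crosscut_from_rectangle[OF \<Omega> cont\<phi>[unfolded R_def] inj\<phi>[unfolded R_def] im\<phi>[unfolded R_def]
        op\<phi>[unfolded R_def] _ x(1-3) ne lim[OF x(1) xs(1) l(1)] lim[OF xs(2) x(3) l(2)]])
    show "p' \<notin> \<Omega>" if "\<And>n. z n \<in> {z. - h < Re z \<and> Re z < h \<and> 0 < Im z \<and> Im z < h}" "z \<longlonglongrightarrow> of_real x"
      "- h < x" "x < h" "(\<lambda>n. \<phi> (z n)) \<longlonglongrightarrow> p'" for z x p'
      by (rule bdry\<phi>[unfolded R_def, OF that])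
  qed
qed

text \<open>
  A chart centred at a point \<open>p\<close> of the other component of \<open>\<Omega> - C\<close> makes the simply connected component \<open>U\<close> a bounded plane
  domain. The covering has a holomorphic section \<open>s\<close> over \<open>U\<close>, so \<open>\<pi>\<close> is injective on the image of \<open>s\<close>, and
  \<open>crosscut_univalent_boundary\<close> finds a half-neighbourhood in this image.
\<close>

lemma true_crosscut_imp_univalent_near:
  assumes \<Omega>: "open \<Omega>" "connected \<Omega>" and q: "q \<notin> \<Omega>" and hol: "sphere_holomorphic_on \<pi> unit_disk"
    and cov: "covering_space unit_disk \<pi> \<Omega>" and C: "true_crosscut \<Omega> C"
  shows "\<exists>\<xi> e S. norm \<xi> = 1 \<and> e > 0 \<and> ball \<xi> e \<inter> unit_disk \<subseteq> S \<and> S \<subseteq> unit_disk \<and> inj_on \<pi> S"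
proof -
  have im: "\<pi> ` unit_disk = \<Omega>" using cov by (simp add: covering_space_imp_surjective)
  obtain a b \<Sigma> U where arc: "C homeomorphic {0<..<1::real}" and CO: "C \<subseteq> \<Omega>" and cl: "closure C = C \<union> {a, b}" and ab: "a \<noteq> b"
    and \<Sigma>: "\<Sigma> \<in> components (frontier \<Omega>)" "a \<in> \<Sigma>" "b \<in> \<Sigma>"
    and card: "card (components (\<Omega> - C)) = 2" and U: "U \<in> components (\<Omega> - C)" "simply_connected U"
    using C unfolding true_crosscut_def open_jordan_arc_def by blast
  have \<Sigma>fr: "\<Sigma> \<subseteq> frontier \<Omega>" using \<Sigma>(1) in_components_subset by blast
  have \<Sigma>O: "\<Sigma> \<inter> \<Omega> = {}" using \<Sigma>fr \<Omega>(1) by (auto simp: frontier_def interior_open)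
  have \<Sigma>cl: "closed \<Sigma>" using closed_components[OF _ \<Sigma>(1)] by simp
  have \<Sigma>con: "connected \<Sigma>" using \<Sigma>(1) in_components_connected by blast
  have abO: "a \<notin> \<Omega>" "b \<notin> \<Omega>" using \<Sigma> \<Sigma>O by auto
  have clO: "closure C \<inter> \<Omega> = C" using cl CO abO by blast
  have Usub: "U \<subseteq> \<Omega> - C" using U(1) in_components_subset by blast
  obtain V where V: "V \<in> components (\<Omega> - C)" "V \<noteq> U"
    using card U(1) by (metis card_2_iff insertCI)
  obtain p where p: "p \<in> V" using in_components_nonempty[OF V(1)] by blast
  have pOC: "p \<in> \<Omega> - C" using p in_components_subset[OF V(1)] by blast
  have pU: "p \<notin> closure U"
  proof
    assume "p \<in> closure U"
    have "closedin (top_of_set (\<Omega> - C)) U" using closedin_component[OF U(1)] .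
    then obtain K where K: "closed K" "U = (\<Omega> - C) \<inter> K" unfolding closedin_closed by blast
    then have "closure U \<subseteq> K" by (intro closure_minimal) auto
    then have "p \<in> U" using \<open>p \<in> closure U\<close> pOC K(2) by blast
    then show False using components_eq[OF U(1) V(1)] V(2) p by blast
  qed
  have pC: "p \<notin> closure C" using pOC clO by blast
  have p\<Sigma>: "p \<notin> \<Sigma>" using pOC \<Sigma>O by blast
  define X where "X = chart p"
  have contX: "continuous_on A X" if "p \<notin> A" for A
    unfolding X_def by (rule continuous_on_subset[OF continuous_on_chart]) (use that in blast)
  have injX: "x = y" if "x \<noteq> p" "y \<noteq> p" "X x = X y" for x y
    using that inj_onD[OF inj_on_chart[of p]] by (auto simp: X_def)
  define \<Omega>' C' U' \<Sigma>' where "\<Omega>' = X ` (\<Omega> - {p})" and "C' = X ` C" and "U' = X ` U" and "\<Sigma>' = X ` \<Sigma>"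
  have disjX: "X ` A \<inter> X ` B = {}" if "p \<notin> A" "p \<notin> B" "A \<inter> B = {}" for A B
  proof (rule ccontr)
    assume "X ` A \<inter> X ` B \<noteq> {}"
    then obtain x y where "x \<in> A" "y \<in> B" "X x = X y" by blast
    then show False using injX[of x y] that by blast
  qed
  have pUU: "p \<notin> U" using pU closure_subset by blast
  have pCC: "p \<notin> C" using pOC by blast
  have oO': "open \<Omega>'" unfolding \<Omega>'_def X_def by (rule open_chart_image) (use \<Omega>(1) in \<open>auto intro: open_delete\<close>)
  have cO': "connected \<Omega>'" unfolding \<Omega>'_def X_def
    by (rule connected_chart_image[OF connected_remove_point[OF \<Omega> q]]) simp
  have C'O': "C' \<subseteq> \<Omega>'" unfolding C'_def \<Omega>'_def using CO pCC by blast
  have Ccon: "connected C" using arc homeomorphic_connectedness connected_Ioo by blast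
  have C'con: "connected C'" unfolding C'_def by (rule connected_continuous_image[OF contX[OF pCC] Ccon])
  have compC': "compact (X ` closure C)" unfolding X_def by (rule compact_chart_image[OF closed_closure pC])
  have clC': "closure C' = X ` closure C"
  proof
    show "closure C' \<subseteq> X ` closure C"
      by (rule closure_minimal) (use compC' compact_imp_closed closure_subset in \<open>auto simp: C'_def\<close>)
    show "X ` closure C \<subseteq> closure C'"
    proof (rule image_closure_subset[OF contX[OF pC]])
      show "X ` C \<subseteq> closure C'" unfolding C'_def by (rule closure_subset)
    qed simp
  qed
  have clC'2: "closure C' = C' \<union> {X a, X b}" unfolding clC' cl by (auto simp: C'_def)
  have "C \<noteq> {}"
  proof
    assume "C = {}"
    then have "{0<..<1::real} = {}" using arc by (simp add: homeomorphic_empty)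
    then show False by simp
  qed
  then have C'ne: "C' \<noteq> {}" by (simp add: C'_def)
  have abp: "a \<noteq> p" "b \<noteq> p" using \<Sigma> p\<Sigma> by auto
  have ab': "X a \<noteq> X b" using injX[OF abp] ab by blast
  have aC': "X a \<notin> C'" "X b \<notin> C'"
  proof -
    have "{a} \<inter> C = {}" "{b} \<inter> C = {}" using abO CO by blast+
    from disjX[OF _ pCC this(1)] disjX[OF _ pCC this(2)] abp show "X a \<notin> C'" "X b \<notin> C'"
      unfolding C'_def by auto
  qed
  have \<Sigma>'c: "compact \<Sigma>'" "connected \<Sigma>'" unfolding \<Sigma>'_def X_def
    by (rule compact_chart_image[OF \<Sigma>cl p\<Sigma>], rule connected_chart_image[OF \<Sigma>con p\<Sigma>])
  have \<Sigma>'O: "\<Sigma>' \<inter> \<Omega>' = {}" unfolding \<Sigma>'_def \<Omega>'_def by (rule disjX) (use p\<Sigma> \<Sigma>O in auto)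
  have OC': "\<Omega>' - C' = X ` (\<Omega> - C - {p})"
  proof -
    have "inj_on X (\<Omega> - {p})" using injX by (auto intro!: inj_onI)
    then have "X ` (\<Omega> - {p}) - X ` C = X ` ((\<Omega> - {p}) - C)"
      by (rule inj_on_image_set_diff[symmetric, of X "\<Omega> - {p}"]) (use CO pCC in auto)
    moreover have "(\<Omega> - {p}) - C = \<Omega> - C - {p}" by blast
    ultimately show ?thesis by (simp only: \<Omega>'_def C'_def)
  qed
  have "U \<in> components (\<Omega> - C - {p})"
    unfolding in_components_maximal
  proof (intro conjI allI impI; (elim conjE)?)
    show "U \<noteq> {}" "connected U" "U \<subseteq> \<Omega> - C - {p}"
      using in_components_nonempty[OF U(1)] in_components_connected[OF U(1)] Usub pUU by auto
    fix D assume D: "D \<noteq> {}" "U \<subseteq> D" "D \<subseteq> \<Omega> - C - {p}" "connected D"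
    have "D \<subseteq> U" by (rule components_maximal[OF U(1) D(4)]) (use D(2,3) in_components_nonempty[OF U(1)] in auto)
    then show "D = U" using D(2) by blast
  qed
  then have U'comp: "U' \<in> components (\<Omega>' - C')"
    unfolding U'_def OC' X_def by (rule components_chart_image) auto
  have homU: "homeomorphism U U' X (unchart p)" unfolding U'_def X_def by (rule homeomorphism_chart_sub[OF pUU])
  have scU': "simply_connected U'" using U(2) homU homeomorphic_simply_connected homeomorphic_def by blast
  have bdU': "bounded U'" unfolding U'_def X_def
    by (rule bounded_chart_image[of "- closure U"]) (use pU closure_subset in auto)
  have oOC': "open (\<Omega>' - C')"
  proof -
    have "X a \<notin> \<Omega>'" "X b \<notin> \<Omega>'" using \<Sigma>'O \<Sigma> by (auto simp: \<Sigma>'_def)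
    then have "\<Omega>' - C' = \<Omega>' - closure C'" using clC'2 by blast
    then show ?thesis using oO' by (metis closed_closure open_Diff)
  qed
  have oU': "open U'" using open_components[OF oOC' U'comp] .
  \<comment> \<open>An arc does not separate the plane, so a bounded open set has frontier points off the arc.\<close>
  have far: "\<not> frontier U' \<subseteq> closure C'"
  proof
    assume sub: "frontier U' \<subseteq> closure C'"
    have "C' homeomorphic C"
      unfolding C'_def X_def using homeomorphism_chart_sub[OF pCC] homeomorphic_def homeomorphic_sym by blast
    then have "C' homeomorphic {0<..<1::real}" using arc homeomorphic_trans by blast
    moreover have "bounded C'" using compC' clC' closure_subset bounded_subset compact_imp_bounded by metis
    ultimately obtain g where g: "arc g" "path_image g = closure C'"
      using open_jordan_arc_closure_arc[OF _ clC'2 ab' aC'] by blast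
    have con: "connected (- closure C')" using connected_arc_complement[OF g(1)] g(2) by simp
    have UO': "U' \<subseteq> \<Omega>' - C'" "U' \<noteq> {}" using U'comp in_components_subset in_components_nonempty by blast+
    have Ucl: "U' \<subseteq> - closure C'" using UO'(1) clC'2 \<Sigma>'O \<Sigma> by (auto simp: \<Sigma>'_def)
    have "- closure C' \<inter> frontier U' = {}" using sub by blast
    moreover have "- closure C' \<inter> U' \<noteq> {}" using Ucl UO'(2) by blast
    ultimately have "- closure C' \<subseteq> U'" using connected_Int_frontier[OF con] by blast
    then have "UNIV = U' \<union> closure C'" by blast
    moreover have "bounded (U' \<union> closure C')" using bdU' compC' clC' compact_imp_bounded by simp
    ultimately show False using not_bounded_UNIV by metis
  qed
  \<comment> \<open>\<open>U\<close> is simply connected, so the covering has a section over it; \<open>s\<close> is this section, read in the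
    coordinate \<open>X\<close>.\<close>
  define f where "f z = chart q (\<pi> z)" for z
  have covf: "covering_space unit_disk f (chart q ` \<Omega>)" unfolding f_def by (rule covering_space_chart[OF cov q])
  have UO: "U \<subseteq> \<Omega>" using Usub by blast
  have qU: "q \<notin> U" using q UO by blast
  have oU: "open U"
  proof -
    have "U = unchart p ` U'" using homU by (simp add: homeomorphism_def)
    then show ?thesis using open_unchart_image[OF oU'] by simp
  qed
  define U0 where "U0 = chart q ` U"
  have oU0: "open U0" unfolding U0_def by (rule open_chart_image[OF oU qU])
  have homq: "homeomorphism U U0 (chart q) (unchart q)" unfolding U0_def by (rule homeomorphism_chart_sub[OF qU])
  have scU0: "simply_connected U0" using U(2) homq homeomorphic_simply_connected homeomorphic_def by blast
  have lpc: "locally path_connected U0" using oU0 by (rule open_imp_locally_path_connected)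
  have U0O: "(\<lambda>y. y) \<in> U0 \<rightarrow> chart q ` \<Omega>" using UO by (auto simp: U0_def)
  obtain g where g: "continuous_on U0 g" "g \<in> U0 \<rightarrow> unit_disk" "\<And>y. y \<in> U0 \<Longrightarrow> f (g y) = y"
    using covering_space_lift[OF covf scU0 lpc continuous_on_id U0O] by blast
  define s where "s w = g (chart q (unchart p w))" for w
  have unU: "unchart p w \<in> U" if "w \<in> U'" for w using homU that by (auto simp: homeomorphism_def)
  have s1: "s w \<in> unit_disk" if "w \<in> U'" for w using g(2) unU[OF that] by (auto simp: s_def U0_def)
  have \<pi>s: "\<pi> (s w) = unchart p w" if w: "w \<in> U'" for w
  proof -
    have "chart q (\<pi> (s w)) = chart q (unchart p w)"
      using g(3)[of "chart q (unchart p w)"] unU[OF w] by (simp add: s_def f_def U0_def)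
    moreover have "\<pi> (s w) \<noteq> q" using im s1[OF w] q by blast
    moreover have "unchart p w \<noteq> q" using unU[OF w] qU by blast
    ultimately show ?thesis using inj_onD[OF inj_on_chart[of q]] by auto
  qed
  have conts: "continuous_on U' s" unfolding s_def
  proof (rule continuous_on_compose2[OF g(1)])
    show "continuous_on U' (\<lambda>w. chart q (unchart p w))"
      by (rule continuous_on_compose2[OF continuous_on_chart continuous_on_unchart]) (use unU qU in auto)
  qed (use unU in \<open>auto simp: U0_def\<close>)
  have Xs: "X (\<pi> (s w)) = w" if "w \<in> U'" for w using \<pi>s[OF that] by (simp add: X_def)
  have injs: "inj_on s U'" using Xs by (metis inj_onI)
  have cont\<pi>: "continuous_on unit_disk \<pi>" by (rule sphere_holomorphic_on_continuous[OF hol])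
  define Dp where "Dp = unit_disk \<inter> \<pi> -` (- {p})"
  have oDp: "open Dp" unfolding Dp_def by (rule continuous_open_preimage[OF cont\<pi>]) auto
  have holX: "(\<lambda>z. chart p (\<pi> z)) holomorphic_on Dp"
    by (rule sphere_holomorphic_on_chart[OF sphere_holomorphic_on_subset[OF hol oDp]]) (auto simp: Dp_def)
  have hols: "s holomorphic_on U'"
    by (rule section_holomorphic[OF oU' conts _ holX]) (use s1 \<pi>s Xs in \<open>auto simp: Dp_def X_def\<close>)
  have ims: "s ` U' \<subseteq> ball 0 1" using s1 by blast
  have H: "\<exists>w0\<in>\<Omega>'. w \<longlonglongrightarrow> w0" if w: "\<And>n. w n \<in> U'" "(\<lambda>n. s (w n)) \<longlonglongrightarrow> z" "norm z < 1" for w z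
  proof -
    have zD: "z \<in> unit_disk" using w(3) by simp
    have l: "(\<lambda>n. \<pi> (s (w n))) \<longlonglongrightarrow> \<pi> z"
      by (rule continuous_on_tendsto_compose[OF cont\<pi> w(2) zD]) (use s1[OF w(1)] in \<open>auto intro!: always_eventually\<close>)
    have inU: "\<pi> (s (w n)) \<in> U" for n using \<pi>s[OF w(1)] unU[OF w(1)] by simp
    have "\<pi> z \<in> closure U" unfolding closure_sequential
      by (rule exI[of _ "\<lambda>n. \<pi> (s (w n))"]) (intro conjI allI inU l)
    then have pz: "\<pi> z \<noteq> p" using pU by auto
    have "(\<lambda>n. X (\<pi> (s (w n)))) \<longlonglongrightarrow> X (\<pi> z)"
      by (rule continuous_on_tendsto_compose[OF contX[of "- {p}"] l]) (use pz inU pUU in \<open>auto intro!: always_eventually\<close>)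
    then have "w \<longlonglongrightarrow> X (\<pi> z)" using Xs[OF w(1)] by simp
    moreover have "X (\<pi> z) \<in> \<Omega>'" using im zD pz by (auto simp: \<Omega>'_def)
    ultimately show ?thesis by blast
  qed
  have "\<exists>\<xi> e. norm \<xi> = 1 \<and> e > 0 \<and> ball \<xi> e \<inter> ball 0 1 \<subseteq> s ` U'"
  proof (rule crosscut_univalent_boundary[OF oO' cO' C'O' C'con _ clC'2 C'ne \<Sigma>'c _ _ \<Sigma>'O U'comp scU' bdU' far hols injs ims])
    show "compact (closure C')" using compC' clC' by simp
    show "X a \<in> \<Sigma>'" "X b \<in> \<Sigma>'" using \<Sigma> by (auto simp: \<Sigma>'_def)
    show "\<exists>w0\<in>\<Omega>'. w \<longlonglongrightarrow> w0" if "\<And>n. w n \<in> U'" "(\<lambda>n. s (w n)) \<longlonglongrightarrow> z" "norm z < 1" for w z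
      using H[OF that] .
  qed
  then obtain \<xi> e where \<xi>: "norm \<xi> = 1" "e > 0" "ball \<xi> e \<inter> ball 0 1 \<subseteq> s ` U'" by blast
  have "inj_on \<pi> (s ` U')"
  proof (rule inj_onI)
    fix x y assume x: "x \<in> s ` U'" and y: "y \<in> s ` U'" and eq: "\<pi> x = \<pi> y"
    obtain v where v: "x = s v" "v \<in> U'" using x by (rule imageE)
    obtain w where w: "y = s w" "w \<in> U'" using y by (rule imageE)
    have "X (\<pi> x) = v" "X (\<pi> y) = w" using Xs[OF v(2)] Xs[OF w(2)] by (simp_all only: v(1) w(1))
    then have "v = w" by (simp only: eq)
    then show "x = y" by (simp only: v(1) w(1))
  qed
  then show ?thesis using \<xi> ims by blast
qed

theorem corollaryE:
  fixes \<Omega> :: "riemann_sphere set" and \<pi> :: "complex \<Rightarrow> riemann_sphere"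
  assumes "sphere_domain \<Omega>" and "hyperbolic \<Omega>"
    and "multiply_connected \<Omega>" and "connectivity \<Omega> > 2"
    and "universal_covering \<pi> \<Omega>"
  shows "cantor_set (limit_set (deck_group \<pi>)) \<longleftrightarrow> (\<exists>C. true_crosscut \<Omega> C)"
proof -
  have \<Omega>: "open \<Omega>" "connected \<Omega>" using assms(1) by (auto simp: sphere_domain_def)
  have hol: "sphere_holomorphic_on \<pi> unit_disk" and cov\<pi>: "covering_space unit_disk \<pi> \<Omega>"
    using assms(5) by (auto simp: universal_covering_def)
  have im: "\<pi> ` unit_disk = \<Omega>" using cov\<pi> by (simp add: covering_space_imp_surjective)
  have more: "card (components (- \<Omega>)) > 2" if fin: "finite (components (- \<Omega>))"
  proof -
    have "enat (card (components (- \<Omega>))) > enat 2" using assms(4) fin by (simp add: connectivity_def numeral_eq_enat)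
    then show ?thesis by simp
  qed
  obtain K1 K2 K3 where K: "closed K1" "closed K2" "closed K3" "K1 \<noteq> {}" "K2 \<noteq> {}" "K3 \<noteq> {}"
    "K1 \<inter> K2 = {}" "K1 \<inter> K3 = {}" "K2 \<inter> K3 = {}" "K1 \<union> K2 \<union> K3 = - \<Omega>"
    by (rule three_closed_pieces[of "- \<Omega>"]) (use \<Omega>(1) more in auto)
  obtain q where q: "q \<in> K3" using K(6) by blast
  have qO: "q \<notin> \<Omega>" "q \<notin> K1" "q \<notin> K2" using q K by blast+
  \<comment> \<open>The chart is centred at a point of the third piece, so that the other two become compact plane sets.\<close>
  define f where "f z = chart q (\<pi> z)" for z
  define \<Omega>0 where "\<Omega>0 = chart q ` \<Omega>"
  have nq: "\<pi> z \<noteq> q" if "z \<in> unit_disk" for z using im qO(1) that by blast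
  have inj: "\<pi> z = \<pi> w" if "z \<in> unit_disk" "w \<in> unit_disk" "f z = f w" for z w
    using inj_onD[OF inj_on_chart[of q]] nq that by (auto simp: f_def)
  interpret planar_cover f \<Omega>0
  proof
    show "f holomorphic_on unit_disk" unfolding f_def by (rule sphere_holomorphic_on_chart[OF hol nq])
    show "covering_space unit_disk f \<Omega>0" unfolding f_def \<Omega>0_def by (rule covering_space_chart[OF cov\<pi> qO(1)])
  qed
  have deck_eq: "deck_group \<pi> = deck"
  proof (intro set_eqI iffI)
    fix \<gamma> assume "\<gamma> \<in> deck"
    then have \<gamma>: "disk_automorphism \<gamma>" "\<And>z. z \<in> unit_disk \<Longrightarrow> f (\<gamma> z) = f z" by (auto simp: deck_def)
    then have \<gamma>D: "\<gamma> z \<in> unit_disk" if "z \<in> unit_disk" for z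
      using bij_betw_apply[of \<gamma> unit_disk unit_disk] that unfolding disk_automorphism_def by blast
    have "\<pi> (\<gamma> z) = \<pi> z" if z: "z \<in> unit_disk" for z by (rule inj[OF \<gamma>D[OF z] z \<gamma>(2)[OF z]])
    then show "\<gamma> \<in> deck_group \<pi>" using \<gamma>(1) by (simp add: deck_group_def)
  qed (auto simp: deck_group_def deck_def f_def)
  have "\<exists>a b c. a \<in> \<Lambda> \<and> b \<in> \<Lambda> \<and> c \<in> \<Lambda> \<and> a \<noteq> b \<and> b \<noteq> c \<and> a \<noteq> c"
  proof -
    have "open \<Omega>0" unfolding \<Omega>0_def by (rule open_chart_image[OF \<Omega>(1) qO(1)])
    moreover have "- \<Omega>0 = chart q ` K1 \<union> chart q ` K2 \<union> unchart q -` K3"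
      unfolding \<Omega>0_def chart_image_eq_vimage[OF qO(1)] chart_image_eq_vimage[OF qO(2)] chart_image_eq_vimage[OF qO(3)]
      using K(10) by blast
    moreover have "compact (chart q ` K1)" "compact (chart q ` K2)"
      using compact_chart_image K(1,2) qO by blast+
    moreover have "closed (unchart q -` K3)" by (rule closed_vimage[OF K(3) continuous_on_unchart])
    moreover have "chart q ` K1 \<inter> chart q ` K2 = {}" "chart q ` K1 \<inter> unchart q -` K3 = {}" "chart q ` K2 \<inter> unchart q -` K3 = {}"
      unfolding chart_image_eq_vimage[OF qO(2)] chart_image_eq_vimage[OF qO(3)] using K(7-9) by blast+
    moreover obtain k1 k2 where "k1 \<in> chart q ` K1" "k2 \<in> chart q ` K2" using K(4,5) by blast
    ultimately show ?thesis by (rule three_limit_points) blast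
  qed
  then obtain a b c where abc: "a \<in> \<Lambda>" "b \<in> \<Lambda>" "c \<in> \<Lambda>" "a \<noteq> b" "b \<noteq> c" "a \<noteq> c" by blast
  show ?thesis unfolding deck_eq
  proof
    assume cantor: "cantor_set \<Lambda>"
    have "\<Lambda> \<noteq> sphere 0 1"
    proof
      assume L: "\<Lambda> = sphere 0 1"
      have "connected \<Lambda>" unfolding L by (rule connected_sphere) simp
      then have "\<Lambda> \<subseteq> connected_component_set \<Lambda> a" using abc(1) by (intro connected_component_maximal) auto
      then have "\<Lambda> \<subseteq> {a}" using cantor abc(1) unfolding cantor_set_def by simp
      then show False using abc by blast
    qed
    then have "\<not> sphere 0 1 \<subseteq> \<Lambda>" using limit_set_subset by (metis subset_antisym)
    then obtain \<xi> where "\<xi> \<in> sphere 0 1" "\<xi> \<notin> \<Lambda>" by (auto simp only: subset_eq)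
    then have \<xi>: "norm \<xi> = 1" "\<xi> \<notin> \<Lambda>" by simp_all
    obtain e1 where e1: "e1 > 0" "inj_on f (ball \<xi> e1 \<inter> unit_disk)" by (rule injective_near_nonlimit[OF \<xi>])
    obtain e2 where e2: "e2 > 0" "ball \<xi> e2 \<subseteq> - \<Lambda>" using \<xi>(2) closed_limit_set by (metis ComplI open_Compl openE)
    define e where "e = min e1 e2"
    show "\<exists>C. true_crosscut \<Omega> C"
    proof (rule univalent_near_imp_true_crosscut[OF \<Omega> hol cov\<pi> \<xi>(1)])
      show "e > 0" using e1(1) e2(1) by (simp add: e_def)
      show "inj_on \<pi> (ball \<xi> e \<inter> unit_disk)"
      proof (rule inj_onI)
        fix x y assume "x \<in> ball \<xi> e \<inter> unit_disk" "y \<in> ball \<xi> e \<inter> unit_disk" "\<pi> x = \<pi> y"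
        then show "x = y" using inj_onD[OF e1(2), of x y] by (auto simp: e_def f_def)
      qed
      fix z \<zeta> p assume z: "\<And>n. z n \<in> unit_disk" "z \<longlonglongrightarrow> \<zeta>" "norm \<zeta> = 1" "dist \<xi> \<zeta> < e" "(\<lambda>n. \<pi> (z n)) \<longlonglongrightarrow> p"
      show "p \<notin> \<Omega>"
      proof
        assume pO: "p \<in> \<Omega>"
        have pq: "p \<in> - {q}" using pO qO(1) by auto
        have "\<zeta> \<notin> \<Lambda>" using z(4) e2(2) by (auto simp: e_def)
        moreover have "(\<lambda>n. f (z n)) \<longlonglongrightarrow> chart q p" unfolding f_def
          by (rule continuous_on_tendsto_compose[OF continuous_on_chart z(5) pq]) (use nq z(1) in \<open>auto intro!: always_eventually\<close>)
        ultimately have "chart q p \<notin> \<Omega>0" using boundary_limit_not_in_image[OF z(3) _ z(1,2)] by blast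
        then show False using pO by (simp add: \<Omega>0_def)
      qed
    qed
  next
    assume "\<exists>C. true_crosscut \<Omega> C"
    then obtain C where C: "true_crosscut \<Omega> C" by blast
    obtain \<xi> e S where \<xi>: "norm \<xi> = 1" "e > 0" "ball \<xi> e \<inter> unit_disk \<subseteq> S" "S \<subseteq> unit_disk" "inj_on \<pi> S"
      using true_crosscut_imp_univalent_near[OF \<Omega> qO(1) hol cov\<pi> C] by blast
    have "inj_on f S"
    proof (rule inj_onI)
      fix x y assume "x \<in> S" "y \<in> S" "f x = f y"
      then show "x = y" using inj[of x y] \<xi>(4) inj_onD[OF \<xi>(5), of x y] by blast
    qed
    then have "\<xi> \<notin> \<Lambda>" by (rule univalent_near_imp_not_limit[OF \<xi>(2,3) _ \<xi>(4)])
    then show "cantor_set \<Lambda>" using limit_set_cantor[OF abc] \<xi>(1) by simp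
  qed
qed

end
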